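(* Assume (H1), (H2), (H3). For any $x\in\mathbb X$ and $y\in\mathbb R$, \[ \lim_{n\to\infty}n^{3/2}\,\mathbb P_x(\tau_y=n)=\frac{2V(x,y)}{\sqrt{2\pi}\,\sigma^3}\int_0^{+\infty}\mathbb E^*_\nu\big(V^*(X_1^*,z)\,;\,S_1^*\geqslant z\big)\,dz. \]
   Context: Let $\mathbb X$ be a finite set and $(X_n)_{n\geqslant0}$ a homogeneous Markov chain on $\mathbb X$ with transition matrix $\mathbf P$; $\mathbb P_x,\mathbb E_x$ denote probability and expectation when $X_0=x$; $\mathbf Pg(x)=\sum_{x'}g(x')\mathbf P(x,x')$. (H1): there exists $k_0\geqslant1$ with $\mathbf P^{k_0}g(x)>0$ for all $x$ and every non-negative, not identically zero $g$. Then $\mathbf P$ has a unique invariant probability $\nu$, positive everywhere; $\nu(g)=\sum_xg(x)\nu(x)$. Let $f:\mathbb X\to\mathbb R$, $S_0=0$, $S_n=\sum_{k=1}^nf(X_k)$, $\tau_y=\inf\{k\geqslant1: y+S_k\leqslant0\}$. (H2): $\nu(f)=0$. (H3): for every $(\theta,a)\in\mathbb R^2$ there exist $n\geqslant0$ and $x_0,\dots,x_n$ with $\mathbf P(x_0,x_1)\cdots\mathbf P(x_{n-1},x_n)\mathbf P(x_n,x_0)>0$ and $f(x_0)+\dots+f(x_n)-(n+1)\theta\notin a\mathbb Z$. $\sigma^2=\nu(f^2)+2\sum_{n\geqslant1}\nu(f\mathbf P^nf)>0$. Under (H1)–(H3) the limit $\lim_n\sqrt n\,\mathbb P_x(\tau_y>n)$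 exists and is finite, and $V(x,y):=\frac{\sqrt{2\pi}\sigma}{2}\lim_n\sqrt n\,\mathbb P_x(\tau_y>n)$. Dual chain: $\mathbf P^*(x,x^* )=\frac{\nu(x^* )}{\nu(x)}\mathbf P(x^*,x)$; $(X_n^* )$ is a Markov chain with transition matrix $\mathbf P^*$; $S_0^*=0$, $S_n^*=-\sum_{k=1}^nf(X_k^* )$, $\tau^*_z=\inf\{k\geqslant1: z+S_k^*\leqslant0\}$; $\mathbb P^*_x$ refers to $X_0^*=x$ and $\mathbb E^*_\nu$ to $X_0^*$ with law $\nu$; $V^*(x,z):=\frac{\sqrt{2\pi}\sigma}{2}\lim_n\sqrt n\,\mathbb P^*_x(\tau^*_z>n)$ (the dual chain satisfies (H1)–(H3) with $-f$, same $\nu$ and $\sigma$). *)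

theory Defs
  imports "HOL-Analysis.Analysis"
begin

definition Pop :: "('a::finite \<Rightarrow> 'a \<Rightarrow> real) \<Rightarrow> ('a \<Rightarrow> real) \<Rightarrow> 'a \<Rightarrow> real" where
  "Pop P g x = (\<Sum>x'\<in>UNIV. g x' * P x x')"

primrec Ppow :: "('a::finite \<Rightarrow> 'a \<Rightarrow> real) \<Rightarrow> nat \<Rightarrow> ('a \<Rightarrow> real) \<Rightarrow> 'a \<Rightarrow> real" where
  "Ppow P 0 g = g"
| "Ppow P (Suc n) g = Pop P (Ppow P n g)"

definition stochastic :: "('a::finite \<Rightarrow> 'a \<Rightarrow> real) \<Rightarrow> bool" where
  "stochastic P \<longleftrightarrow> (\<forall>x y. P x y \<ge> 0) \<and> (\<forall>x. (\<Sum>y\<in>UNIV. P x y) = 1)"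

definition invariant_prob :: "('a::finite \<Rightarrow> 'a \<Rightarrow> real) \<Rightarrow> ('a \<Rightarrow> real) \<Rightarrow> bool" where
  "invariant_prob P \<nu> \<longleftrightarrow> (\<forall>x. \<nu> x \<ge> 0) \<and> (\<Sum>x\<in>UNIV. \<nu> x) = 1
     \<and> (\<forall>y. (\<Sum>x\<in>UNIV. \<nu> x * P x y) = \<nu> y)"

definition H1 :: "('a::finite \<Rightarrow> 'a \<Rightarrow> real) \<Rightarrow> bool" where
  "H1 P \<longleftrightarrow> (\<exists>k0\<ge>1. \<forall>g. (\<forall>x. g x \<ge> 0) \<and> (\<exists>x. g x \<noteq> 0) \<longrightarrow> (\<forall>x. Ppow P k0 g x > 0))"

definition H2 :: "('a::finite \<Rightarrow> real) \<Rightarrow> ('a \<Rightarrow> real) \<Rightarrow> bool" where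
  "H2 \<nu> f \<longleftrightarrow> (\<Sum>x\<in>UNIV. f x * \<nu> x) = 0"

definition H3 :: "('a::finite \<Rightarrow> 'a \<Rightarrow> real) \<Rightarrow> ('a \<Rightarrow> real) \<Rightarrow> bool" where
  "H3 P f \<longleftrightarrow> (\<forall>\<theta> a::real. \<exists>(n::nat) (xs::nat \<Rightarrow> 'a).
      (\<Prod>i<n. P (xs i) (xs (Suc i))) * P (xs n) (xs 0) > 0 \<and>
      (\<Sum>i\<le>n. f (xs i)) - real (n + 1) * \<theta> \<notin> {a * of_int k | k. True})"

definition sigma2 :: "('a::finite \<Rightarrow> 'a \<Rightarrow> real) \<Rightarrow> ('a \<Rightarrow> real) \<Rightarrow> ('a \<Rightarrow> real) \<Rightarrow> real" where
  "sigma2 P \<nu> f = (\<Sum>x\<in>UNIV. f x ^ 2 * \<nu> x)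
     + 2 * (\<Sum>n. (\<Sum>x\<in>UNIV. f x * Ppow P (Suc n) f x * \<nu> x))"

text \<open>surv P f n x y = P_x(tau_y > n), where S_k = f(X_1)+...+f(X_k) and
  tau_y = inf{k >= 1 : y + S_k <= 0}; computed by the Markov property on path sums.\<close>
primrec surv :: "('a::finite \<Rightarrow> 'a \<Rightarrow> real) \<Rightarrow> ('a \<Rightarrow> real) \<Rightarrow> nat \<Rightarrow> 'a \<Rightarrow> real \<Rightarrow> real" where
  "surv P f 0 x y = 1"
| "surv P f (Suc n) x y =
     (\<Sum>x'\<in>UNIV. P x x' * (if y + f x' > 0 then surv P f n x' (y + f x') else 0))"

fun tau_eq :: "('a::finite \<Rightarrow> 'a \<Rightarrow> real) \<Rightarrow> ('a \<Rightarrow> real) \<Rightarrow> nat \<Rightarrow> 'a \<Rightarrow> real \<Rightarrow> real" where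
  "tau_eq P f 0 x y = 0"
| "tau_eq P f (Suc 0) x y = (\<Sum>x'\<in>UNIV. P x x' * (if y + f x' \<le> 0 then 1 else 0))"
| "tau_eq P f (Suc (Suc n)) x y =
     (\<Sum>x'\<in>UNIV. P x x' * (if y + f x' > 0 then tau_eq P f (Suc n) x' (y + f x') else 0))"

definition Vfun :: "('a::finite \<Rightarrow> 'a \<Rightarrow> real) \<Rightarrow> ('a \<Rightarrow> real) \<Rightarrow> real \<Rightarrow> 'a \<Rightarrow> real \<Rightarrow> real" where
  "Vfun P f \<sigma> x y = sqrt (2 * pi) * \<sigma> / 2 * lim (\<lambda>n. sqrt (real n) * surv P f n x y)"

definition Pdual :: "('a::finite \<Rightarrow> 'a \<Rightarrow> real) \<Rightarrow> ('a \<Rightarrow> real) \<Rightarrow> 'a \<Rightarrow> 'a \<Rightarrow> real" where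
  "Pdual P \<nu> x xs = \<nu> xs / \<nu> x * P xs x"

end

theory Submission
  imports Defs "HOL-Probability.Probability" "HOL-Real_Asymp.Real_Asymp"
begin

text \<open>
  Expectations of the walk are powers of operators on functions of \<open>(x, y)\<close>: the free step and the
  step killed on leaving \<open>(0, \<infinity>)\<close>. The approximate eigenfunctions \<open>cis (t * y) * eigf t x\<close> of the free
  step, with eigenvalue close to \<open>exp (- \<sigma>2 * t\<^sup>2 / 2)\<close>, show that the sine transform of the killed walk
  at frequency \<open>\<xi> / sqrt n\<close>, multiplied by \<open>sqrt n\<close>, tends to \<open>V(x, y) * \<xi> * exp (- \<sigma>2 * \<xi>\<^sup>2 / 2)\<close>, where
  \<open>V\<close> is the harmonic function of the killed walk.

  Split \<open>n\<close> into three stretches of length about \<open>n / 3\<close>. Read backwards, the last stretch is the dual walk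
  killed at zero, started from the exit overshoot; the local limit theorem together with the reflection
  principle replaces the middle stretch by the odd Gaussian kernel
  \<open>1 / pi * (\<integral>t. exp (- \<sigma>2 * m * t\<^sup>2 / 2) * sin (t * w) * sin (t * r))\<close>, whose reflection error is
  negligible because the walk has bounded jumps. What remains is an integral of the product of the sine
  transforms of the first stretch and of the dual one, and dominated convergence gives the limit.
\<close>

subsection \<open>Steps of the walk as operators\<close>

text \<open>The order n^(-3/2) is a product of three factors m^(-1/2): survival of the first
  stretch, the density in the middle, and the total mass of the last stretch, which duality bounds
  by a dual survival probability. Every error must be small relative to this product, uniformly in
  the state. \<open>H3\<close> controls the Fourier operators only on compact sets of frequencies,
  so the local limit theorem is first proved for functions smoothed by a kernel with compactly
  supported transform. Functions with jumps are then squeezed between neighbours displaced by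
  \<eta>, at a relative cost of order \<eta>. The middle stretch is killed at zero while the limit
  theorem concerns the free walk. The bridge is an odd extension: a killed path never reads the
  values at negative levels, and a free path that crosses zero meets a nearly odd expectation that
  is small there. The function \<open>V\<close> is built rather than assumed: \<open>harmV\<close>
  is a series over exit times, and the sine transform yields the survival asymptotics that identify
  it with \<open>Vfun\<close>.\<close>

definition walk_step :: "('a::finite \<Rightarrow> real \<Rightarrow> 'a \<Rightarrow> real) \<Rightarrow> ('a \<Rightarrow> real) \<Rightarrow> ('a \<Rightarrow> real \<Rightarrow> real) \<Rightarrow> 'a \<Rightarrow> real \<Rightarrow> real" where
  "walk_step c f g x y = (\<Sum>x'\<in>UNIV. c x y x' * g x' (y + f x'))"

text \<open>The weight in \<open>walk_step\<close> may depend on the old state, the level and the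
  new state, so that the free, killed and exit steps are instances of it and share one set of facts
  on linearity, monotonicity and integrals.\<close>

definition free_step :: "('a::finite \<Rightarrow> 'a \<Rightarrow> real) \<Rightarrow> ('a \<Rightarrow> real) \<Rightarrow> ('a \<Rightarrow> real \<Rightarrow> real) \<Rightarrow> 'a \<Rightarrow> real \<Rightarrow> real" where
  "free_step P f = walk_step (\<lambda>x y x'. P x x') f"

definition killed_step :: "('a::finite \<Rightarrow> 'a \<Rightarrow> real) \<Rightarrow> ('a \<Rightarrow> real) \<Rightarrow> ('a \<Rightarrow> real \<Rightarrow> real) \<Rightarrow> 'a \<Rightarrow> real \<Rightarrow> real" where
  "killed_step P f = walk_step (\<lambda>x y x'. if y + f x' > 0 then P x x' else 0) f"

definition exit_step :: "('a::finite \<Rightarrow> 'a \<Rightarrow> real) \<Rightarrow> ('a \<Rightarrow> real) \<Rightarrow> ('a \<Rightarrow> real \<Rightarrow> real) \<Rightarrow> 'a \<Rightarrow> real \<Rightarrow> real" where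
  "exit_step P f = walk_step (\<lambda>x y x'. if y + f x' \<le> 0 then P x x' else 0) f"

lemma walk_step_pow_Suc:
  "(walk_step c f ^^ Suc n) g x y = (\<Sum>x'\<in>UNIV. c x y x' * (walk_step c f ^^ n) g x' (y + f x'))"
  unfolding funpow.simps o_def by (rule walk_step_def)

lemma killed_pow_Suc:
  "(killed_step P f ^^ Suc n) g x y = (\<Sum>x'\<in>UNIV. P x x' * (if y + f x' > 0 then (killed_step P f ^^ n) g x' (y + f x') else 0))"
  unfolding killed_step_def walk_step_pow_Suc by (intro sum.cong) auto

lemma free_pow_Suc:
  "(free_step P f ^^ Suc n) g x y = (\<Sum>x'\<in>UNIV. P x x' * (free_step P f ^^ n) g x' (y + f x'))"
  unfolding free_step_def by (rule walk_step_pow_Suc)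

lemma walk_step_pow_linear:
  "(walk_step c f ^^ n) (\<lambda>x y. a * g x y + b * h x y) x y = a * (walk_step c f ^^ n) g x y + b * (walk_step c f ^^ n) h x y"
proof (induction n arbitrary: x y)
  case (Suc n)
  show ?case
    by (simp add: Suc.IH walk_step_pow_Suc ring_distribs sum.distrib sum_distrib_left mult_ac del: funpow.simps)
qed simp

lemma walk_step_pow_add:
  "(walk_step c f ^^ n) (\<lambda>x y. g x y + h x y) x y = (walk_step c f ^^ n) g x y + (walk_step c f ^^ n) h x y"
  using walk_step_pow_linear[of n c f 1 g 1 h] by simp

lemma walk_step_pow_diff:
  "(walk_step c f ^^ n) (\<lambda>x y. g x y - h x y) x y = (walk_step c f ^^ n) g x y - (walk_step c f ^^ n) h x y"
  using walk_step_pow_linear[of n c f 1 g "-1" h] by simp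

lemma walk_step_pow_scale:
  "(walk_step c f ^^ n) (\<lambda>x y. a * g x y) x y = a * (walk_step c f ^^ n) g x y"
  using walk_step_pow_linear[of n c f a g 0 g] by simp

lemma walk_step_pow_zero: "(walk_step c f ^^ n) (\<lambda>x y. 0) x y = 0"
  using walk_step_pow_scale[of n c f 0 "\<lambda>x y. 0"] by simp

lemma walk_step_pow_sum:
  "(walk_step c f ^^ n) (\<lambda>x y. \<Sum>i\<in>I. g i x y) x y = (\<Sum>i\<in>I. (walk_step c f ^^ n) (g i) x y)"
  by (induction I rule: infinite_finite_induct) (simp_all add: walk_step_pow_zero walk_step_pow_add)

lemma walk_step_pow_mono:
  assumes "\<And>x y x'. c x y x' \<ge> 0" "\<And>x y. g x y \<le> h x y"
  shows "(walk_step c f ^^ n) g x y \<le> (walk_step c f ^^ n) h x y"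
proof (induction n arbitrary: x y)
  case (Suc n)
  show ?case
    by (auto simp: walk_step_pow_Suc simp del: funpow.simps intro!: sum_mono mult_left_mono Suc.IH assms)
qed (simp add: assms)

lemma walk_step_pow_nonneg:
  assumes "\<And>x y x'. c x y x' \<ge> 0" "\<And>x y. g x y \<ge> 0"
  shows "(walk_step c f ^^ n) g x y \<ge> 0"
  using walk_step_pow_mono[of c "\<lambda>x y. 0" g n f x y] assms by (simp add: walk_step_pow_zero)

text \<open>A power of a step is a finite combination of values of the function, so the exchange
  with the integral needs integrability at each point only, and no joint measurability.\<close>

lemma walk_step_pow_integral:
  assumes "\<And>x y. integrable M (\<lambda>s. g s x y)"
  shows "integrable M (\<lambda>s. (walk_step c f ^^ n) (g s) x y)"
    and "(walk_step c f ^^ n) (\<lambda>x y. \<integral>s. g s x y \<partial>M) x y = (\<integral>s. (walk_step c f ^^ n) (g s) x y \<partial>M)"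
proof (induction n arbitrary: x y)
  case 0
  { case 1 show ?case by (simp add: assms) }
  { case 2 show ?case by simp }
next
  case (Suc n)
  { case 1 show ?case by (simp add: walk_step_pow_Suc Suc.IH del: funpow.simps) }
  { case 2 show ?case by (simp add: walk_step_pow_Suc Suc.IH integral_sum del: funpow.simps) }
qed

lemma walk_step_pow_measurable:
  assumes c: "\<And>x x'. (\<lambda>y. c x y x') \<in> borel_measurable borel" and g: "\<And>x. g x \<in> borel_measurable borel"
  shows "(walk_step c f ^^ n) g x \<in> borel_measurable borel"
proof (induction n arbitrary: x)
  case (Suc n)
  note [measurable] = c Suc.IH
  have "(\<lambda>y. (walk_step c f ^^ Suc n) g x y) \<in> borel_measurable borel"
    unfolding walk_step_pow_Suc by measurable
  then show ?case .
qed (simp add: g)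

lemma killed_step_measurable:
  assumes g: "\<And>x. g x \<in> borel_measurable borel"
  shows "(killed_step P f ^^ n) g x \<in> borel_measurable borel"
  unfolding killed_step_def by (rule walk_step_pow_measurable) (use g in measurable)

lemma free_eq_killed_exit: "free_step P f g x y = killed_step P f g x y + exit_step P f g x y"
  unfolding free_step_def killed_step_def exit_step_def walk_step_def sum.distrib[symmetric]
  by (intro sum.cong) auto

text \<open>The killed walk evaluates its function at positive levels only. The exception is the
  zeroth power, which evaluates at the starting level itself; hence the side condition.\<close>

lemma killed_pow_cong:
  assumes "\<And>x y. y > 0 \<Longrightarrow> g x y = h x y" "n > 0 \<or> y > 0"
  shows "(killed_step P f ^^ n) g x y = (killed_step P f ^^ n) h x y"
  using assms(2)
proof (induction n arbitrary: x y)
  case (Suc n)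
  show ?case unfolding killed_pow_Suc by (intro sum.cong) (auto simp: Suc.IH)
qed (simp add: assms)

lemma killed_pow_mono:
  assumes P: "\<And>x y. P x y \<ge> 0" and "\<And>x y. y > 0 \<Longrightarrow> g x y \<le> h x y" "n > 0 \<or> y > 0"
  shows "(killed_step P f ^^ n) g x y \<le> (killed_step P f ^^ n) h x y"
  using assms(3)
proof (induction n arbitrary: x y)
  case (Suc n)
  show ?case unfolding killed_pow_Suc by (intro sum_mono) (auto simp: Suc.IH P intro!: mult_left_mono)
qed (simp add: assms)

lemma surv_eq_killed: "surv P f n x y = (killed_step P f ^^ n) (\<lambda>x y. 1) x y"
  by (induction n arbitrary: x y) (simp, simp only: killed_pow_Suc surv.simps)

text \<open>The level \<open>c\<close> is left free because the last step has to be examined at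
  levels near zero as well, when displacements of the starting point are absorbed.\<close>

definition exit_prob :: "('a::finite \<Rightarrow> 'a \<Rightarrow> real) \<Rightarrow> ('a \<Rightarrow> real) \<Rightarrow> real \<Rightarrow> 'a \<Rightarrow> real \<Rightarrow> real" where
  "exit_prob P f c x y = (\<Sum>x'\<in>UNIV. P x x' * (if y + f x' \<le> c then 1 else 0))"

lemma tau_eq_killed: "tau_eq P f (Suc n) x y = (killed_step P f ^^ n) (exit_prob P f 0) x y"
proof (induction n arbitrary: x y)
  case (Suc n)
  show ?case unfolding killed_pow_Suc tau_eq.simps Suc.IH ..
qed (simp add: exit_prob_def)

text \<open>Free paths are sorted by the step at which they first leave: k killed steps, one exit
  step, and free motion for the remaining \<open>l - Suc k\<close> steps. Formally, the sum
  telescopes when free steps are exchanged for killed ones one at a time.\<close>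

lemma free_killed_telescope:
  "(free_step P f ^^ l) g x y = (killed_step P f ^^ l) g x y
     + (\<Sum>k<l. (killed_step P f ^^ k) (exit_step P f ((free_step P f ^^ (l - Suc k)) g)) x y)"
proof -
  let ?a = "\<lambda>k. (killed_step P f ^^ k) ((free_step P f ^^ (l - k)) g) x y"
  have "?a k - ?a (Suc k) = (killed_step P f ^^ k) (exit_step P f ((free_step P f ^^ (l - Suc k)) g)) x y" if "k < l" for k
  proof -
    let ?G = "(free_step P f ^^ (l - Suc k)) g"
    have "l - k = Suc (l - Suc k)" using that by simp
    then have "(free_step P f ^^ (l - k)) g = free_step P f ?G" by simp
    also have "\<dots> = (\<lambda>x y. killed_step P f ?G x y + exit_step P f ?G x y)"
      by (intro ext) (rule free_eq_killed_exit)
    finally have "?a k = (killed_step P f ^^ k) (killed_step P f ?G) x y + (killed_step P f ^^ k) (exit_step P f ?G) x y"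
      by (simp only: killed_step_def walk_step_pow_add)
    then show ?thesis by (simp add: funpow_swap1)
  qed
  then have "(\<Sum>k<l. ?a k - ?a (Suc k)) = (\<Sum>k<l. (killed_step P f ^^ k) (exit_step P f ((free_step P f ^^ (l - Suc k)) g)) x y)"
    by (intro sum.cong) auto
  then show ?thesis by (subst (asm) sum_lessThan_telescope') simp
qed

subsection \<open>Ergodicity and the Poisson equation\<close>

text \<open>A locale, because every result is needed twice: for the given chain and, by
  \<open>dual_walk\<close>, for its time reversal with \<open>- f\<close>.\<close>

locale markov_walk =
  fixes P :: "'a::finite \<Rightarrow> 'a \<Rightarrow> real" and \<nu> f :: "'a \<Rightarrow> real"
  assumes stoch: "stochastic P" and inv_prob: "invariant_prob P \<nu>"
    and primitive: "H1 P" and centred: "H2 \<nu> f" and nonlattice: "H3 P f"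
begin

abbreviation "Q \<equiv> killed_step P f"
abbreviation "T \<equiv> free_step P f"

lemma P_nonneg: "P x y \<ge> 0" and P_sum: "(\<Sum>y\<in>UNIV. P x y) = 1"
  using stoch by (auto simp: stochastic_def)

lemma nu_nonneg: "\<nu> x \<ge> 0" and nu_sum: "(\<Sum>x\<in>UNIV. \<nu> x) = 1" and nu_inv: "(\<Sum>x\<in>UNIV. \<nu> x * P x y) = \<nu> y"
  using inv_prob by (auto simp: invariant_prob_def)

lemma nu_Pop: "(\<Sum>x\<in>UNIV. Pop P g x * \<nu> x) = (\<Sum>x\<in>UNIV. g x * \<nu> x)"
proof -
  have "(\<Sum>x\<in>UNIV. Pop P g x * \<nu> x) = (\<Sum>x\<in>UNIV. \<Sum>x'\<in>UNIV. g x' * (\<nu> x * P x x'))"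
    by (simp add: Pop_def sum_distrib_left sum_distrib_right mult_ac)
  also have "\<dots> = (\<Sum>x'\<in>UNIV. \<Sum>x\<in>UNIV. g x' * (\<nu> x * P x x'))" by (rule sum.swap)
  also have "\<dots> = (\<Sum>x'\<in>UNIV. g x' * \<nu> x')" by (simp add: sum_distrib_left[symmetric] nu_inv)
  finally show ?thesis .
qed

lemma nu_Ppow: "(\<Sum>x\<in>UNIV. Ppow P n g x * \<nu> x) = (\<Sum>x\<in>UNIV. g x * \<nu> x)"
  by (induction n) (simp_all add: nu_Pop)

lemma Ppow_add: "Ppow P (m + n) g = Ppow P m (Ppow P n g)"
  by (induction m) simp_all

lemma Ppow_kernel: "Ppow P n g x = (\<Sum>x'\<in>UNIV. g x' * Ppow P n (\<lambda>z. if z = x' then 1 else 0) x)"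
proof (induction n arbitrary: x)
  case 0
  have "(\<Sum>x'\<in>UNIV. g x' * (if x = x' then 1 else 0)) = (\<Sum>x'\<in>{x}. g x')"
    by (rule sum.mono_neutral_cong_right) auto
  then show ?case by simp
next
  case (Suc n)
  have "Ppow P (Suc n) g x = (\<Sum>y\<in>UNIV. \<Sum>x'\<in>UNIV. g x' * (Ppow P n (\<lambda>z. if z = x' then 1 else 0) y * P x y))"
    by (simp add: Pop_def sum_distrib_right sum_distrib_left mult_ac, subst Suc.IH, simp add: sum_distrib_left sum_distrib_right mult_ac)
  also have "\<dots> = (\<Sum>x'\<in>UNIV. \<Sum>y\<in>UNIV. g x' * (Ppow P n (\<lambda>z. if z = x' then 1 else 0) y * P x y))" by (rule sum.swap)
  finally show ?case by (simp add: Pop_def sum_distrib_left)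
qed

lemma Ppow_const: "Ppow P n (\<lambda>_. c) x = c"
  by (induction n arbitrary: x) (simp_all add: Pop_def sum_distrib_left[symmetric] P_sum)

lemma Ppow_mono: "(\<And>x. g x \<le> h x) \<Longrightarrow> Ppow P n g x \<le> Ppow P n h x"
  by (induction n arbitrary: x) (auto simp: Pop_def P_nonneg intro!: sum_mono mult_right_mono)

lemma Ppow_bound: "(\<And>x. \<bar>g x\<bar> \<le> c) \<Longrightarrow> \<bar>Ppow P n g x\<bar> \<le> c"
  using Ppow_mono[of g "\<lambda>_. c" n x] Ppow_mono[of "\<lambda>_. - c" g n x]
  by (simp add: Ppow_const abs_le_iff) (smt (verit))

lemma ex_positive_power: "\<exists>k0\<ge>1. \<forall>x x'. Ppow P k0 (\<lambda>z. if z = x' then 1 else 0) x > 0"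
proof -
  from primitive obtain k0 where "k0 \<ge> 1" and k: "\<And>g. (\<forall>x. g x \<ge> 0) \<and> (\<exists>x. g x \<noteq> 0) \<longrightarrow> (\<forall>x. Ppow P k0 g x > 0)"
    unfolding H1_def by auto
  moreover have "Ppow P k0 (\<lambda>z. if z = x' then 1 else 0) x > 0" for x x'
    using k[of "\<lambda>z. if z = x' then 1 else 0"] by (auto split: if_splits)
  ultimately show ?thesis by blast
qed

lemma nu_pos: "\<nu> y > 0"
proof -
  obtain k0 where k: "\<forall>x x'. Ppow P k0 (\<lambda>z. if z = x' then 1 else 0) x > 0" using ex_positive_power by blast
  let ?p = "Ppow P k0 (\<lambda>z. if z = y then 1 else 0)"
  have "\<nu> y = (\<Sum>x\<in>UNIV. (if x = y then 1 else 0) * \<nu> x)"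
    by (simp add: if_distrib[of "\<lambda>u. u * _"] sum.delta cong: if_cong)
  also have "\<dots> = (\<Sum>x\<in>UNIV. ?p x * \<nu> x)" by (rule nu_Ppow[symmetric])
  finally have *: "\<nu> y = (\<Sum>x\<in>UNIV. ?p x * \<nu> x)" .
  have "\<exists>z. \<nu> z > 0"
  proof (rule ccontr)
    assume "\<not> ?thesis"
    then have "\<And>z. \<nu> z = 0" using nu_nonneg by (meson linorder_not_less order_antisym)
    then show False using nu_sum by simp
  qed
  then obtain z where "\<nu> z > 0" ..
  then have "0 < ?p z * \<nu> z" using k by simp
  also have "\<dots> \<le> (\<Sum>x\<in>UNIV. ?p x * \<nu> x)"
    by (rule member_le_sum) (auto simp: less_imp_le[OF k[rule_format]] nu_nonneg)
  finally show ?thesis using * by simp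
qed

text \<open>Doeblin's argument: all entries of the power \<open>k0\<close> are at least
  \<open>e\<close>, so \<open>e * \<nu>\<close> can be subtracted from each row. What remains is
  nonnegative with row sums 1 - e, and on functions of mean zero the subtraction changes nothing.
  Each block of \<open>k0\<close> steps therefore contracts by 1 - e.\<close>

lemma Ppow_decay:
  "\<exists>C r::real. C \<ge> 0 \<and> 0 \<le> r \<and> r < 1 \<and>
    (\<forall>g n x c. (\<Sum>x\<in>UNIV. g x * \<nu> x) = 0 \<longrightarrow> (\<forall>x. \<bar>g x\<bar> \<le> c) \<longrightarrow> \<bar>Ppow P n g x\<bar> \<le> C * c * r ^ n)"
proof -
  obtain k0 where k0: "k0 \<ge> 1" and k: "\<forall>x x'. Ppow P k0 (\<lambda>z. if z = x' then 1 else 0) x > 0" using ex_positive_power by blast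
  define p where "p x x' = Ppow P k0 (\<lambda>z. if z = x' then 1 else 0) x" for x x'
  \<comment> \<open>The cap 1/2 keeps 1 - e positive, so that it has a positive root of order
    \<open>k0\<close> and may stand in a denominator.\<close>
  define e where "e = min (1/2) (Min (range (\<lambda>(x, x'). p x x')))"
  have e0: "e > 0" using k by (auto simp: e_def p_def)
  have e1: "e \<le> 1/2" by (simp add: e_def)
  have ep: "e \<le> p x x'" for x x'
  proof -
    have "Min (range (\<lambda>(x, x'). p x x')) \<le> p x x'" by (rule Min_le) (auto intro: image_eqI[of _ _ "(x, x')"])
    then show ?thesis by (simp add: e_def)
  qed
  have nu1: "\<nu> x \<le> 1" for x using nu_sum member_le_sum[of x UNIV \<nu>] nu_nonneg by simp
  have contr: "\<bar>Ppow P k0 g x\<bar> \<le> (1 - e) * c" if g: "(\<Sum>x\<in>UNIV. g x * \<nu> x) = 0" "\<And>x. \<bar>g x\<bar> \<le> c" for g x c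
  proof -
    have w: "0 \<le> p x x' - e * \<nu> x'" for x'
    proof -
      have "e * \<nu> x' \<le> e * 1" using nu1[of x'] e0 by (intro mult_left_mono) auto
      then show ?thesis using ep[of x x'] by linarith
    qed
    have p1: "(\<Sum>x'\<in>UNIV. p x x') = 1" using Ppow_kernel[of k0 "\<lambda>_. 1" x] unfolding Ppow_const p_def by simp
    have "Ppow P k0 g x = (\<Sum>x'\<in>UNIV. g x' * p x x')" by (subst Ppow_kernel) (simp add: p_def)
    also have "\<dots> = (\<Sum>x'\<in>UNIV. g x' * p x x') - e * (\<Sum>x\<in>UNIV. g x * \<nu> x)" using g by simp
    also have "\<dots> = (\<Sum>x'\<in>UNIV. g x' * (p x x' - e * \<nu> x'))" by (simp add: ring_distribs sum_subtractf sum_distrib_left mult_ac)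
    finally have "\<bar>Ppow P k0 g x\<bar> \<le> (\<Sum>x'\<in>UNIV. \<bar>g x' * (p x x' - e * \<nu> x')\<bar>)" by (simp add: sum_abs)
    also have "\<dots> \<le> (\<Sum>x'\<in>UNIV. c * (p x x' - e * \<nu> x'))"
      using w g(2) by (intro sum_mono) (auto simp: abs_mult intro!: mult_right_mono)
    also have "\<dots> = (1 - e) * c" by (simp add: sum_distrib_left[symmetric] sum_subtractf p1 nu_sum)
    finally show ?thesis .
  qed
  have iter: "\<bar>Ppow P (q * k0) g x\<bar> \<le> (1 - e) ^ q * c" if g: "(\<Sum>x\<in>UNIV. g x * \<nu> x) = 0" "\<And>x. \<bar>g x\<bar> \<le> c" for g x c q
  proof (induction q arbitrary: x)
    case (Suc q)
    have "\<bar>Ppow P k0 (Ppow P (q * k0) g) x\<bar> \<le> (1 - e) * ((1 - e) ^ q * c)"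
      by (rule contr) (auto simp: nu_Ppow g Suc.IH)
    then show ?case by (simp add: Ppow_add mult.assoc)
  qed (simp add: g)
  define r where "r = root k0 (1 - e)"
  have rk: "r ^ k0 = 1 - e" using k0 e1 by (simp add: r_def)
  have r: "0 < r" "r < 1" using k0 e0 e1 by (auto simp: r_def)
  show ?thesis
  proof (rule exI[of _ "1 / (1 - e)"], rule exI[of _ r], intro conjI allI impI)
    fix g n x c assume g: "(\<Sum>x\<in>UNIV. g x * \<nu> x) = 0" and "\<forall>x. \<bar>g x\<bar> \<le> (c::real)"
    then have g: "(\<Sum>x\<in>UNIV. g x * \<nu> x) = 0" "\<And>x. \<bar>g x\<bar> \<le> (c::real)" by auto
    have c: "c \<ge> 0" using g(2)[of x] by linarith
    let ?q = "n div k0"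
    have "Ppow P n g x = Ppow P (n mod k0) (Ppow P (?q * k0) g) x"
      by (simp add: Ppow_add[symmetric] add.commute)
    also have "\<bar>\<dots>\<bar> \<le> (1 - e) ^ ?q * c" by (rule Ppow_bound) (rule iter[OF g])
    also have "(1 - e) ^ ?q = r ^ (k0 * ?q)" by (simp only: power_mult rk)
    \<comment> \<open>The incomplete last block costs at most r^(-k0) = 1 / (1 - e), which is the
      constant of the lemma.\<close>
    also have "\<dots> \<le> r ^ n / r ^ k0"
    proof -
      have "n = k0 * ?q + n mod k0" by simp
      then have "r ^ n = r ^ (k0 * ?q) * r ^ (n mod k0)" by (metis power_add)
      moreover have "r ^ (n mod k0) \<ge> r ^ k0"
        using k0 r by (intro power_decreasing) auto
      ultimately show ?thesis using r by (simp add: field_simps)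
    qed
    finally have "\<bar>Ppow P n g x\<bar> \<le> r ^ n / r ^ k0 * c" using c by (simp add: mult_right_mono)
    also have "r ^ n / r ^ k0 * c = 1 / (1 - e) * c * r ^ n" unfolding rk by simp
    finally show "\<bar>Ppow P n g x\<bar> \<le> 1 / (1 - e) * c * r ^ n" .
  next
    show "0 \<le> 1 / (1 - e)" using e1 by simp
  qed (use r in simp_all)
qed

section \<open>Poisson equation, martingale corrections and positivity of the variance\<close>

definition "potential g x = (\<Sum>n. Ppow P n g x)"

lemma summable_Ppow:
  assumes "(\<Sum>x\<in>UNIV. g x * \<nu> x) = 0"
  shows "summable (\<lambda>n. Ppow P n g x)"
proof -
  obtain C r :: real where r: "C \<ge> 0" "0 \<le> r" "r < 1"
    and *: "\<forall>g n x c. (\<Sum>x\<in>UNIV. g x * \<nu> x) = 0 \<longrightarrow> (\<forall>x. \<bar>g x\<bar> \<le> c) \<longrightarrow> \<bar>Ppow P n g x\<bar> \<le> C * c * r ^ n"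
    using Ppow_decay by blast
  let ?c = "\<Sum>x\<in>UNIV. \<bar>g x\<bar>"
  have "\<bar>g x\<bar> \<le> ?c" for x by (rule member_le_sum) auto
  then have 1: "norm (Ppow P n g x) \<le> C * ?c * r ^ n" for n unfolding real_norm_def by (intro *[rule_format, OF assms])
  have 2: "summable (\<lambda>n. C * ?c * r ^ n)" using r by (intro summable_mult summable_geometric) simp
  show ?thesis by (rule summable_comparison_test'[OF 2 1])
qed

text \<open>The potential series converges geometrically for g of mean zero, and removing its first
  term amounts to applying P.\<close>

lemma poisson:
  assumes g: "(\<Sum>x\<in>UNIV. g x * \<nu> x) = 0"
  shows "(\<lambda>n. Ppow P (Suc n) g x) sums Pop P (potential g) x"
    and "potential g x - Pop P (potential g) x = g x"
proof -
  have s: "(\<lambda>n. Ppow P n g x) sums potential g x" for x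
    unfolding potential_def by (rule summable_sums[OF summable_Ppow[OF g]])
  show 1: "(\<lambda>n. Ppow P (Suc n) g x) sums Pop P (potential g) x"
    unfolding Ppow.simps Pop_def by (intro sums_sum sums_mult2 s)
  from sums_Suc[OF 1] have "(\<lambda>n. Ppow P n g x) sums (Pop P (potential g) x + g x)" by simp
  with s show "potential g x - Pop P (potential g) x = g x" using sums_unique2 by fastforce
qed

text \<open>\<open>y + corrA x\<close> is the martingale of the free walk, and \<open>(y + corrA x)\<^sup>2 + corrD x\<close> grows by \<open>\<sigma>2\<close> in each step.\<close>

definition "corrB = potential f"
definition "corrA x = Pop P corrB x"
text \<open>The conditional variance of the martingale increment \<open>corrB x' - corrA x\<close>
  in a step from x, as \<open>cond_variance\<close> confirms.\<close>

definition "cvar x = Pop P (\<lambda>z. corrB z ^ 2) x - corrA x ^ 2"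
definition "\<sigma>2 = sigma2 P \<nu> f"
definition "corrD = potential (\<lambda>x. cvar x - \<sigma>2)"

lemma centred': "(\<Sum>x\<in>UNIV. f x * \<nu> x) = 0" using centred by (simp add: H2_def)

lemma corrB_eq: "corrB x = corrA x + f x"
  using poisson(2)[OF centred', of x] by (simp add: corrB_def corrA_def)

lemma drift_zero: "(\<Sum>x'\<in>UNIV. P x x' * (corrB x' - corrA x)) = 0"
  by (simp add: ring_distribs sum_subtractf sum_distrib_right[symmetric] P_sum corrA_def Pop_def mult_ac)

lemma cond_variance: "(\<Sum>x'\<in>UNIV. P x x' * (corrB x' - corrA x)\<^sup>2) = cvar x"
proof -
  have "(\<Sum>x'\<in>UNIV. P x x' * (corrB x' - corrA x)\<^sup>2)
     = (\<Sum>x'\<in>UNIV. (corrB x')\<^sup>2 * P x x') - 2 * corrA x * (\<Sum>x'\<in>UNIV. corrB x' * P x x') + (corrA x)\<^sup>2 * (\<Sum>x'\<in>UNIV. P x x')"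
    by (simp add: power2_eq_square algebra_simps sum_subtractf sum.distrib sum_distrib_left sum_distrib_right)
  then show ?thesis by (simp add: P_sum cvar_def Pop_def corrA_def[unfolded Pop_def, symmetric] power2_eq_square)
qed

text \<open>Since \<open>corrB\<close> is \<open>corrA\<close> plus \<open>f\<close>, the expression
  f^2 + 2 f corrA is a difference of squares corrB^2 - corrA^2. Invariance of \<open>\<nu>\<close>
  replaces corrB^2 by its one-step expectation, which leaves the conditional variance. The
  covariance series in \<open>sigma2\<close> is summed by \<open>poisson\<close>.\<close>

lemma sigma2_mean: "(\<Sum>x\<in>UNIV. cvar x * \<nu> x) = \<sigma>2"
proof -
  have 1: "(\<lambda>n. \<Sum>x\<in>UNIV. f x * Ppow P (Suc n) f x * \<nu> x) sums (\<Sum>x\<in>UNIV. f x * corrA x * \<nu> x)"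
    unfolding corrA_def corrB_def by (intro sums_sum sums_mult sums_mult2 poisson centred')
  have "\<sigma>2 = (\<Sum>x\<in>UNIV. f x ^ 2 * \<nu> x) + 2 * (\<Sum>x\<in>UNIV. f x * corrA x * \<nu> x)"
    using sums_unique[OF 1] by (simp add: \<sigma>2_def sigma2_def)
  also have "\<dots> = (\<Sum>x\<in>UNIV. (f x ^ 2 + 2 * (f x * corrA x)) * \<nu> x)"
    by (simp add: sum_distrib_left sum.distrib ring_distribs mult_ac)
  also have "\<dots> = (\<Sum>x\<in>UNIV. (corrB x)\<^sup>2 * \<nu> x - (corrA x)\<^sup>2 * \<nu> x)"
    by (intro sum.cong) (auto simp: corrB_eq power2_eq_square algebra_simps)
  also have "\<dots> = (\<Sum>x\<in>UNIV. Pop P (\<lambda>z. corrB z ^ 2) x * \<nu> x) - (\<Sum>x\<in>UNIV. (corrA x)\<^sup>2 * \<nu> x)"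
    by (simp add: sum_subtractf nu_Pop)
  also have "\<dots> = (\<Sum>x\<in>UNIV. cvar x * \<nu> x)" by (simp add: cvar_def sum_subtractf left_diff_distrib)
  finally show ?thesis by simp
qed

lemma corrD_eq: "(\<Sum>x'\<in>UNIV. P x x' * corrD x') = corrD x - cvar x + \<sigma>2"
proof -
  have "(\<Sum>x\<in>UNIV. (cvar x - \<sigma>2) * \<nu> x) = 0"
    by (simp add: left_diff_distrib sum_subtractf sigma2_mean sum_distrib_left[symmetric] nu_sum)
  from poisson(2)[OF this, of x] show ?thesis by (simp add: corrD_def Pop_def mult.commute)
qed

text \<open>If the mean of \<open>cvar\<close> vanished, f would be a difference of values of
  \<open>corrB\<close> along every possible transition, and its sum around every possible cycle
  would be zero.\<close>

lemma \<sigma>2_pos: "\<sigma>2 > 0"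
proof (rule ccontr)
  assume n: "\<not> \<sigma>2 > 0"
  have c0: "cvar x \<ge> 0" for x unfolding cond_variance[symmetric] by (intro sum_nonneg) (auto simp: P_nonneg)
  have "(\<Sum>x\<in>UNIV. cvar x * \<nu> x) = 0"
    using n sigma2_mean sum_nonneg[of UNIV "\<lambda>x. cvar x * \<nu> x"] c0 nu_nonneg by auto
  then have "\<And>x. cvar x * \<nu> x = 0" by (subst (asm) sum_nonneg_eq_0_iff) (auto simp: c0 nu_nonneg)
  then have cv: "cvar x = 0" for x using nu_pos[of x] by (metis less_irrefl mult_eq_0_iff)
  have step: "f x = corrB x - corrB x'" if "P x x' > 0" for x x'
  proof -
    have "(\<Sum>x'\<in>UNIV. P x x' * (corrB x' - corrA x)\<^sup>2) = 0" by (simp add: cond_variance cv)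
    then have "P x x' * (corrB x' - corrA x)\<^sup>2 = 0" by (subst (asm) sum_nonneg_eq_0_iff) (auto simp: P_nonneg)
    then show ?thesis using that corrB_eq[of x] by simp
  qed
  \<comment> \<open>With both parameters zero the lattice is {0}, so some possible cycle has a
    nonzero sum.\<close>
  from nonlattice[unfolded H3_def, rule_format, of 0 0] obtain n xs where
    pr: "(\<Prod>i<n. P (xs i) (xs (Suc i))) * P (xs n) (xs 0) > 0" and ns: "(\<Sum>i\<le>n. f (xs i)) \<noteq> 0" by auto
  have "(\<Prod>i<n. P (xs i) (xs (Suc i))) \<ge> 0" by (intro prod_nonneg) (auto simp: P_nonneg)
  then have pp: "(\<Prod>i<n. P (xs i) (xs (Suc i))) > 0" and pn: "P (xs n) (xs 0) > 0"
    using pr by (auto simp: zero_less_mult_iff)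
  have "P (xs i) (xs (Suc i)) > 0" if "i < n" for i
    using pp P_nonneg[of "xs i" "xs (Suc i)"] that
    by (metis finite_lessThan lessThan_iff less_irrefl order_le_less prod_zero)
  then have "(\<Sum>i<n. f (xs i)) = (\<Sum>i<n. corrB (xs i) - corrB (xs (Suc i)))"
    by (intro sum.cong) (auto simp: step)
  also have "\<dots> = corrB (xs 0) - corrB (xs n)" by (rule sum_lessThan_telescope')
  finally have "(\<Sum>i\<le>n. f (xs i)) = 0"
    using step[OF pn] by (simp add: lessThan_Suc_atMost[symmetric])
  with ns show False by simp
qed

end

subsection \<open>Fourier operators\<close>

lemma exp_minus_bounds:
  fixes s :: real assumes "s \<ge> 0"
  shows "\<bar>1 - s - exp (- s)\<bar> \<le> s\<^sup>2" "\<bar>1 - exp (- s)\<bar> \<le> s"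
proof -
  have a: "1 - s \<le> exp (- s)" using exp_ge_add_one_self[of "- s"] by simp
  have "exp (- s) * (1 + s) \<le> exp (- s) * exp s" using exp_ge_add_one_self[of s] by (intro mult_left_mono) auto
  then have "exp (- s) * (1 + s) \<le> 1" by (simp add: exp_minus)
  then have "exp (- s) \<le> 1 / (1 + s)" using assms by (simp add: field_simps)
  also have "\<dots> \<le> 1 - s + s\<^sup>2"
  proof -
    have "1 \<le> (1 - s + s\<^sup>2) * (1 + s)" using assms by (simp add: algebra_simps power2_eq_square)
    then show ?thesis using assms by (simp add: field_simps)
  qed
  finally show "\<bar>1 - s - exp (- s)\<bar> \<le> s\<^sup>2" using a by simp
  show "\<bar>1 - exp (- s)\<bar> \<le> s" using a assms by simp
qed

lemma cis_expansion: "norm (cis u - (1 + \<i> * of_real u - of_real (u\<^sup>2 / 2))) \<le> \<bar>u\<bar> ^ 3"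
proof -
  have "norm (iexp u - (\<Sum>k\<le>2. (\<i> * u) ^ k / fact k)) \<le> \<bar>u\<bar> ^ Suc 2 / fact (Suc 2)" by (rule iexp_approx1)
  also have "(\<Sum>k\<le>2. (\<i> * of_real u) ^ k / fact k) = 1 + \<i> * of_real u - of_real (u\<^sup>2 / 2)"
    by (simp add: numeral_2_eq_2 power2_eq_square field_simps)
  also have "\<bar>u\<bar> ^ Suc 2 / fact (Suc 2) = \<bar>u\<bar> ^ 3 / 6" by (simp add: fact_numeral eval_nat_numeral)
  also have "\<dots> \<le> \<bar>u\<bar> ^ 3" using zero_le_power[of "\<bar>u\<bar>" 3] by linarith
  finally show ?thesis by (simp add: cis_conv_exp)
qed

lemma cis_near_1: "norm (cis u - 1) \<le> \<bar>u\<bar>"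
proof -
  have "norm (iexp u - (\<Sum>k\<le>0. (\<i> * u) ^ k / fact k)) \<le> \<bar>u\<bar> ^ Suc 0 / fact (Suc 0)" by (rule iexp_approx1)
  then show ?thesis by (simp add: cis_conv_exp)
qed

context markov_walk
begin

text \<open>The free step maps \<open>cis (t * y) * g x\<close> to
  \<open>cis (t * y) * Fop t g x\<close>: on functions of frequency t in the level, the walk reduces
  to a finite matrix.\<close>

definition Fop :: "real \<Rightarrow> ('a \<Rightarrow> complex) \<Rightarrow> 'a \<Rightarrow> complex" where
  "Fop t g x = (\<Sum>x'\<in>UNIV. of_real (P x x') * cis (t * f x') * g x')"

lemma Fop_pow_Suc: "(Fop t ^^ Suc n) g x = (\<Sum>x'\<in>UNIV. of_real (P x x') * cis (t * f x') * (Fop t ^^ n) g x')"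
  unfolding funpow.simps o_def by (rule Fop_def)

lemma Fop_pow_linear: "(Fop t ^^ n) (\<lambda>x. a * g x + b * h x) x = a * (Fop t ^^ n) g x + b * (Fop t ^^ n) h x"
proof (induction n arbitrary: x)
  case (Suc n)
  show ?case unfolding Fop_pow_Suc Suc.IH
    by (simp add: ring_distribs sum.distrib sum_distrib_left mult_ac)
qed simp

lemma Fop_pow_sum: "(Fop t ^^ n) (\<lambda>x. \<Sum>i\<in>I. a i * g i x) x = (\<Sum>i\<in>I. a i * (Fop t ^^ n) (g i) x)"
proof (induction I rule: infinite_finite_induct)
  case (insert i I)
  then show ?case using Fop_pow_linear[of n t "a i" "g i" 1 "\<lambda>x. \<Sum>i\<in>I. a i * g i x"] by simp
qed (use Fop_pow_linear[of n t 0 "\<lambda>_. 0" 0 "\<lambda>_. 0"] in simp_all)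

lemma norm_wsum_le:
  assumes "\<And>x'. norm (z x') \<le> (c::real)"
  shows "norm (\<Sum>x'\<in>UNIV. of_real (P x x') * (z x' :: complex)) \<le> c"
proof -
  have "norm (\<Sum>x'\<in>UNIV. of_real (P x x') * z x') \<le> (\<Sum>x'\<in>UNIV. P x x' * c)"
    using assms by (intro sum_norm_le) (auto simp: norm_mult P_nonneg intro!: mult_left_mono)
  then show ?thesis by (simp add: sum_distrib_right[symmetric] P_sum)
qed

lemma Fop_pow_bound: "(\<And>x. norm (g x) \<le> c) \<Longrightarrow> norm ((Fop t ^^ n) g x) \<le> c"
proof (induction n arbitrary: x)
  case (Suc n)
  show ?case unfolding Fop_pow_Suc mult.assoc
    by (rule norm_wsum_le) (simp add: norm_mult Suc)
qed simp

text \<open>The expectation, from x, of the phase exp(i t S_n) on the event that the chain is at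
  \<open>x'\<close> after n steps.\<close>

definition "Fker n t x x' = (Fop t ^^ n) (\<lambda>z. if z = x' then 1 else 0) x"

lemma Fker_0: "Fker 0 t x x' = (if x = x' then 1 else 0)" by (simp add: Fker_def)

lemma Fker_Suc: "Fker (Suc n) t x z = (\<Sum>x'\<in>UNIV. of_real (P x x') * cis (t * f x') * Fker n t x' z)"
  unfolding Fker_def by (rule Fop_pow_Suc)

lemma Fop_pow_kernel: "(Fop t ^^ n) g x = (\<Sum>x'\<in>UNIV. g x' * Fker n t x x')"
proof -
  have "g = (\<lambda>x. \<Sum>i\<in>UNIV. g i * (if x = i then 1 else 0))"
    by (rule ext) (simp add: if_distrib[of "\<lambda>u. _ * u"] sum.delta cong: if_cong)
  then have "(Fop t ^^ n) g x = (Fop t ^^ n) (\<lambda>x. \<Sum>i\<in>UNIV. g i * (if x = i then 1 else 0)) x" by simp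
  also have "\<dots> = (\<Sum>x'\<in>UNIV. g x' * Fker n t x x')" unfolding Fop_pow_sum Fker_def ..
  finally show ?thesis .
qed

lemma Fker_cont: "continuous_on UNIV (\<lambda>t. Fker n t x z)"
proof (induction n arbitrary: x)
  case (Suc n)
  show ?case unfolding Fker_Suc cis_conv_exp by (intro continuous_intros Suc)
qed (simp add: Fker_0)

definition "Pker n x x' = Ppow P n (\<lambda>z. if z = x' then 1 else 0) x"

lemma Pker_0: "Pker 0 x x' = (if x = x' then 1 else 0)" by (simp add: Pker_def)

lemma Pker_Suc: "Pker (Suc n) x z = (\<Sum>x'\<in>UNIV. P x x' * Pker n x' z)"
  by (simp add: Pker_def Pop_def mult.commute)

lemma Pker_nonneg: "Pker n x z \<ge> 0"
  using Ppow_mono[of "\<lambda>_. 0" "\<lambda>u. if u = z then 1 else 0" n x] by (simp add: Pker_def Ppow_const)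

lemma Pker_sum: "(\<Sum>z\<in>UNIV. Pker n x z) = 1"
  using Ppow_kernel[of n "\<lambda>_. 1" x] unfolding Ppow_const Pker_def by simp

lemma norm_Fker_le: "norm (Fker n t x z) \<le> Pker n x z"
proof (induction n arbitrary: x)
  case (Suc n)
  show ?case unfolding Fker_Suc Pker_Suc
    using Suc by (intro sum_norm_le) (auto simp: norm_mult P_nonneg intro!: mult_left_mono)
qed (simp add: Fker_0 Pker_0)

definition "Fnorm n t x = (\<Sum>z\<in>UNIV. norm (Fker n t x z))"

lemma Fop_pow_Fnorm: "(\<And>x. norm (g x) \<le> c) \<Longrightarrow> norm ((Fop t ^^ n) g x) \<le> Fnorm n t x * c"
  unfolding Fop_pow_kernel Fnorm_def sum_distrib_right
  by (intro sum_norm_le) (auto simp: norm_mult mult.commute[of "norm (Fker n t x _)"] intro!: mult_right_mono)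

text \<open>The conjugate phases of the row of the kernel form an extremal function. Hence
  \<open>Fnorm\<close> is an operator norm, row by row, and inherits bounds for
  compositions.\<close>

lemma Fnorm_attained: "\<exists>g. (\<forall>z. norm (g z) \<le> 1) \<and> norm ((Fop t ^^ n) g x) = Fnorm n t x"
proof -
  define g where "g z = cnj (sgn (Fker n t x z))" for z
  have "(Fop t ^^ n) g x = (\<Sum>z\<in>UNIV. of_real (norm (Fker n t x z)))"
    unfolding Fop_pow_kernel
  proof (intro sum.cong refl)
    fix z show "g z * Fker n t x z = complex_of_real (norm (Fker n t x z))"
    proof (cases "Fker n t x z = 0")
      case False
      have "cnj (Fker n t x z) * Fker n t x z = of_real ((norm (Fker n t x z))\<^sup>2)"
        using complex_norm_square[of "Fker n t x z"] by (simp add: mult.commute)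
      then show ?thesis using False by (simp add: g_def sgn_eq power2_eq_square field_simps)
    qed (simp add: g_def)
  qed
  also have "\<dots> = of_real (Fnorm n t x)" by (simp add: Fnorm_def)
  finally have "(Fop t ^^ n) g x = of_real (Fnorm n t x)" .
  moreover have "Fnorm n t x \<ge> 0" unfolding Fnorm_def by (rule sum_nonneg) simp
  ultimately have "norm ((Fop t ^^ n) g x) = Fnorm n t x" by simp
  moreover have "norm (g z) \<le> 1" for z by (simp add: g_def norm_sgn)
  ultimately show ?thesis by blast
qed

text \<open>The extra factors of \<open>Fop t\<close> are contractions in the supremum norm. Bounds
  obtained at different exponents can thus be brought to a common one.\<close>

lemma Fnorm_mono:
  assumes "\<And>x. Fnorm q t x \<le> c" "q \<le> n"
  shows "Fnorm n t x \<le> c"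
proof -
  obtain g where g: "\<forall>z. norm (g z) \<le> 1" "norm ((Fop t ^^ n) g x) = Fnorm n t x" using Fnorm_attained by blast
  have "(Fop t ^^ n) g x = (Fop t ^^ q) ((Fop t ^^ (n - q)) g) x"
    using assms(2) by (metis funpow_add le_add_diff_inverse o_apply)
  also have "norm \<dots> \<le> Fnorm q t x * 1"
    by (intro Fop_pow_Fnorm Fop_pow_bound) (use g in auto)
  finally show ?thesis using g assms(1)[of x] by simp
qed

lemma Fnorm_iterate:
  assumes "\<And>x. Fnorm q t x \<le> c" "0 \<le> c" "\<And>x. norm (g x) \<le> 1"
  shows "norm ((Fop t ^^ (j * q)) g x) \<le> c ^ j"
proof (induction j arbitrary: x)
  case (Suc j)
  have "(Fop t ^^ (Suc j * q)) g x = (Fop t ^^ q) ((Fop t ^^ (j * q)) g) x"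
    by (simp add: funpow_add)
  also have "norm \<dots> \<le> Fnorm q t x * c ^ j"
    by (intro Fop_pow_Fnorm Suc)
  also have "\<dots> \<le> c * c ^ j" using assms by (intro mult_right_mono) auto
  finally show ?case by simp
qed (simp add: assms)

lemma Fnorm_half_exp:
  assumes h: "\<And>x. Fnorm q t x \<le> 1/2" and "q \<ge> 1" and g: "\<And>x. norm (g x) \<le> 1"
  shows "norm ((Fop t ^^ k) g x) \<le> 2 * exp (- ln 2 * real k / real q)"
proof -
  let ?j = "k div q"
  have "(Fop t ^^ k) g x = (Fop t ^^ (k mod q)) ((Fop t ^^ (?j * q)) g) x"
    by (metis add.commute funpow_add mod_div_mult_eq o_apply)
  also have "norm \<dots> \<le> (1/2) ^ ?j"
    by (intro Fop_pow_bound Fnorm_iterate h g) auto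
  also have "(1/2::real) ^ ?j = exp (- ln 2 * real ?j)"
  proof -
    have "exp (- ln 2 * real ?j) = exp (- ln 2) ^ ?j" by (metis exp_of_nat_mult mult.commute)
    then show ?thesis by (simp add: exp_minus power_divide field_simps)
  qed
  \<comment> \<open>Rounding k / q down loses at most one halving, the source of the factor
    2.\<close>
  also have "\<dots> \<le> exp (ln 2 - ln 2 * real k / real q)"
  proof -
    have "k < (?j + 1) * q" using assms(2) by (metis Suc_eq_plus1 dividend_less_div_times mult.commute mult_Suc_right not_one_le_zero gr0I add.commute mult_Suc)
    then have "real k \<le> (real ?j + 1) * real q" by (metis less_imp_le of_nat_1 of_nat_add of_nat_le_iff of_nat_mult)
    then have "real k / real q \<le> real ?j + 1" using assms(2) by (simp add: field_simps)
    then have "ln 2 * (real k / real q) \<le> ln 2 * (real ?j + 1)" by (intro mult_left_mono) auto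
    then show ?thesis by (simp add: algebra_simps)
  qed
  also have "\<dots> = 2 * exp (- ln 2 * real k / real q)" by (simp add: exp_diff exp_minus field_simps)
  finally show ?thesis .
qed

section \<open>Second-order perturbation of the leading eigenvalue\<close>

definition "eigf t x = cis (t * corrA x) * of_real (1 - t\<^sup>2 * corrD x / 2)"

text \<open>The phase \<open>cis (t * corrA x)\<close> in \<open>eigf\<close> turns f into the
  martingale increment d, because f x' + corrA x' = corrA x + d x'. In the expansion the linear term
  then averages to zero, and the quadratic term gives \<open>cvar\<close>, which depends on x; the
  factor with \<open>corrD\<close> replaces it by the constant \<open>\<sigma>2\<close>. What
  remains is of third order in t.\<close>

lemma eigf_approx:
  "\<exists>C\<ge>0. \<forall>t x. \<bar>t\<bar> \<le> 1 \<longrightarrow> norm (Fop t (eigf t) x - of_real (exp (- \<sigma>2 * t\<^sup>2 / 2)) * eigf t x) \<le> C * \<bar>t\<bar> ^ 3"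
proof -
  define K where "K = 1 + (\<Sum>x\<in>UNIV. \<bar>corrA x\<bar>) + (\<Sum>x\<in>UNIV. \<bar>corrB x\<bar>) + (\<Sum>x\<in>UNIV. \<bar>corrD x\<bar>) + \<sigma>2"
  have mem: "\<bar>h x\<bar> \<le> (\<Sum>x\<in>UNIV. \<bar>h x\<bar>)" for h :: "'a \<Rightarrow> real" and x by (rule member_le_sum) auto
  have pos: "0 \<le> (\<Sum>x\<in>UNIV. \<bar>h x\<bar>)" for h :: "'a \<Rightarrow> real" by (rule sum_nonneg) simp
  have K1: "K \<ge> 1" using pos[of corrA] pos[of corrB] pos[of corrD] \<sigma>2_pos unfolding K_def by linarith
  have dK: "\<bar>corrB x' - corrA x\<bar> \<le> K" for x x'
    using mem[of corrB x'] mem[of corrA x] pos[of corrD] \<sigma>2_pos unfolding K_def by linarith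
  have DK: "\<bar>corrD x\<bar> \<le> K" for x
    using mem[of corrD x] pos[of corrA] pos[of corrB] \<sigma>2_pos unfolding K_def by linarith
  have sK: "\<sigma>2 \<le> K" using pos[of corrA] pos[of corrB] pos[of corrD] unfolding K_def by linarith
  define Cw where "Cw = K ^ 3 * (1 + K) + K * (K + K\<^sup>2)"
  define C where "C = Cw + K\<^sup>2 + K * K"
  show ?thesis
  proof (intro exI[of _ C] conjI allI impI)
    show "C \<ge> 0" using K1 by (auto simp: C_def Cw_def)
    fix t :: real and x assume t: "\<bar>t\<bar> \<le> 1"
    have t2: "t\<^sup>2 \<le> 1" using t by (simp add: abs_square_le_1)
    define d where "d x' = corrB x' - corrA x" for x'
    define q where "q x' = t\<^sup>2 * corrD x' / 2" for x'
    have qK: "\<bar>q x'\<bar> \<le> t\<^sup>2 * K" for x'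
    proof -
      have "\<bar>q x'\<bar> = t\<^sup>2 * \<bar>corrD x'\<bar> / 2" by (simp add: q_def abs_mult)
      also have "\<dots> \<le> t\<^sup>2 * \<bar>corrD x'\<bar>" by simp
      also have "\<dots> \<le> t\<^sup>2 * K" by (intro mult_left_mono DK) simp
      finally show ?thesis .
    qed
    \<comment> \<open>The terms of order at most two in t of the product
      \<open>cis (t * d x') * (1 - q x')\<close>; their average is computed exactly below.\<close>
    define main where "main x' = (1 + \<i> * of_real (t * d x') - of_real ((t * d x')\<^sup>2 / 2)) - of_real (q x')" for x'
    have w: "norm (cis (t * d x') * of_real (1 - q x') - main x') \<le> Cw * \<bar>t\<bar> ^ 3" for x'
    proof -
      let ?E = "cis (t * d x') - (1 + \<i> * of_real (t * d x') - of_real ((t * d x')\<^sup>2 / 2))"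
      have eq: "cis (t * d x') * of_real (1 - q x') - main x' = ?E * of_real (1 - q x') - of_real (q x') * (\<i> * of_real (t * d x') - of_real ((t * d x')\<^sup>2 / 2))"
      proof -
        have "c * (1 - p) - ((1 + a - b) - p) = (c - (1 + a - b)) * (1 - p) - p * (a - b)" for a b c p :: complex
          by (simp add: algebra_simps)
        then show ?thesis unfolding main_def of_real_diff of_real_1 .
      qed
      have td: "\<bar>t * d x'\<bar> \<le> \<bar>t\<bar> * K" by (simp add: abs_mult d_def dK mult_left_mono)
      have "norm ?E \<le> \<bar>t * d x'\<bar> ^ 3" by (rule cis_expansion)
      also have "\<dots> \<le> (\<bar>t\<bar> * K) ^ 3" by (rule power_mono[OF td]) simp
      finally have E: "norm ?E \<le> (\<bar>t\<bar> * K) ^ 3" .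
      have "t\<^sup>2 * K \<le> 1 * K" using t2 K1 by (intro mult_right_mono) auto
      then have q1: "\<bar>1 - q x'\<bar> \<le> 1 + K" using qK[of x'] by simp
      have "norm (\<i> * of_real (t * d x') - complex_of_real ((t * d x')\<^sup>2 / 2)) \<le> \<bar>t * d x'\<bar> + (t * d x')\<^sup>2 / 2"
        by (rule order_trans[OF norm_triangle_ineq4]) (simp only: norm_mult norm_ii norm_of_real mult_1, simp)
      also have "\<dots> \<le> \<bar>t\<bar> * K + (\<bar>t\<bar> * K)\<^sup>2"
      proof -
        have "(t * d x')\<^sup>2 \<le> (\<bar>t\<bar> * K)\<^sup>2" using power_mono[OF td, of 2] by simp
        then show ?thesis using td zero_le_power2[of "t * d x'"] by linarith
      qed
      also have "\<dots> \<le> \<bar>t\<bar> * (K + K\<^sup>2)"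
      proof -
        have "\<bar>t\<bar> * \<bar>t\<bar> \<le> \<bar>t\<bar> * 1" using t by (intro mult_left_mono) auto
        then have "\<bar>t\<bar> * \<bar>t\<bar> * K\<^sup>2 \<le> \<bar>t\<bar> * K\<^sup>2" by (intro mult_right_mono) auto
        then show ?thesis by (simp add: power2_eq_square algebra_simps)
      qed
      finally have I: "norm (\<i> * of_real (t * d x') - complex_of_real ((t * d x')\<^sup>2 / 2)) \<le> \<bar>t\<bar> * (K + K\<^sup>2)" .
      have "norm (cis (t * d x') * of_real (1 - q x') - main x') \<le> (\<bar>t\<bar> * K) ^ 3 * (1 + K) + (t\<^sup>2 * K) * (\<bar>t\<bar> * (K + K\<^sup>2))"
        unfolding eq
        by (rule order_trans[OF norm_triangle_ineq4], unfold norm_mult norm_of_real, intro add_mono mult_mono E q1 qK I) (use K1 in auto)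
      also have "\<dots> = Cw * \<bar>t\<bar> ^ 3"
        by (simp add: Cw_def power2_eq_square power3_eq_cube algebra_simps flip: abs_mult)
      finally show ?thesis .
    qed
    have mainsum: "(\<Sum>x'\<in>UNIV. of_real (P x x') * main x') = of_real (1 - q x - \<sigma>2 * t\<^sup>2 / 2)"
    proof -
      have "(\<Sum>x'\<in>UNIV. of_real (P x x') * main x')
        = of_real (\<Sum>x'\<in>UNIV. P x x') + \<i> * of_real (t * (\<Sum>x'\<in>UNIV. P x x' * d x'))
          - of_real (t\<^sup>2 / 2 * (\<Sum>x'\<in>UNIV. P x x' * (d x')\<^sup>2)) - of_real (t\<^sup>2 / 2 * (\<Sum>x'\<in>UNIV. P x x' * corrD x'))"
        unfolding main_def q_def
        by (simp add: ring_distribs sum.distrib sum_subtractf sum_distrib_left power_mult_distrib mult_ac)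
      also have "\<dots> = of_real (1 - q x - \<sigma>2 * t\<^sup>2 / 2)"
        unfolding P_sum d_def drift_zero cond_variance corrD_eq q_def by (simp add: field_simps)
      finally show ?thesis .
    qed
    define e where "e = exp (- \<sigma>2 * t\<^sup>2 / 2)"
    have F: "Fop t (eigf t) x = cis (t * corrA x) * (\<Sum>x'\<in>UNIV. of_real (P x x') * (cis (t * d x') * of_real (1 - q x')))"
      unfolding Fop_def sum_distrib_left
    proof (intro sum.cong refl)
      fix x'
      have "cis (t * f x') * cis (t * corrA x') = cis (t * corrA x) * cis (t * d x')"
        by (simp add: cis_mult d_def corrB_eq algebra_simps)
      then show "of_real (P x x') * cis (t * f x') * eigf t x' = cis (t * corrA x) * (of_real (P x x') * (cis (t * d x') * of_real (1 - q x')))"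
        by (simp add: eigf_def q_def mult_ac) 
    qed
    have "Fop t (eigf t) x - of_real e * eigf t x =
       cis (t * corrA x) * ((\<Sum>x'\<in>UNIV. of_real (P x x') * (cis (t * d x') * of_real (1 - q x') - main x')) + of_real ((1 - q x - \<sigma>2 * t\<^sup>2 / 2) - e * (1 - q x)))"
      unfolding F eigf_def right_diff_distrib sum_subtractf mainsum q_def by (simp add: algebra_simps)
    then have eq: "norm (Fop t (eigf t) x - of_real e * eigf t x) = norm ((\<Sum>x'\<in>UNIV. of_real (P x x') * (cis (t * d x') * of_real (1 - q x') - main x')) + of_real ((1 - q x - \<sigma>2 * t\<^sup>2 / 2) - e * (1 - q x)))"
      by (simp only: norm_mult norm_cis mult_1)
    have "norm (Fop t (eigf t) x - of_real e * eigf t x) \<le> norm (\<Sum>x'\<in>UNIV. of_real (P x x') * (cis (t * d x') * of_real (1 - q x') - main x')) + \<bar>(1 - q x - \<sigma>2 * t\<^sup>2 / 2) - e * (1 - q x)\<bar>"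
      unfolding eq by (rule order_trans[OF norm_triangle_ineq]) (simp only: norm_of_real order_refl)
    also have "\<dots> \<le> Cw * \<bar>t\<bar> ^ 3 + (K\<^sup>2 + K * K) * \<bar>t\<bar> ^ 3"
    proof (intro add_mono norm_wsum_le w)
      define s where "s = \<sigma>2 * t\<^sup>2 / 2"
      have s0: "s \<ge> 0" using \<sigma>2_pos by (simp add: s_def)
      have "s \<le> \<sigma>2 * t\<^sup>2" using \<sigma>2_pos by (simp add: s_def)
      also have "\<dots> \<le> K * t\<^sup>2" by (intro mult_right_mono sK) simp
      finally have sK': "s \<le> t\<^sup>2 * K" by (simp add: mult.commute)
      have es: "e = exp (- s)" by (simp add: e_def s_def)
      have "(1 - q x - s) - e * (1 - q x) = (1 - s - exp (- s)) - q x * (1 - exp (- s))" by (simp add: es algebra_simps)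
      then have "\<bar>(1 - q x - s) - e * (1 - q x)\<bar> \<le> \<bar>1 - s - exp (- s)\<bar> + \<bar>q x\<bar> * \<bar>1 - exp (- s)\<bar>"
        by (metis abs_mult abs_triangle_ineq4)
      also have "\<dots> \<le> s\<^sup>2 + (t\<^sup>2 * K) * s"
        by (intro add_mono mult_mono qK exp_minus_bounds s0) (use K1 in auto)
      also have "\<dots> \<le> (t\<^sup>2 * K)\<^sup>2 + (t\<^sup>2 * K) * (t\<^sup>2 * K)"
        by (intro add_mono power_mono mult_left_mono sK' s0) (use K1 in auto)
      also have "\<dots> = (K\<^sup>2 + K * K) * (\<bar>t\<bar> ^ 3 * \<bar>t\<bar>)"
        by (simp add: power2_eq_square power3_eq_cube algebra_simps flip: abs_mult)
      also have "\<dots> \<le> (K\<^sup>2 + K * K) * (\<bar>t\<bar> ^ 3 * 1)"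
        using t K1 by (intro mult_left_mono) auto
      finally show "\<bar>(1 - q x - \<sigma>2 * t\<^sup>2 / 2) - e * (1 - q x)\<bar> \<le> (K\<^sup>2 + K * K) * \<bar>t\<bar> ^ 3" by (simp add: s_def)
    qed
    also have "\<dots> = C * \<bar>t\<bar> ^ 3" by (simp add: C_def algebra_simps)
    finally show "norm (Fop t (eigf t) x - of_real (exp (- \<sigma>2 * t\<^sup>2 / 2)) * eigf t x) \<le> C * \<bar>t\<bar> ^ 3" by (simp add: e_def)
  qed
qed


definition "fM = (\<Sum>x\<in>UNIV. \<bar>f x\<bar>)"

lemma fM: "\<bar>f x\<bar> \<le> fM" "fM \<ge> 0"
  unfolding fM_def by (rule member_le_sum) (auto intro: sum_nonneg)

text \<open>The operators contract and the approximate eigenvalue is at most 1, so the one-step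
  defects simply add up.\<close>

lemma eigf_pow:
  "\<exists>C\<ge>0. \<forall>t n x. \<bar>t\<bar> \<le> 1 \<longrightarrow> norm ((Fop t ^^ n) (eigf t) x - of_real (exp (- \<sigma>2 * t\<^sup>2 / 2 * real n)) * eigf t x) \<le> real n * C * \<bar>t\<bar> ^ 3"
proof -
  obtain C where C0: "C \<ge> 0" and C: "\<forall>t x. \<bar>t\<bar> \<le> 1 \<longrightarrow> norm (Fop t (eigf t) x - of_real (exp (- \<sigma>2 * t\<^sup>2 / 2)) * eigf t x) \<le> C * \<bar>t\<bar> ^ 3"
    using eigf_approx by blast
  show ?thesis
  proof (intro exI[of _ C] conjI C0 allI impI)
    fix t :: real and n x assume t: "\<bar>t\<bar> \<le> 1"
    define l where "l = exp (- \<sigma>2 * t\<^sup>2 / 2)"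
    have l: "0 \<le> l" "l \<le> 1" using \<sigma>2_pos by (auto simp: l_def)
    have "norm ((Fop t ^^ n) (eigf t) x - of_real (l ^ n) * eigf t x) \<le> real n * C * \<bar>t\<bar> ^ 3"
    proof (induction n arbitrary: x)
      case (Suc n)
      let ?r = "\<lambda>x. (Fop t ^^ n) (eigf t) x - of_real (l ^ n) * eigf t x"
      have "(Fop t ^^ n) (eigf t) = (\<lambda>x. of_real (l ^ n) * eigf t x + 1 * ?r x)" by (rule ext) simp
      then have "(Fop t ^^ Suc n) (eigf t) x = (Fop t ^^ 1) (\<lambda>x. of_real (l ^ n) * eigf t x + 1 * ?r x) x" by simp
      also have "\<dots> = of_real (l ^ n) * Fop t (eigf t) x + (Fop t ^^ 1) ?r x" unfolding Fop_pow_linear by simp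
      finally have "(Fop t ^^ Suc n) (eigf t) x - of_real (l ^ Suc n) * eigf t x
          = of_real (l ^ n) * (Fop t (eigf t) x - of_real l * eigf t x) + (Fop t ^^ 1) ?r x"
        by (simp add: algebra_simps)
      also have "norm \<dots> \<le> l ^ n * (C * \<bar>t\<bar> ^ 3) + real n * C * \<bar>t\<bar> ^ 3"
      proof (rule order_trans[OF norm_triangle_ineq], rule add_mono)
        have "norm (of_real (l ^ n) * (Fop t (eigf t) x - of_real l * eigf t x)) = l ^ n * norm (Fop t (eigf t) x - of_real l * eigf t x)"
          using l by (simp only: norm_mult norm_of_real) simp
        also have "\<dots> \<le> l ^ n * (C * \<bar>t\<bar> ^ 3)" using C t l by (intro mult_left_mono) (auto simp: l_def)
        finally show "norm (of_real (l ^ n) * (Fop t (eigf t) x - of_real l * eigf t x)) \<le> l ^ n * (C * \<bar>t\<bar> ^ 3)" .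
        show "norm ((Fop t ^^ 1) ?r x) \<le> real n * C * \<bar>t\<bar> ^ 3" by (rule Fop_pow_bound[OF Suc.IH])
      qed
      also have "\<dots> \<le> 1 * (C * \<bar>t\<bar> ^ 3) + real n * C * \<bar>t\<bar> ^ 3"
        using l C0 by (intro add_mono mult_right_mono power_le_one) auto
      finally show ?case by (simp add: algebra_simps)
    qed simp
    moreover have "l ^ n = exp (- \<sigma>2 * t\<^sup>2 / 2 * real n)"
      unfolding l_def by (subst exp_of_nat_mult[symmetric]) (simp add: mult.commute)
    ultimately show "norm ((Fop t ^^ n) (eigf t) x - of_real (exp (- \<sigma>2 * t\<^sup>2 / 2 * real n)) * eigf t x) \<le> real n * C * \<bar>t\<bar> ^ 3" by simp
  qed
qed

lemma eigf_near_1: "\<exists>C\<ge>0. \<forall>t x. \<bar>t\<bar> \<le> 1 \<longrightarrow> norm (eigf t x - 1) \<le> C * \<bar>t\<bar>"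
proof -
  define K where "K = (\<Sum>x\<in>UNIV. \<bar>corrA x\<bar> + \<bar>corrD x\<bar>)"
  have K: "\<bar>corrA x\<bar> + \<bar>corrD x\<bar> \<le> K" for x unfolding K_def by (rule member_le_sum) auto
  show ?thesis
  proof (intro exI[of _ K] conjI allI impI)
    show "K \<ge> 0" using K[of undefined] by linarith
    fix t :: real and x assume t: "\<bar>t\<bar> \<le> 1"
    have "eigf t x - 1 = (cis (t * corrA x) - 1) - cis (t * corrA x) * of_real (t\<^sup>2 * corrD x / 2)"
      unfolding eigf_def of_real_diff of_real_1 right_diff_distrib by (simp only: mult_1_right diff_diff_eq add.commute)
    then have "norm (eigf t x - 1) \<le> norm (cis (t * corrA x) - 1) + norm (cis (t * corrA x) * of_real (t\<^sup>2 * corrD x / 2))"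
      by (simp only: norm_triangle_ineq4)
    also have "\<dots> \<le> \<bar>t * corrA x\<bar> + \<bar>t\<^sup>2 * corrD x / 2\<bar>"
      by (intro add_mono cis_near_1) (simp only: norm_mult norm_cis norm_of_real mult_1 order_refl)
    also have "\<dots> \<le> \<bar>t\<bar> * \<bar>corrA x\<bar> + \<bar>t\<bar> * \<bar>corrD x\<bar>"
    proof (rule add_mono)
      have "\<bar>t\<bar> * \<bar>t\<bar> \<le> \<bar>t\<bar> * 1" using t by (intro mult_left_mono) auto
      then have "\<bar>t\<bar> * \<bar>t\<bar> * \<bar>corrD x\<bar> \<le> \<bar>t\<bar> * 1 * \<bar>corrD x\<bar>" by (intro mult_right_mono) auto
      moreover have "\<bar>t\<^sup>2 * corrD x / 2\<bar> = \<bar>t\<bar> * \<bar>t\<bar> * \<bar>corrD x\<bar> / 2" by (simp add: abs_mult power2_eq_square)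
      moreover have "0 \<le> \<bar>t\<bar> * 1 * \<bar>corrD x\<bar>" by simp
      ultimately show "\<bar>t\<^sup>2 * corrD x / 2\<bar> \<le> \<bar>t\<bar> * \<bar>corrD x\<bar>" by linarith
    qed (simp add: abs_mult)
    also have "\<dots> \<le> K * \<bar>t\<bar>" using mult_right_mono[OF K[of x], of "\<bar>t\<bar>"] by (simp add: algebra_simps)
    finally show "norm (eigf t x - 1) \<le> K * \<bar>t\<bar>" .
  qed
qed

section \<open>Gaussian approximation of the Fourier kernels and decay near frequency zero\<close>

lemma Fker_Pker: "norm (Fker n t x z - of_real (Pker n x z)) \<le> real n * (\<bar>t\<bar> * fM)"
proof (induction n arbitrary: x)
  case (Suc n)
  have "Fker (Suc n) t x z - of_real (Pker (Suc n) x z) = (\<Sum>x'\<in>UNIV. of_real (P x x') * (cis (t * f x') * Fker n t x' z - of_real (Pker n x' z)))"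
    unfolding Fker_Suc Pker_Suc by (simp add: right_diff_distrib sum_subtractf mult.assoc)
  also have "norm \<dots> \<le> \<bar>t\<bar> * fM + real n * (\<bar>t\<bar> * fM)"
  proof (rule norm_wsum_le)
    fix x'
    have "cis (t * f x') * Fker n t x' z - of_real (Pker n x' z) = (cis (t * f x') - 1) * Fker n t x' z + (Fker n t x' z - of_real (Pker n x' z))"
      by (simp add: algebra_simps)
    also have "norm \<dots> \<le> norm ((cis (t * f x') - 1) * Fker n t x' z) + real n * (\<bar>t\<bar> * fM)"
      by (rule order_trans[OF norm_triangle_ineq], rule add_mono[OF order_refl Suc.IH])
    also have "norm ((cis (t * f x') - 1) * Fker n t x' z) \<le> (\<bar>t\<bar> * fM) * 1"
      unfolding norm_mult
    proof (rule mult_mono)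
      have "norm (cis (t * f x') - 1) \<le> \<bar>t * f x'\<bar>" by (rule cis_near_1)
      also have "\<dots> \<le> \<bar>t\<bar> * fM" unfolding abs_mult by (rule mult_left_mono[OF fM(1)]) simp
      finally show "norm (cis (t * f x') - 1) \<le> \<bar>t\<bar> * fM" .
      show "norm (Fker n t x' z) \<le> 1" unfolding Fker_def by (rule Fop_pow_bound) simp
    qed (use fM in auto)
    finally show "norm (cis (t * f x') * Fker n t x' z - of_real (Pker n x' z)) \<le> \<bar>t\<bar> * fM + real n * (\<bar>t\<bar> * fM)" by simp
  qed
  finally show ?case by (simp add: algebra_simps)
qed (simp add: Fker_0 Pker_0)

lemma Pker_lim: "\<exists>C r. C \<ge> 0 \<and> 0 \<le> r \<and> r < 1 \<and> (\<forall>n x z. \<bar>Pker n x z - \<nu> z\<bar> \<le> C * r ^ n)"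
proof -
  obtain C r :: real where r: "C \<ge> 0" "0 \<le> r" "r < 1"
    and *: "\<forall>g n x c. (\<Sum>x\<in>UNIV. g x * \<nu> x) = 0 \<longrightarrow> (\<forall>x. \<bar>g x\<bar> \<le> c) \<longrightarrow> \<bar>Ppow P n g x\<bar> \<le> C * c * r ^ n"
    using Ppow_decay by blast
  have nu1: "\<nu> x \<le> 1" for x using nu_sum member_le_sum[of x UNIV \<nu>] nu_nonneg by simp
  have "\<bar>Pker n x z - \<nu> z\<bar> \<le> C * 1 * r ^ n" for n x z
  proof -
    let ?g = "\<lambda>u. (if u = z then 1 else 0) - \<nu> z"
    have a: "(\<Sum>x\<in>UNIV. ?g x * \<nu> x) = 0"
      by (simp add: left_diff_distrib sum_subtractf sum_distrib_left[symmetric] nu_sum if_distrib[of "\<lambda>u. u * _"] sum.delta cong: if_cong)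
    have b: "\<forall>x. \<bar>?g x\<bar> \<le> 1" using nu1[of z] nu_nonneg[of z] by auto
    have "\<bar>Ppow P n ?g x\<bar> \<le> C * 1 * r ^ n"
      by (rule *[THEN spec[of _ ?g], THEN spec[of _ n], THEN spec[of _ x], THEN spec[of _ 1], THEN mp, OF a, THEN mp, OF b])
    moreover have "Ppow P n ?g x = Pker n x z - \<nu> z"
    proof -
      have "Ppow P n ?g x = (\<Sum>x'\<in>UNIV. ?g x' * Pker n x x')" unfolding Pker_def by (rule Ppow_kernel)
      also have "\<dots> = Pker n x z - \<nu> z * (\<Sum>x'\<in>UNIV. Pker n x x')"
        by (simp add: left_diff_distrib sum_subtractf sum_distrib_left[symmetric] if_distrib[of "\<lambda>u. u * _"] sum.delta cong: if_cong)
      finally show ?thesis by (simp add: Pker_sum)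
    qed
    ultimately show ?thesis by simp
  qed
  with r show ?thesis by (intro exI[of _ C] exI[of _ r]) auto
qed

text \<open>The last m steps bring the state to equilibrium: their kernel is close to
  \<open>\<nu> z * eigf t\<close>, with error r^m from mixing and (m + 1) |t| from the neglected
  phases. The first n steps act on this approximate eigenfunction and produce the Gaussian factor,
  with error n |t|^3. Both mixing time and horizon stay free, to be chosen differently in the
  applications.\<close>

lemma Fker_approx:
  "\<exists>C r. C \<ge> 0 \<and> 0 \<le> r \<and> r < 1 \<and> (\<forall>t n m x z. \<bar>t\<bar> \<le> 1 \<longrightarrow>
     norm (Fker (n + m) t x z - of_real (\<nu> z * exp (- \<sigma>2 * t\<^sup>2 / 2 * real n))) \<le> C * (r ^ m + (real m + 1) * \<bar>t\<bar> + real n * \<bar>t\<bar> ^ 3))"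
proof -
  obtain C1 r where r: "C1 \<ge> 0" "0 \<le> r" "r < 1" and C1: "\<forall>n x z. \<bar>Pker n x z - \<nu> z\<bar> \<le> C1 * r ^ n"
    using Pker_lim by blast
  obtain C2 where C2: "C2 \<ge> 0" and C2': "\<forall>t x. \<bar>t\<bar> \<le> 1 \<longrightarrow> norm (eigf t x - 1) \<le> C2 * \<bar>t\<bar>"
    using eigf_near_1 by blast
  obtain C3 where C3: "C3 \<ge> 0" and C3': "\<forall>t n x. \<bar>t\<bar> \<le> 1 \<longrightarrow> norm ((Fop t ^^ n) (eigf t) x - of_real (exp (- \<sigma>2 * t\<^sup>2 / 2 * real n)) * eigf t x) \<le> real n * C3 * \<bar>t\<bar> ^ 3"
    using eigf_pow by blast
  have nu1: "\<nu> x \<le> 1" for x using nu_sum member_le_sum[of x UNIV \<nu>] nu_nonneg by simp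
  define C where "C = fM + C1 + 2 * C2 + C3"
  have "norm (Fker (n + m) t x z - of_real (\<nu> z * exp (- \<sigma>2 * t\<^sup>2 / 2 * real n))) \<le> C * (r ^ m + (real m + 1) * \<bar>t\<bar> + real n * \<bar>t\<bar> ^ 3)"
    if t: "\<bar>t\<bar> \<le> 1" for t n m x z
  proof -
    define e where "e = exp (- \<sigma>2 * t\<^sup>2 / 2 * real n)"
    have e: "0 \<le> e" "e \<le> 1" using \<sigma>2_pos by (auto simp: e_def)
    define h where "h x = Fker m t x z - of_real (\<nu> z) * eigf t x" for x
    have hb: "norm (h x) \<le> real m * (\<bar>t\<bar> * fM) + C1 * r ^ m + C2 * \<bar>t\<bar>" for x
    proof -
      have "h x = (Fker m t x z - of_real (Pker m x z)) + of_real (Pker m x z - \<nu> z) - of_real (\<nu> z) * (eigf t x - 1)"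
        by (simp add: h_def algebra_simps)
      also have "norm \<dots> \<le> norm (Fker m t x z - of_real (Pker m x z)) + norm (of_real (Pker m x z - \<nu> z) :: complex) + norm (of_real (\<nu> z) * (eigf t x - 1))"
        by (meson add_mono norm_triangle_ineq norm_triangle_ineq4 order_refl order_trans)
      also have "\<dots> \<le> real m * (\<bar>t\<bar> * fM) + C1 * r ^ m + 1 * (C2 * \<bar>t\<bar>)"
        unfolding norm_mult norm_of_real
        by (intro add_mono mult_mono Fker_Pker C1[rule_format] C2'[rule_format] t) (use nu1 nu_nonneg C2 in auto)
      finally show ?thesis by simp
    qed
    have "Fker m t x' z = of_real (\<nu> z) * eigf t x' + 1 * h x'" for x' by (simp add: h_def)
    then have "(\<lambda>x'. Fker m t x' z) = (\<lambda>x'. of_real (\<nu> z) * eigf t x' + 1 * h x')" by (rule ext)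
    moreover have "Fker (n + m) t x z = (Fop t ^^ n) (\<lambda>x'. Fker m t x' z) x"
      by (simp add: Fker_def funpow_add)
    ultimately have "Fker (n + m) t x z = (Fop t ^^ n) (\<lambda>x'. of_real (\<nu> z) * eigf t x' + 1 * h x') x" by (simp only:)
    then have "Fker (n + m) t x z = of_real (\<nu> z) * (Fop t ^^ n) (eigf t) x + (Fop t ^^ n) h x"
      unfolding Fop_pow_linear by simp
    then have split: "Fker (n + m) t x z - of_real (\<nu> z * e) =
      of_real (\<nu> z) * ((Fop t ^^ n) (eigf t) x - of_real e * eigf t x) + of_real (\<nu> z) * (of_real e * (eigf t x - 1)) + (Fop t ^^ n) h x"
      by (simp add: algebra_simps)
    have n: "norm (complex_of_real (\<nu> z)) \<le> 1" using nu1[of z] nu_nonneg[of z] by simp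
    have i1: "norm (of_real (\<nu> z) * ((Fop t ^^ n) (eigf t) x - of_real e * eigf t x)) \<le> 1 * (real n * C3 * \<bar>t\<bar> ^ 3)"
      unfolding norm_mult e_def by (rule mult_mono[OF n C3'[rule_format, OF t]]) simp_all
    have "norm (of_real e * (eigf t x - 1)) \<le> 1 * (C2 * \<bar>t\<bar>)"
      unfolding norm_mult by (rule mult_mono[OF _ C2'[rule_format, OF t]]) (use e in simp_all)
    then have i2: "norm (of_real (\<nu> z) * (of_real e * (eigf t x - 1))) \<le> 1 * (1 * (C2 * \<bar>t\<bar>))"
      unfolding norm_mult[of "of_real (\<nu> z)"] by (rule mult_mono[OF n]) simp_all
    have i3: "norm ((Fop t ^^ n) h x) \<le> real m * (\<bar>t\<bar> * fM) + C1 * r ^ m + C2 * \<bar>t\<bar>"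
      by (rule Fop_pow_bound[OF hb])
    have "norm (Fker (n + m) t x z - of_real (\<nu> z * e)) \<le> 1 * (real n * C3 * \<bar>t\<bar> ^ 3) + 1 * (1 * (C2 * \<bar>t\<bar>)) + (real m * (\<bar>t\<bar> * fM) + C1 * r ^ m + C2 * \<bar>t\<bar>)"
      unfolding split by (rule norm_triangle_le[OF add_mono[OF norm_triangle_le[OF add_mono[OF i1 i2]] i3]])
    also have "\<dots> \<le> C * (r ^ m + (real m + 1) * \<bar>t\<bar> + real n * \<bar>t\<bar> ^ 3)"
    proof -
      define X where "X = r ^ m"
      define Y where "Y = real m * \<bar>t\<bar>"
      define Z where "Z = real n * \<bar>t\<bar> ^ 3"
      define W where "W = \<bar>t\<bar>"
      have nn: "X \<ge> 0" "Y \<ge> 0" "Z \<ge> 0" "W \<ge> 0" using r by (auto simp: X_def Y_def Z_def W_def)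
      have "C3 * Z + 2 * C2 * W + fM * Y + C1 * X \<le> C * X + C * Y + C * W + C * Z"
      proof -
        have "C3 * Z \<le> C * Z" "2 * C2 * W \<le> C * W" "fM * Y \<le> C * Y" "C1 * X \<le> C * X"
          using nn fM(2) r C2 C3 by (auto simp: C_def intro!: mult_right_mono)
        then show ?thesis by linarith
      qed
      then show ?thesis by (simp add: X_def Y_def Z_def W_def algebra_simps)
    qed
    finally show ?thesis by (simp add: e_def)
  qed
  moreover have "C \<ge> 0" using fM(2) r C2 C3 by (simp add: C_def)
  ultimately show ?thesis using r by blast
qed

text \<open>A block of n + m steps with n of order 1 / t^2 has norm at most 1/2: the Gaussian
  factor, the mixing error and the error proportional to |t| are each at most 1/8. Halving once per
  block of length of order 1 / t^2 is Gaussian decay in t times the square root of k.\<close>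

lemma Fop_decay_near_0:
  "\<exists>\<delta> c. 0 < \<delta> \<and> 0 < c \<and> (\<forall>t g k x. \<bar>t\<bar> \<le> \<delta> \<longrightarrow> (\<forall>x. norm (g x) \<le> 1) \<longrightarrow> norm ((Fop t ^^ k) g x) \<le> 2 * exp (- c * real k * t\<^sup>2))"
proof -
  obtain C r where r: "C \<ge> 0" "0 \<le> r" "r < 1" and C: "\<forall>t n m x z. \<bar>t\<bar> \<le> 1 \<longrightarrow>
     norm (Fker (n + m) t x z - of_real (\<nu> z * exp (- \<sigma>2 * t\<^sup>2 / 2 * real n))) \<le> C * (r ^ m + (real m + 1) * \<bar>t\<bar> + real n * \<bar>t\<bar> ^ 3)"
    using Fker_approx by blast
  define N where "N = real (card (UNIV :: 'a set))"
  define D where "D = C * N + 1"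
  have D1: "D \<ge> 1" "C * N \<le> D" using r by (auto simp: D_def N_def)
  have "1 / (8 * D) > 0" using D1 by simp
  \<comment> \<open>The mixing time m is independent of t; only n grows as t tends to zero.\<close>
  then obtain m where m: "r ^ m < 1 / (8 * D)" using real_arch_pow_inv r by blast
  \<comment> \<open>For n at least a / t^2 the Gaussian exponent is at least 7, and exp(-7) is at
    most 1/8.\<close>
  define a where "a = 14 / \<sigma>2 + 1"
  have a: "a \<ge> 1" "\<sigma>2 * a / 2 \<ge> 7" using \<sigma>2_pos by (auto simp: a_def field_simps)
  define E where "E = real m + 1 + 2 * a"
  have E: "E > 0" using a by (simp add: E_def)
  define \<delta> where "\<delta> = min 1 (1 / (8 * D * E))"
  define c where "c = ln 2 / (2 * a + real m)"
  have \<delta>: "\<delta> > 0" "\<delta> \<le> 1" using D1 E by (auto simp: \<delta>_def)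
  have c: "c > 0" using a by (simp add: c_def add_pos_nonneg)
  have "norm ((Fop t ^^ k) g x) \<le> 2 * exp (- c * real k * t\<^sup>2)" if t: "\<bar>t\<bar> \<le> \<delta>" and g: "\<forall>x. norm (g x) \<le> 1" for t g k x
  proof (cases "t = 0")
    case True
    have "norm ((Fop t ^^ k) g x) \<le> 1" by (rule Fop_pow_bound) (use g in auto)
    then show ?thesis by (simp add: True)
  next
    case False
    have t1: "\<bar>t\<bar> \<le> 1" using t \<delta> by simp
    have t2: "0 < t\<^sup>2" "t\<^sup>2 \<le> 1" using False t1 by (auto simp: abs_square_le_1)
    define n where "n = nat \<lceil>a / t\<^sup>2\<rceil>"
    have at: "a / t\<^sup>2 > 0" using a t2 by simp
    have n1: "a / t\<^sup>2 \<le> real n" unfolding n_def by linarith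
    have n2: "real n \<le> a / t\<^sup>2 + 1" unfolding n_def using at by linarith
    have n3: "real n * \<bar>t\<bar> ^ 3 \<le> 2 * a * \<bar>t\<bar>"
    proof -
      have "real n * \<bar>t\<bar> ^ 3 \<le> (a / t\<^sup>2 + 1) * \<bar>t\<bar> ^ 3" using n2 by (intro mult_right_mono) auto
      also have "\<dots> = a * \<bar>t\<bar> + \<bar>t\<bar> * t\<^sup>2"
        using False by (simp add: field_simps power2_eq_square power3_eq_cube flip: abs_mult)
      also have "\<dots> \<le> a * \<bar>t\<bar> + \<bar>t\<bar> * a" using t2 a by (intro add_mono mult_left_mono) auto
      finally show ?thesis by (simp add: mult_ac)
    qed
    have half: "Fnorm (n + m) t x \<le> 1/2" for x
    proof -
      define b where "b = r ^ m + (real m + 1) * \<bar>t\<bar> + real n * \<bar>t\<bar> ^ 3"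
      define e where "e = exp (- \<sigma>2 * t\<^sup>2 / 2 * real n)"
      have "norm (Fker (n + m) t x z) \<le> \<nu> z * e + C * b" for z
      proof -
        have "norm (Fker (n + m) t x z) \<le> norm (of_real (\<nu> z * e) :: complex) + norm (Fker (n + m) t x z - of_real (\<nu> z * e))"
          by (rule norm_triangle_sub)
        also have "norm (of_real (\<nu> z * e) :: complex) = \<nu> z * e"
          using nu_nonneg[of z] by (simp add: e_def norm_mult)
        finally show ?thesis using C[rule_format, OF t1, of n m x z] unfolding e_def b_def by linarith
      qed
      then have "Fnorm (n + m) t x \<le> (\<Sum>z\<in>UNIV. \<nu> z * e + C * b)"
        unfolding Fnorm_def by (rule sum_mono)
      also have "\<dots> = e + C * N * b" by (simp add: sum.distrib sum_distrib_right[symmetric] nu_sum N_def)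
      also have "e \<le> 1/8"
      proof -
        have "a \<le> t\<^sup>2 * real n" using n1 t2 by (simp add: field_simps)
        then have "\<sigma>2 / 2 * a \<le> \<sigma>2 / 2 * (t\<^sup>2 * real n)" using \<sigma>2_pos by (intro mult_left_mono) auto
        then have "7 \<le> \<sigma>2 * t\<^sup>2 / 2 * real n" using a by (simp add: field_simps)
        then have "e \<le> exp (- 7)" by (simp add: e_def)
        also have "exp (-7::real) \<le> 1 / 8" using exp_ge_add_one_self[of "7::real"] by (simp add: exp_minus field_simps)
        finally show ?thesis .
      qed
      also have "C * N * b \<le> D * (1 / (8 * D) + E * \<delta>)"
      proof (rule mult_mono)
        have "b \<le> r ^ m + ((real m + 1) * \<bar>t\<bar> + 2 * a * \<bar>t\<bar>)" using n3 by (simp add: b_def)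
        also have "\<dots> = r ^ m + E * \<bar>t\<bar>" by (simp add: E_def algebra_simps)
        also have "\<dots> \<le> 1 / (8 * D) + E * \<delta>" using m t E by (intro add_mono mult_left_mono) auto
        finally show "b \<le> 1 / (8 * D) + E * \<delta>" .
        show "0 \<le> b" using r by (simp add: b_def)
      qed (use D1 in auto)
      also have "\<dots> \<le> 1/8 + 1/8"
      proof -
        have "D * E * \<delta> \<le> D * E * (1 / (8 * D * E))" using D1 E by (intro mult_left_mono) (auto simp: \<delta>_def)
        then show ?thesis using D1 E by (simp add: field_simps)
      qed
      finally show ?thesis by simp
    qed
    have q1: "n + m \<ge> 1" using n1 at by (cases n) auto
    have q2: "real (n + m) \<le> (2 * a + real m) / t\<^sup>2"
    proof -
      have "1 \<le> a / t\<^sup>2" using a t2 by (simp add: field_simps)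
      moreover have "real m \<le> real m / t\<^sup>2" using t2 by (simp add: field_simps mult_left_le)
      ultimately show ?thesis using n2 by (simp add: add_divide_distrib)
    qed
    have "norm ((Fop t ^^ k) g x) \<le> 2 * exp (- ln 2 * real k / real (n + m))"
      by (rule Fnorm_half_exp[OF half q1]) (use g in auto)
    also have "\<dots> \<le> 2 * exp (- c * real k * t\<^sup>2)"
    proof -
      have "t\<^sup>2 / (2 * a + real m) \<le> 1 / real (n + m)"
        using q1 q2 t2 a by (simp add: field_simps)
      then have "ln 2 * real k * (t\<^sup>2 / (2 * a + real m)) \<le> ln 2 * real k * (1 / real (n + m))"
        by (intro mult_left_mono) auto
      then show ?thesis by (simp add: c_def mult_ac)
    qed
    finally show ?thesis .
  qed
  with \<delta> c show ?thesis by blast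
qed

section \<open>Phases along paths and the nonlattice condition\<close>

inductive reach :: "nat \<Rightarrow> 'a \<Rightarrow> 'a \<Rightarrow> real \<Rightarrow> bool" where
  reach_0: "reach 0 x x 0"
| reach_Suc: "P x x' > 0 \<Longrightarrow> reach n x' z s \<Longrightarrow> reach (Suc n) x z (f x' + s)"

text \<open>\<open>reach\<close> counts f at every visited state except the first, exactly as S_n
  does, so sums add under concatenation and a closed path counts each of its states once.\<close>

lemma reach_append: "reach m x y s \<Longrightarrow> reach n y z s' \<Longrightarrow> reach (m + n) x z (s + s')"
  by (induction rule: reach.induct) (auto simp: add.assoc intro: reach_Suc)

lemma reach_power: "reach k z z s \<Longrightarrow> reach (j * k) z z (real j * s)"
proof (induction j)
  case (Suc j)
  from reach_append[OF Suc.prems Suc.IH[OF Suc.prems]] show ?case by (simp add: algebra_simps)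
qed (simp add: reach_0)

lemma reach_exists: "Pker n x z > 0 \<Longrightarrow> \<exists>s. reach n x z s"
proof (induction n arbitrary: x)
  case 0
  then show ?case by (auto simp: Pker_0 split: if_splits intro: reach_0)
next
  case (Suc n)
  have "\<exists>x'. P x x' * Pker n x' z > 0"
  proof (rule ccontr)
    assume "\<not> ?thesis"
    then have "(\<Sum>x'\<in>UNIV. P x x' * Pker n x' z) \<le> 0" by (intro sum_nonpos) (auto simp: not_less)
    then show False using Suc.prems by (simp add: Pker_Suc)
  qed
  then obtain x' where "P x x' * Pker n x' z > 0" ..
  then have "P x x' > 0" "Pker n x' z > 0" using P_nonneg[of x x'] by (auto simp: zero_less_mult_iff)
  then show ?case using Suc.IH[of x'] reach_Suc by blast
qed

lemma Pker_pos_of_reach: "reach n x z s \<Longrightarrow> Pker n x z > 0"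
proof (induction rule: reach.induct)
  case (reach_Suc x x' n z s)
  have "0 < P x x' * Pker n x' z" using reach_Suc by simp
  also have "\<dots> \<le> (\<Sum>x'\<in>UNIV. P x x' * Pker n x' z)" by (rule member_le_sum) (auto simp: P_nonneg Pker_nonneg)
  finally show ?case by (simp add: Pker_Suc)
qed (simp add: Pker_0)

text \<open>If a Fourier operator at \<open>t \<noteq> 0\<close> had spectral radius one, equality in the triangle inequality would make
  all paths between two points carry the same phase, which \<open>H3\<close> forbids.\<close>

lemma sum_aligned:
  fixes a :: "'b \<Rightarrow> complex" and b :: "'b \<Rightarrow> real"
  assumes "finite I" "\<And>i. i \<in> I \<Longrightarrow> norm (a i) \<le> b i" "(\<Sum>i\<in>I. a i) = of_real (\<Sum>i\<in>I. b i)" "i \<in> I"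
  shows "a i = of_real (b i)"
proof -
  have re: "Re (a i) \<le> b i" if "i \<in> I" for i using assms(2)[OF that] complex_Re_le_cmod order_trans by blast
  have "(\<Sum>i\<in>I. Re (a i)) = (\<Sum>i\<in>I. b i)" using arg_cong[OF assms(3), of Re] by simp
  then have "(\<Sum>i\<in>I. b i - Re (a i)) = 0" by (simp add: sum_subtractf)
  then have "b i - Re (a i) = 0" using assms(1,4) re by (subst (asm) sum_nonneg_eq_0_iff) auto
  then have r: "Re (a i) = b i" by simp
  have "(Re (a i))\<^sup>2 + (Im (a i))\<^sup>2 \<le> (b i)\<^sup>2"
    using power_mono[OF assms(2)[OF assms(4)], of 2] by (simp add: cmod_power2)
  then have "Im (a i) = 0" using r by simp
  with r show ?thesis by (simp add: complex_eq_iff)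
qed

text \<open>Induction along the path. After division by the common phase u, the triangle inequality
  over the next state is an equality, so each branch of positive probability is aligned; the rest of
  the path then carries the phase u with that of its first step removed.\<close>

lemma reach_phase: "reach n x z s \<Longrightarrow> Fker n t x z = u * of_real (Pker n x z) \<Longrightarrow> norm u = 1 \<Longrightarrow> cis (t * s) = u"
proof (induction arbitrary: u rule: reach.induct)
  case (reach_0 x)
  then show ?case by (simp add: Fker_0 Pker_0)
next
  case (reach_Suc x x' n z s)
  have uu: "cnj u * u = 1" using reach_Suc.prems(2) complex_norm_square[of u] by (simp add: mult.commute)
  have "cnj u * (of_real (P x x') * cis (t * f x') * Fker n t x' z) = of_real (P x x' * Pker n x' z)"
  proof (rule sum_aligned[where I = UNIV and a = "\<lambda>x'. cnj u * (of_real (P x x') * cis (t * f x') * Fker n t x' z)" and b = "\<lambda>x'. P x x' * Pker n x' z"])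
    show "(\<Sum>x'\<in>UNIV. cnj u * (of_real (P x x') * cis (t * f x') * Fker n t x' z)) = of_real (\<Sum>x'\<in>UNIV. P x x' * Pker n x' z)"
    proof -
      have "(\<Sum>x'\<in>UNIV. cnj u * (of_real (P x x') * cis (t * f x') * Fker n t x' z)) = cnj u * Fker (Suc n) t x z"
        by (simp only: Fker_Suc sum_distrib_left)
      also have "\<dots> = (cnj u * u) * of_real (Pker (Suc n) x z)" by (simp only: reach_Suc.prems(1) mult.assoc)
      finally show ?thesis by (simp add: uu Pker_Suc)
    qed
    show "norm (cnj u * (of_real (P x y) * cis (t * f y) * Fker n t y z)) \<le> P x y * Pker n y z" for y
      using reach_Suc.prems(2) by (auto simp: norm_mult P_nonneg intro!: mult_left_mono norm_Fker_le)
  qed auto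
  then have "cnj u * (cis (t * f x') * Fker n t x' z) = of_real (Pker n x' z)" using reach_Suc.hyps(1) by simp
  then have "u * cnj (cis (t * f x')) * (cnj u * (cis (t * f x') * Fker n t x' z)) = u * cnj (cis (t * f x')) * of_real (Pker n x' z)" by simp
  moreover have "u * cnj (cis (t * f x')) * (cnj u * (cis (t * f x') * Fker n t x' z)) = (cnj u * u) * (cnj (cis (t * f x')) * cis (t * f x')) * Fker n t x' z"
    by (simp only: mult_ac)
  moreover have cc: "cnj (cis (t * f x')) * cis (t * f x') = 1" by (simp add: cis_cnj cis_mult)
  ultimately have "Fker n t x' z = (u * cnj (cis (t * f x'))) * of_real (Pker n x' z)" by (simp add: uu)
  then have "cis (t * s) = u * cnj (cis (t * f x'))"
    by (rule reach_Suc.IH) (simp add: norm_mult reach_Suc.prems(2))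
  then have "cis (t * f x') * cis (t * s) = u * (cnj (cis (t * f x')) * cis (t * f x'))" by (simp only: mult_ac)
  then show ?case unfolding cc by (simp add: cis_mult ring_distribs)
qed

lemma Fker_strict:
  assumes "reach n x z s" "reach n x z s'" "cis (t * s) \<noteq> cis (t * s')"
  shows "norm (Fker n t x z) < Pker n x z"
proof (rule ccontr)
  assume "\<not> ?thesis"
  then have eq: "norm (Fker n t x z) = Pker n x z" using norm_Fker_le[of n t x z] by simp
  have p: "Pker n x z > 0" using Pker_pos_of_reach[OF assms(1)] .
  define u where "u = Fker n t x z / of_real (Pker n x z)"
  have "Fker n t x z = u * of_real (Pker n x z)" "norm u = 1"
    using p eq by (simp_all add: u_def norm_divide)
  then show False using reach_phase assms by metis
qed

text \<open>Two paths of equal length from x to z are compared. Both visit \<open>xs 0\<close>. One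
  runs through the cycle of length L given by \<open>H3\<close> and later through L loops at z of
  length \<open>k0\<close> with sum \<open>s0\<close>; the other omits the cycle and uses L loops of
  length \<open>Suc k0\<close> with sum \<open>s1\<close>. Their sums differ by the cycle sum minus
  L (s1 - s0), which is the quantity in \<open>H3\<close> for \<theta> = s1 - s0. As the phases
  disagree, the kernel entry at z is strictly smaller than its probability.\<close>

lemma Fnorm_lt_1:
  assumes t: "t \<noteq> 0"
  shows "\<exists>q. \<forall>x. Fnorm q t x < 1"
proof -
  obtain k0 where k0: "k0 \<ge> 1" and k: "\<forall>x x'. Ppow P k0 (\<lambda>z. if z = x' then 1 else 0) x > 0" using ex_positive_power by blast
  have pk: "Pker k0 x z > 0" for x z using k by (simp add: Pker_def)
  have pk1: "Pker (Suc k0) x z > 0" for x z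
  proof -
    have "\<exists>x'. P x x' > 0"
    proof (rule ccontr)
      assume "\<not> ?thesis"
      then have "(\<Sum>x'\<in>UNIV. P x x') \<le> 0" by (intro sum_nonpos) (auto simp: not_less)
      then show False by (simp add: P_sum)
    qed
    then obtain x' where "P x x' > 0" ..
    moreover obtain s where "reach k0 x' z s" using reach_exists[OF pk] by blast
    ultimately show ?thesis using reach_Suc Pker_pos_of_reach by blast
  qed
  define z :: 'a where "z = undefined"
  obtain s0 where s0: "reach k0 z z s0" using reach_exists[OF pk] by blast
  obtain s1 where s1: "reach (Suc k0) z z s1" using reach_exists[OF pk1] by blast
  define \<theta> where "\<theta> = s1 - s0"
  \<comment> \<open>The lattice generated by 2 pi / t consists of exactly those differences of sums
    that the frequency t cannot detect.\<close>
  from nonlattice[unfolded H3_def, rule_format, of \<theta> "2 * pi / t"] obtain n xs where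
    pr: "(\<Prod>i<n. P (xs i) (xs (Suc i))) * P (xs n) (xs 0) > 0"
    and ns: "(\<Sum>i\<le>n. f (xs i)) - real (n + 1) * \<theta> \<notin> {2 * pi / t * of_int k | k. True}" by blast
  have "(\<Prod>i<n. P (xs i) (xs (Suc i))) \<ge> 0" by (intro prod_nonneg) (auto simp: P_nonneg)
  then have pp: "(\<Prod>i<n. P (xs i) (xs (Suc i))) > 0" and pn: "P (xs n) (xs 0) > 0"
    using pr by (auto simp: zero_less_mult_iff)
  have ps: "P (xs i) (xs (Suc i)) > 0" if "i < n" for i
    using pp P_nonneg[of "xs i" "xs (Suc i)"] that
    by (metis finite_lessThan lessThan_iff less_irrefl order_le_less prod_zero)
  have "i \<le> n \<Longrightarrow> reach i (xs 0) (xs i) (\<Sum>j<i. f (xs (Suc j)))" for i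
  proof (induction i)
    case (Suc i)
    have "reach (i + Suc 0) (xs 0) (xs (Suc i)) ((\<Sum>j<i. f (xs (Suc j))) + (f (xs (Suc i)) + 0))"
      by (rule reach_append[OF Suc.IH reach_Suc[OF ps reach_0]]) (use Suc.prems in auto)
    then show ?case by simp
  qed (simp add: reach_0)
  from reach_append[OF this[OF order_refl] reach_Suc[OF pn reach_0]]
  have cyc: "reach (Suc n) (xs 0) (xs 0) (\<Sum>i\<le>n. f (xs i))"
    by (simp add: sum.lessThan_Suc_shift lessThan_Suc_atMost[symmetric] add.commute del: sum.lessThan_Suc)
  define L where "L = Suc n"
  define q where "q = k0 + (k0 + L * Suc k0)"
  have "Fnorm q t x < 1" for x
  proof -
    obtain a where a: "reach k0 x (xs 0) a" using reach_exists[OF pk] by blast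
    obtain b where b: "reach k0 (xs 0) z b" using reach_exists[OF pk] by blast
    have r1: "reach (k0 + (L + (k0 + L * k0))) x z (a + ((\<Sum>i\<le>n. f (xs i)) + (b + real L * s0)))"
      unfolding L_def by (intro reach_append[OF a] reach_append[OF cyc] reach_append[OF b] reach_power s0)
    have r2: "reach (k0 + (k0 + L * Suc k0)) x z (a + (b + real L * s1))"
      by (intro reach_append[OF a] reach_append[OF b] reach_power s1)
    have "cis (t * (a + ((\<Sum>i\<le>n. f (xs i)) + (b + real L * s0)))) \<noteq> cis (t * (a + (b + real L * s1)))" (is "cis (t * ?u) \<noteq> cis (t * ?v)")
    proof
      assume "cis (t * ?u) = cis (t * ?v)"
      then obtain k :: int where "t * ?u = t * ?v + 2 * pi * k"
        using sin_cos_eq_iff[of "t * ?u" "t * ?v"] by (auto simp: complex_eq_iff)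
      then have "t * (?u - ?v) = 2 * pi * k" by (simp add: algebra_simps)
      then have "?u - ?v = 2 * pi / t * of_int k" using t by (simp add: field_simps)
      moreover have "?u - ?v = (\<Sum>i\<le>n. f (xs i)) - real (n + 1) * \<theta>" by (simp add: \<theta>_def L_def algebra_simps)
      ultimately have "(\<Sum>i\<le>n. f (xs i)) - real (n + 1) * \<theta> = 2 * pi / t * of_int k" by linarith
      then show False using ns by blast
    qed
    moreover have "k0 + (L + (k0 + L * k0)) = q" by (simp add: q_def)
    ultimately have lt: "norm (Fker q t x z) < Pker q x z"
      using Fker_strict r1 r2 unfolding q_def by metis
    have "Fnorm q t x < (\<Sum>z\<in>UNIV. Pker q x z)"
      unfolding Fnorm_def by (rule sum_strict_mono_ex1) (use lt norm_Fker_le in auto)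
    then show ?thesis by (simp add: Pker_sum)
  qed
  then show ?thesis by blast
qed


lemma Fnorm_half_pointwise:
  assumes "t \<noteq> 0" shows "\<exists>q. \<forall>x. Fnorm q t x < 1/2"
proof -
  obtain q where q: "\<forall>x. Fnorm q t x < 1" using Fnorm_lt_1[OF assms] by blast
  define c where "c = Max (range (Fnorm q t))"
  have c1: "c < 1" using q by (auto simp: c_def)
  have cx: "Fnorm q t x \<le> c" for x unfolding c_def by (rule Max_ge) auto
  have "0 \<le> Fnorm q t undefined" unfolding Fnorm_def by (rule sum_nonneg) simp
  then have c0: "c \<ge> 0" using cx[of undefined] by linarith
  obtain j where j: "c ^ j < 1/2" using real_arch_pow_inv[of "1/2" c] c1 by auto
  have "Fnorm (j * q) t x < 1/2" for x
  proof -
    obtain g where g: "\<forall>z. norm (g z) \<le> 1" "norm ((Fop t ^^ (j * q)) g x) = Fnorm (j * q) t x" using Fnorm_attained by blast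
    have "norm ((Fop t ^^ (j * q)) g x) \<le> c ^ j" by (rule Fnorm_iterate[OF cx c0]) (use g in simp)
    then show ?thesis using g j by simp
  qed
  then show ?thesis by blast
qed

text \<open>Each frequency has its own exponent, and by continuity the bound persists nearby. A
  finite subcover and \<open>Fnorm_mono\<close> give one exponent, for which the sum of the chosen
  ones is large enough.\<close>

lemma Fnorm_half_on_compact:
  assumes "\<delta> > 0"
  shows "\<exists>q\<ge>1. \<forall>t x. \<delta> \<le> \<bar>t\<bar> \<longrightarrow> \<bar>t\<bar> \<le> L \<longrightarrow> Fnorm q t x \<le> 1/2"
proof -
  define K where "K = {t::real. \<delta> \<le> \<bar>t\<bar>} \<inter> cball 0 L"
  have K: "compact K" unfolding K_def
    by (intro closed_Int_compact closed_Collect_le continuous_intros compact_cball)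
  have "\<forall>t\<in>K. \<exists>q. \<forall>x. Fnorm q t x < 1/2" using Fnorm_half_pointwise assms by (auto simp: K_def)
  then obtain qf where qf: "\<forall>t\<in>K. \<forall>x. Fnorm (qf t) t x < 1/2" by metis
  define U where "U t = (\<Inter>x\<in>UNIV. {s. Fnorm (qf t) s x < 1/2})" for t
  have cont: "continuous_on UNIV (\<lambda>s. Fnorm q s x)" for q x
    unfolding Fnorm_def by (intro continuous_intros Fker_cont)
  have "open (U t)" for t unfolding U_def
    by (intro open_INT ballI finite_class.finite open_Collect_less continuous_on_const cont)
  moreover have "K \<subseteq> (\<Union>t\<in>K. U t)" using qf by (auto simp: U_def)
  ultimately obtain D where D: "D \<subseteq> K" "finite D" "K \<subseteq> (\<Union>t\<in>D. U t)"
    using compactE_image[OF K, of K U] by metis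
  define q where "q = Suc (\<Sum>t\<in>D. qf t)"
  have "Fnorm q s x \<le> 1/2" if "\<delta> \<le> \<bar>s\<bar>" "\<bar>s\<bar> \<le> L" for s x
  proof -
    have "s \<in> K" using that by (simp add: K_def)
    then obtain t where t: "t \<in> D" "s \<in> U t" using D by blast
    have "qf t \<le> q" using member_le_sum[of t D qf] t D by (simp add: q_def)
    moreover have "Fnorm (qf t) s x \<le> 1/2" for x using t by (auto simp: U_def less_imp_le)
    ultimately show ?thesis using Fnorm_mono by blast
  qed
  then show ?thesis by (intro exI[of _ q]) (auto simp: q_def)
qed

text \<open>Away from zero the decay is exponential in k at a fixed rate; as |t| is at most L, it
  can be written with t^2 in the exponent and merged with the bound near zero.\<close>

lemma Fop_decay:
  assumes L: "L > 0"
  shows "\<exists>c>0. \<forall>t g k x. \<bar>t\<bar> \<le> L \<longrightarrow> (\<forall>x. norm (g x) \<le> 1) \<longrightarrow> norm ((Fop t ^^ k) g x) \<le> 2 * exp (- c * real k * t\<^sup>2)"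
proof -
  obtain \<delta> c1 where d: "0 < \<delta>" "0 < c1" and c1: "\<forall>t g k x. \<bar>t\<bar> \<le> \<delta> \<longrightarrow> (\<forall>x. norm (g x) \<le> 1) \<longrightarrow> norm ((Fop t ^^ k) g x) \<le> 2 * exp (- c1 * real k * t\<^sup>2)"
    using Fop_decay_near_0 by blast
  obtain q where q: "q \<ge> 1" "\<forall>t x. \<delta> \<le> \<bar>t\<bar> \<longrightarrow> \<bar>t\<bar> \<le> L \<longrightarrow> Fnorm q t x \<le> 1/2"
    using Fnorm_half_on_compact[OF d(1)] by blast
  define c where "c = min c1 (ln 2 / (real q * L\<^sup>2))"
  have c: "c > 0" "c \<le> c1" "c \<le> ln 2 / (real q * L\<^sup>2)" using d q L by (auto simp: c_def)
  have "norm ((Fop t ^^ k) g x) \<le> 2 * exp (- c * real k * t\<^sup>2)" if t: "\<bar>t\<bar> \<le> L" and g: "\<forall>x. norm (g x) \<le> 1" for t g k x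
  proof (cases "\<bar>t\<bar> \<le> \<delta>")
    case True
    have "norm ((Fop t ^^ k) g x) \<le> 2 * exp (- c1 * real k * t\<^sup>2)" using c1 True g by blast
    also have "\<dots> \<le> 2 * exp (- c * real k * t\<^sup>2)"
      using mult_right_mono[OF c(2), of "real k * t\<^sup>2"] by (simp add: mult_ac)
    finally show ?thesis .
  next
    case False
    have "norm ((Fop t ^^ k) g x) \<le> 2 * exp (- ln 2 * real k / real q)"
      by (rule Fnorm_half_exp) (use q t False g in auto)
    also have "\<dots> \<le> 2 * exp (- c * real k * t\<^sup>2)"
    proof -
      have "t\<^sup>2 \<le> L\<^sup>2" using t L by (simp add: abs_le_square_iff[symmetric])
      then have "c * t\<^sup>2 \<le> ln 2 / (real q * L\<^sup>2) * L\<^sup>2" using c by (intro mult_mono) auto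
      then have "real k * (c * t\<^sup>2) \<le> real k * (ln 2 / real q)" using L by (intro mult_left_mono) auto
      then show ?thesis by (simp add: mult_ac)
    qed
    finally show ?thesis .
  qed
  with c show ?thesis by blast
qed

text \<open>In \<open>Fker_approx\<close> the mixing time m is fixed first, making r^m small; at
  frequency s divided by the square root of n the two other errors then vanish.\<close>

lemma Fker_clt: "(\<lambda>n. Fker n (s / sqrt (real n)) x z) \<longlonglongrightarrow> of_real (\<nu> z * exp (- \<sigma>2 * s\<^sup>2 / 2))"
proof (rule LIMSEQ_I)
  fix e :: real assume e: "e > 0"
  obtain C r where r: "C \<ge> 0" "0 \<le> r" "r < 1" and C: "\<forall>t n m x z. \<bar>t\<bar> \<le> 1 \<longrightarrow>
     norm (Fker (n + m) t x z - of_real (\<nu> z * exp (- \<sigma>2 * t\<^sup>2 / 2 * real n))) \<le> C * (r ^ m + (real m + 1) * \<bar>t\<bar> + real n * \<bar>t\<bar> ^ 3)"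
    using Fker_approx by blast
  obtain m where m: "r ^ m < e / (3 * (C + 1))" using real_arch_pow_inv[of "e / (3 * (C + 1))" r] e r by auto
  have m': "C * r ^ m < e / 3"
  proof -
    have "C * r ^ m \<le> (C + 1) * r ^ m" using r by (intro mult_right_mono) auto
    also have "\<dots> < (C + 1) * (e / (3 * (C + 1)))" using m r by (intro mult_strict_left_mono) auto
    also have "\<dots> = e / 3" using r by (simp add: field_simps)
    finally show ?thesis .
  qed
  let ?t = "\<lambda>n. s / sqrt (real n)"
  have "(\<lambda>n. C * ((real m + 1) * \<bar>?t n\<bar> + real (n - m) * \<bar>?t n\<bar> ^ 3)) \<longlonglongrightarrow> C * ((real m + 1) * \<bar>0\<bar> + 0)"
  proof (intro tendsto_intros)
    show t0: "?t \<longlonglongrightarrow> 0" by real_asymp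
    show "(\<lambda>n. real (n - m) * \<bar>?t n\<bar> ^ 3) \<longlonglongrightarrow> 0"
    proof (rule Lim_null_comparison)
      have "(\<lambda>n. \<bar>s\<bar> ^ 3 / sqrt (real n)) \<longlonglongrightarrow> 0" by real_asymp
      then show "(\<lambda>n. \<bar>s\<bar> ^ 3 / sqrt (real n)) \<longlonglongrightarrow> 0" .
      show "\<forall>\<^sub>F n in sequentially. norm (real (n - m) * \<bar>?t n\<bar> ^ 3) \<le> \<bar>s\<bar> ^ 3 / sqrt (real n)"
        using eventually_gt_at_top[of 0]
      proof eventually_elim
        case (elim n)
        have "real (n - m) * \<bar>?t n\<bar> ^ 3 \<le> real n * \<bar>?t n\<bar> ^ 3" by (intro mult_right_mono) auto
        also have "\<dots> = \<bar>s\<bar> ^ 3 / sqrt (real n)"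
        proof -
          have "real n = sqrt (real n) * sqrt (real n)" by simp
          then have "real n * \<bar>?t n\<bar> ^ 3 = sqrt (real n) * sqrt (real n) * (\<bar>s\<bar> ^ 3 / (sqrt (real n) * sqrt (real n) * sqrt (real n)))"
            by (simp add: power_divide abs_divide power3_eq_cube)
          also have "\<dots> = \<bar>s\<bar> ^ 3 / sqrt (real n)" using elim by (simp add: field_simps)
          finally show ?thesis .
        qed
        finally show ?case by simp
      qed
    qed
  qed
  then have "(\<lambda>n. C * ((real m + 1) * \<bar>?t n\<bar> + real (n - m) * \<bar>?t n\<bar> ^ 3)) \<longlonglongrightarrow> 0" by simp
  then have ev1: "\<forall>\<^sub>F n in sequentially. C * ((real m + 1) * \<bar>?t n\<bar> + real (n - m) * \<bar>?t n\<bar> ^ 3) < e / 3"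
    using e by (intro order_tendstoD) auto
  have "(\<lambda>n. (?t n)\<^sup>2 * (real n - real m)) \<longlonglongrightarrow> s\<^sup>2"
  proof -
    have "(\<lambda>n. s\<^sup>2 * ((real n - real m) / real n)) \<longlonglongrightarrow> s\<^sup>2 * 1" by (intro tendsto_intros) real_asymp
    then show ?thesis by (simp add: power_divide)
  qed
  then have "(\<lambda>n. \<nu> z * exp (- \<sigma>2 * ((?t n)\<^sup>2 * (real n - real m)) / 2)) \<longlonglongrightarrow> \<nu> z * exp (- \<sigma>2 * s\<^sup>2 / 2)"
    by (intro tendsto_intros) auto
  then have ev2: "\<forall>\<^sub>F n in sequentially. \<bar>\<nu> z * exp (- \<sigma>2 * ((?t n)\<^sup>2 * (real n - real m)) / 2) - \<nu> z * exp (- \<sigma>2 * s\<^sup>2 / 2)\<bar> < e / 3"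
    using e by (auto dest!: tendstoD[where e = "e/3"] simp: dist_real_def)
  have "?t \<longlonglongrightarrow> 0" by real_asymp
  then have ev3: "\<forall>\<^sub>F n in sequentially. \<bar>?t n\<bar> < 1" by (auto dest!: tendstoD[where e = 1] simp: dist_real_def)
  have "\<forall>\<^sub>F n in sequentially. norm (Fker n (?t n) x z - of_real (\<nu> z * exp (- \<sigma>2 * s\<^sup>2 / 2))) < e"
    using ev1 ev2 ev3 eventually_ge_at_top[of m]
  proof eventually_elim
    case (elim n)
    let ?E = "\<nu> z * exp (- \<sigma>2 * ((?t n)\<^sup>2 * (real n - real m)) / 2)"
    have "norm (Fker ((n - m) + m) (?t n) x z - of_real (\<nu> z * exp (- \<sigma>2 * (?t n)\<^sup>2 / 2 * real (n - m)))) \<le> C * (r ^ m + (real m + 1) * \<bar>?t n\<bar> + real (n - m) * \<bar>?t n\<bar> ^ 3)"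
      using C elim(3) by (metis less_imp_le)
    moreover have "\<nu> z * exp (- \<sigma>2 * (?t n)\<^sup>2 / 2 * real (n - m)) = ?E" using elim(4) by (simp add: of_nat_diff mult.assoc)
    moreover have "n - m + m = n" using elim(4) by simp
    ultimately have 1: "norm (Fker n (?t n) x z - of_real ?E) \<le> C * (r ^ m + (real m + 1) * \<bar>?t n\<bar> + real (n - m) * \<bar>?t n\<bar> ^ 3)" by metis
    have 2: "C * (r ^ m + (real m + 1) * \<bar>?t n\<bar> + real (n - m) * \<bar>?t n\<bar> ^ 3) = C * r ^ m + C * ((real m + 1) * \<bar>?t n\<bar> + real (n - m) * \<bar>?t n\<bar> ^ 3)"
      by (simp add: algebra_simps)
    have "norm (Fker n (?t n) x z - of_real (\<nu> z * exp (- \<sigma>2 * s\<^sup>2 / 2))) = norm ((Fker n (?t n) x z - of_real ?E) + complex_of_real (?E - \<nu> z * exp (- \<sigma>2 * s\<^sup>2 / 2)))" by simp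
    also have "\<dots> \<le> norm (Fker n (?t n) x z - of_real ?E) + norm (complex_of_real (?E - \<nu> z * exp (- \<sigma>2 * s\<^sup>2 / 2)))"
      by (rule norm_triangle_ineq)
    finally show ?case using 1 2 m' elim(1,2) unfolding norm_of_real by linarith
  qed
  then show "\<exists>no. \<forall>n\<ge>no. norm (Fker n (?t n) x z - of_real (\<nu> z * exp (- \<sigma>2 * s\<^sup>2 / 2))) < e"
    by (simp add: eventually_sequentially)
qed

end

subsection \<open>Gaussian integrals and the Fejer kernel\<close>

lemma fubini_dominated:
  fixes k :: "real \<Rightarrow> real \<Rightarrow> real"
  assumes m: "(\<lambda>(s, r). k s r) \<in> borel_measurable (borel \<Otimes>\<^sub>M borel)"
    and a: "integrable lborel a" and b: "integrable lborel b" and le: "\<And>s r. \<bar>k s r\<bar> \<le> a s * b r"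
  shows "(\<integral>s. (\<integral>r. k s r \<partial>lborel) \<partial>lborel) = (\<integral>r. (\<integral>s. k s r \<partial>lborel) \<partial>lborel)"
proof -
  have m': "(\<lambda>(s, r). k s r) \<in> borel_measurable (lborel \<Otimes>\<^sub>M lborel)"
    using m by (simp cong: measurable_cong_sets)
  have ms: "(\<lambda>r. k s r) \<in> borel_measurable lborel" for s
    using m by (auto simp: measurable_lborel1 dest!: measurable_Pair_compose_split[where g = "\<lambda>_. s"] intro: measurable_compose[of "Pair s"])
  have ar: "integrable lborel (\<lambda>r. a s * b r)" for s using b by simp
  have int: "integrable lborel (\<lambda>r. k s r)" for s
  proof (rule Bochner_Integration.integrable_bound[OF ar ms], intro AE_I2)
    show "norm (k s r) \<le> norm (a s * b r)" for r using le[of s r] abs_ge_self[of "a s * b r"] by simp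
  qed
  have "integrable (lborel \<Otimes>\<^sub>M lborel) (\<lambda>(s, r). k s r)"
  proof (rule lborel_pair.Fubini_integrable[OF m'])
    have mm: "(\<lambda>s. \<integral>r. norm (k s r) \<partial>lborel) \<in> borel_measurable lborel"
      using m' by measurable
    have "integrable lborel (\<lambda>s. \<bar>a s\<bar> * (\<integral>r. \<bar>b r\<bar> \<partial>lborel))" using a by (simp add: integrable_abs)
    then have "integrable lborel (\<lambda>s. \<integral>r. norm (k s r) \<partial>lborel)"
    proof (rule Bochner_Integration.integrable_bound[OF _ mm], intro AE_I2)
      fix s
      have "(\<integral>r. norm (k s r) \<partial>lborel) \<le> (\<integral>r. \<bar>a s\<bar> * \<bar>b r\<bar> \<partial>lborel)"
      proof (rule integral_mono)
        show "norm (k s r) \<le> \<bar>a s\<bar> * \<bar>b r\<bar>" for r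
          using le[of s r] abs_ge_self[of "a s * b r"] by (simp add: abs_mult)
      qed (use int b in simp_all)
      then have "(\<integral>r. norm (k s r) \<partial>lborel) \<le> \<bar>a s\<bar> * (\<integral>r. \<bar>b r\<bar> \<partial>lborel)" by simp
      moreover have "0 \<le> (\<integral>r. norm (k s r) \<partial>lborel)" by simp
      ultimately show "norm (\<integral>r. norm (k s r) \<partial>lborel) \<le> norm (\<bar>a s\<bar> * (\<integral>r. \<bar>b r\<bar> \<partial>lborel))" by simp
    qed
    then show "integrable lborel (\<lambda>s. \<integral>r. norm ((\<lambda>(s, r). k s r) (s, r)) \<partial>lborel)" by simp
    show "AE s in lborel. integrable lborel (\<lambda>r. (\<lambda>(s, r). k s r) (s, r))" using int by simp
  qed
  from lborel_pair.Fubini_integral[OF this] show ?thesis by simp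
qed

lemma std_gauss_cos: "(\<integral>u. std_normal_density u * cos (t * u) \<partial>lborel) = exp (- t\<^sup>2 / 2)"
proof -
  have "char std_normal_distribution t = (\<integral>u. std_normal_density u *\<^sub>R iexp (t * u) \<partial>lborel)"
    unfolding char_def by (subst integral_density) auto
  moreover have "integrable lborel (\<lambda>u. std_normal_density u *\<^sub>R iexp (t * u))"
  proof (rule Bochner_Integration.integrable_bound)
    show "integrable lborel (\<lambda>u. std_normal_density u * u ^ 0)" by (rule integrable_std_normal_moment)
  qed (auto simp: norm_mult)
  ultimately have "Re (char std_normal_distribution t) = (\<integral>u. Re (std_normal_density u *\<^sub>R iexp (t * u)) \<partial>lborel)"
    by (simp only: integral_Re)
  also have "\<dots> = (\<integral>u. std_normal_density u * cos (t * u) \<partial>lborel)"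
    by (intro Bochner_Integration.integral_cong) (auto simp: Re_exp)
  finally show ?thesis unfolding char_std_normal_distribution by simp
qed

lemma gauss_integrable_moment:
  fixes a :: real assumes a: "a > 0"
  shows "integrable lborel (\<lambda>u. exp (- a * u\<^sup>2 / 2) * u ^ k)"
proof -
  have "integrable lborel (\<lambda>u. std_normal_density (0 + sqrt a * u) * (0 + sqrt a * u) ^ k)"
    using a by (subst lborel_integrable_real_affine_iff[of "sqrt a" "\<lambda>u. std_normal_density u * u ^ k" 0]) (auto intro: integrable_std_normal_moment)
  then have "integrable lborel (\<lambda>u. sqrt (2 * pi) / sqrt a ^ k * (std_normal_density (0 + sqrt a * u) * (0 + sqrt a * u) ^ k))"
    by (rule integrable_mult_right)
  moreover have "(\<lambda>u. sqrt (2 * pi) / sqrt a ^ k * (std_normal_density (0 + sqrt a * u) * (0 + sqrt a * u) ^ k)) = (\<lambda>u. exp (- a * u\<^sup>2 / 2) * u ^ k)"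
    using a by (intro ext) (simp add: std_normal_density_def power_mult_distrib)
  ultimately show ?thesis by simp
qed

lemma gauss_integrable:
  fixes a :: real assumes "a > 0" shows "integrable lborel (\<lambda>u. exp (- a * u\<^sup>2 / 2))"
  using gauss_integrable_moment[OF assms, of 0] by simp

lemma gauss_integrable_cos:
  fixes a :: real assumes "a > 0" shows "integrable lborel (\<lambda>u. exp (- a * u\<^sup>2 / 2) * cos (t * u))"
  by (rule Bochner_Integration.integrable_bound[OF gauss_integrable[OF assms]]) (auto simp: abs_mult intro!: mult_left_le)

lemma gauss_cos:
  fixes a :: real assumes a: "a > 0"
  shows "(\<integral>u. exp (- a * u\<^sup>2 / 2) * cos (t * u) \<partial>lborel) = sqrt (2 * pi / a) * exp (- t\<^sup>2 / (2 * a))"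
proof -
  let ?s = "sqrt a"
  have s: "?s > 0" "?s * ?s = a" using a by auto
  have "(\<integral>u. std_normal_density u * cos (t / ?s * u) \<partial>lborel) = \<bar>?s\<bar> *\<^sub>R (\<integral>u. std_normal_density (0 + ?s * u) * cos (t / ?s * (0 + ?s * u)) \<partial>lborel)"
    by (rule lborel_integral_real_affine) (use s in simp)
  also have "\<dots> = ?s * (\<integral>u. 1 / sqrt (2 * pi) * (exp (- a * u\<^sup>2 / 2) * cos (t * u)) \<partial>lborel)"
    using s by (simp add: std_normal_density_def power_mult_distrib)
  also have "\<dots> = ?s / sqrt (2 * pi) * (\<integral>u. exp (- a * u\<^sup>2 / 2) * cos (t * u) \<partial>lborel)"
    by (subst integral_mult_right_zero) simp
  finally have "(\<integral>u. exp (- a * u\<^sup>2 / 2) * cos (t * u) \<partial>lborel) = sqrt (2 * pi) / ?s * exp (- (t / ?s)\<^sup>2 / 2)"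
    unfolding std_gauss_cos using s by (simp add: field_simps)
  also have "(t / ?s)\<^sup>2 = t\<^sup>2 / a" using a by (simp add: power_divide)
  finally show ?thesis by (simp add: real_sqrt_divide)
qed

section \<open>The Fejer kernel as an approximate identity\<close>

definition "tri L t = max 0 (1 - \<bar>t\<bar> / L) / (2 * pi)" for L t :: real
text \<open>The kernel is nonnegative, has total mass one because of the factor 1 / (2 pi) in
  \<open>tri\<close>, and its transform vanishes beyond L. Smoothing with it involves frequencies up
  to L only, where \<open>Fop_decay\<close> is available.\<close>

definition "fejer L u = (\<integral>t. tri L t * cos (t * u) \<partial>lborel)" for L u :: real

lemma tri_measurable [measurable]: "tri L \<in> borel_measurable borel"
  unfolding tri_def by measurable

lemma tri_nonneg: "tri L t \<ge> 0" by (simp add: tri_def)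

lemma tri_le:
  assumes "L > 0" shows "tri L t \<le> 1"
proof -
  have "max 0 (1 - \<bar>t\<bar> / L) \<le> 1" using assms by simp
  moreover have "1 \<le> 2 * pi" using pi_gt3 by simp
  ultimately show ?thesis unfolding tri_def by (subst divide_le_eq) auto
qed

lemma tri_eq_0: "L > 0 \<Longrightarrow> \<bar>t\<bar> > L \<Longrightarrow> tri L t = 0" by (simp add: tri_def field_simps)

lemma tri_integrable:
  assumes "L > 0" shows "integrable lborel (tri L)"
proof (rule Bochner_Integration.integrable_bound)
  show "integrable lborel (indicator {-L..L} :: real \<Rightarrow> real)" by (rule integrable_real_indicator) (auto simp: emeasure_lborel_Icc_eq)
  show "AE t in lborel. norm (tri L t) \<le> norm (indicator {-L..L} t :: real)"
  proof (rule AE_I2)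
    show "norm (tri L t) \<le> norm (indicator {-L..L} t :: real)" for t
      using tri_le[OF assms, of t] tri_eq_0[OF assms, of t] tri_nonneg[of L t]
      by (cases "\<bar>t\<bar> \<le> L") (simp_all add: indicator_def abs_le_iff)
  qed
qed simp

lemma tri_cos_integrable: "L > 0 \<Longrightarrow> integrable lborel (\<lambda>t. tri L t * cos (t * u))"
  by (rule Bochner_Integration.integrable_bound[OF tri_integrable]) (auto simp: abs_mult tri_nonneg intro!: mult_left_le)

lemma fejer_measurable [measurable]: "fejer L \<in> borel_measurable borel"
  unfolding fejer_def by measurable

lemma fejer_bound: "L > 0 \<Longrightarrow> \<bar>fejer L u\<bar> \<le> (\<integral>t. tri L t \<partial>lborel)"
proof -
  assume L: "L > 0"
  have "\<bar>fejer L u\<bar> \<le> (\<integral>t. \<bar>tri L t * cos (t * u)\<bar> \<partial>lborel)" unfolding fejer_def by (rule integral_abs_bound)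
  also have "\<dots> \<le> (\<integral>t. tri L t \<partial>lborel)"
  proof (rule integral_mono)
    show "\<bar>tri L t * cos (t * u)\<bar> \<le> tri L t" for t by (simp add: abs_mult tri_nonneg mult_left_le)
  qed (use L in \<open>simp_all add: tri_integrable tri_cos_integrable integrable_abs\<close>)
  finally show ?thesis .
qed

lemma fejer_scale:
  assumes L: "L > 0" shows "fejer L u = L * fejer 1 (L * u)"
proof -
  have "fejer L u = \<bar>L\<bar> *\<^sub>R (\<integral>t. tri L (0 + L * t) * cos ((0 + L * t) * u) \<partial>lborel)"
    unfolding fejer_def by (rule lborel_integral_real_affine) (use L in simp)
  also have "\<dots> = L * fejer 1 (L * u)" using L by (simp add: fejer_def tri_def abs_mult mult_ac)
  finally show ?thesis .
qed

text \<open>Integration by parts on the two halves of the triangle. The closed form is what shows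
  that the kernel is nonnegative.\<close>

lemma fejer_closed_form:
  assumes u: "u \<noteq> 0" shows "fejer 1 u = (1 - cos u) / (pi * u\<^sup>2)"
proof -
  have 1: "(\<integral>t. ((1 - t) * cos (t * u)) * indicator {0..1} t \<partial>lborel) = (1 - cos u) / u\<^sup>2"
  proof -
    have "(\<integral>t. ((1 - t) * cos (t * u)) * indicator {0..1} t \<partial>lborel) =
      ((1 - 1) * sin (1 * u) / u - cos (1 * u) / u\<^sup>2) - ((1 - 0) * sin (0 * u) / u - cos (0 * u) / u\<^sup>2)"
    proof (rule integral_FTC_Icc_real)
      show "DERIV (\<lambda>t. (1 - t) * sin (t * u) / u - cos (t * u) / u\<^sup>2) t :> (1 - t) * cos (t * u)" for t
        using u by (auto intro!: derivative_eq_intros simp: field_simps power2_eq_square)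
      show "isCont (\<lambda>t. (1 - t) * cos (t * u)) t" for t by (intro continuous_intros)
    qed simp
    then show ?thesis by (simp add: diff_divide_distrib)
  qed
  have 2: "(\<integral>t. ((1 + t) * cos (t * u)) * indicator {-1..0} t \<partial>lborel) = (1 - cos u) / u\<^sup>2"
  proof -
    have "(\<integral>t. ((1 + t) * cos (t * u)) * indicator {-1..0} t \<partial>lborel) =
      ((1 + 0) * sin (0 * u) / u + cos (0 * u) / u\<^sup>2) - ((1 + - 1) * sin (- 1 * u) / u + cos (- 1 * u) / u\<^sup>2)"
    proof (rule integral_FTC_Icc_real)
      show "DERIV (\<lambda>t. (1 + t) * sin (t * u) / u + cos (t * u) / u\<^sup>2) t :> (1 + t) * cos (t * u)" for t
        using u by (auto intro!: derivative_eq_intros simp: field_simps power2_eq_square)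
      show "isCont (\<lambda>t. (1 + t) * cos (t * u)) t" for t by (intro continuous_intros)
    qed simp
    then show ?thesis by (simp add: diff_divide_distrib)
  qed
  have i1: "integrable lborel (\<lambda>t. ((1 - t) * cos (t * u)) * indicator {0..1} t)"
    using borel_integrable_compact[of "{0..1::real}" "\<lambda>t. (1 - t) * cos (t * u)"]
    by (simp add: mult.commute[of _ "indicator _ _"] continuous_intros)
  have i2: "integrable lborel (\<lambda>t. ((1 + t) * cos (t * u)) * indicator {-1..0} t)"
    using borel_integrable_compact[of "{-1..0::real}" "\<lambda>t. (1 + t) * cos (t * u)"]
    by (simp add: mult.commute[of _ "indicator _ _"] continuous_intros)
  have "fejer 1 u = (\<integral>t. (((1 - t) * cos (t * u)) * indicator {0..1} t + ((1 + t) * cos (t * u)) * indicator {-1..0} t) / (2 * pi) \<partial>lborel)"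
    unfolding fejer_def
  proof (rule integral_cong_AE)
    \<comment> \<open>The two indicators overlap at 0, where the sum counts twice; this is a null
      set.\<close>
    show "AE t in lborel. tri 1 t * cos (t * u) = (((1 - t) * cos (t * u)) * indicator {0..1} t + ((1 + t) * cos (t * u)) * indicator {-1..0} t) / (2 * pi)"
      using AE_lborel_singleton[of 0]
      by eventually_elim (auto simp: tri_def indicator_def max_def)
  qed measurable
  also have "\<dots> = ((1 - cos u) / u\<^sup>2 + (1 - cos u) / u\<^sup>2) / (2 * pi)"
    using i1 i2 by (simp add: 1 2)
  also have "\<dots> = (1 - cos u) / (pi * u\<^sup>2)"
  proof -
    have "(c / v + c / v) / (2 * pi) = c / (pi * v)" for c v :: real by (cases "v = 0") (auto simp: field_simps)
    then show ?thesis .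
  qed
  finally show ?thesis .
qed

lemma fejer_1_nonneg: "fejer 1 u \<ge> 0"
proof (cases "u = 0")
  case True
  have "0 \<le> (\<integral>t. tri 1 t \<partial>lborel)" by (rule integral_nonneg_AE) (simp add: tri_nonneg)
  then show ?thesis by (simp add: True fejer_def)
next
  case False
  then show ?thesis by (simp add: fejer_closed_form)
qed

lemma fejer_nonneg: "L > 0 \<Longrightarrow> fejer L u \<ge> 0"
  by (subst fejer_scale) (auto simp: fejer_1_nonneg)

text \<open>A Gaussian factor makes the integral absolutely convergent before integrability of the
  kernel is known. Fubini moves it to the side of \<open>tri\<close>, and the substitution t = b s
  exposes the limit b to 0.\<close>

lemma fejer_1_gauss:
  assumes b: "b > 0"
  shows "(\<integral>u. fejer 1 u * exp (- b\<^sup>2 * u\<^sup>2 / 2) \<partial>lborel) = (\<integral>s. sqrt (2 * pi) * (tri 1 (b * s) * exp (- s\<^sup>2 / 2)) \<partial>lborel)"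
proof -
  have b2: "b\<^sup>2 > 0" using b by simp
  have "(\<integral>u. fejer 1 u * exp (- b\<^sup>2 * u\<^sup>2 / 2) \<partial>lborel) = (\<integral>u. (\<integral>t. tri 1 t * cos (t * u) * exp (- b\<^sup>2 * u\<^sup>2 / 2) \<partial>lborel) \<partial>lborel)"
    by (simp add: fejer_def)
  also have "\<dots> = (\<integral>t. (\<integral>u. tri 1 t * cos (t * u) * exp (- b\<^sup>2 * u\<^sup>2 / 2) \<partial>lborel) \<partial>lborel)"
  proof (rule fubini_dominated)
    show "\<bar>tri 1 t * cos (t * u) * exp (- b\<^sup>2 * u\<^sup>2 / 2)\<bar> \<le> exp (- b\<^sup>2 * u\<^sup>2 / 2) * tri 1 t" for t u
    proof -
      have "\<bar>cos (t * u)\<bar> \<le> 1" by simp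
      then have "tri 1 t * \<bar>cos (t * u)\<bar> * exp (- b\<^sup>2 * u\<^sup>2 / 2) \<le> tri 1 t * 1 * exp (- b\<^sup>2 * u\<^sup>2 / 2)"
        by (intro mult_right_mono mult_left_mono tri_nonneg) auto
      then show ?thesis by (simp add: abs_mult tri_nonneg mult.commute)
    qed
  qed (use b2 tri_integrable[of 1] gauss_integrable[OF b2] in simp_all)
  also have "\<dots> = (\<integral>t. tri 1 t * (sqrt (2 * pi / b\<^sup>2) * exp (- t\<^sup>2 / (2 * b\<^sup>2))) \<partial>lborel)"
  proof (rule Bochner_Integration.integral_cong[OF refl])
    fix t
    have "(\<integral>u. tri 1 t * cos (t * u) * exp (- b\<^sup>2 * u\<^sup>2 / 2) \<partial>lborel) = (\<integral>u. tri 1 t * (exp (- b\<^sup>2 * u\<^sup>2 / 2) * cos (t * u)) \<partial>lborel)"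
      by (intro Bochner_Integration.integral_cong) auto
    also have "\<dots> = tri 1 t * (\<integral>u. exp (- b\<^sup>2 * u\<^sup>2 / 2) * cos (t * u) \<partial>lborel)" by simp
    finally show "(\<integral>u. tri 1 t * cos (t * u) * exp (- b\<^sup>2 * u\<^sup>2 / 2) \<partial>lborel) = tri 1 t * (sqrt (2 * pi / b\<^sup>2) * exp (- t\<^sup>2 / (2 * b\<^sup>2)))"
      unfolding gauss_cos[OF b2] .
  qed
  also have "\<dots> = \<bar>b\<bar> *\<^sub>R (\<integral>s. tri 1 (0 + b * s) * (sqrt (2 * pi / b\<^sup>2) * exp (- (0 + b * s)\<^sup>2 / (2 * b\<^sup>2))) \<partial>lborel)"
    by (rule lborel_integral_real_affine) (use b in simp)
  also have "\<dots> = (\<integral>s. b * (tri 1 (0 + b * s) * (sqrt (2 * pi / b\<^sup>2) * exp (- (0 + b * s)\<^sup>2 / (2 * b\<^sup>2)))) \<partial>lborel)"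
    using b by simp
  also have "\<dots> = (\<integral>s. sqrt (2 * pi) * (tri 1 (b * s) * exp (- s\<^sup>2 / 2)) \<partial>lborel)"
    using b by (intro Bochner_Integration.integral_cong) (auto simp: real_sqrt_divide power_mult_distrib)
  finally show ?thesis .
qed

text \<open>As b decreases to zero, the left side of \<open>fejer_1_gauss\<close> increases to the
  total mass and the right side converges, by domination, to a Gaussian integral equal to 1.
  Monotone convergence gives integrability along with the value.\<close>

lemma fejer_1_total: "integrable lborel (fejer 1)" "(\<integral>u. fejer 1 u \<partial>lborel) = 1"
proof -
  define b where "b n = 1 / (real n + 1)" for n
  have b0: "b n > 0" for n by (simp add: b_def)
  have bl: "b \<longlonglongrightarrow> 0" unfolding b_def by real_asymp
  let ?i = "\<lambda>n u. fejer 1 u * exp (- (b n)\<^sup>2 * u\<^sup>2 / 2)"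
  have "(\<lambda>n. \<integral>s. sqrt (2 * pi) * (tri 1 (b n * s) * exp (- s\<^sup>2 / 2)) \<partial>lborel) \<longlonglongrightarrow> (\<integral>s. sqrt (2 * pi) * (1 / (2 * pi) * exp (- s\<^sup>2 / 2)) \<partial>lborel)"
  proof (rule integral_dominated_convergence[where w = "\<lambda>s. sqrt (2 * pi) * exp (- 1 * s\<^sup>2 / 2)"])
    show "integrable lborel (\<lambda>s. sqrt (2 * pi) * exp (- 1 * s\<^sup>2 / 2) :: real)"
      by (intro integrable_mult_right gauss_integrable) simp
    show "AE s in lborel. (\<lambda>n. sqrt (2 * pi) * (tri 1 (b n * s) * exp (- s\<^sup>2 / 2))) \<longlonglongrightarrow> sqrt (2 * pi) * (1 / (2 * pi) * exp (- s\<^sup>2 / 2))"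
    proof (rule AE_I2)
      fix s :: real
      have "(\<lambda>n. max 0 (1 - \<bar>b n * s\<bar> / 1) / (2 * pi)) \<longlonglongrightarrow> max 0 (1 - \<bar>0 * s\<bar> / 1) / (2 * pi)"
        by (intro tendsto_intros bl) auto
      then show "(\<lambda>n. sqrt (2 * pi) * (tri 1 (b n * s) * exp (- s\<^sup>2 / 2))) \<longlonglongrightarrow> sqrt (2 * pi) * (1 / (2 * pi) * exp (- s\<^sup>2 / 2))"
        by (intro tendsto_intros) (simp add: tri_def)
    qed
    show "AE s in lborel. norm (sqrt (2 * pi) * (tri 1 (b n * s) * exp (- s\<^sup>2 / 2))) \<le> sqrt (2 * pi) * exp (- 1 * s\<^sup>2 / 2)" for n
    proof (rule AE_I2)
      fix s
      have "tri 1 (b n * s) * exp (- s\<^sup>2 / 2) \<le> 1 * exp (- s\<^sup>2 / 2)" by (intro mult_right_mono tri_le) auto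
      then show "norm (sqrt (2 * pi) * (tri 1 (b n * s) * exp (- s\<^sup>2 / 2))) \<le> sqrt (2 * pi) * exp (- 1 * s\<^sup>2 / 2)"
        by (simp add: abs_mult tri_nonneg)
    qed
  qed measurable
  also have "(\<integral>s. sqrt (2 * pi) * (1 / (2 * pi) * exp (- s\<^sup>2 / 2)) \<partial>lborel) = 1"
  proof -
    have "(\<integral>s. sqrt (2 * pi) * (1 / (2 * pi) * exp (- s\<^sup>2 / 2)) \<partial>lborel) = sqrt (2 * pi) * (1 / (2 * pi)) * (\<integral>s. exp (- 1 * s\<^sup>2 / 2) * cos (0 * s) \<partial>lborel)"
      by simp
    also have "\<dots> = sqrt (2 * pi) * (1 / (2 * pi)) * sqrt (2 * pi)" by (subst gauss_cos) auto
    also have "\<dots> = (sqrt (2 * pi) * sqrt (2 * pi)) / (2 * pi)" by (simp add: field_simps)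
    finally show ?thesis by simp
  qed
  finally have lim: "(\<lambda>n. \<integral>u. ?i n u \<partial>lborel) \<longlonglongrightarrow> 1" by (simp only: fejer_1_gauss[OF b0])
  have int: "integrable lborel (?i n)" for n
  proof (rule Bochner_Integration.integrable_bound)
    show "integrable lborel (\<lambda>u. (\<integral>t. tri 1 t \<partial>lborel) * exp (- (b n)\<^sup>2 * u\<^sup>2 / 2))"
      using b0[of n] by (intro integrable_mult_right gauss_integrable) simp
    have "\<bar>fejer 1 u\<bar> \<le> \<bar>\<integral>t. tri 1 t \<partial>lborel\<bar>" for u using fejer_bound[of 1 u] by linarith
    then show "AE u in lborel. norm (?i n u) \<le> norm ((\<integral>t. tri 1 t \<partial>lborel) * exp (- (b n)\<^sup>2 * u\<^sup>2 / 2))"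
      by (auto simp: abs_mult intro!: AE_I2 mult_right_mono)
  qed measurable
  have mono: "AE u in lborel. mono (\<lambda>n. ?i n u)"
  proof (rule AE_I2, rule monoI)
    fix u and n m :: nat assume "n \<le> m"
    then have "b m \<le> b n" by (simp add: b_def field_simps)
    then have "(b m)\<^sup>2 \<le> (b n)\<^sup>2" using b0[of m] by (intro power_mono) auto
    then have "(b m)\<^sup>2 * u\<^sup>2 \<le> (b n)\<^sup>2 * u\<^sup>2" by (intro mult_right_mono) auto
    then show "?i n u \<le> ?i m u" by (intro mult_left_mono fejer_1_nonneg) simp
  qed
  have ptw: "AE u in lborel. (\<lambda>n. ?i n u) \<longlonglongrightarrow> fejer 1 u"
  proof (rule AE_I2)
    fix u
    have "(\<lambda>n. ?i n u) \<longlonglongrightarrow> fejer 1 u * exp (- 0\<^sup>2 * u\<^sup>2 / 2)" by (intro tendsto_intros bl)  auto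
    then show "(\<lambda>n. ?i n u) \<longlonglongrightarrow> fejer 1 u" by simp
  qed
  show "integrable lborel (fejer 1)" by (rule integrable_monotone_convergence[OF int mono ptw lim]) simp
  show "(\<integral>u. fejer 1 u \<partial>lborel) = 1" by (rule integral_monotone_convergence[OF int mono ptw lim]) simp
qed

lemma fejer_integrable: 
  assumes L: "L > 0" shows "integrable lborel (fejer L)"
proof -
  have "integrable lborel (\<lambda>u. L * fejer 1 (0 + L * u))"
    using L fejer_1_total(1) by (intro integrable_mult_right lborel_integrable_real_affine) auto
  moreover have "(\<lambda>u. L * fejer 1 (0 + L * u)) = fejer L" using L by (intro ext) (simp add: fejer_scale[of L])
  ultimately show ?thesis by (simp only:)
qed

lemma fejer_scale_integral:
  assumes L: "L > 0"
  shows "(\<integral>u. indicator {-\<eta>..\<eta>} u * fejer L u \<partial>lborel) = (\<integral>u. indicator {-\<eta> * L..\<eta> * L} u * fejer 1 u \<partial>lborel)"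
proof -
  have "(\<integral>u. indicator {-\<eta> * L..\<eta> * L} u * fejer 1 u \<partial>lborel) = \<bar>L\<bar> *\<^sub>R (\<integral>u. indicator {-\<eta> * L..\<eta> * L} (0 + L * u) * fejer 1 (0 + L * u) \<partial>lborel)"
    by (rule lborel_integral_real_affine) (use L in simp)
  also have "\<dots> = (\<integral>u. L * (indicator {-\<eta> * L..\<eta> * L} (0 + L * u) * fejer 1 (0 + L * u)) \<partial>lborel)"
    using L by simp
  also have "\<dots> = (\<integral>u. indicator {-\<eta>..\<eta>} u * fejer L u \<partial>lborel)"
  proof (intro Bochner_Integration.integral_cong refl)
    fix u
    have "(L * u \<in> {-\<eta> * L..\<eta> * L}) = (u \<in> {-\<eta>..\<eta>})"
      using L mult_le_cancel_left_pos[of L "-\<eta>" u] mult_le_cancel_left_pos[of L u \<eta>] by (auto simp: mult.commute)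
    then show "L * (indicator {-\<eta> * L..\<eta> * L} (0 + L * u) * fejer 1 (0 + L * u)) = indicator {-\<eta>..\<eta>} u * fejer L u"
      by (simp add: fejer_scale[OF L] indicator_def)
  qed
  finally show ?thesis ..
qed

lemma fejer_total:
  assumes L: "L > 0" shows "(\<integral>u. fejer L u \<partial>lborel) = 1"
proof -
  have "(\<integral>u. fejer 1 u \<partial>lborel) = \<bar>L\<bar> *\<^sub>R (\<integral>u. fejer 1 (0 + L * u) \<partial>lborel)"
    by (rule lborel_integral_real_affine) (use L in simp)
  also have "\<dots> = (\<integral>u. fejer L u \<partial>lborel)" using L by (simp add: fejer_scale[OF L])
  finally show ?thesis using fejer_1_total by simp
qed

lemma fejer_concentrates:
  assumes \<eta>: "\<eta> > 0"
  shows "\<exists>L>0. (\<integral>u. indicator {-\<eta>..\<eta>} u * fejer L u \<partial>lborel) \<ge> 1 - \<eta>"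
proof -
  have "(\<lambda>n::nat. \<integral>u. indicator {-\<eta> * (real n + 1)..\<eta> * (real n + 1)} u * fejer 1 u \<partial>lborel) \<longlonglongrightarrow> (\<integral>u. fejer 1 u \<partial>lborel)"
  proof (rule integral_dominated_convergence[where w = "fejer 1"])
    show "AE u in lborel. (\<lambda>n::nat. indicator {-\<eta> * (real n + 1)..\<eta> * (real n + 1)} u * fejer 1 u) \<longlonglongrightarrow> fejer 1 u"
    proof (rule AE_I2)
      fix u
      obtain N :: nat where N: "\<bar>u\<bar> / \<eta> < real N" using reals_Archimedean2 by blast
      have "\<forall>\<^sub>F n::nat in sequentially. indicator {-\<eta> * (real n + 1)..\<eta> * (real n + 1)} u * fejer 1 u = fejer 1 u"
        using eventually_ge_at_top[of N]
      proof eventually_elim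
        case (elim n)
        have "\<bar>u\<bar> < \<eta> * real N" using N \<eta> by (simp add: field_simps)
        also have "\<dots> \<le> \<eta> * (real n + 1)" using elim \<eta> by (intro mult_left_mono) auto
        finally show ?case by (simp add: indicator_def abs_less_iff)
      qed
      then show "(\<lambda>n::nat. indicator {-\<eta> * (real n + 1)..\<eta> * (real n + 1)} u * fejer 1 u) \<longlonglongrightarrow> fejer 1 u"
        by (rule tendsto_eventually)
    qed
  qed (auto simp: fejer_1_total fejer_1_nonneg indicator_def)
  then have "(\<lambda>n::nat. \<integral>u. indicator {-\<eta> * (real n + 1)..\<eta> * (real n + 1)} u * fejer 1 u \<partial>lborel) \<longlonglongrightarrow> 1"
    by (simp add: fejer_1_total)
  then have "\<forall>\<^sub>F n in sequentially. (\<integral>u. indicator {-\<eta> * (real n + 1)..\<eta> * (real n + 1)} u * fejer 1 u \<partial>lborel) > 1 - \<eta>"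
    using \<eta> by (intro order_tendstoD) auto
  then obtain n :: nat where n: "(\<integral>u. indicator {-\<eta> * (real n + 1)..\<eta> * (real n + 1)} u * fejer 1 u \<partial>lborel) > 1 - \<eta>"
    by (auto simp: eventually_sequentially)
  show ?thesis
    by (rule exI[of _ "real n + 1"], subst fejer_scale_integral) (use n in auto)
qed

subsection \<open>A local limit theorem for the free walk\<close>

lemma gauss_integrable_cos':
  fixes a :: real assumes "a > 0" shows "integrable lborel (\<lambda>u. exp (- a * u\<^sup>2 / 2) * cos (u * t))"
  using gauss_integrable_cos[OF assms, of t] by (simp only: mult.commute[of t])

lemma cis_measurable [measurable]: "cis \<in> borel_measurable borel"
  unfolding cis_conv_exp by (intro borel_measurable_continuous_onI continuous_intros)

context markov_walk
begin

text \<open>The L1 distance of the two Fourier integrands on their natural scale. Summing over all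
  pairs of states makes it a bound uniform in both.\<close>

definition "llt_err L j = (\<Sum>x\<in>UNIV. \<Sum>z\<in>UNIV. sqrt (real j) *
   (\<integral>t. norm (of_real (tri L t) * Fker j t x z - of_real (\<nu> z * exp (- (\<sigma>2 * real j) * t\<^sup>2 / 2) / (2 * pi))) \<partial>lborel))"

lemma Fker_measurable [measurable (raw)]: "g \<in> borel_measurable M \<Longrightarrow> (\<lambda>s. Fker j (g s) x z) \<in> borel_measurable M"
  by (rule measurable_compose[OF _ borel_measurable_continuous_onI[OF Fker_cont]])

lemma nu_le_1: "\<nu> x \<le> 1" using nu_sum member_le_sum[of x UNIV \<nu>] nu_nonneg by simp

lemma two_pi_ge_1: "1 \<le> 2 * pi" using pi_gt3 by simp

lemma llt_integrand_bound:
  assumes "L > 0"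
  shows "\<exists>c>0. \<forall>j t x z. norm (of_real (tri L t) * Fker j t x z - of_real (\<nu> z * exp (- (\<sigma>2 * real j) * t\<^sup>2 / 2) / (2 * pi)))
     \<le> 2 * exp (- c * real j * t\<^sup>2) + exp (- (\<sigma>2 * real j) * t\<^sup>2 / 2)"
proof -
  obtain c where c: "c > 0" and *: "\<forall>t g k x. \<bar>t\<bar> \<le> L \<longrightarrow> (\<forall>x. norm (g x) \<le> 1) \<longrightarrow> norm ((Fop t ^^ k) g x) \<le> 2 * exp (- c * real k * t\<^sup>2)"
    using Fop_decay[OF assms] by blast
  have "norm (of_real (tri L t) * Fker j t x z - of_real (\<nu> z * exp (- (\<sigma>2 * real j) * t\<^sup>2 / 2) / (2 * pi)))
     \<le> 2 * exp (- c * real j * t\<^sup>2) + exp (- (\<sigma>2 * real j) * t\<^sup>2 / 2)" for j t x z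
  proof (rule order_trans[OF norm_triangle_ineq4], rule add_mono)
    show "norm (of_real (tri L t) * Fker j t x z) \<le> 2 * exp (- c * real j * t\<^sup>2)"
    proof (cases "\<bar>t\<bar> \<le> L")
      case True
      have "norm (Fker j t x z) \<le> 2 * exp (- c * real j * t\<^sup>2)" unfolding Fker_def
        using *[rule_format, OF True, of "\<lambda>u. if u = z then 1 else 0" j x] by simp
      moreover have "norm (of_real (tri L t) * Fker j t x z) \<le> 1 * norm (Fker j t x z)"
        unfolding norm_mult using tri_le[OF assms] tri_nonneg[of L t] by (intro mult_right_mono) auto
      ultimately show ?thesis by linarith
    next
      case False
      then show ?thesis using tri_eq_0[OF assms, of t] by simp
    qed
    show "norm (complex_of_real (\<nu> z * exp (- (\<sigma>2 * real j) * t\<^sup>2 / 2) / (2 * pi))) \<le> exp (- (\<sigma>2 * real j) * t\<^sup>2 / 2)"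
    proof -
      have "\<nu> z * exp (- (\<sigma>2 * real j) * t\<^sup>2 / 2) / (2 * pi) \<le> 1 * exp (- (\<sigma>2 * real j) * t\<^sup>2 / 2) / 1"
        using nu_le_1[of z] nu_nonneg[of z] two_pi_ge_1 by (intro frac_le mult_right_mono) auto
      moreover have "0 \<le> \<nu> z * exp (- (\<sigma>2 * real j) * t\<^sup>2 / 2) / (2 * pi)" using nu_nonneg[of z] by simp
      ultimately show ?thesis unfolding norm_of_real by simp
    qed
  qed
  with c show ?thesis by blast
qed

lemma llt_integrand_integrable:
  assumes L: "L > 0" and j: "j \<ge> 1"
  shows "integrable lborel (\<lambda>t. of_real (tri L t) * Fker j t x z - of_real (\<nu> z * exp (- (\<sigma>2 * real j) * t\<^sup>2 / 2) / (2 * pi)))"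
proof -
  obtain c where c: "c > 0" and b: "\<forall>j t x z. norm (of_real (tri L t) * Fker j t x z - of_real (\<nu> z * exp (- (\<sigma>2 * real j) * t\<^sup>2 / 2) / (2 * pi)))
     \<le> 2 * exp (- c * real j * t\<^sup>2) + exp (- (\<sigma>2 * real j) * t\<^sup>2 / 2)"
    using llt_integrand_bound[OF L] by blast
  have 1: "integrable lborel (\<lambda>t. 2 * exp (- (2 * c * real j) * t\<^sup>2 / 2) + exp (- (\<sigma>2 * real j) * t\<^sup>2 / 2))"
    using c j \<sigma>2_pos by (intro Bochner_Integration.integrable_add integrable_mult_right gauss_integrable) auto
  show ?thesis
  proof (rule Bochner_Integration.integrable_bound[OF 1])
    show "AE t in lborel. norm (of_real (tri L t) * Fker j t x z - of_real (\<nu> z * exp (- (\<sigma>2 * real j) * t\<^sup>2 / 2) / (2 * pi))) \<le> norm (2 * exp (- (2 * c * real j) * t\<^sup>2 / 2) + exp (- (\<sigma>2 * real j) * t\<^sup>2 / 2))"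
    proof (rule AE_I2)
      fix t
      show "norm (of_real (tri L t) * Fker j t x z - of_real (\<nu> z * exp (- (\<sigma>2 * real j) * t\<^sup>2 / 2) / (2 * pi))) \<le> norm (2 * exp (- (2 * c * real j) * t\<^sup>2 / 2) + exp (- (\<sigma>2 * real j) * t\<^sup>2 / 2))"
        using b[rule_format, of t j x z] by (simp add: mult_ac)
    qed
  qed measurable
qed

text \<open>The substitution t = s / sqrt j absorbs the factor sqrt j. \<open>Fker_clt\<close> gives
  the pointwise limit and \<open>Fop_decay\<close> the Gaussian majorant.\<close>

lemma llt_err_tendsto:
  assumes L: "L > 0" shows "llt_err L \<longlonglongrightarrow> 0"
proof -
  obtain c where c: "c > 0" and b: "\<forall>j t x z. norm (of_real (tri L t) * Fker j t x z - of_real (\<nu> z * exp (- (\<sigma>2 * real j) * t\<^sup>2 / 2) / (2 * pi)))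
     \<le> 2 * exp (- c * real j * t\<^sup>2) + exp (- (\<sigma>2 * real j) * t\<^sup>2 / 2)"
    using llt_integrand_bound[OF L] by blast
  let ?h = "\<lambda>j x z t. norm (of_real (tri L t) * Fker j t x z - of_real (\<nu> z * exp (- (\<sigma>2 * real j) * t\<^sup>2 / 2) / (2 * pi)))"
  have *: "(\<lambda>n. sqrt (real (Suc n)) * (\<integral>t. ?h (Suc n) x z t \<partial>lborel)) \<longlonglongrightarrow> 0" for x z
  proof -
    let ?r = "\<lambda>n. sqrt (real (Suc n))"
    have sub: "?r n * (\<integral>t. ?h (Suc n) x z t \<partial>lborel) = (\<integral>s. ?h (Suc n) x z (s / ?r n) \<partial>lborel)" for n
    proof -
      have "(\<integral>t. ?h (Suc n) x z t \<partial>lborel) = \<bar>1 / ?r n\<bar> *\<^sub>R (\<integral>s. ?h (Suc n) x z (0 + 1 / ?r n * s) \<partial>lborel)"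
        by (rule lborel_integral_real_affine) simp
      then show ?thesis by simp
    qed
    have "(\<lambda>n. \<integral>s. ?h (Suc n) x z (s / ?r n) \<partial>lborel) \<longlonglongrightarrow> (\<integral>s. (0::real) \<partial>(lborel :: real measure))"
    proof (rule integral_dominated_convergence[where w = "\<lambda>s. 2 * exp (- (2 * c) * s\<^sup>2 / 2) + exp (- \<sigma>2 * s\<^sup>2 / 2)"])
      show "integrable lborel (\<lambda>s. 2 * exp (- (2 * c) * s\<^sup>2 / 2) + exp (- \<sigma>2 * s\<^sup>2 / 2))"
        using c \<sigma>2_pos by (intro Bochner_Integration.integrable_add integrable_mult_right gauss_integrable) auto
      show "AE s in lborel. norm (?h (Suc n) x z (s / ?r n)) \<le> 2 * exp (- (2 * c) * s\<^sup>2 / 2) + exp (- \<sigma>2 * s\<^sup>2 / 2)" for n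
      proof (rule AE_I2)
        fix s
        have e: "c * (real (Suc n) * (s / ?r n)\<^sup>2) = c * s\<^sup>2" "\<sigma>2 * (real (Suc n) * (s / ?r n)\<^sup>2) = \<sigma>2 * s\<^sup>2"
          by (simp_all add: power_divide)
        have "?h (Suc n) x z (s / ?r n) \<le> 2 * exp (- (c * (real (Suc n) * (s / ?r n)\<^sup>2))) + exp (- (\<sigma>2 * (real (Suc n) * (s / ?r n)\<^sup>2)) / 2)"
          using b[rule_format, of "s / ?r n" "Suc n" x z] by (simp only: mult.assoc mult_minus_left)
        then show "norm (?h (Suc n) x z (s / ?r n)) \<le> 2 * exp (- (2 * c) * s\<^sup>2 / 2) + exp (- \<sigma>2 * s\<^sup>2 / 2)"
          unfolding e by simp
      qed
      show "AE s in lborel. (\<lambda>n. ?h (Suc n) x z (s / ?r n)) \<longlonglongrightarrow> 0"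
      proof (rule AE_I2)
        fix s
        have r0: "(\<lambda>n. s / ?r n) \<longlonglongrightarrow> 0" by real_asymp
        have "(\<lambda>n. max 0 (1 - \<bar>s / ?r n\<bar> / L) / (2 * pi)) \<longlonglongrightarrow> max 0 (1 - \<bar>0\<bar> / L) / (2 * pi)"
          by (intro tendsto_intros r0) (use L in auto)
        then have 1: "(\<lambda>n. tri L (s / ?r n)) \<longlonglongrightarrow> 1 / (2 * pi)" by (simp add: tri_def)
        have 2: "(\<lambda>n. Fker (Suc n) (s / ?r n) x z) \<longlonglongrightarrow> of_real (\<nu> z * exp (- \<sigma>2 * s\<^sup>2 / 2))"
          using LIMSEQ_Suc[OF Fker_clt[of s x z]] .
        have e: "- (\<sigma>2 * real (Suc n)) * (s / ?r n)\<^sup>2 / 2 = - \<sigma>2 * s\<^sup>2 / 2" for n by (simp add: power_divide)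
        have "(\<lambda>n. norm (of_real (tri L (s / ?r n)) * Fker (Suc n) (s / ?r n) x z - of_real (\<nu> z * exp (- \<sigma>2 * s\<^sup>2 / 2) / (2 * pi))))
           \<longlonglongrightarrow> norm (complex_of_real (1 / (2 * pi)) * of_real (\<nu> z * exp (- \<sigma>2 * s\<^sup>2 / 2)) - of_real (\<nu> z * exp (- \<sigma>2 * s\<^sup>2 / 2) / (2 * pi)))"
          by (intro tendsto_intros 1 2)
        then show "(\<lambda>n. ?h (Suc n) x z (s / ?r n)) \<longlonglongrightarrow> 0" unfolding e by simp
      qed
    qed measurable
    then show ?thesis unfolding sub by (simp only: Bochner_Integration.integral_zero)
  qed
  have "(\<lambda>n. llt_err L (Suc n)) \<longlonglongrightarrow> (\<Sum>x\<in>(UNIV::'a set). \<Sum>z\<in>(UNIV::'a set). 0)"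
    unfolding llt_err_def by (intro tendsto_sum *)
  then show ?thesis by (simp add: filterlim_sequentially_Suc)
qed

text \<open>The centred Gaussian density of variance \<open>\<sigma>2 * real j\<close>, kept as an
  inversion integral since the bounds and the reflection identity are read off from it.\<close>

definition "gk j a = (\<integral>t. exp (- (\<sigma>2 * real j) * t\<^sup>2 / 2) * cos (t * a) \<partial>lborel) / (2 * pi)"

definition "gC0 = (\<integral>t. exp (- \<sigma>2 * t\<^sup>2 / 2) \<partial>lborel)"
definition "gC1 = (\<integral>t. \<bar>exp (- \<sigma>2 * t\<^sup>2 / 2) * t\<bar> \<partial>lborel)"

lemma gk_measurable [measurable]: "gk j \<in> borel_measurable borel"
  unfolding gk_def by measurable

lemma gC0_nonneg: "gC0 \<ge> 0" unfolding gC0_def by (rule integral_nonneg_AE) simp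
lemma gC1_nonneg: "gC1 \<ge> 0" unfolding gC1_def by (rule integral_nonneg_AE) simp

lemma gauss_scaled:
  assumes j: "j \<ge> 1"
  shows "(\<integral>t. exp (- (\<sigma>2 * real j) * t\<^sup>2 / 2) \<partial>lborel) = gC0 / sqrt (real j)"
    and "(\<integral>t. \<bar>exp (- (\<sigma>2 * real j) * t\<^sup>2 / 2) * t\<bar> \<partial>lborel) = gC1 / real j"
proof -
  let ?r = "sqrt (real j)"
  have r: "?r > 0" "?r * ?r = real j" using j by auto
  have "gC0 = \<bar>?r\<bar> *\<^sub>R (\<integral>t. exp (- \<sigma>2 * (0 + ?r * t)\<^sup>2 / 2) \<partial>lborel)"
    unfolding gC0_def by (rule lborel_integral_real_affine) (use r in simp)
  then show "(\<integral>t. exp (- (\<sigma>2 * real j) * t\<^sup>2 / 2) \<partial>lborel) = gC0 / sqrt (real j)"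
    using r by (simp add: power_mult_distrib mult.assoc field_simps)
  have "gC1 = \<bar>?r\<bar> *\<^sub>R (\<integral>t. \<bar>exp (- \<sigma>2 * (0 + ?r * t)\<^sup>2 / 2) * (0 + ?r * t)\<bar> \<partial>lborel)"
    unfolding gC1_def by (rule lborel_integral_real_affine) (use r in simp)
  also have "(\<lambda>t. \<bar>exp (- \<sigma>2 * (0 + ?r * t)\<^sup>2 / 2) * (0 + ?r * t)\<bar>) = (\<lambda>t. ?r * \<bar>exp (- (\<sigma>2 * real j) * t\<^sup>2 / 2) * t\<bar>)"
    using r by (intro ext) (simp add: power_mult_distrib mult.assoc abs_mult)
  also have "\<bar>?r\<bar> *\<^sub>R (\<integral>t. ?r * \<bar>exp (- (\<sigma>2 * real j) * t\<^sup>2 / 2) * t\<bar> \<partial>lborel) = (?r * ?r) * (\<integral>t. \<bar>exp (- (\<sigma>2 * real j) * t\<^sup>2 / 2) * t\<bar> \<partial>lborel)"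
    using r by (simp del: real_sqrt_mult_self)
  finally show "(\<integral>t. \<bar>exp (- (\<sigma>2 * real j) * t\<^sup>2 / 2) * t\<bar> \<partial>lborel) = gC1 / real j"
    unfolding r using j by (simp add: field_simps)
qed

lemma gk_bound:
  assumes j: "j \<ge> 1" shows "\<bar>gk j a\<bar> \<le> gC0 / sqrt (real j)"
proof -
  have p: "\<sigma>2 * real j > 0" using j \<sigma>2_pos by simp
  have "\<bar>\<integral>t. exp (- (\<sigma>2 * real j) * t\<^sup>2 / 2) * cos (t * a) \<partial>lborel\<bar> \<le> (\<integral>t. \<bar>exp (- (\<sigma>2 * real j) * t\<^sup>2 / 2) * cos (t * a)\<bar> \<partial>lborel)"
    by (rule integral_abs_bound)
  also have "\<dots> \<le> (\<integral>t. exp (- (\<sigma>2 * real j) * t\<^sup>2 / 2) \<partial>lborel)"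
  proof (rule integral_mono)
    have "\<bar>cos (t * a)\<bar> \<le> 1" for t by simp
    then show "\<bar>exp (- (\<sigma>2 * real j) * t\<^sup>2 / 2) * cos (t * a)\<bar> \<le> exp (- (\<sigma>2 * real j) * t\<^sup>2 / 2)" for t
      unfolding abs_mult by (subst abs_of_nonneg) (auto intro!: mult_left_le)
  qed (use gauss_integrable[OF p] gauss_integrable_cos'[OF p, of a, THEN integrable_abs] in \<open>simp_all only: mult_minus_left\<close>)
  finally have 1: "\<bar>\<integral>t. exp (- (\<sigma>2 * real j) * t\<^sup>2 / 2) * cos (t * a) \<partial>lborel\<bar> \<le> gC0 / sqrt (real j)"
    by (simp only: gauss_scaled[OF j])
  have "\<bar>gk j a\<bar> = \<bar>\<integral>t. exp (- (\<sigma>2 * real j) * t\<^sup>2 / 2) * cos (t * a) \<partial>lborel\<bar> / (2 * pi)" unfolding gk_def by simp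
  also have "\<dots> \<le> (gC0 / sqrt (real j)) / 1" using 1 two_pi_ge_1 gC0_nonneg by (intro frac_le) auto
  finally show ?thesis by simp
qed

lemma gk_reflect:
  assumes j: "j \<ge> 1"
  shows "gk j (b - r) - gk j (b + r) = (\<integral>t. exp (- (\<sigma>2 * real j) * t\<^sup>2 / 2) * (sin (t * b) * sin (t * r)) \<partial>lborel) / pi"
proof -
  have p: "\<sigma>2 * real j > 0" using j \<sigma>2_pos by simp
  let ?e = "\<lambda>t. exp (- (\<sigma>2 * real j) * t\<^sup>2 / 2)"
  have "gk j (b - r) - gk j (b + r) = ((\<integral>t. ?e t * cos (t * (b - r)) \<partial>lborel) - (\<integral>t. ?e t * cos (t * (b + r)) \<partial>lborel)) / (2 * pi)"
    unfolding gk_def by (simp add: diff_divide_distrib)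
  also have "(\<integral>t. ?e t * cos (t * (b - r)) \<partial>lborel) - (\<integral>t. ?e t * cos (t * (b + r)) \<partial>lborel) = (\<integral>t. ?e t * cos (t * (b - r)) - ?e t * cos (t * (b + r)) \<partial>lborel)"
    by (rule Bochner_Integration.integral_diff[OF gauss_integrable_cos'[OF p] gauss_integrable_cos'[OF p], symmetric])
  also have "\<dots> = (\<integral>t. 2 * (?e t * (sin (t * b) * sin (t * r))) \<partial>lborel)"
  proof (rule Bochner_Integration.integral_cong[OF refl])
    have "e * cos (t * (b - r)) - e * cos (t * (b + r)) = 2 * (e * (sin (t * b) * sin (t * r)))" for e t :: real
      unfolding right_diff_distrib[of t] distrib_left[of t] cos_diff cos_add by (simp add: algebra_simps)
    then show "?e t * cos (t * (b - r)) - ?e t * cos (t * (b + r)) = 2 * (?e t * (sin (t * b) * sin (t * r)))" for t .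
  qed
  also have "\<dots> = 2 * (\<integral>t. ?e t * (sin (t * b) * sin (t * r)) \<partial>lborel)" by (rule integral_mult_right_zero)
  finally show ?thesis by simp
qed

lemma gauss_abs_integrable:
  fixes a :: real assumes "a > 0" shows "integrable lborel (\<lambda>t. \<bar>exp (- a * t\<^sup>2 / 2) * t\<bar>)"
  using gauss_integrable_moment[OF assms, of 1, THEN integrable_abs] by simp

text \<open>One of the two sines in the odd kernel is bounded by |t b|. The resulting factor t
  improves the order 1 / sqrt j of a density to 1 / j at bounded distance from zero, and this gain
  is what makes reflection effective at exit points.\<close>

lemma gk_reflect_bound:
  assumes j: "j \<ge> 1" shows "\<bar>gk j (b - r) - gk j (b + r)\<bar> \<le> \<bar>b\<bar> * gC1 / real j"
proof -
  have p: "\<sigma>2 * real j > 0" using j \<sigma>2_pos by simp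
  let ?e = "\<lambda>t. exp (- (\<sigma>2 * real j) * t\<^sup>2 / 2)"
  have le: "\<bar>?e t * (sin (t * b) * sin (t * r))\<bar> \<le> \<bar>b\<bar> * \<bar>?e t * t\<bar>" for t
  proof -
    have "\<bar>sin (t * b)\<bar> * \<bar>sin (t * r)\<bar> \<le> \<bar>t * b\<bar> * 1" by (intro mult_mono abs_sin_le_one abs_sin_x_le_abs_x) auto
    then have "?e t * (\<bar>sin (t * b)\<bar> * \<bar>sin (t * r)\<bar>) \<le> ?e t * (\<bar>t * b\<bar> * 1)" by (intro mult_left_mono) auto
    then show ?thesis by (simp add: abs_mult mult_ac)
  qed
  have i: "integrable lborel (\<lambda>t. \<bar>b\<bar> * \<bar>?e t * t\<bar>)" by (intro integrable_mult_right gauss_abs_integrable[OF p])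
  have "\<bar>\<integral>t. ?e t * (sin (t * b) * sin (t * r)) \<partial>lborel\<bar> \<le> (\<integral>t. \<bar>?e t * (sin (t * b) * sin (t * r))\<bar> \<partial>lborel)"
    by (rule integral_abs_bound)
  also have "\<dots> \<le> (\<integral>t. \<bar>b\<bar> * \<bar>?e t * t\<bar> \<partial>lborel)"
  proof (rule integral_mono[OF _ i le])
    show "integrable lborel (\<lambda>t. \<bar>?e t * (sin (t * b) * sin (t * r))\<bar>)"
    proof (rule Bochner_Integration.integrable_bound[OF i])
      show "AE t in lborel. norm \<bar>?e t * (sin (t * b) * sin (t * r))\<bar> \<le> norm (\<bar>b\<bar> * \<bar>?e t * t\<bar>)"
        by (rule AE_I2) (use le in \<open>simp only: real_norm_def abs_abs abs_mult\<close>)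
    qed measurable
  qed
  also have "\<dots> = \<bar>b\<bar> * (gC1 / real j)" by (simp only: integral_mult_right_zero gauss_scaled[OF j])
  finally have 1: "\<bar>\<integral>t. ?e t * (sin (t * b) * sin (t * r)) \<partial>lborel\<bar> \<le> \<bar>b\<bar> * gC1 / real j" by simp
  have "\<bar>gk j (b - r) - gk j (b + r)\<bar> = \<bar>\<integral>t. ?e t * (sin (t * b) * sin (t * r)) \<partial>lborel\<bar> / pi" unfolding gk_reflect[OF j] by simp
  also have "\<dots> \<le> (\<bar>b\<bar> * gC1 / real j) / 1" using 1 gC1_nonneg pi_gt3 by (intro frac_le) auto
  finally show ?thesis by simp
qed

text \<open>Real parts are taken because the step operators act on real functions.\<close>

lemma T_char: "(T ^^ j) (\<lambda>x y. Re (cis (t * (y - r)) * g x)) x w = Re (cis (t * (w - r)) * (Fop t ^^ j) g x)"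
proof (induction j arbitrary: x w)
  case (Suc j)
  have "(T ^^ Suc j) (\<lambda>x y. Re (cis (t * (y - r)) * g x)) x w = (\<Sum>x'\<in>UNIV. P x x' * Re (cis (t * (w + f x' - r)) * (Fop t ^^ j) g x'))"
    unfolding free_pow_Suc Suc.IH ..
  also have "\<dots> = (\<Sum>x'\<in>UNIV. Re (cis (t * (w - r)) * (of_real (P x x') * cis (t * f x') * (Fop t ^^ j) g x')))"
  proof (intro sum.cong refl)
    fix x'
    have "cis (t * (w + f x' - r)) = cis (t * (w - r)) * cis (t * f x')" by (simp add: cis_mult algebra_simps)
    then have eq: "cis (t * (w - r)) * (of_real (P x x') * cis (t * f x') * (Fop t ^^ j) g x') = of_real (P x x') * (cis (t * (w + f x' - r)) * (Fop t ^^ j) g x')"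
      by (simp only: mult_ac)
    have "Re (of_real p * q) = p * Re q" for p q by simp
    then show "P x x' * Re (cis (t * (w + f x' - r)) * (Fop t ^^ j) g x') = Re (cis (t * (w - r)) * (of_real (P x x') * cis (t * f x') * (Fop t ^^ j) g x'))"
      by (simp only: eq)
  qed
  also have "\<dots> = Re (cis (t * (w - r)) * (Fop t ^^ Suc j) g x)" unfolding Fop_pow_Suc sum_distrib_left Re_sum ..
  finally show ?case .
qed simp

text \<open>The distribution of the displacement after j steps on the event of ending in z, smoothed
  by the Fejer kernel and written by Fourier inversion; see \<open>T_fejer\<close>.\<close>

definition "Gam L j x z a = (\<integral>t. tri L t * Re (cis (t * a) * Fker j t x z) \<partial>lborel)"

lemma T_fejer:
  assumes L: "L > 0"
  shows "(T ^^ j) (\<lambda>x y. if x = z then fejer L (y - r) else 0) x w = Gam L j x z (w - r)"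
proof -
  let ?g = "\<lambda>t x y. tri L t * Re (cis (t * (y - r)) * (if x = z then 1 else 0))"
  have int: "integrable lborel (\<lambda>t. ?g t x y)" for x y
    using tri_cos_integrable[OF L, of "y - r"] by (cases "x = z") (simp_all add: mult.commute)
  have "(\<lambda>x y. if x = z then fejer L (y - r) else 0) = (\<lambda>x y. \<integral>t. ?g t x y \<partial>lborel)"
    by (intro ext) (simp add: fejer_def)
  then have "(T ^^ j) (\<lambda>x y. if x = z then fejer L (y - r) else 0) x w = (\<integral>t. (T ^^ j) (?g t) x w \<partial>lborel)"
    by (simp only: free_step_def walk_step_pow_integral(2)[OF int])
  also have "\<dots> = Gam L j x z (w - r)"
    unfolding Gam_def free_step_def walk_step_pow_scale unfolding free_step_def[symmetric] T_char Fker_def ..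
  finally show ?thesis .
qed

lemma Gam_measurable [measurable]: "Gam L j x z \<in> borel_measurable borel"
  unfolding Gam_def by measurable

lemma Gam_approx:
  assumes L: "L > 0" and j: "j \<ge> 1"
  shows "\<bar>Gam L j x z a - \<nu> z * gk j a\<bar> \<le> llt_err L j / sqrt (real j)"
proof -
  let ?h = "\<lambda>t. of_real (tri L t) * Fker j t x z - of_real (\<nu> z * exp (- (\<sigma>2 * real j) * t\<^sup>2 / 2) / (2 * pi))"
  have p: "\<sigma>2 * real j > 0" using j \<sigma>2_pos by simp
  note hi = llt_integrand_integrable[OF L j, of x z]
  have i2: "integrable lborel (\<lambda>t. \<nu> z / (2 * pi) * (exp (- (\<sigma>2 * real j) * t\<^sup>2 / 2) * cos (t * a)))"
    by (intro integrable_mult_right gauss_integrable_cos'[OF p])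
  have i3: "integrable lborel (\<lambda>t. Re (cis (t * a) * ?h t))"
  proof (rule Bochner_Integration.integrable_bound[OF integrable_norm[OF hi]])
    show "(\<lambda>t. Re (cis (t * a) * ?h t)) \<in> borel_measurable lborel" by measurable
    show "AE t in lborel. norm (Re (cis (t * a) * ?h t)) \<le> norm (norm (?h t))"
    proof (rule AE_I2)
      fix t
      have "\<bar>Re (cis (t * a) * ?h t)\<bar> \<le> norm (cis (t * a) * ?h t)" by (rule abs_Re_le_cmod)
      then show "norm (Re (cis (t * a) * ?h t)) \<le> norm (norm (?h t))" by (simp only: norm_mult norm_cis mult_1 real_norm_def abs_norm_cancel)
    qed
  qed
  have e: "tri L t * Re (cis (t * a) * Fker j t x z) = Re (cis (t * a) * ?h t) + \<nu> z / (2 * pi) * (exp (- (\<sigma>2 * real j) * t\<^sup>2 / 2) * cos (t * a))" for t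
    by (simp add: algebra_simps)
  have "Gam L j x z a = (\<integral>t. Re (cis (t * a) * ?h t) \<partial>lborel) + (\<integral>t. \<nu> z / (2 * pi) * (exp (- (\<sigma>2 * real j) * t\<^sup>2 / 2) * cos (t * a)) \<partial>lborel)"
    unfolding Gam_def e by (rule Bochner_Integration.integral_add[OF i3 i2])
  also have "(\<integral>t. \<nu> z / (2 * pi) * (exp (- (\<sigma>2 * real j) * t\<^sup>2 / 2) * cos (t * a)) \<partial>lborel) = \<nu> z * gk j a"
    unfolding integral_mult_right_zero gk_def by simp
  finally have "\<bar>Gam L j x z a - \<nu> z * gk j a\<bar> = \<bar>\<integral>t. Re (cis (t * a) * ?h t) \<partial>lborel\<bar>" by simp
  also have "\<dots> \<le> (\<integral>t. \<bar>Re (cis (t * a) * ?h t)\<bar> \<partial>lborel)" by (rule integral_abs_bound)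
  also have "\<dots> \<le> (\<integral>t. norm (?h t) \<partial>lborel)"
  proof (rule integral_mono[OF integrable_abs[OF i3] integrable_norm[OF hi]])
    fix t
    have "\<bar>Re (cis (t * a) * ?h t)\<bar> \<le> norm (cis (t * a) * ?h t)" by (rule abs_Re_le_cmod)
    then show "\<bar>Re (cis (t * a) * ?h t)\<bar> \<le> norm (?h t)" by (simp only: norm_mult norm_cis mult_1)
  qed
  also have "\<dots> \<le> llt_err L j / sqrt (real j)"
  proof -
    let ?I = "\<lambda>x z. sqrt (real j) * (\<integral>t. norm (of_real (tri L t) * Fker j t x z - of_real (\<nu> z * exp (- (\<sigma>2 * real j) * t\<^sup>2 / 2) / (2 * pi))) \<partial>lborel)"
    have nn: "?I x z \<ge> 0" for x z by (intro mult_nonneg_nonneg integral_nonneg_AE) auto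
    have "?I x z \<le> (\<Sum>z\<in>UNIV. ?I x z)" by (rule member_le_sum[of z UNIV "?I x"]) (use nn in auto)
    also have "\<dots> \<le> llt_err L j" unfolding llt_err_def
      by (rule member_le_sum[of x UNIV "\<lambda>x. \<Sum>z\<in>UNIV. ?I x z"]) (use nn in \<open>auto intro!: sum_nonneg\<close>)
    finally show ?thesis using j by (simp add: field_simps)
  qed
  finally show ?thesis .
qed

lemma llt_err_nonneg: "llt_err L j \<ge> 0"
  unfolding llt_err_def by (intro sum_nonneg mult_nonneg_nonneg integral_nonneg_AE) auto

end

lemma integrable_mult_bounded:
  fixes F h :: "real \<Rightarrow> real"
  assumes F: "integrable lborel F" and [measurable]: "h \<in> borel_measurable borel" and K: "\<And>r. \<bar>h r\<bar> \<le> K"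
  shows "integrable lborel (\<lambda>r. F r * h r)"
proof (rule Bochner_Integration.integrable_bound)
  show "integrable lborel (\<lambda>r. K * F r)" using F by simp
  have [measurable]: "F \<in> borel_measurable borel" using F by (simp add: borel_measurable_integrable measurable_lborel1[symmetric] del: measurable_lborel1)
  show "(\<lambda>r. F r * h r) \<in> borel_measurable lborel" by measurable
  show "AE r in lborel. norm (F r * h r) \<le> norm (K * F r)"
  proof (rule AE_I2)
    fix r
    have "\<bar>h r\<bar> * \<bar>F r\<bar> \<le> \<bar>K\<bar> * \<bar>F r\<bar>" using K[of r] by (intro mult_right_mono) auto
    then show "norm (F r * h r) \<le> norm (K * F r)" by (simp add: abs_mult mult.commute)
  qed
qed

lemma integrable_reflect_shift:
  fixes F :: "real \<Rightarrow> real"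
  assumes "integrable lborel F" shows "integrable lborel (\<lambda>u. F (y - u))"
  using lborel_integrable_real_affine[OF assms, of "-1" y] by simp

lemma integral_reflect_shift:
  fixes F :: "real \<Rightarrow> real"
  shows "(\<integral>u. F (y - u) \<partial>lborel) = (\<integral>r. F r \<partial>lborel)"
  using lborel_integral_real_affine[of "-1" F y] by simp

context markov_walk
begin

section \<open>Smoothing, windows and the local limit theorem\<close>

definition totI :: "('a \<Rightarrow> real \<Rightarrow> real) \<Rightarrow> real" where
  "totI F = (\<Sum>z\<in>UNIV. \<integral>r. F z r \<partial>lborel)"
text \<open>The prediction of the local limit theorem for \<open>(T ^^ j) F x w\<close>: final state
  in equilibrium, displacement Gaussian, no dependence on x.\<close>

definition "Gs j F w = (\<Sum>z\<in>UNIV. \<nu> z * (\<integral>r. F z r * gk j (w - r) \<partial>lborel))"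
definition "smooth L F x y = (\<integral>r. F x r * fejer L (y - r) \<partial>lborel)"

lemma fejer_shift_integrable:
  assumes "L > 0" "integrable lborel (F :: real \<Rightarrow> real)"
  shows "integrable lborel (\<lambda>r. F r * fejer L (y - r))"
  by (rule integrable_mult_bounded[OF assms(2), where K = "\<integral>t. tri L t \<partial>lborel"]) (use fejer_bound[OF assms(1)] in auto)

lemma smooth_alt: "smooth L F x y = (\<integral>u. F x (y - u) * fejer L u \<partial>lborel)"
  unfolding smooth_def using integral_reflect_shift[of "\<lambda>r. F x r * fejer L (y - r)" y] by simp

lemma gk_shift_integrable:
  assumes "j \<ge> 1" "integrable lborel (F :: real \<Rightarrow> real)"
  shows "integrable lborel (\<lambda>r. F r * gk j (w - r))"
  by (rule integrable_mult_bounded[OF assms(2), where K = "gC0 / sqrt (real j)"]) (use gk_bound[OF assms(1)] in auto)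

lemma T_smooth:
  assumes L: "L > 0" and F: "\<And>z. integrable lborel (F z)"
  shows "(T ^^ j) (smooth L F) x w = (\<Sum>z\<in>UNIV. \<integral>r. F z r * Gam L j x z (w - r) \<partial>lborel)"
proof -
  let ?k = "\<lambda>z r x y. F z r * (if x = z then fejer L (y - r) else 0)"
  have int: "integrable lborel (\<lambda>r. ?k z r x y)" for z x y
    using fejer_shift_integrable[OF L F, of x y] by (cases "x = z") auto
  have "smooth L F = (\<lambda>x y. \<Sum>z\<in>UNIV. \<integral>r. ?k z r x y \<partial>lborel)"
  proof (intro ext)
    fix x y
    have "(\<Sum>z\<in>UNIV. \<integral>r. ?k z r x y \<partial>lborel) = (\<Sum>z\<in>UNIV. if x = z then \<integral>r. F z r * fejer L (y - r) \<partial>lborel else 0)"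
      by (intro sum.cong) auto
    then show "smooth L F x y = (\<Sum>z\<in>UNIV. \<integral>r. ?k z r x y \<partial>lborel)" by (simp add: smooth_def)
  qed
  then have "(T ^^ j) (smooth L F) x w = (\<Sum>z\<in>UNIV. \<integral>r. (T ^^ j) (?k z r) x w \<partial>lborel)"
    by (simp only: free_step_def walk_step_pow_sum walk_step_pow_integral(2)[OF int])
  also have "\<dots> = (\<Sum>z\<in>UNIV. \<integral>r. F z r * Gam L j x z (w - r) \<partial>lborel)"
    unfolding free_step_def walk_step_pow_scale unfolding free_step_def[symmetric] T_fejer[OF L] ..
  finally show ?thesis .
qed

lemma T_smooth_approx:
  assumes L: "L > 0" and j: "j \<ge> 1" and F: "\<And>z. integrable lborel (F z)" and F0: "\<And>z r. F z r \<ge> 0"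
  shows "\<bar>(T ^^ j) (smooth L F) x w - Gs j F w\<bar> \<le> llt_err L j / sqrt (real j) * totI F"
proof -
  let ?e = "llt_err L j / sqrt (real j)"
  have ga: "\<bar>Gam L j x z a\<bar> \<le> ?e + gC0 / sqrt (real j)" for z a
  proof -
    have "\<bar>\<nu> z * gk j a\<bar> \<le> 1 * (gC0 / sqrt (real j))"
      unfolding abs_mult using nu_le_1[of z] nu_nonneg[of z] by (intro mult_mono gk_bound j) auto
    then show ?thesis using Gam_approx[OF L j, of x z a] by linarith
  qed
  have iG: "integrable lborel (\<lambda>r. F z r * Gam L j x z (w - r))" for z
    by (rule integrable_mult_bounded[OF F, where K = "?e + gC0 / sqrt (real j)"]) (use ga in auto)
  have iD: "integrable lborel (\<lambda>r. F z r * (Gam L j x z (w - r) - \<nu> z * gk j (w - r)))" for z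
    by (rule integrable_mult_bounded[OF F, where K = ?e]) (use Gam_approx[OF L j] in auto)
  have "(T ^^ j) (smooth L F) x w - Gs j F w = (\<Sum>z\<in>UNIV. \<integral>r. F z r * (Gam L j x z (w - r) - \<nu> z * gk j (w - r)) \<partial>lborel)"
    unfolding T_smooth[OF L F] Gs_def sum_subtractf[symmetric]
  proof (intro sum.cong refl)
    fix z
    have "(\<integral>r. F z r * (Gam L j x z (w - r) - \<nu> z * gk j (w - r)) \<partial>lborel) = (\<integral>r. F z r * Gam L j x z (w - r) - \<nu> z * (F z r * gk j (w - r)) \<partial>lborel)"
      by (intro Bochner_Integration.integral_cong) (auto simp: algebra_simps)
    also have "\<dots> = (\<integral>r. F z r * Gam L j x z (w - r) \<partial>lborel) - \<nu> z * (\<integral>r. F z r * gk j (w - r) \<partial>lborel)"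
      using iG[of z] gk_shift_integrable[OF j F, of z w] by simp
    finally show "(\<integral>r. F z r * Gam L j x z (w - r) \<partial>lborel) - \<nu> z * (\<integral>r. F z r * gk j (w - r) \<partial>lborel) = (\<integral>r. F z r * (Gam L j x z (w - r) - \<nu> z * gk j (w - r)) \<partial>lborel)" ..
  qed
  also have "\<bar>\<dots>\<bar> \<le> (\<Sum>z\<in>UNIV. ?e * (\<integral>r. F z r \<partial>lborel))"
  proof (rule order_trans[OF sum_abs], rule sum_mono)
    fix z
    have "\<bar>\<integral>r. F z r * (Gam L j x z (w - r) - \<nu> z * gk j (w - r)) \<partial>lborel\<bar> \<le> (\<integral>r. \<bar>F z r * (Gam L j x z (w - r) - \<nu> z * gk j (w - r))\<bar> \<partial>lborel)"
      by (rule integral_abs_bound)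
    also have "\<dots> \<le> (\<integral>r. ?e * F z r \<partial>lborel)"
    proof (rule integral_mono[OF integrable_abs[OF iD]])
      show "\<bar>F z r * (Gam L j x z (w - r) - \<nu> z * gk j (w - r))\<bar> \<le> ?e * F z r" for r
        unfolding abs_mult using mult_right_mono[OF Gam_approx[OF L j, of x z "w - r"] F0[of z r]] F0[of z r] by (simp add: mult.commute)
    qed (use F in simp)
    finally show "\<bar>\<integral>r. F z r * (Gam L j x z (w - r) - \<nu> z * gk j (w - r)) \<partial>lborel\<bar> \<le> ?e * (\<integral>r. F z r \<partial>lborel)" by simp
  qed
  also have "\<dots> = ?e * totI F" unfolding totI_def by (rule sum_distrib_left[symmetric])
  finally show ?thesis .
qed

lemma Gs_mono_diff:
  assumes j: "j \<ge> 1" and F: "\<And>z. integrable lborel (F z)" and F': "\<And>z. integrable lborel (F' z)" and le: "\<And>z r. F z r \<le> F' z r"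
  shows "\<bar>Gs j F' w - Gs j F w\<bar> \<le> gC0 / sqrt (real j) * (totI F' - totI F)"
proof -
  let ?c = "gC0 / sqrt (real j)"
  have iD: "integrable lborel (\<lambda>r. F' z r - F z r)" for z using F F' by simp
  have "Gs j F' w - Gs j F w = (\<Sum>z\<in>UNIV. \<nu> z * (\<integral>r. (F' z r - F z r) * gk j (w - r) \<partial>lborel))"
    unfolding Gs_def sum_subtractf[symmetric]
    using gk_shift_integrable[OF j F, of _ w] gk_shift_integrable[OF j F', of _ w]
    by (intro sum.cong refl) (simp add: left_diff_distrib right_diff_distrib)
  also have "\<bar>\<dots>\<bar> \<le> (\<Sum>z\<in>UNIV. ?c * (\<integral>r. F' z r - F z r \<partial>lborel))"
  proof (rule order_trans[OF sum_abs], rule sum_mono)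
    fix z
    have "\<bar>\<integral>r. (F' z r - F z r) * gk j (w - r) \<partial>lborel\<bar> \<le> (\<integral>r. \<bar>(F' z r - F z r) * gk j (w - r)\<bar> \<partial>lborel)"
      by (rule integral_abs_bound)
    also have "\<dots> \<le> (\<integral>r. ?c * (F' z r - F z r) \<partial>lborel)"
    proof (rule integral_mono[OF integrable_abs[OF gk_shift_integrable[OF j iD]]])
      fix r
      have "0 \<le> F' z r - F z r" using le[of z r] by simp
      then show "\<bar>(F' z r - F z r) * gk j (w - r)\<bar> \<le> ?c * (F' z r - F z r)"
        unfolding abs_mult using mult_right_mono[OF gk_bound[OF j, of "w - r"], of "F' z r - F z r"] by (simp add: mult.commute)
    qed (use iD in simp)
    also have "\<dots> = ?c * (\<integral>r. F' z r - F z r \<partial>lborel)" by (rule integral_mult_right_zero)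
    finally have 1: "\<bar>\<integral>r. (F' z r - F z r) * gk j (w - r) \<partial>lborel\<bar> \<le> ?c * (\<integral>r. F' z r - F z r \<partial>lborel)" .
    have "\<bar>\<nu> z * (\<integral>r. (F' z r - F z r) * gk j (w - r) \<partial>lborel)\<bar> \<le> 1 * \<bar>\<integral>r. (F' z r - F z r) * gk j (w - r) \<partial>lborel\<bar>"
      unfolding abs_mult using nu_le_1[of z] nu_nonneg[of z] by (intro mult_right_mono) auto
    with 1 show "\<bar>\<nu> z * (\<integral>r. (F' z r - F z r) * gk j (w - r) \<partial>lborel)\<bar> \<le> ?c * (\<integral>r. F' z r - F z r \<partial>lborel)" by linarith
  qed
  also have "\<dots> = ?c * (totI F' - totI F)"
    unfolding totI_def sum_subtractf[symmetric] sum_distrib_left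
    by (intro sum.cong refl) (simp add: F F')
  finally show ?thesis .
qed

text \<open>\<open>G\<close> stays between \<open>Gm\<close> and \<open>Gp\<close> even if their
  arguments are displaced by up to \<eta>. This is what allows values of \<open>G\<close> to be
  compared with averages over a kernel concentrated within \<eta>.\<close>

definition windowed :: "real \<Rightarrow> ('a \<Rightarrow> real \<Rightarrow> real) \<Rightarrow> ('a \<Rightarrow> real \<Rightarrow> real) \<Rightarrow> ('a \<Rightarrow> real \<Rightarrow> real) \<Rightarrow> bool" where
  "windowed \<eta> Gm G Gp \<longleftrightarrow> (\<forall>z. integrable lborel (Gm z) \<and> integrable lborel (G z) \<and> integrable lborel (Gp z)) \<and>
  (\<forall>z r. 0 \<le> Gm z r) \<and>
  (\<forall>z r u. \<bar>u\<bar> \<le> \<eta> \<longrightarrow> Gm z (r + u) \<le> G z r \<and> G z r \<le> Gp z (r + u))"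

lemma T_shift: "(T ^^ j) (\<lambda>x y. g x (y - u)) x w = (T ^^ j) g x (w - u)"
proof (induction j arbitrary: x w)
  case (Suc j)
  show ?case unfolding free_pow_Suc Suc.IH by (intro sum.cong refl) (simp add: algebra_simps)
qed simp

lemma T_mono: "(\<And>x y. g x y \<le> h x y) \<Longrightarrow> (T ^^ j) g x w \<le> (T ^^ j) h x w"
  unfolding free_step_def by (rule walk_step_pow_mono) (auto simp: P_nonneg)

lemma T_nonneg: "(\<And>x y. g x y \<ge> 0) \<Longrightarrow> (T ^^ j) g x w \<ge> 0"
  unfolding free_step_def by (rule walk_step_pow_nonneg) (auto simp: P_nonneg)

text \<open>The kernel has mass at least 1 - \<eta> within \<eta>, so (1 - \<eta>) G lies below the
  smoothed \<open>Gp\<close>, which gives the upper estimate. The smoothed \<open>Gm\<close> lies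
  below G plus the part of the average taken outside the window, which gives the lower one. Smoothed
  functions are handled by \<open>T_smooth_approx\<close>. The null sequence depends on \<eta> alone
  and serves all windowed functions at once.\<close>

theorem llt:
  assumes \<eta>: "0 < \<eta>" "\<eta> \<le> 1/2"
  shows "\<exists>\<epsilon>::nat \<Rightarrow> real. \<epsilon> \<longlonglongrightarrow> 0 \<and> (\<forall>j. 0 \<le> \<epsilon> j) \<and> (\<forall>Gm G Gp j x w. windowed \<eta> Gm G Gp \<longrightarrow> j \<ge> 1 \<longrightarrow>
    (T ^^ j) G x w \<le> (2 * gC0 + \<epsilon> j) * totI Gp / sqrt (real j) \<and>
    \<bar>(T ^^ j) G x w - Gs j G w\<bar> \<le> (gC0 * (totI Gp - totI Gm) + (2 * gC0 * \<eta> + \<epsilon> j) * totI Gp) / sqrt (real j))"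
proof -
  obtain L where L: "L > 0" and conc: "(\<integral>u. indicator {-\<eta>..\<eta>} u * fejer L u \<partial>lborel) \<ge> 1 - \<eta>"
    using fejer_concentrates[OF \<eta>(1)] by blast
  let ?i = "indicator {-\<eta>..\<eta>} :: real \<Rightarrow> real"
  have main: "(T ^^ j) G x w \<le> (2 * gC0 + 2 * llt_err L j) * totI Gp / sqrt (real j) \<and>
    \<bar>(T ^^ j) G x w - Gs j G w\<bar> \<le> (gC0 * (totI Gp - totI Gm) + (2 * gC0 * \<eta> + 2 * llt_err L j) * totI Gp) / sqrt (real j)"
    if W: "windowed \<eta> Gm G Gp" and j: "j \<ge> 1" for Gm G Gp j x w
  proof -
    have im: "integrable lborel (Gm z)" and iG: "integrable lborel (G z)" and ip: "integrable lborel (Gp z)" for z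
      using W by (auto simp: windowed_def)
    have m0: "0 \<le> Gm z r" for z r using W by (simp add: windowed_def)
    have wm: "Gm z (r + u) \<le> G z r" and wp: "G z r \<le> Gp z (r + u)" if "\<bar>u\<bar> \<le> \<eta>" for z r u
      using W that by (auto simp: windowed_def)
    have le_m: "Gm z r \<le> G z r" and le_p: "G z r \<le> Gp z r" for z r
      using wm[of 0 z r] wp[of 0 z r] \<eta> by auto
    have G0: "0 \<le> G z r" for z r using m0[of z r] le_m[of z r] by linarith
    have p0: "0 \<le> Gp z r" for z r using G0[of z r] le_p[of z r] by linarith
    define S where "S = sqrt (real j)"
    define e where "e = llt_err L j"
    define I where "I = totI Gp"
    have S: "S > 0" using j by (simp add: S_def)
    have e0: "e \<ge> 0" by (simp add: e_def llt_err_nonneg)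
    have tot_mono: "totI F \<le> totI F'" if "\<And>z. integrable lborel (F z)" "\<And>z. integrable lborel (F' z)" "\<And>z r. F z r \<le> F' z r" for F F'
      unfolding totI_def by (rule sum_mono, rule integral_mono) (use that in auto)
    have I0: "I \<ge> 0" unfolding I_def totI_def by (intro sum_nonneg integral_nonneg_AE) (auto simp: p0)
    have ImG: "totI Gm \<le> totI G" "totI G \<le> I" unfolding I_def by (auto intro!: tot_mono im iG ip le_m le_p)
    have fi: "integrable lborel (\<lambda>u. ?i u * fejer L u)"
      using integrable_mult_bounded[OF fejer_integrable[OF L], of ?i 1] by (simp add: mult.commute indicator_def)
    have up: "(1 - \<eta>) * G x y \<le> smooth L Gp x y" for x y
    proof -
      have "(1 - \<eta>) * G x y \<le> (\<integral>u. ?i u * fejer L u \<partial>lborel) * G x y"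
        using conc G0 by (intro mult_right_mono) auto
      also have "\<dots> = (\<integral>u. ?i u * fejer L u * G x y \<partial>lborel)" by simp
      also have "\<dots> \<le> (\<integral>u. Gp x (y - u) * fejer L u \<partial>lborel)"
      proof (rule integral_mono)
        show "integrable lborel (\<lambda>u. ?i u * fejer L u * G x y)" using fi by simp
        show "integrable lborel (\<lambda>u. Gp x (y - u) * fejer L u)"
          by (rule integrable_mult_bounded[OF integrable_reflect_shift[OF ip], where K = "\<integral>t. tri L t \<partial>lborel"]) (use fejer_bound[OF L] in auto)
        fix u
        show "?i u * fejer L u * G x y \<le> Gp x (y - u) * fejer L u"
        proof (cases "u \<in> {-\<eta>..\<eta>}")
          case True
          then have "G x y \<le> Gp x (y + - u)" by (intro wp) auto
          then have "fejer L u * G x y \<le> fejer L u * Gp x (y - u)" using fejer_nonneg[OF L] by (intro mult_left_mono) auto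
          then show ?thesis using True by (simp add: mult.commute)
        next
          case False
          then show ?thesis using fejer_nonneg[OF L] p0 by simp
        qed
      qed
      finally show ?thesis by (simp add: smooth_alt)
    qed
    have A1: "(1 - \<eta>) * (T ^^ j) G x w \<le> Gs j Gp w + e / S * I" for x w
    proof -
      have "(1 - \<eta>) * (T ^^ j) G x w = (T ^^ j) (\<lambda>x y. (1 - \<eta>) * G x y) x w"
        unfolding free_step_def walk_step_pow_scale ..
      also have "\<dots> \<le> (T ^^ j) (smooth L Gp) x w" by (rule T_mono) (rule up)
      also have "\<dots> \<le> Gs j Gp w + e / S * I"
        using T_smooth_approx[where F = Gp and x = x and w = w, OF L j ip p0] by (simp add: e_def S_def I_def abs_le_iff)
      finally show ?thesis .
    qed
    have Gsp: "Gs j Gp w \<le> gC0 / S * I" for w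
    proof -
      have z: "integrable lborel (\<lambda>r. 0 :: real)" by simp
      have "\<bar>Gs j Gp w - Gs j (\<lambda>z r. 0) w\<bar> \<le> gC0 / S * (I - totI (\<lambda>z r. 0))"
        unfolding S_def I_def by (rule Gs_mono_diff[where F = "\<lambda>z r. 0" and F' = Gp, OF j z ip p0])
      then show ?thesis by (simp add: Gs_def totI_def)
    qed
    have TG0: "(T ^^ j) G x w \<ge> 0" for x w by (rule T_nonneg) (rule G0)
    \<comment> \<open>A bound uniform in state and level, from the upper estimate and 1 - \<eta>
      \<ge> 1/2. It controls both the missing fraction \<eta> of G and the tail of the
      kernel.\<close>
    define B where "B = 2 * (gC0 + e) * I / S"
    have B: "(T ^^ j) G x w \<le> B" for x w
    proof -
      have "1/2 * (T ^^ j) G x w \<le> (1 - \<eta>) * (T ^^ j) G x w" using \<eta> TG0 by (intro mult_right_mono) auto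
      also have "\<dots> \<le> gC0 / S * I + e / S * I" using A1[of x w] Gsp[of w] by linarith
      also have "\<dots> = B / 2" by (simp add: B_def add_divide_distrib distrib_right)
      finally show ?thesis by simp
    qed
    have B0: "0 \<le> B" using B[of x w] TG0[of x w] by linarith
    have \<eta>B: "\<eta> * B \<le> (2 * gC0 * \<eta> * I + e * I) / S"
    proof -
      have "\<eta> * B = (2 * gC0 * \<eta> * I + (2 * \<eta>) * (e * I)) / S" by (simp add: B_def field_simps)
      also have "\<dots> \<le> (2 * gC0 * \<eta> * I + 1 * (e * I)) / S"
        using \<eta> e0 I0 S by (intro divide_right_mono add_left_mono mult_right_mono) auto
      finally show ?thesis by simp
    qed
    have d1: "\<bar>Gs j Gp w - Gs j G w\<bar> \<le> gC0 / S * (I - totI G)"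
      unfolding S_def I_def by (rule Gs_mono_diff[OF j iG ip le_p])
    have d2: "\<bar>Gs j G w - Gs j Gm w\<bar> \<le> gC0 / S * (totI G - totI Gm)"
      unfolding S_def by (rule Gs_mono_diff[OF j im iG le_m])
    have c0: "gC0 / S \<ge> 0" using gC0_nonneg S by simp
    have d1': "gC0 / S * (I - totI G) \<le> gC0 / S * (I - totI Gm)" using ImG by (intro mult_left_mono c0) simp
    have d2': "gC0 / S * (totI G - totI Gm) \<le> gC0 / S * (I - totI Gm)" using ImG by (intro mult_left_mono c0) simp
    have upper: "(T ^^ j) G x w \<le> Gs j G w + gC0 / S * (I - totI Gm) + e / S * I + \<eta> * B"
    proof -
      have "(T ^^ j) G x w = (1 - \<eta>) * (T ^^ j) G x w + \<eta> * (T ^^ j) G x w" by (simp add: left_diff_distrib)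
      also have "\<eta> * (T ^^ j) G x w \<le> \<eta> * B" using B \<eta> by (intro mult_left_mono) auto
      finally have "(T ^^ j) G x w \<le> (1 - \<eta>) * (T ^^ j) G x w + \<eta> * B" by simp
      then show ?thesis using A1[of x w] d1 d1' by linarith
    qed
    let ?tl = "\<lambda>u x y. Gm x (y - u) * ((1 - ?i u) * fejer L u)"
    have [measurable]: "(\<lambda>u. (1 - ?i u) * fejer L u) \<in> borel_measurable borel" by measurable
    have fb: "\<bar>(1 - ?i u) * fejer L u\<bar> \<le> (\<integral>t. tri L t \<partial>lborel)" for u
      using fejer_bound[OF L, of u] fejer_nonneg[OF L, of u] by (auto simp: indicator_def)
    have tint: "integrable lborel (\<lambda>u. ?tl u x y)" for x y
      by (rule integrable_mult_bounded[OF integrable_reflect_shift[OF im] _ fb]) measurable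
    have low: "smooth L Gm x y \<le> G x y + (\<integral>u. ?tl u x y \<partial>lborel)" for x y
    proof -
      have "smooth L Gm x y \<le> (\<integral>u. ?i u * fejer L u * G x y + ?tl u x y \<partial>lborel)"
        unfolding smooth_alt
      proof (rule integral_mono)
        show "integrable lborel (\<lambda>u. Gm x (y - u) * fejer L u)"
          by (rule integrable_mult_bounded[OF integrable_reflect_shift[OF im], where K = "\<integral>t. tri L t \<partial>lborel"]) (use fejer_bound[OF L] in auto)
        show "integrable lborel (\<lambda>u. ?i u * fejer L u * G x y + ?tl u x y)"
          using fi by (intro Bochner_Integration.integrable_add tint) simp
        fix u
        show "Gm x (y - u) * fejer L u \<le> ?i u * fejer L u * G x y + ?tl u x y"
        proof (cases "u \<in> {-\<eta>..\<eta>}")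
          case True
          then have "Gm x (y + - u) \<le> G x y" by (intro wm) auto
          then have "fejer L u * Gm x (y - u) \<le> fejer L u * G x y" using fejer_nonneg[OF L] by (intro mult_left_mono) auto
          then show ?thesis using True by (simp add: mult.commute)
        qed simp
      qed
      also have "\<dots> = (\<integral>u. ?i u * fejer L u \<partial>lborel) * G x y + (\<integral>u. ?tl u x y \<partial>lborel)"
        using fi tint by simp
      also have "(\<integral>u. ?i u * fejer L u \<partial>lborel) * G x y \<le> 1 * G x y"
      proof (rule mult_right_mono[OF _ G0])
        have "(\<integral>u. ?i u * fejer L u \<partial>lborel) \<le> (\<integral>u. fejer L u \<partial>lborel)"
          by (rule integral_mono[OF fi fejer_integrable[OF L]]) (auto simp: indicator_def fejer_nonneg[OF L])
        then show "(\<integral>u. ?i u * fejer L u \<partial>lborel) \<le> 1" by (simp add: fejer_total[OF L])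
      qed
      finally show ?thesis by simp
    qed
    \<comment> \<open>The free walk commutes with translations, so the tail is an average of
      \<open>(T ^^ j) Gm\<close> at displaced levels. Each value is at most B, and the kernel has
      mass at most \<eta> outside the window.\<close>
    have Ttail: "(T ^^ j) (\<lambda>x y. \<integral>u. ?tl u x y \<partial>lborel) x w \<le> \<eta> * B"
    proof -
      have eq: "(T ^^ j) (?tl u) x w = (1 - ?i u) * fejer L u * (T ^^ j) Gm x (w - u)" for u
      proof -
        have "(T ^^ j) (?tl u) x w = (T ^^ j) (\<lambda>x y. ((1 - ?i u) * fejer L u) * Gm x (y - u)) x w" by (simp only: mult.commute)
        also have "\<dots> = ((1 - ?i u) * fejer L u) * (T ^^ j) (\<lambda>x y. Gm x (y - u)) x w" unfolding free_step_def walk_step_pow_scale ..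
        finally show ?thesis unfolding T_shift .
      qed
      have "integrable lborel (\<lambda>u. (T ^^ j) (?tl u) x w)" unfolding free_step_def by (rule walk_step_pow_integral(1)[OF tint])
      then have int: "integrable lborel (\<lambda>u. (1 - ?i u) * fejer L u * (T ^^ j) Gm x (w - u))" unfolding eq .
      have ci: "integrable lborel (\<lambda>u. fejer L u - ?i u * fejer L u)" using fi fejer_integrable[OF L] by simp
      then have ci': "integrable lborel (\<lambda>u. (fejer L u - ?i u * fejer L u) * B)" by simp
      have "(T ^^ j) (\<lambda>x y. \<integral>u. ?tl u x y \<partial>lborel) x w = (\<integral>u. (T ^^ j) (?tl u) x w \<partial>lborel)"
        unfolding free_step_def by (rule walk_step_pow_integral(2)[OF tint])
      also have "\<dots> = (\<integral>u. (1 - ?i u) * fejer L u * (T ^^ j) Gm x (w - u) \<partial>lborel)" unfolding eq ..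
      also have "\<dots> \<le> (\<integral>u. (fejer L u - ?i u * fejer L u) * B \<partial>lborel)"
      proof (rule integral_mono[OF int ci'])
        fix u
        have "(T ^^ j) Gm x (w - u) \<le> (T ^^ j) G x (w - u)" by (rule T_mono) (rule le_m)
        also have "\<dots> \<le> B" by (rule B)
        finally have "(1 - ?i u) * fejer L u * (T ^^ j) Gm x (w - u) \<le> (1 - ?i u) * fejer L u * B"
          by (rule mult_left_mono) (auto simp: fejer_nonneg[OF L] indicator_def)
        then show "(1 - ?i u) * fejer L u * (T ^^ j) Gm x (w - u) \<le> (fejer L u - ?i u * fejer L u) * B" by (simp add: left_diff_distrib)
      qed
      also have "\<dots> = (1 - (\<integral>u. ?i u * fejer L u \<partial>lborel)) * B"
        using fi fejer_integrable[OF L] by (simp add: fejer_total[OF L])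
      also have "\<dots> \<le> \<eta> * B" using conc B0 by (intro mult_right_mono) auto
      finally show ?thesis .
    qed
    have lower: "(T ^^ j) G x w \<ge> Gs j G w - gC0 / S * (I - totI Gm) - e / S * I - \<eta> * B"
    proof -
      have "(T ^^ j) (smooth L Gm) x w \<le> (T ^^ j) (\<lambda>x y. G x y + (\<integral>u. ?tl u x y \<partial>lborel)) x w" by (rule T_mono) (rule low)
      also have "\<dots> = (T ^^ j) G x w + (T ^^ j) (\<lambda>x y. \<integral>u. ?tl u x y \<partial>lborel) x w"
        unfolding free_step_def by (rule walk_step_pow_add)
      finally have 1: "(T ^^ j) (smooth L Gm) x w \<le> (T ^^ j) G x w + \<eta> * B" using Ttail by linarith
      have 2: "\<bar>(T ^^ j) (smooth L Gm) x w - Gs j Gm w\<bar> \<le> e / S * totI Gm"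
        unfolding e_def S_def by (rule T_smooth_approx[OF L j im m0])
      have "e / S * totI Gm \<le> e / S * I" using ImG e0 S by (intro mult_left_mono) auto
      with 1 2 d2 d2' show ?thesis by linarith
    qed
    have "\<bar>(T ^^ j) G x w - Gs j G w\<bar> \<le> gC0 / S * (I - totI Gm) + e / S * I + (2 * gC0 * \<eta> * I + e * I) / S"
    proof -
      have "\<bar>a - g\<bar> \<le> p + q + u" if "a \<le> g + p + q + b" "g - p - q - b \<le> a" "b \<le> u" for a g p q b u :: real
        using that by linarith
      from this[OF upper lower \<eta>B] show ?thesis .
    qed
    also have "\<dots> = (gC0 * (I - totI Gm) + (2 * gC0 * \<eta> + 2 * e) * I) / S"
      using S by (simp add: field_simps)
    finally have "\<bar>(T ^^ j) G x w - Gs j G w\<bar> \<le> (gC0 * (I - totI Gm) + (2 * gC0 * \<eta> + 2 * e) * I) / S" .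
    moreover have "(T ^^ j) G x w \<le> (2 * gC0 + 2 * e) * I / S" using B[of x w] by (simp add: B_def distrib_left)
    ultimately show ?thesis by (simp only: S_def e_def I_def)
  qed
  have "(\<lambda>j. 2 * llt_err L j) \<longlonglongrightarrow> 2 * 0" by (intro tendsto_intros llt_err_tendsto[OF L])
  then have "(\<lambda>j. 2 * llt_err L j) \<longlonglongrightarrow> 0" by simp
  then show ?thesis
    using main llt_err_nonneg by (intro exI[of _ "\<lambda>j. 2 * llt_err L j"] conjI allI impI) auto
qed

end

subsection \<open>Survival estimates\<close>

text \<open>Each term is at most the increment of 2 sqrt. The term k = 0 is a division by zero and
  hence zero.\<close>

lemma sum_inverse_sqrt_le: "(\<Sum>k<n. 1 / sqrt (real k)) \<le> 2 * sqrt (real n)"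
proof -
  have "(\<Sum>k\<le>n. 1 / sqrt (real k)) \<le> 2 * sqrt (real n)"
  proof (induction n)
    case (Suc n)
    let ?a = "sqrt (real n)" and ?b = "sqrt (real (Suc n))"
    have b: "?b > 0" "?a \<le> ?b" "?a \<ge> 0" by auto
    have "(?b - ?a) * (?b + ?a) = 1" by (simp add: algebra_simps)
    also have "\<dots> = (1 / ?b) * ?b" using b by simp
    finally have eq: "(?b - ?a) * (?b + ?a) = (1 / ?b) * ?b" .
    have "(?b - ?a) * (?b + ?a) \<le> (?b - ?a) * (2 * ?b)" using b by (intro mult_left_mono) auto
    then have "(1 / ?b) * ?b \<le> (2 * (?b - ?a)) * ?b" unfolding eq by (simp only: mult_ac)
    then have "1 / ?b \<le> 2 * (?b - ?a)" using b(1) by (rule mult_right_le_imp_le)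
    then show ?case using Suc by simp
  qed simp
  moreover have "(\<Sum>k<n. 1 / sqrt (real k)) \<le> (\<Sum>k\<le>n. 1 / sqrt (real k))" by (intro sum_mono2) auto
  ultimately show ?thesis by linarith
qed

lemma walk_step_pow_tendsto:
  assumes "\<And>x y. ((\<lambda>n. h n x y) \<longlongrightarrow> h' x y) F"
  shows "((\<lambda>n. (walk_step c f ^^ k) (h n) x y) \<longlongrightarrow> (walk_step c f ^^ k) h' x y) F"
proof (induction k arbitrary: x y)
  case (Suc k)
  show ?case unfolding walk_step_pow_Suc by (intro tendsto_intros Suc)
qed (simp add: assms)

text \<open>The start may lie at a nonpositive level, down to -b, while all later levels of the
  killed walk are positive.\<close>

lemma killed_pow_mono_from:
  assumes P: "\<And>x y. P x y \<ge> 0" and gh: "\<And>x y. y \<ge> - b \<Longrightarrow> g x y \<le> h x y" and "b \<ge> 0" "y \<ge> - b"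
  shows "(killed_step P f ^^ n) g x y \<le> (killed_step P f ^^ n) h x y"
  using assms(4)
proof (induction n arbitrary: x y)
  case (Suc n)
  show ?case unfolding killed_pow_Suc using \<open>b \<ge> 0\<close> by (intro sum_mono) (auto simp: Suc.IH P intro!: mult_left_mono)
qed (simp add: gh)

text \<open>Variation of constants: l plays the part of an eigenvalue, and the defect of g at time k
  is propagated by l over the remaining steps.\<close>

lemma killed_pow_telescope:
  "(killed_step P f ^^ n) g x y = l ^ n * g x y + (\<Sum>k<n. l ^ (n - Suc k) * (killed_step P f ^^ k) (\<lambda>x y. killed_step P f g x y - l * g x y) x y)"
proof (induction n)
  case (Suc n)
  let ?r = "\<lambda>x y. killed_step P f g x y - l * g x y"
  have "(killed_step P f ^^ Suc n) g x y = (killed_step P f ^^ n) (killed_step P f g) x y" by (simp add: funpow_swap1)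
  also have "killed_step P f g = (\<lambda>x y. l * g x y + 1 * ?r x y)" by (intro ext) simp
  also have "(killed_step P f ^^ n) (\<lambda>x y. l * g x y + 1 * ?r x y) x y = l * (killed_step P f ^^ n) g x y + (killed_step P f ^^ n) ?r x y"
    unfolding killed_step_def walk_step_pow_linear by simp
  also have "\<dots> = l ^ Suc n * g x y + (\<Sum>k<n. l * (l ^ (n - Suc k) * (killed_step P f ^^ k) ?r x y)) + (killed_step P f ^^ n) ?r x y"
    unfolding Suc.IH by (simp add: distrib_left sum_distrib_left)
  also have "(\<Sum>k<n. l * (l ^ (n - Suc k) * (killed_step P f ^^ k) ?r x y)) = (\<Sum>k<n. l ^ (Suc n - Suc k) * (killed_step P f ^^ k) ?r x y)"
  proof (intro sum.cong refl)
    fix k assume "k \<in> {..<n}"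
    then have "Suc n - Suc k = Suc (n - Suc k)" by auto
    then show "l * (l ^ (n - Suc k) * (killed_step P f ^^ k) ?r x y) = l ^ (Suc n - Suc k) * (killed_step P f ^^ k) ?r x y" by simp
  qed
  finally show ?case by simp
qed simp

context markov_walk
begin

lemma T_one_step: "T g x y = (\<Sum>x'\<in>UNIV. P x x' * g x' (y + f x'))"
  by (simp add: free_step_def walk_step_def)

lemma Q_le_T:
  assumes "\<And>x y. g x y \<ge> 0" shows "(Q ^^ n) g x y \<le> (T ^^ n) g x y"
proof (induction n arbitrary: x y)
  case (Suc n)
  have "(Q ^^ n) g x y \<ge> 0" for x y unfolding killed_step_def by (rule walk_step_pow_nonneg) (auto simp: P_nonneg assms)
  show ?case unfolding killed_pow_Suc free_pow_Suc
  proof (intro sum_mono mult_left_mono P_nonneg)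
    fix x'
    have "0 \<le> (T ^^ n) g x' (y + f x')" by (rule T_nonneg) (rule assms)
    then show "(if 0 < y + f x' then (Q ^^ n) g x' (y + f x') else 0) \<le> (T ^^ n) g x' (y + f x')"
      using Suc.IH by simp
  qed
qed simp

lemma Q_mono: "(\<And>x y. g x y \<le> h x y) \<Longrightarrow> (Q ^^ n) g x y \<le> (Q ^^ n) h x y"
  unfolding killed_step_def by (rule walk_step_pow_mono) (auto simp: P_nonneg)

lemma Q_nonneg: "(\<And>x y. g x y \<ge> 0) \<Longrightarrow> (Q ^^ n) g x y \<ge> 0"
  unfolding killed_step_def by (rule walk_step_pow_nonneg) (auto simp: P_nonneg)

lemma Q_abs_le:
  assumes "\<And>x y. y > 0 \<Longrightarrow> \<bar>g x y\<bar> \<le> c * h x y" "n > 0 \<or> y > 0"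
  shows "\<bar>(Q ^^ n) g x y\<bar> \<le> c * (Q ^^ n) h x y"
proof -
  have "(Q ^^ n) g x y \<le> (Q ^^ n) (\<lambda>x y. c * h x y) x y"
    by (rule killed_pow_mono[OF P_nonneg _ assms(2)]) (use assms(1) in \<open>simp add: abs_le_iff\<close>)
  moreover have "(Q ^^ n) (\<lambda>x y. (- c) * h x y) x y \<le> (Q ^^ n) g x y"
  proof (rule killed_pow_mono[OF P_nonneg _ assms(2)])
    show "(- c) * h x y \<le> g x y" if "y > 0" for x y
      using assms(1)[OF that, of x] unfolding mult_minus_left by linarith
  qed
  ultimately show ?thesis unfolding killed_step_def walk_step_pow_scale by simp
qed

lemma surv_nonneg: "surv P f n x y \<ge> 0"
  unfolding surv_eq_killed by (rule Q_nonneg) simp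

lemma T_pow_const: "(T ^^ n) (\<lambda>x y. c) x y = c"
proof (induction n arbitrary: x y)
  case (Suc n)
  show ?case unfolding free_pow_Suc Suc.IH by (simp add: sum_distrib_right[symmetric] P_sum)
qed simp

lemma surv_le_1: "surv P f n x y \<le> 1"
  using Q_le_T[of "\<lambda>x y. 1" n x y] by (simp add: surv_eq_killed T_pow_const)

lemma Q_mono_level:
  assumes "\<And>x y y'. y \<le> y' \<Longrightarrow> g x y \<le> g x y'" "\<And>x y. 0 \<le> g x y" "y \<le> y'"
  shows "(Q ^^ n) g x y \<le> (Q ^^ n) g x y'"
  using assms(3)
proof (induction n arbitrary: x y y')
  case (Suc n)
  show ?case unfolding killed_pow_Suc using Suc.prems
    by (intro sum_mono mult_left_mono P_nonneg) (auto intro!: Suc.IH Q_nonneg assms(2))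
qed (simp add: assms)

lemma T_linear_martingale: "(\<Sum>x'\<in>UNIV. P x x' * ((y + f x') + corrA x' + K)) = y + corrA x + K"
proof -
  have "(\<Sum>x'\<in>UNIV. P x x' * ((y + f x') + corrA x' + K)) = (\<Sum>x'\<in>UNIV. P x x' * (corrB x' - corrA x) + P x x' * (y + corrA x + K))"
    by (intro sum.cong refl) (simp add: corrB_eq algebra_simps)
  also have "\<dots> = 0 + 1 * (y + corrA x + K)" unfolding sum.distrib drift_zero sum_distrib_right[symmetric] P_sum ..
  finally show ?thesis by simp
qed

lemma T_square_martingale: "(\<Sum>x'\<in>UNIV. P x x' * (((y + f x') + corrA x' + K)\<^sup>2 + corrD x')) = (y + corrA x + K)\<^sup>2 + corrD x + \<sigma>2"
proof -
  let ?Z = "y + corrA x + K"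
  have "(\<Sum>x'\<in>UNIV. P x x' * (((y + f x') + corrA x' + K)\<^sup>2 + corrD x')) =
    (\<Sum>x'\<in>UNIV. P x x' * ?Z\<^sup>2 + P x x' * (corrB x' - corrA x) * (2 * ?Z) + P x x' * (corrB x' - corrA x)\<^sup>2 + P x x' * corrD x')"
    by (intro sum.cong refl) (simp add: corrB_eq algebra_simps power2_eq_square)
  also have "\<dots> = 1 * ?Z\<^sup>2 + 0 * (2 * ?Z) + cvar x + (corrD x - cvar x + \<sigma>2)"
    unfolding sum.distrib drift_zero sum_distrib_right[symmetric] P_sum cond_variance corrD_eq ..
  finally show ?thesis by simp
qed

definition "aM = (\<Sum>x\<in>UNIV. \<bar>corrA x\<bar>)"
definition "dM = (\<Sum>x\<in>UNIV. \<bar>corrD x\<bar>)"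

lemma aM: "\<bar>corrA x\<bar> \<le> aM" "aM \<ge> 0" unfolding aM_def by (rule member_le_sum) (auto intro: sum_nonneg)
lemma dM: "\<bar>corrD x\<bar> \<le> dM" "dM \<ge> 0" unfolding dM_def by (rule member_le_sum) (auto intro: sum_nonneg)

text \<open>A supersolution of the survival recursion on \<open>0 < y \<le> R\<close>, built from the linear and the quadratic martingale.\<close>

lemma surv_supersolution:
  fixes R :: real and n :: nat
  assumes R: "R > 0" and n: "n \<ge> 1"
  defines "K \<equiv> aM + fM"
  defines "R' \<equiv> R + 2 * fM + 2 * aM"
  defines "Z \<equiv> (\<lambda>x y. y + corrA x + K)"
  defines "\<Psi> \<equiv> (\<lambda>x y. 2 * R' * Z x y - (Z x y)\<^sup>2 - corrD x + dM)"
  assumes "j \<le> n" "0 < y" "y \<le> R"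
  shows "surv P f j x y \<le> Z x y / R + \<Psi> x y / (\<sigma>2 * real n) + (1 - real j / real n)"
  using assms(7-9)
proof (induction j arbitrary: x y)
  have Zlo: "y + fM \<le> Z x y" for x y using aM(1)[of x] by (simp add: Z_def K_def abs_le_iff)
  have Zhi: "Z x y \<le> y + 2 * aM + fM" for x y using aM(1)[of x] by (simp add: Z_def K_def abs_le_iff)
  \<comment> \<open>The shift K makes Z nonnegative even after an overshoot of size fM, and R'
    bounds Z up to level R + fM. Hence 2 R' Z - Z^2 \<ge> R' Z \<ge> 0, and dM - corrD is
    nonnegative as well.\<close>
  have Psi0: "\<Psi> x y \<ge> 0" if "- fM \<le> y" "y \<le> R + fM" for x y
  proof -
    have "0 \<le> Z x y" "Z x y \<le> R'" using Zlo[of y x] Zhi[of x y] that by (auto simp: R'_def)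
    then have "0 \<le> Z x y * (R' - Z x y)" "0 \<le> R' * Z x y" using fM(2) aM(2) R by (auto simp: R'_def)
    then have "0 \<le> 2 * R' * Z x y - (Z x y)\<^sup>2" by (simp add: algebra_simps power2_eq_square)
    then show ?thesis using dM(1)[of x] by (simp add: \<Psi>_def abs_le_iff)
  qed
  have sn: "\<sigma>2 * real n > 0" using \<sigma>2_pos n by simp
  {
    case 0
    have "0 \<le> Z x y / R" using Zlo[of y x] fM(2) 0 R by simp
    moreover have "0 \<le> \<Psi> x y / (\<sigma>2 * real n)" using Psi0[of y x] 0 fM(2) sn by simp
    ultimately show ?case by simp
  next
    case (Suc j)
    let ?w = "\<lambda>x y. Z x y / R + \<Psi> x y / (\<sigma>2 * real n) + (1 - real j / real n)"
    have jn: "1 - real j / real n \<ge> 0" using Suc.prems(1) n by simp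
    have "surv P f (Suc j) x y \<le> (\<Sum>x'\<in>UNIV. P x x' * ?w x' (y + f x'))"
      unfolding surv.simps
    proof (intro sum_mono mult_left_mono P_nonneg)
      fix x'
      have y': "- fM \<le> y + f x'" "y + f x' \<le> R + fM" using fM(1)[of x'] Suc.prems by (auto simp: abs_le_iff)
      have z0: "0 \<le> Z x' (y + f x') / R" using Zlo[of "y + f x'" x'] y' R by simp
      have p0: "0 \<le> \<Psi> x' (y + f x') / (\<sigma>2 * real n)" using Psi0[OF y', of x'] sn by simp
      have big: "surv P f j x' (y + f x') \<le> ?w x' (y + f x')" if "R < y + f x'"
      proof -
        have "R \<le> Z x' (y + f x')" using Zlo[of "y + f x'" x'] fM(2) that by linarith
        then have "1 \<le> Z x' (y + f x') / R" using R by simp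
        then show ?thesis using p0 jn surv_le_1[of j x' "y + f x'"] by linarith
      qed
      show "(if 0 < y + f x' then surv P f j x' (y + f x') else 0) \<le> ?w x' (y + f x')"
      proof (cases "0 < y + f x'")
        case True
        show ?thesis
        proof (cases "y + f x' \<le> R")
          case le: True
          then show ?thesis using Suc.IH[of "y + f x'" x'] Suc.prems(1) True by simp
        next
          case False
          then show ?thesis using big True by simp
        qed
      next
        case False
        then show ?thesis using z0 p0 jn by simp
      qed
    qed
    \<comment> \<open>The linear part is a martingale, while \<Psi> loses \<open>\<sigma>2\<close>
      in expectation at each step. Divided by \<open>\<sigma>2 * real n\<close>, this loss is 1 / n
      and pays for the increase of j by one.\<close>
    also have "\<dots> = Z x y / R + (\<Psi> x y - \<sigma>2) / (\<sigma>2 * real n) + (1 - real j / real n)"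
    proof -
      define c1 where "c1 = 1 / R + 2 * R' / (\<sigma>2 * real n)"
      define c2 where "c2 = - 1 / (\<sigma>2 * real n)"
      define c3 where "c3 = dM / (\<sigma>2 * real n) + (1 - real j / real n)"
      have w: "?w x y = c1 * Z x y + c2 * ((Z x y)\<^sup>2 + corrD x) + c3" for x y
        unfolding \<Psi>_def c1_def c2_def c3_def by (simp add: add_divide_distrib diff_divide_distrib distrib_right)
      have "(\<Sum>x'\<in>UNIV. P x x' * ?w x' (y + f x')) = c1 * (\<Sum>x'\<in>UNIV. P x x' * Z x' (y + f x')) + c2 * (\<Sum>x'\<in>UNIV. P x x' * ((Z x' (y + f x'))\<^sup>2 + corrD x')) + c3 * (\<Sum>x'\<in>UNIV. P x x')"
        unfolding w by (simp add: distrib_left sum.distrib sum_distrib_left mult_ac)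
      also have "\<dots> = c1 * Z x y + c2 * ((Z x y)\<^sup>2 + corrD x + \<sigma>2) + c3"
        unfolding Z_def T_linear_martingale T_square_martingale P_sum by simp
      also have "\<dots> = ?w x y + c2 * \<sigma>2" unfolding w by (simp add: distrib_left)
      also have "c2 * \<sigma>2 = - \<sigma>2 / (\<sigma>2 * real n)" by (simp add: c2_def)
      finally show ?thesis by (simp add: diff_divide_distrib)
    qed
    also have "\<dots> = Z x y / R + \<Psi> x y / (\<sigma>2 * real n) + (1 - real (Suc j) / real n)"
      using \<sigma>2_pos n by (simp add: diff_divide_distrib add_divide_distrib)
    finally show ?case .
  }
qed

text \<open>The supersolution is used with R = sqrt n and j = n, where its last term vanishes and
  the others are of order (1 + y) / sqrt n. Beyond level sqrt n the bound is trivial, and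
  nonpositive starts are compared with the level max y 1.\<close>

lemma surv_bound: "\<exists>C\<ge>0. \<forall>n x y. surv P f n x y * sqrt (real n) \<le> C * (2 + \<bar>y\<bar>)"
proof -
  define c3 where "c3 = 1 + 2 * aM + fM"
  define C where "C = 1 + c3 + (2 * (1 + 2 * fM + 2 * aM) * c3 + 2 * dM) / \<sigma>2"
  have c3: "c3 \<ge> 1" using aM fM by (simp add: c3_def)
  have C1: "C \<ge> 1" using c3 aM(2) fM(2) dM(2) \<sigma>2_pos by (simp add: C_def)
  have pos: "surv P f n x y * sqrt (real n) \<le> C * (1 + y)" if n: "n \<ge> 1" and y: "y > 0" for n x y
  proof (cases "y \<le> sqrt (real n)")
    case False
    have "surv P f n x y * sqrt (real n) \<le> 1 * sqrt (real n)" by (intro mult_right_mono surv_le_1) simp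
    also have "\<dots> \<le> 1 * (1 + y)" using False by simp
    also have "\<dots> \<le> C * (1 + y)" using C1 y by (intro mult_right_mono) auto
    finally show ?thesis .
  next
    case True
    define r where "r = sqrt (real n)"
    have r: "r \<ge> 1" "r * r = real n" using n by (auto simp: r_def)
    define K where "K = aM + fM"
    define R' where "R' = r + 2 * fM + 2 * aM"
    define Z where "Z = y + corrA x + K"
    have "surv P f n x y \<le> Z / r + (2 * R' * Z - Z\<^sup>2 - corrD x + dM) / (\<sigma>2 * real n) + (1 - real n / real n)"
      unfolding Z_def K_def R'_def by (rule surv_supersolution) (use r n y True in \<open>auto simp: r_def\<close>)
    then have s: "surv P f n x y \<le> Z / r + (2 * R' * Z - Z\<^sup>2 - corrD x + dM) / (\<sigma>2 * real n)" using n by simp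
    have Z0: "0 \<le> Z" using aM(1)[of x] fM(2) y by (simp add: Z_def K_def abs_le_iff)
    have Z1: "Z \<le> c3 * (1 + y)"
    proof -
      have "Z \<le> y + 2 * aM + fM" using aM(1)[of x] by (simp add: Z_def K_def abs_le_iff)
      also have "\<dots> \<le> c3 * (1 + y)" using y aM(2) fM(2) by (simp add: c3_def algebra_simps)
      finally show ?thesis .
    qed
    have R1: "R' \<le> (1 + 2 * fM + 2 * aM) * r"
    proof -
      have "(2 * fM + 2 * aM) * 1 \<le> (2 * fM + 2 * aM) * r" using r fM(2) aM(2) by (intro mult_left_mono) auto
      then show ?thesis by (simp add: R'_def algebra_simps)
    qed
    have R0: "R' \<ge> 0" using r fM(2) aM(2) by (simp add: R'_def)
    have num: "2 * R' * Z - Z\<^sup>2 - corrD x + dM \<le> (2 * (1 + 2 * fM + 2 * aM) * c3 + 2 * dM) * (1 + y) * r"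
    proof -
      have "R' * Z \<le> ((1 + 2 * fM + 2 * aM) * r) * (c3 * (1 + y))" using R1 Z1 Z0 r fM(2) aM(2) by (intro mult_mono) auto
      moreover have "2 * dM * 1 \<le> 2 * dM * ((1 + y) * r)"
      proof (intro mult_left_mono)
        have "1 * 1 \<le> (1 + y) * r" using y r by (intro mult_mono) auto
        then show "1 \<le> (1 + y) * r" by simp
      qed (use dM in simp)
      moreover have "- corrD x \<le> dM" using dM(1)[of x] by (simp add: abs_le_iff)
      ultimately have "2 * R' * Z - Z\<^sup>2 - corrD x + dM \<le> 2 * (((1 + 2 * fM + 2 * aM) * r) * (c3 * (1 + y))) + 2 * dM * ((1 + y) * r)"
        using zero_le_power2[of Z] by linarith
      then show ?thesis by (simp add: algebra_simps)
    qed
    have "surv P f n x y * r \<le> (Z / r + (2 * R' * Z - Z\<^sup>2 - corrD x + dM) / (\<sigma>2 * (r * r))) * r"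
      using s r by (intro mult_right_mono) auto
    also have "\<dots> = Z + (2 * R' * Z - Z\<^sup>2 - corrD x + dM) / (\<sigma>2 * r)"
    proof -
      have "(a / r + N / (s * (r * r))) * r = a + N / (s * r)" for a N s :: real using r(1) by (cases "s = 0") (simp_all add: field_simps)
      then show ?thesis .
    qed
    also have "\<dots> \<le> c3 * (1 + y) + (2 * (1 + 2 * fM + 2 * aM) * c3 + 2 * dM) * (1 + y) * r / (\<sigma>2 * r)"
      using Z1 num \<sigma>2_pos r(1) by (intro add_mono divide_right_mono) auto
    also have "\<dots> = (c3 + (2 * (1 + 2 * fM + 2 * aM) * c3 + 2 * dM) / \<sigma>2) * (1 + y)"
    proof -
      have "a * (1 + y) + k * (1 + y) * r / (s * r) = (a + k / s) * (1 + y)" for a k s :: real using r(1) by (simp add: distrib_right[of a])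
      then show ?thesis .
    qed
    also have "\<dots> \<le> C * (1 + y)" using y by (intro mult_right_mono) (auto simp: C_def)
    finally show ?thesis by (simp add: r_def)
  qed
  have "surv P f n x y * sqrt (real n) \<le> C * (2 + \<bar>y\<bar>)" for n x y
  proof (cases "n \<ge> 1")
    case True
    have "surv P f n x y \<le> surv P f n x (max y 1)" unfolding surv_eq_killed by (rule Q_mono_level) auto
    then have "surv P f n x y * sqrt (real n) \<le> surv P f n x (max y 1) * sqrt (real n)" by (intro mult_right_mono) auto
    also have "\<dots> \<le> C * (1 + max y 1)" by (rule pos[OF True]) simp
    also have "\<dots> \<le> C * (2 + \<bar>y\<bar>)" using C1 by (intro mult_left_mono) auto
    finally show ?thesis .
  next
    case False
    then show ?thesis using C1 by (simp add: not_le)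
  qed
  then show ?thesis using C1 by (intro exI[of _ C]) auto
qed

text \<open>The linear martingale, shifted so as to stay nonnegative at the overshoot, can only lose
  expectation under killing. It dominates the level itself.\<close>

lemma mean_bound: "\<exists>C\<ge>0. \<forall>n x y. (Q ^^ n) (\<lambda>x y. max 0 y) x y \<le> C + \<bar>y\<bar>"
proof -
  define K where "K = aM + fM"
  let ?Z = "\<lambda>x y. y + corrA x + K"
  have Zlo: "y + fM \<le> ?Z x y" for x y using aM(1)[of x] by (simp add: K_def abs_le_iff)
  have *: "(Q ^^ n) ?Z x y \<le> ?Z x y" if "y > 0" for n x y
    using that
  proof (induction n arbitrary: x y)
    case (Suc n)
    have "(Q ^^ Suc n) ?Z x y \<le> (\<Sum>x'\<in>UNIV. P x x' * ?Z x' (y + f x'))"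
      unfolding killed_pow_Suc
    proof (intro sum_mono mult_left_mono P_nonneg)
      fix x'
      have "0 \<le> ?Z x' (y + f x')" using Zlo[of "y + f x'" x'] fM(1)[of x'] Suc.prems by linarith
      then show "(if 0 < y + f x' then (Q ^^ n) ?Z x' (y + f x') else 0) \<le> ?Z x' (y + f x')"
        using Suc.IH[of "y + f x'" x'] by auto
    qed
    then show ?case by (simp only: T_linear_martingale)
  qed simp
  have "(Q ^^ n) (\<lambda>x y. max 0 y) x y \<le> (1 + 2 * aM + fM) + \<bar>y\<bar>" for n x y
  proof -
    have "(Q ^^ n) (\<lambda>x y. max 0 y) x y \<le> (Q ^^ n) (\<lambda>x y. max 0 y) x (max y 1)" by (rule Q_mono_level) auto
    also have "\<dots> \<le> (Q ^^ n) ?Z x (max y 1)"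
    proof (rule killed_pow_mono[OF P_nonneg])
      show "max 0 y \<le> ?Z x y" if "y > 0" for x y using Zlo[of y x] fM(2) that by simp
    qed (simp add: less_max_iff_disj)
    also have "\<dots> \<le> ?Z x (max y 1)" by (rule *) simp
    also have "\<dots> \<le> (1 + 2 * aM + fM) + \<bar>y\<bar>" 
    proof -
      have "max y 1 \<le> 1 + \<bar>y\<bar>" by auto
      then show ?thesis using aM(1)[of x] unfolding K_def by linarith
    qed
    finally show ?thesis .
  qed
  then show ?thesis using aM(2) fM(2) by (intro exI[of _ "1 + 2 * aM + fM"]) auto
qed

lemma T_upper: "\<exists>K\<ge>0. \<forall>Gm G Gp j x w. windowed (1/2) Gm G Gp \<longrightarrow> j \<ge> 1 \<longrightarrow> (T ^^ j) G x w \<le> K * totI Gp / sqrt (real j)"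
proof -
  obtain \<epsilon> :: "nat \<Rightarrow> real" where e: "\<epsilon> \<longlonglongrightarrow> 0" "\<forall>j. 0 \<le> \<epsilon> j" and *: "\<forall>Gm G Gp j x w. windowed (1/2) Gm G Gp \<longrightarrow> j \<ge> 1 \<longrightarrow>
    (T ^^ j) G x w \<le> (2 * gC0 + \<epsilon> j) * totI Gp / sqrt (real j) \<and>
    \<bar>(T ^^ j) G x w - Gs j G w\<bar> \<le> (gC0 * (totI Gp - totI Gm) + (2 * gC0 * (1/2) + \<epsilon> j) * totI Gp) / sqrt (real j)"
    using llt[of "1/2"] by auto
  obtain B where B: "\<forall>j. \<bar>\<epsilon> j\<bar> \<le> B" using convergent_imp_Bseq[OF convergentI[OF e(1)]] by (auto simp: Bseq_def)
  have B0: "B \<ge> 0" using B abs_ge_zero order_trans by blast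
  have "(T ^^ j) G x w \<le> (2 * gC0 + B) * totI Gp / sqrt (real j)" if W: "windowed (1/2) Gm G Gp" and j: "j \<ge> 1" for Gm G Gp j x w
  proof -
    have "0 \<le> Gp z r" for z r
    proof -
      have "0 \<le> Gm z r" "Gm z (r + 0) \<le> G z r" "G z r \<le> Gp z (r + 0)" using W unfolding windowed_def by (auto simp del: add_0_right)
      then show ?thesis by simp
    qed
    then have t0: "0 \<le> totI Gp" unfolding totI_def by (intro sum_nonneg integral_nonneg_AE) auto
    have "(T ^^ j) G x w \<le> (2 * gC0 + \<epsilon> j) * totI Gp / sqrt (real j)" using * W j by blast
    also have "\<dots> \<le> (2 * gC0 + B) * totI Gp / sqrt (real j)"
      using B t0 by (intro divide_right_mono mult_right_mono add_left_mono) (auto simp: abs_le_iff)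
    finally show ?thesis .
  qed
  then show ?thesis using B0 gC0_nonneg by (intro exI[of _ "2 * gC0 + B"]) auto
qed

end

subsection \<open>The sine transform of the killed walk\<close>

lemma sin_near_id: "\<bar>sin u - u\<bar> \<le> \<bar>u\<bar> ^ 3" for u :: real
proof -
  have "\<bar>Im (cis u - (1 + \<i> * of_real u - of_real (u\<^sup>2 / 2)))\<bar> \<le> \<bar>u\<bar> ^ 3"
    by (rule order_trans[OF abs_Im_le_cmod cis_expansion])
  then show ?thesis by simp
qed

lemma sqrt_scaled_null:
  assumes t: "(\<lambda>n. sqrt (real n) * t n) \<longlonglongrightarrow> \<xi>" shows "t \<longlonglongrightarrow> 0"
proof -
  have "(\<lambda>n. (sqrt (real n) * t n) * (1 / sqrt (real n))) \<longlonglongrightarrow> \<xi> * 0"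
    by (intro tendsto_mult t) real_asymp
  then have "(\<lambda>n. (sqrt (real n) * t n) * (1 / sqrt (real n))) \<longlonglongrightarrow> 0" by simp
  then show ?thesis
  proof (rule Lim_transform_eventually)
    show "\<forall>\<^sub>F n in sequentially. (sqrt (real n) * t n) * (1 / sqrt (real n)) = t n"
      using eventually_gt_at_top[of 0] by eventually_elim simp
  qed
qed

lemma sin_scaled_tendsto:
  assumes t: "(\<lambda>n. sqrt (real n) * t n) \<longlonglongrightarrow> \<xi>"
  shows "(\<lambda>n. sqrt (real n) * sin (t n * z)) \<longlonglongrightarrow> \<xi> * z"
proof -
  note t0 = sqrt_scaled_null[OF t]
  have "(\<lambda>n. \<bar>sqrt (real n) * t n\<bar> * \<bar>t n\<bar> ^ 2 * \<bar>z\<bar> ^ 3) \<longlonglongrightarrow> \<bar>\<xi>\<bar> * \<bar>0\<bar> ^ 2 * \<bar>z\<bar> ^ 3"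
    by (intro tendsto_intros t t0)
  then have b0: "(\<lambda>n. \<bar>sqrt (real n) * t n\<bar> * \<bar>t n\<bar> ^ 2 * \<bar>z\<bar> ^ 3) \<longlonglongrightarrow> 0" by simp
  have "(\<lambda>n. sqrt (real n) * (sin (t n * z) - t n * z)) \<longlonglongrightarrow> 0"
  proof (rule Lim_null_comparison[OF _ b0], rule always_eventually, rule allI)
    fix n
    have "norm (sqrt (real n) * (sin (t n * z) - t n * z)) \<le> sqrt (real n) * \<bar>t n * z\<bar> ^ 3"
      using sin_near_id[of "t n * z"] by (simp add: abs_mult mult_left_mono)
    also have "\<dots> = \<bar>sqrt (real n) * t n\<bar> * \<bar>t n\<bar> ^ 2 * \<bar>z\<bar> ^ 3"
    proof -
      have "r * (a * b) ^ 3 = r * a * a ^ 2 * b ^ 3" for r a b :: real by (simp add: power2_eq_square power3_eq_cube)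
      then show ?thesis by (simp only: abs_mult abs_of_nonneg real_sqrt_ge_zero of_nat_0_le_iff)
    qed
    finally show "norm (sqrt (real n) * (sin (t n * z) - t n * z)) \<le> \<bar>sqrt (real n) * t n\<bar> * \<bar>t n\<bar> ^ 2 * \<bar>z\<bar> ^ 3" .
  qed
  from tendsto_add[OF this tendsto_mult[OF t tendsto_const[of z]]]
  show ?thesis by (simp add: algebra_simps)
qed

context markov_walk
begin

text \<open>The imaginary part of an approximate eigenfunction of the free step. On bounded sets of
  levels, in particular at exit points, it is O(t).\<close>

definition "sinE t x y = Im (cis (t * y) * eigf t x)" for t :: real

lemma sinE_eq: "sinE t x y = sin (t * (y + corrA x)) * (1 - t\<^sup>2 * corrD x / 2)"
proof -
  have "cis (t * y) * eigf t x = cis (t * (y + corrA x)) * of_real (1 - t\<^sup>2 * corrD x / 2)"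
    unfolding eigf_def mult.assoc[symmetric] cis_mult by (simp add: distrib_left)
  then show ?thesis unfolding sinE_def by simp
qed

lemma T_sinE: "\<exists>C\<ge>0. \<forall>t x y. \<bar>t\<bar> \<le> 1 \<longrightarrow> \<bar>T (sinE t) x y - exp (- \<sigma>2 * t\<^sup>2 / 2) * sinE t x y\<bar> \<le> C * \<bar>t\<bar> ^ 3"
proof -
  obtain C where C0: "C \<ge> 0" and C: "\<forall>t x. \<bar>t\<bar> \<le> 1 \<longrightarrow> norm (Fop t (eigf t) x - of_real (exp (- \<sigma>2 * t\<^sup>2 / 2)) * eigf t x) \<le> C * \<bar>t\<bar> ^ 3"
    using eigf_approx by blast
  have "\<bar>T (sinE t) x y - exp (- \<sigma>2 * t\<^sup>2 / 2) * sinE t x y\<bar> \<le> C * \<bar>t\<bar> ^ 3" if t: "\<bar>t\<bar> \<le> 1" for t x y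
  proof -
    let ?l = "exp (- \<sigma>2 * t\<^sup>2 / 2)"
    have rm: "p * Im q = Im (of_real p * q)" for p q by simp
    have "T (sinE t) x y = (\<Sum>x'\<in>UNIV. Im (cis (t * y) * (of_real (P x x') * cis (t * f x') * eigf t x')))"
      unfolding T_one_step sinE_def
    proof (intro sum.cong refl)
      fix x'
      have c: "cis (t * (y + f x')) = cis (t * y) * cis (t * f x')" by (simp add: cis_mult distrib_left)
      show "P x x' * Im (cis (t * (y + f x')) * eigf t x') = Im (cis (t * y) * (of_real (P x x') * cis (t * f x') * eigf t x'))"
        unfolding rm c by (simp only: mult_ac)
    qed
    also have "\<dots> = Im (cis (t * y) * Fop t (eigf t) x)" unfolding Fop_def sum_distrib_left Im_sum ..
    finally have "T (sinE t) x y - ?l * sinE t x y = Im (cis (t * y) * Fop t (eigf t) x - of_real ?l * (cis (t * y) * eigf t x))"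
      unfolding sinE_def rm by (simp only: minus_complex.sel)
    also have "cis (t * y) * Fop t (eigf t) x - of_real ?l * (cis (t * y) * eigf t x) = cis (t * y) * (Fop t (eigf t) x - of_real ?l * eigf t x)"
      by (simp only: right_diff_distrib mult_ac)
    finally have "\<bar>T (sinE t) x y - ?l * sinE t x y\<bar> \<le> norm (cis (t * y) * (Fop t (eigf t) x - of_real ?l * eigf t x))"
      by (simp only: abs_Im_le_cmod)
    also have "\<dots> \<le> C * \<bar>t\<bar> ^ 3" using C[rule_format, OF t, of x] by (simp only: norm_mult norm_cis mult_1)
    finally show ?thesis .
  qed
  with C0 show ?thesis by blast
qed

text \<open>The expectation of g at the exit point, on the event that the walk leaves at step k +
  1.\<close>

definition "exitk g k x y = (Q ^^ k) (exit_step P f g) x y"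

lemma exitk_summable: "summable (\<lambda>k. exitk (\<lambda>x y. 1) k x y)" and exitk_nonneg: "exitk (\<lambda>x y. 1) k x y \<ge> 0"
proof -
  have nn: "exitk (\<lambda>x y. 1) k x y \<ge> 0" for k x y unfolding exitk_def
    by (rule Q_nonneg) (auto simp: exit_step_def walk_step_def P_nonneg intro!: sum_nonneg)
  show "exitk (\<lambda>x y. 1) k x y \<ge> 0" by (rule nn)
  show "summable (\<lambda>k. exitk (\<lambda>x y. 1) k x y)"
  proof (rule summableI_nonneg_bounded[where x = 1], rule nn)
    fix l
    have "(\<lambda>x y. (T ^^ j) (\<lambda>x y. 1) x y) = (\<lambda>x y. 1)" for j by (intro ext) (rule T_pow_const)
    then have T1: "(T ^^ j) (\<lambda>x y. 1) = (\<lambda>x y. 1)" for j by simp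
    show "(\<Sum>k<l. exitk (\<lambda>x y. 1) k x y) \<le> 1"
      using free_killed_telescope[where P = P and f = f and l = l and g = "\<lambda>x y. 1" and x = x and y = y] surv_nonneg[of l x y]
      unfolding T1 exitk_def surv_eq_killed by linarith
  qed
qed

text \<open>A step from a level of at least -b lands no lower than -b - fM, so only this range of
  exit points counts; b allows for nonpositive starts.\<close>

lemma exitk_bound:
  assumes g: "\<And>x y'. - b - fM \<le> y' \<Longrightarrow> y' \<le> 0 \<Longrightarrow> \<bar>g x y'\<bar> \<le> c" and b: "b \<ge> 0" "y \<ge> - b"
  shows "\<bar>exitk g k x y\<bar> \<le> c * exitk (\<lambda>x y. 1) k x y"
proof -
  have e: "\<bar>exit_step P f g x y\<bar> \<le> c * exit_step P f (\<lambda>x y. 1) x y" if "y \<ge> - b" for x y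
    unfolding exit_step_def walk_step_def sum_distrib_left
  proof (rule order_trans[OF sum_abs], rule sum_mono)
    fix x'
    have "- b - fM \<le> y + f x'" using that fM(1)[of x'] by (simp add: abs_le_iff)
    then have "\<bar>g x' (y + f x')\<bar> \<le> c" if "y + f x' \<le> 0" using g that by simp
    then show "\<bar>(if y + f x' \<le> 0 then P x x' else 0) * g x' (y + f x')\<bar> \<le> c * ((if y + f x' \<le> 0 then P x x' else 0) * 1)"
      using P_nonneg[of x x'] by (auto simp: abs_mult mult.commute[of c] intro!: mult_left_mono)
  qed
  have "exitk g k x y \<le> (Q ^^ k) (\<lambda>x y. c * exit_step P f (\<lambda>x y. 1) x y) x y" unfolding exitk_def
    by (rule killed_pow_mono_from[OF P_nonneg _ b]) (use e in \<open>simp add: abs_le_iff\<close>)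
  moreover have "(Q ^^ k) (\<lambda>x y. (- c) * exit_step P f (\<lambda>x y. 1) x y) x y \<le> exitk g k x y" unfolding exitk_def
  proof (rule killed_pow_mono_from[OF P_nonneg _ b])
    show "(- c) * exit_step P f (\<lambda>x y. 1) x y \<le> exit_step P f g x y" if "y \<ge> - b" for x y
      using e[OF that, of x] unfolding mult_minus_left by linarith
  qed
  ultimately show ?thesis unfolding exitk_def killed_step_def walk_step_pow_scale by simp
qed

text \<open>Optional stopping written out: the initial value of the linear martingale minus its
  expectation at the exit point. The series over exit times converges because exit points stay in a
  bounded range.\<close>

definition "harmV x y = y + corrA x - (\<Sum>k. exitk (\<lambda>x y. y + corrA x) k x y)"

lemma surv_sum_bound: "\<exists>C\<ge>0. \<forall>n. (\<Sum>k<n. surv P f k x y) \<le> 1 + C * sqrt (real n)"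
proof -
  obtain C where C: "C \<ge> 0" "\<forall>n x y. surv P f n x y * sqrt (real n) \<le> C * (2 + \<bar>y\<bar>)" using surv_bound by blast
  let ?c = "C * (2 + \<bar>y\<bar>)"
  have "(\<Sum>k<n. surv P f k x y) \<le> 1 + (2 * ?c) * sqrt (real n)" for n
  proof -
    have "surv P f k x y \<le> (if k = 0 then 1 else 0) + ?c * (1 / sqrt (real k))" for k
    proof (cases "k = 0")
      case False
      have "surv P f k x y * sqrt (real k) \<le> ?c" using C by blast
      then show ?thesis using False by (simp add: field_simps)
    qed simp
    then have "(\<Sum>k<n. surv P f k x y) \<le> (\<Sum>k<n. (if k = 0 then 1 else 0) + ?c * (1 / sqrt (real k)))" by (rule sum_mono)
    also have "\<dots> = (\<Sum>k<n. if k = 0 then 1 else 0) + ?c * (\<Sum>k<n. 1 / sqrt (real k))"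
      by (simp add: sum.distrib sum_distrib_left)
    also have "\<dots> \<le> 1 + ?c * (2 * sqrt (real n))"
      using C(1) by (intro add_mono mult_left_mono sum_inverse_sqrt_le) (auto simp: sum.delta)
    finally show ?thesis by simp
  qed
  then show ?thesis using C(1) by (intro exI[of _ "2 * ?c"]) auto
qed

lemma surv_tendsto_0: "(\<lambda>n. surv P f n x y) \<longlonglongrightarrow> 0"
proof -
  obtain C where C: "C \<ge> 0" "\<forall>n x y. surv P f n x y * sqrt (real n) \<le> C * (2 + \<bar>y\<bar>)" using surv_bound by blast
  have "(\<lambda>n. C * (2 + \<bar>y\<bar>) / sqrt (real n)) \<longlonglongrightarrow> 0" by real_asymp
  then show ?thesis
  proof (rule Lim_null_comparison[rotated])
    show "\<forall>\<^sub>F n in sequentially. norm (surv P f n x y) \<le> C * (2 + \<bar>y\<bar>) / sqrt (real n)"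
      using eventually_gt_at_top[of 0]
    proof eventually_elim
      case (elim n)
      then show ?case using C(2)[rule_format, of n x y] surv_nonneg[of n x y] by (simp add: field_simps)
    qed
  qed
qed

text \<open>\<open>killed_pow_telescope\<close> leaves three terms. The first is explicit. The
  defects are O(|t|^3) per step, weighted by survival probabilities whose sum is O(sqrt n); with t
  of order n^(-1/2) and the factor sqrt n this is O(n^(-1/2)). The exit terms converge one by one,
  with the exit probabilities as summable majorant, and their limit completes
  \<open>harmV\<close>.\<close>

lemma sinE_pow_tendsto:
  assumes t: "(\<lambda>n. sqrt (real n) * t n) \<longlonglongrightarrow> \<xi>"
  shows "(\<lambda>n. sqrt (real n) * (Q ^^ n) (sinE (t n)) x y) \<longlonglongrightarrow> harmV x y * (\<xi> * exp (- \<sigma>2 * \<xi>\<^sup>2 / 2))"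
proof -
  note t0 = sqrt_scaled_null[OF t]
  have ev1: "\<forall>\<^sub>F n in sequentially. \<bar>t n\<bar> \<le> 1"
    using tendstoD[OF t0, of 1] by (auto simp: dist_real_def elim: eventually_mono)
  have t2: "(\<lambda>n. (t n)\<^sup>2 * real n) \<longlonglongrightarrow> \<xi>\<^sup>2"
  proof -
    have "(\<lambda>n. (sqrt (real n) * t n)\<^sup>2) \<longlonglongrightarrow> \<xi>\<^sup>2" by (intro tendsto_intros t)
    then show ?thesis by (simp add: power_mult_distrib mult.commute)
  qed
  define l where "l n = exp (- \<sigma>2 * (t n)\<^sup>2 / 2)" for n
  have lpow: "l n ^ j = exp (- \<sigma>2 * ((t n)\<^sup>2 * real j) / 2)" for n j
    unfolding l_def by (subst exp_of_nat_mult[symmetric]) (simp add: mult_ac)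
  have l1: "0 \<le> l n" "l n \<le> 1" for n using \<sigma>2_pos by (auto simp: l_def)
  have lk: "(\<lambda>n. l n ^ (n - j)) \<longlonglongrightarrow> exp (- \<sigma>2 * \<xi>\<^sup>2 / 2)" for j
  proof -
    have "(\<lambda>n. (t n)\<^sup>2 * real n - (t n)\<^sup>2 * real j) \<longlonglongrightarrow> \<xi>\<^sup>2 - 0\<^sup>2 * real j" by (intro tendsto_intros t2 t0)
    then have "(\<lambda>n. exp (- \<sigma>2 * ((t n)\<^sup>2 * real n - (t n)\<^sup>2 * real j) / 2)) \<longlonglongrightarrow> exp (- \<sigma>2 * \<xi>\<^sup>2 / 2)"
      by (intro tendsto_intros) simp_all
    then show ?thesis
    proof (rule Lim_transform_eventually)
      show "\<forall>\<^sub>F n in sequentially. exp (- \<sigma>2 * ((t n)\<^sup>2 * real n - (t n)\<^sup>2 * real j) / 2) = l n ^ (n - j)"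
        using eventually_ge_at_top[of j] by eventually_elim (simp add: lpow of_nat_diff right_diff_distrib)
    qed
  qed
  obtain C where C0: "C \<ge> 0" and C: "\<forall>t x y. \<bar>t\<bar> \<le> 1 \<longrightarrow> \<bar>T (sinE t) x y - exp (- \<sigma>2 * t\<^sup>2 / 2) * sinE t x y\<bar> \<le> C * \<bar>t\<bar> ^ 3"
    using T_sinE by blast
  define err where "err n = (\<Sum>k<n. l n ^ (n - Suc k) * (Q ^^ k) (\<lambda>x y. T (sinE (t n)) x y - l n * sinE (t n) x y) x y)" for n
  have decomp: "(Q ^^ n) (sinE (t n)) x y = l n ^ n * sinE (t n) x y + err n - (\<Sum>k<n. l n ^ (n - Suc k) * exitk (sinE (t n)) k x y)" for n
  proof -
    have "(\<lambda>x y. Q (sinE (t n)) x y - l n * sinE (t n) x y) = (\<lambda>x y. (T (sinE (t n)) x y - l n * sinE (t n) x y) - exit_step P f (sinE (t n)) x y)"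
      by (intro ext) (simp add: free_eq_killed_exit)
    then have "(Q ^^ k) (\<lambda>x y. Q (sinE (t n)) x y - l n * sinE (t n) x y) x y = (Q ^^ k) (\<lambda>x y. T (sinE (t n)) x y - l n * sinE (t n) x y) x y - exitk (sinE (t n)) k x y" for k
      unfolding exitk_def by (simp only: killed_step_def walk_step_pow_diff)
    then show ?thesis
      unfolding killed_pow_telescope[where n = n and l = "l n" and g = "sinE (t n)"] err_def by (simp add: right_diff_distrib sum_subtractf)
  qed
  have sE: "(\<lambda>n. sqrt (real n) * sinE (t n) x y) \<longlonglongrightarrow> \<xi> * (y + corrA x)" for x y
  proof -
    have "(\<lambda>n. sqrt (real n) * sin (t n * (y + corrA x)) * (1 - (t n)\<^sup>2 * corrD x / 2)) \<longlonglongrightarrow> \<xi> * (y + corrA x) * (1 - 0\<^sup>2 * corrD x / 2)"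
      by (intro tendsto_mult[OF sin_scaled_tendsto[OF t]] tendsto_intros t0) simp
    then show ?thesis by (simp add: sinE_eq mult.assoc)
  qed
  have main: "(\<lambda>n. l n ^ n * (sqrt (real n) * sinE (t n) x y)) \<longlonglongrightarrow> exp (- \<sigma>2 * \<xi>\<^sup>2 / 2) * (\<xi> * (y + corrA x))"
    using tendsto_mult[OF lk[of 0] sE] by simp
  have err: "(\<lambda>n. sqrt (real n) * err n) \<longlonglongrightarrow> 0"
  proof -
    obtain C' where C': "C' \<ge> 0" "\<forall>n. (\<Sum>k<n. surv P f k x y) \<le> 1 + C' * sqrt (real n)" using surv_sum_bound by blast
    have "(\<lambda>n. C * \<bar>sqrt (real n) * t n\<bar> ^ 3 * ((1 + C' * sqrt (real n)) / real n)) \<longlonglongrightarrow> C * \<bar>\<xi>\<bar> ^ 3 * 0"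
      by (intro tendsto_mult tendsto_intros t) real_asymp
    then have z: "(\<lambda>n. C * \<bar>sqrt (real n) * t n\<bar> ^ 3 * ((1 + C' * sqrt (real n)) / real n)) \<longlonglongrightarrow> 0" by simp
    show ?thesis
    proof (rule Lim_null_comparison[OF _ z])
      show "\<forall>\<^sub>F n in sequentially. norm (sqrt (real n) * err n) \<le> C * \<bar>sqrt (real n) * t n\<bar> ^ 3 * ((1 + C' * sqrt (real n)) / real n)"
        using ev1 eventually_gt_at_top[of 0]
      proof eventually_elim
        case (elim n)
        have "\<bar>(Q ^^ k) (\<lambda>x y. T (sinE (t n)) x y - l n * sinE (t n) x y) x y\<bar> \<le> C * \<bar>t n\<bar> ^ 3 * surv P f k x y" for k
        proof -
          let ?h = "\<lambda>x y. T (sinE (t n)) x y - l n * sinE (t n) x y"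
          have b: "\<bar>?h x y\<bar> \<le> C * \<bar>t n\<bar> ^ 3 * 1" for x y using C elim(1) by (simp add: l_def)
          have "(Q ^^ k) ?h x y \<le> (Q ^^ k) (\<lambda>x y. C * \<bar>t n\<bar> ^ 3 * 1) x y" by (rule Q_mono) (use b abs_le_D1 in blast)
          moreover have "(Q ^^ k) (\<lambda>x y. - (C * \<bar>t n\<bar> ^ 3) * 1) x y \<le> (Q ^^ k) ?h x y"
          proof (rule Q_mono)
            show "- (C * \<bar>t n\<bar> ^ 3) * 1 \<le> ?h x y" for x y using b[of x y] unfolding mult_minus_left by linarith
          qed
          ultimately show ?thesis unfolding surv_eq_killed killed_step_def walk_step_pow_scale by (simp add: abs_le_iff)
        qed
        then have h: "\<bar>l n ^ (n - Suc k) * (Q ^^ k) (\<lambda>x y. T (sinE (t n)) x y - l n * sinE (t n) x y) x y\<bar> \<le> 1 * (C * \<bar>t n\<bar> ^ 3 * surv P f k x y)" for k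
          unfolding abs_mult[of "l n ^ (n - Suc k)"] by (rule mult_mono[rotated]) (use l1 in \<open>auto simp: power_le_one\<close>)
        have "\<bar>err n\<bar> \<le> (\<Sum>k<n. 1 * (C * \<bar>t n\<bar> ^ 3 * surv P f k x y))" unfolding err_def
          by (rule order_trans[OF sum_abs], rule sum_mono, rule h)
        also have "\<dots> = C * \<bar>t n\<bar> ^ 3 * (\<Sum>k<n. surv P f k x y)" by (simp add: sum_distrib_left)
        also have "\<dots> \<le> C * \<bar>t n\<bar> ^ 3 * (1 + C' * sqrt (real n))" using C' C0 by (intro mult_left_mono) auto
        finally have "\<bar>err n\<bar> \<le> C * \<bar>t n\<bar> ^ 3 * (1 + C' * sqrt (real n))" .
        then have "sqrt (real n) * \<bar>err n\<bar> \<le> sqrt (real n) * (C * \<bar>t n\<bar> ^ 3 * (1 + C' * sqrt (real n)))" by (intro mult_left_mono) auto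
        also have "\<dots> = C * \<bar>sqrt (real n) * t n\<bar> ^ 3 * ((1 + C' * sqrt (real n)) / real n)"
        proof -
          define r where "r = sqrt (real n)"
          have r: "r > 0" "real n = r * r" using elim(2) by (auto simp: r_def)
          show ?thesis unfolding r_def[symmetric] r(2) using r(1) by (simp add: abs_mult power_mult_distrib power3_eq_cube)
        qed
        finally show ?case by (simp add: abs_mult)
      qed
    qed
  qed
  define b where "b = \<bar>y\<bar>"
  define B where "B = (b + fM + aM) * (1 + dM)"
  have eb: "\<bar>sqrt (real n) * exitk (sinE (t n)) k x y\<bar> \<le> \<bar>sqrt (real n) * t n\<bar> * B * exitk (\<lambda>x y. 1) k x y" if "\<bar>t n\<bar> \<le> 1" for n k
  proof -
    have "\<bar>exitk (sinE (t n)) k x y\<bar> \<le> (\<bar>t n\<bar> * B) * exitk (\<lambda>x y. 1) k x y"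
    proof (rule exitk_bound[where b = b])
      fix x y' assume y': "- b - fM \<le> y'" "y' \<le> 0"
      have y1: "\<bar>y' + corrA x\<bar> \<le> b + fM + aM" using y' aM(1)[of x] by (simp add: abs_le_iff)
      have d1: "\<bar>1 - (t n)\<^sup>2 * corrD x / 2\<bar> \<le> 1 + dM"
      proof -
        have "(t n)\<^sup>2 \<le> 1" using that by (simp add: abs_square_le_1)
        then have "(t n)\<^sup>2 * \<bar>corrD x\<bar> \<le> 1 * dM" using dM(1)[of x] dM(2) by (intro mult_mono) auto
        moreover have "\<bar>(t n)\<^sup>2 * corrD x / 2\<bar> \<le> (t n)\<^sup>2 * \<bar>corrD x\<bar>" by (simp add: abs_mult)
        ultimately show ?thesis by linarith
      qed
      have "\<bar>sin (t n * (y' + corrA x))\<bar> \<le> \<bar>t n\<bar> * \<bar>y' + corrA x\<bar>"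
        using abs_sin_x_le_abs_x[of "t n * (y' + corrA x)"] by (simp add: abs_mult)
      also have "\<dots> \<le> \<bar>t n\<bar> * (b + fM + aM)" by (rule mult_left_mono[OF y1]) simp
      finally have s1: "\<bar>sin (t n * (y' + corrA x))\<bar> \<le> \<bar>t n\<bar> * (b + fM + aM)" .
      have "\<bar>sin (t n * (y' + corrA x))\<bar> * \<bar>1 - (t n)\<^sup>2 * corrD x / 2\<bar> \<le> (\<bar>t n\<bar> * (b + fM + aM)) * (1 + dM)"
        by (rule mult_mono[OF s1 d1]) (use fM(2) aM(2) in \<open>auto simp: b_def\<close>)
      then show "\<bar>sinE (t n) x y'\<bar> \<le> \<bar>t n\<bar> * B" by (simp add: sinE_eq abs_mult B_def mult.assoc)
    qed (auto simp: b_def)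
    then have "sqrt (real n) * \<bar>exitk (sinE (t n)) k x y\<bar> \<le> sqrt (real n) * ((\<bar>t n\<bar> * B) * exitk (\<lambda>x y. 1) k x y)" by (intro mult_left_mono) auto
    then show ?thesis by (simp add: abs_mult mult.assoc)
  qed
  have B0: "B \<ge> 0" using fM(2) aM(2) dM(2) by (simp add: B_def b_def)
  obtain D where D: "\<forall>n. \<bar>sqrt (real n) * t n\<bar> \<le> D" using convergent_imp_Bseq[OF convergentI[OF t]] by (auto simp: Bseq_def)
  \<comment> \<open>The sum up to n is extended by zeros to a series, the form in which Tannery's
    theorem applies.\<close>
  define a where "a k n = (if k < n then l n ^ (n - Suc k) * (sqrt (real n) * exitk (sinE (t n)) k x y) else 0)" for k n
  have "(\<lambda>n. \<Sum>k. a k n) \<longlonglongrightarrow> (\<Sum>k. exp (- \<sigma>2 * \<xi>\<^sup>2 / 2) * (\<xi> * exitk (\<lambda>x y. y + corrA x) k x y))"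
  proof (rule tannerys_theorem[THEN conjunct2, THEN conjunct2])
    fix k
    have "(\<lambda>n. l n ^ (n - Suc k) * (sqrt (real n) * exitk (sinE (t n)) k x y)) \<longlonglongrightarrow> exp (- \<sigma>2 * \<xi>\<^sup>2 / 2) * exitk (\<lambda>x y. \<xi> * (y + corrA x)) k x y"
    proof (intro tendsto_mult lk)
      have "(\<lambda>n. exitk (\<lambda>x y. sqrt (real n) * sinE (t n) x y) k x y) \<longlonglongrightarrow> exitk (\<lambda>x y. \<xi> * (y + corrA x)) k x y"
        unfolding exitk_def killed_step_def
      proof (rule walk_step_pow_tendsto)
        fix x y
        show "(\<lambda>n. exit_step P f (\<lambda>x y. sqrt (real n) * sinE (t n) x y) x y) \<longlonglongrightarrow> exit_step P f (\<lambda>x y. \<xi> * (y + corrA x)) x y"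
          unfolding exit_step_def walk_step_def by (intro tendsto_intros sE)
      qed
      moreover have "exitk (\<lambda>x y. sqrt (real n) * sinE (t n) x y) k x y = sqrt (real n) * exitk (sinE (t n)) k x y" for n
      proof -
        have "exit_step P f (\<lambda>x y. sqrt (real n) * sinE (t n) x y) = (\<lambda>x y. sqrt (real n) * exit_step P f (sinE (t n)) x y)"
          by (intro ext) (simp add: exit_step_def walk_step_def sum_distrib_left mult_ac)
        then show ?thesis unfolding exitk_def by (simp only: killed_step_def walk_step_pow_scale)
      qed
      ultimately show "(\<lambda>n. sqrt (real n) * exitk (sinE (t n)) k x y) \<longlonglongrightarrow> exitk (\<lambda>x y. \<xi> * (y + corrA x)) k x y" by simp
    qed
    moreover have "exitk (\<lambda>x y. \<xi> * (y + corrA x)) k x y = \<xi> * exitk (\<lambda>x y. y + corrA x) k x y"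
    proof -
      have "exit_step P f (\<lambda>x y. \<xi> * (y + corrA x)) = (\<lambda>x y. \<xi> * exit_step P f (\<lambda>x y. y + corrA x) x y)"
        by (intro ext) (simp only: exit_step_def walk_step_def sum_distrib_left mult_ac)
      then show ?thesis unfolding exitk_def by (simp only: killed_step_def walk_step_pow_scale)
    qed
    ultimately have "(\<lambda>n. l n ^ (n - Suc k) * (sqrt (real n) * exitk (sinE (t n)) k x y)) \<longlonglongrightarrow> exp (- \<sigma>2 * \<xi>\<^sup>2 / 2) * (\<xi> * exitk (\<lambda>x y. y + corrA x) k x y)" by simp
    then show "(\<lambda>n. a k n) \<longlonglongrightarrow> exp (- \<sigma>2 * \<xi>\<^sup>2 / 2) * (\<xi> * exitk (\<lambda>x y. y + corrA x) k x y)"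
    proof (rule Lim_transform_eventually)
      show "\<forall>\<^sub>F n in sequentially. l n ^ (n - Suc k) * (sqrt (real n) * exitk (sinE (t n)) k x y) = a k n"
        using eventually_gt_at_top[of k] by eventually_elim (simp add: a_def)
    qed
  next
    show "\<forall>\<^sub>F (k, n) in at_top \<times>\<^sub>F sequentially. norm (a k n) \<le> D * B * exitk (\<lambda>x y. 1) k x y"
    proof -
      have "norm (a k n) \<le> D * B * exitk (\<lambda>x y. 1) k x y" if "\<bar>t n\<bar> \<le> 1" for k n
      proof -
        have D0: "D \<ge> 0" using D abs_ge_zero order_trans by blast
        have "norm (a k n) \<le> 1 * \<bar>sqrt (real n) * exitk (sinE (t n)) k x y\<bar>"
          unfolding a_def by (auto simp: abs_mult l1 intro!: mult_left_le_one_le power_le_one mult_nonneg_nonneg)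
        also have "\<dots> \<le> \<bar>sqrt (real n) * t n\<bar> * B * exitk (\<lambda>x y. 1) k x y" using eb[OF that] by simp
        also have "\<dots> \<le> D * B * exitk (\<lambda>x y. 1) k x y" using D B0 exitk_nonneg by (intro mult_right_mono) auto
        finally show ?thesis .
      qed
      then show ?thesis unfolding eventually_prod_filter
        by (intro exI[of _ "\<lambda>_. True"] exI[of _ "\<lambda>n. \<bar>t n\<bar> \<le> 1"]) (use ev1 in auto)
    qed
    show "summable (\<lambda>k. D * B * exitk (\<lambda>x y. 1) k x y)" by (intro summable_mult exitk_summable)
  qed simp
  moreover have "(\<Sum>k. a k n) = (\<Sum>k<n. l n ^ (n - Suc k) * (sqrt (real n) * exitk (sinE (t n)) k x y))" for n
    by (subst suminf_finite[of "{..<n}"]) (auto simp: a_def)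
  moreover have "(\<Sum>k. exp (- \<sigma>2 * \<xi>\<^sup>2 / 2) * (\<xi> * exitk (\<lambda>x y. y + corrA x) k x y)) = exp (- \<sigma>2 * \<xi>\<^sup>2 / 2) * (\<xi> * (\<Sum>k. exitk (\<lambda>x y. y + corrA x) k x y))"
  proof -
    have "summable (\<lambda>k. exitk (\<lambda>x y. y + corrA x) k x y)"
    proof (rule summable_comparison_test'[of "\<lambda>k. (b + fM + aM) * exitk (\<lambda>x y. 1) k x y" 0])
      show "norm (exitk (\<lambda>x y. y + corrA x) k x y) \<le> (b + fM + aM) * exitk (\<lambda>x y. 1) k x y" for k
        unfolding real_norm_def
      proof (rule exitk_bound[where b = b])
        fix x y' assume y': "- b - fM \<le> y'" "y' \<le> 0"
        then show "\<bar>y' + corrA x\<bar> \<le> b + fM + aM" using aM(1)[of x] by (simp add: abs_le_iff)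
      qed (auto simp: b_def)
    qed (intro summable_mult exitk_summable)
    then show ?thesis by (simp add: suminf_mult summable_mult)
  qed
  ultimately have ex: "(\<lambda>n. \<Sum>k<n. l n ^ (n - Suc k) * (sqrt (real n) * exitk (sinE (t n)) k x y)) \<longlonglongrightarrow> exp (- \<sigma>2 * \<xi>\<^sup>2 / 2) * (\<xi> * (\<Sum>k. exitk (\<lambda>x y. y + corrA x) k x y))" by simp
  have "(\<lambda>n. l n ^ n * (sqrt (real n) * sinE (t n) x y) + sqrt (real n) * err n - (\<Sum>k<n. l n ^ (n - Suc k) * (sqrt (real n) * exitk (sinE (t n)) k x y)))
     \<longlonglongrightarrow> exp (- \<sigma>2 * \<xi>\<^sup>2 / 2) * (\<xi> * (y + corrA x)) + 0 - exp (- \<sigma>2 * \<xi>\<^sup>2 / 2) * (\<xi> * (\<Sum>k. exitk (\<lambda>x y. y + corrA x) k x y))"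
    by (intro tendsto_intros main err ex)
  also have "exp (- \<sigma>2 * \<xi>\<^sup>2 / 2) * (\<xi> * (y + corrA x)) + 0 - exp (- \<sigma>2 * \<xi>\<^sup>2 / 2) * (\<xi> * (\<Sum>k. exitk (\<lambda>x y. y + corrA x) k x y)) = harmV x y * (\<xi> * exp (- \<sigma>2 * \<xi>\<^sup>2 / 2))"
    unfolding harmV_def by (simp add: algebra_simps)
  also have "(\<lambda>n. l n ^ n * (sqrt (real n) * sinE (t n) x y) + sqrt (real n) * err n - (\<Sum>k<n. l n ^ (n - Suc k) * (sqrt (real n) * exitk (sinE (t n)) k x y))) = (\<lambda>n. sqrt (real n) * (Q ^^ n) (sinE (t n)) x y)"
    unfolding decomp by (intro ext) (simp add: algebra_simps sum_distrib_left)
  finally show ?thesis .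
qed

text \<open>Replacing \<open>sinE\<close> by the plain sine costs O(t) on the event of survival.
  Since sqrt n times t stays bounded and the survival probability vanishes, the cost disappears in
  the limit.\<close>

theorem sine_limit:
  assumes t: "(\<lambda>n. sqrt (real n) * t n) \<longlonglongrightarrow> \<xi>"
  shows "(\<lambda>n. sqrt (real n) * (Q ^^ n) (\<lambda>x y. sin (t n * y)) x y) \<longlonglongrightarrow> harmV x y * (\<xi> * exp (- \<sigma>2 * \<xi>\<^sup>2 / 2))"
proof -
  have ev1: "\<forall>\<^sub>F n in sequentially. \<bar>t n\<bar> \<le> 1"
    using tendstoD[OF sqrt_scaled_null[OF t], of 1] by (auto simp: dist_real_def elim: eventually_mono)
  have "(\<lambda>n. \<bar>sqrt (real n) * t n\<bar> * (aM + dM) * surv P f n x y) \<longlonglongrightarrow> \<bar>\<xi>\<bar> * (aM + dM) * 0"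
    by (intro tendsto_intros t surv_tendsto_0)
  then have z: "(\<lambda>n. \<bar>sqrt (real n) * t n\<bar> * (aM + dM) * surv P f n x y) \<longlonglongrightarrow> 0" by simp
  have "(\<lambda>n. sqrt (real n) * (Q ^^ n) (\<lambda>x y. sin (t n * y)) x y - sqrt (real n) * (Q ^^ n) (sinE (t n)) x y) \<longlonglongrightarrow> 0"
  proof (rule Lim_null_comparison[OF _ z])
    show "\<forall>\<^sub>F n in sequentially. norm (sqrt (real n) * (Q ^^ n) (\<lambda>x y. sin (t n * y)) x y - sqrt (real n) * (Q ^^ n) (sinE (t n)) x y) \<le> \<bar>sqrt (real n) * t n\<bar> * (aM + dM) * surv P f n x y"
      using ev1 eventually_gt_at_top[of 0]
    proof eventually_elim
      case (elim n)
      have pt: "\<bar>sin (t n * y) - sinE (t n) x y\<bar> \<le> (\<bar>t n\<bar> * (aM + dM)) * 1" for x y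
      proof -
        have "\<bar>sin (t n * y) - sin (t n * (y + corrA x))\<bar> \<le> \<bar>t n\<bar> * aM"
        proof -
          have "\<bar>sin (t n * y) - sin (t n * (y + corrA x))\<bar> \<le> \<bar>t n * y - t n * (y + corrA x)\<bar>"
          proof -
            have "\<bar>sin p - sin q\<bar> \<le> \<bar>p - q\<bar>" for p q :: real
            proof -
              have "sin p - sin q = 2 * sin ((p - q) / 2) * cos ((p + q) / 2)" by (rule sin_diff_sin)
              then have "\<bar>sin p - sin q\<bar> = 2 * (\<bar>sin ((p - q) / 2)\<bar> * \<bar>cos ((p + q) / 2)\<bar>)" by (simp add: abs_mult)
              also have "\<dots> \<le> 2 * (\<bar>(p - q) / 2\<bar> * 1)"
                by (intro mult_left_mono mult_mono abs_sin_x_le_abs_x abs_cos_le_one) auto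
              finally show ?thesis by simp
            qed
            then show ?thesis .
          qed
          also have "\<dots> = \<bar>t n\<bar> * \<bar>corrA x\<bar>" by (simp add: distrib_left abs_mult)
          also have "\<dots> \<le> \<bar>t n\<bar> * aM" by (intro mult_left_mono aM) simp
          finally show ?thesis .
        qed
        moreover have "\<bar>sin (t n * (y + corrA x)) * ((t n)\<^sup>2 * corrD x / 2)\<bar> \<le> \<bar>t n\<bar> * dM"
        proof -
          have "\<bar>t n\<bar> * \<bar>t n\<bar> \<le> \<bar>t n\<bar> * 1" using elim(1) by (intro mult_left_mono) auto
          then have "(\<bar>t n\<bar> * \<bar>t n\<bar>) * \<bar>corrD x\<bar> \<le> (\<bar>t n\<bar> * 1) * dM" by (rule mult_mono[OF _ dM(1)]) simp_all
          moreover have "\<bar>sin (t n * (y + corrA x)) * ((t n)\<^sup>2 * corrD x / 2)\<bar> \<le> 1 * ((\<bar>t n\<bar> * \<bar>t n\<bar>) * \<bar>corrD x\<bar>)"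
          proof -
            have "\<bar>(t n)\<^sup>2 * corrD x / 2\<bar> = (\<bar>t n\<bar> * \<bar>t n\<bar>) * \<bar>corrD x\<bar> / 2" by (simp add: abs_mult power2_eq_square)
            moreover have "0 \<le> (\<bar>t n\<bar> * \<bar>t n\<bar>) * \<bar>corrD x\<bar>" by simp
            ultimately have "\<bar>(t n)\<^sup>2 * corrD x / 2\<bar> \<le> (\<bar>t n\<bar> * \<bar>t n\<bar>) * \<bar>corrD x\<bar>" by linarith
            then show ?thesis unfolding abs_mult[of "sin _"] by (rule mult_mono[OF abs_sin_le_one]) simp_all
          qed
          ultimately show ?thesis by simp
        qed
        moreover have "sin (t n * y) - sinE (t n) x y = (sin (t n * y) - sin (t n * (y + corrA x))) + sin (t n * (y + corrA x)) * ((t n)\<^sup>2 * corrD x / 2)"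
          by (simp add: sinE_eq right_diff_distrib)
        ultimately show ?thesis by (simp add: distrib_left abs_le_iff)
      qed
      have "\<bar>(Q ^^ n) (\<lambda>x y. sin (t n * y) - sinE (t n) x y) x y\<bar> \<le> (\<bar>t n\<bar> * (aM + dM)) * (Q ^^ n) (\<lambda>x y. 1) x y"
        by (rule Q_abs_le) (use pt elim in auto)
      then have "sqrt (real n) * \<bar>(Q ^^ n) (\<lambda>x y. sin (t n * y) - sinE (t n) x y) x y\<bar> \<le> sqrt (real n) * ((\<bar>t n\<bar> * (aM + dM)) * surv P f n x y)"
        unfolding surv_eq_killed by (intro mult_left_mono) auto
      moreover have "(Q ^^ n) (\<lambda>x y. sin (t n * y) - sinE (t n) x y) x y = (Q ^^ n) (\<lambda>x y. sin (t n * y)) x y - (Q ^^ n) (sinE (t n)) x y"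
        unfolding killed_step_def by (rule walk_step_pow_diff)
      ultimately show ?case by (simp add: right_diff_distrib[symmetric] abs_mult mult.assoc)
    qed
  qed
  from tendsto_add[OF this sinE_pow_tendsto[OF t, of x y]] show ?thesis by simp
qed

end

subsection \<open>Asymptotics of the survival probability\<close>

text \<open>The probability that a centred Gaussian of variance \<kappa> lies within v of zero. For
  positive v it tends to 1 as \<kappa> tends to 0, and it is a Gaussian mixture of the functions
  sin(\<xi> v) / \<xi>, to which \<open>sine_limit\<close> applies.\<close>

definition "Xi \<kappa> v = (\<integral>s. indicator {-v..v} s * normal_density 0 (sqrt \<kappa>) s \<partial>lborel)" for \<kappa> v :: real

lemma sin_quotient_integral:
  fixes \<xi> v :: real
  assumes "\<xi> \<noteq> 0" "v \<ge> 0"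
  shows "(\<integral>s. cos (\<xi> * s) * indicator {-v..v} s \<partial>lborel) = 2 * (sin (\<xi> * v) / \<xi>)"
proof -
  have "(\<integral>s. cos (\<xi> * s) * indicator {-v..v} s \<partial>lborel) = sin (\<xi> * v) / \<xi> - sin (\<xi> * (- v)) / \<xi>"
  proof (rule integral_FTC_Icc_real)
    show "DERIV (\<lambda>s. sin (\<xi> * s) / \<xi>) s :> cos (\<xi> * s)" for s
      using assms(1) by (auto intro!: derivative_eq_intros)
    show "isCont (\<lambda>s. cos (\<xi> * s)) s" for s by (intro continuous_intros)
  qed (use assms in simp)
  then show ?thesis by simp
qed

lemma abs_sin_quotient: "\<bar>sin (\<xi> * v) / \<xi>\<bar> \<le> \<bar>v\<bar>" for \<xi> v :: real
proof (cases "\<xi> = 0")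
  case False
  then show ?thesis using abs_sin_x_le_abs_x[of "\<xi> * v"] by (simp add: abs_mult field_simps)
qed simp

lemma sin_quotient_integrable:
  fixes \<kappa> v :: real
  assumes "\<kappa> > 0" shows "integrable lborel (\<lambda>\<xi>. exp (- \<kappa> * \<xi>\<^sup>2 / 2) * (sin (\<xi> * v) / \<xi>))"
  by (rule integrable_mult_bounded[OF gauss_integrable[OF assms] _ abs_sin_quotient]) measurable

text \<open>The quotient sin(\<xi> v) / \<xi> is half the integral of cos(\<xi> s) over |s| \<le> v;
  Fubini and the transform of the Gaussian do the rest.\<close>

lemma Xi_sine:
  assumes \<kappa>: "\<kappa> > 0" and v: "v \<ge> 0"
  shows "Xi \<kappa> v = (\<integral>\<xi>. exp (- \<kappa> * \<xi>\<^sup>2 / 2) * (sin (\<xi> * v) / \<xi>) \<partial>lborel) / pi"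
proof -
  have "(\<integral>\<xi>. exp (- \<kappa> * \<xi>\<^sup>2 / 2) * (sin (\<xi> * v) / \<xi>) \<partial>lborel) = (\<integral>\<xi>. (\<integral>s. exp (- \<kappa> * \<xi>\<^sup>2 / 2) * (cos (\<xi> * s) * indicator {-v..v} s) / 2 \<partial>lborel) \<partial>lborel)"
  proof (rule integral_cong_AE)
    show "AE \<xi> in lborel. exp (- \<kappa> * \<xi>\<^sup>2 / 2) * (sin (\<xi> * v) / \<xi>) = (\<integral>s. exp (- \<kappa> * \<xi>\<^sup>2 / 2) * (cos (\<xi> * s) * indicator {-v..v} s) / 2 \<partial>lborel)"
      using AE_lborel_singleton[of 0]
    proof eventually_elim
      case (elim \<xi>)
      have "(\<integral>s. exp (- \<kappa> * \<xi>\<^sup>2 / 2) * (cos (\<xi> * s) * indicator {-v..v} s) / 2 \<partial>lborel) = exp (- \<kappa> * \<xi>\<^sup>2 / 2) * (\<integral>s. cos (\<xi> * s) * indicator {-v..v} s \<partial>lborel) / 2"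
        by simp
      then show ?case using sin_quotient_integral[OF elim v] by simp
    qed
  qed measurable
  also have "\<dots> = (\<integral>s. (\<integral>\<xi>. exp (- \<kappa> * \<xi>\<^sup>2 / 2) * (cos (\<xi> * s) * indicator {-v..v} s) / 2 \<partial>lborel) \<partial>lborel)"
  proof (rule fubini_dominated)
    show "integrable lborel (\<lambda>\<xi>. exp (- \<kappa> * \<xi>\<^sup>2 / 2))" by (rule gauss_integrable[OF \<kappa>])
    show "integrable lborel (indicator {-v..v} :: real \<Rightarrow> real)" by (rule integrable_real_indicator) (auto simp: emeasure_lborel_Icc_eq)
    fix \<xi> s :: real
    have "\<bar>cos (\<xi> * s)\<bar> * indicator {-v..v} s / 2 \<le> 1 * indicator {-v..v} s / 2"
      by (intro divide_right_mono mult_right_mono abs_cos_le_one) auto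
    also have "\<dots> \<le> indicator {-v..v} s" by simp
    finally have "exp (- \<kappa> * \<xi>\<^sup>2 / 2) * (\<bar>cos (\<xi> * s)\<bar> * indicator {-v..v} s / 2) \<le> exp (- \<kappa> * \<xi>\<^sup>2 / 2) * indicator {-v..v} s"
      by (intro mult_left_mono) auto
    then show "\<bar>exp (- \<kappa> * \<xi>\<^sup>2 / 2) * (cos (\<xi> * s) * indicator {-v..v} s) / 2\<bar> \<le> exp (- \<kappa> * \<xi>\<^sup>2 / 2) * indicator {-v..v} s"
      by (simp add: abs_mult)
  qed measurable
  also have "\<dots> = (\<integral>s. pi * (indicator {-v..v} s * normal_density 0 (sqrt \<kappa>) s) \<partial>lborel)"
  proof (rule Bochner_Integration.integral_cong[OF refl])
    fix s :: real
    have "(\<integral>\<xi>. exp (- \<kappa> * \<xi>\<^sup>2 / 2) * (cos (\<xi> * s) * indicator {-v..v} s) / 2 \<partial>lborel) = (\<integral>\<xi>. indicator {-v..v} s / 2 * (exp (- \<kappa> * \<xi>\<^sup>2 / 2) * cos (s * \<xi>)) \<partial>lborel)"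
      by (intro Bochner_Integration.integral_cong) (auto simp: mult_ac)
    also have "\<dots> = indicator {-v..v} s / 2 * (sqrt (2 * pi / \<kappa>) * exp (- s\<^sup>2 / (2 * \<kappa>)))"
      unfolding integral_mult_right_zero gauss_cos[OF \<kappa>] ..
    also have "sqrt (2 * pi / \<kappa>) = 2 * pi / sqrt (2 * pi * \<kappa>)"
    proof -
      have "sqrt (2 * pi / \<kappa>) * sqrt (2 * pi * \<kappa>) = sqrt ((2 * pi)\<^sup>2)"
        using \<kappa> by (simp only: real_sqrt_mult[symmetric]) (simp add: power2_eq_square)
      also have "\<dots> = 2 * pi" unfolding real_sqrt_abs by simp
      finally have "sqrt (2 * pi / \<kappa>) * sqrt (2 * pi * \<kappa>) = 2 * pi" .
      moreover have "sqrt (2 * pi * \<kappa>) > 0" using \<kappa> by simp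
      ultimately show ?thesis by (metis less_irrefl nonzero_mult_div_cancel_right)
    qed
    finally show "(\<integral>\<xi>. exp (- \<kappa> * \<xi>\<^sup>2 / 2) * (cos (\<xi> * s) * indicator {-v..v} s) / 2 \<partial>lborel) = pi * (indicator {-v..v} s * normal_density 0 (sqrt \<kappa>) s)"
      using \<kappa> by (simp add: normal_density_def)
  qed
  finally show ?thesis by (simp add: Xi_def)
qed

lemma Xi_integrable: "\<kappa> > 0 \<Longrightarrow> integrable lborel (\<lambda>s. indicator {-v..v} s * normal_density 0 (sqrt \<kappa>) s)"
  using integrable_mult_bounded[OF integrable_normal_density, of "sqrt \<kappa>" "indicator {-v..v}" 1 0] by (simp add: mult.commute indicator_def)

lemma Xi_le_1: "\<kappa> > 0 \<Longrightarrow> Xi \<kappa> v \<le> 1"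
  unfolding Xi_def
  using integral_mono[OF Xi_integrable[of \<kappa> v] integrable_normal_density[of "sqrt \<kappa>" 0]] by (simp add: indicator_def)

lemma Xi_nonneg: "0 \<le> Xi \<kappa> v"
  unfolding Xi_def by (rule integral_nonneg_AE) simp

lemma Xi_tail:
  assumes \<kappa>: "\<kappa> > 0" and d: "0 < d" "d \<le> v"
  shows "1 - Xi \<kappa> v \<le> \<kappa> / d\<^sup>2"
proof -
  let ?n = "normal_density 0 (sqrt \<kappa>)"
  have m: "has_bochner_integral lborel (\<lambda>s. ?n s * (s - 0) ^ (2 * 1)) (fact (2 * 1) / ((2 / (sqrt \<kappa>)\<^sup>2) ^ 1 * fact 1))"
    by (rule normal_moment_even) (use \<kappa> in simp)
  have mi: "integrable lborel (\<lambda>s. ?n s * s\<^sup>2)" using m by (simp add: has_bochner_integral_iff power2_eq_square)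
  have mv: "(\<integral>s. ?n s * s\<^sup>2 \<partial>lborel) = \<kappa>" using m \<kappa> by (simp add: has_bochner_integral_iff fact_numeral)
  have "1 - Xi \<kappa> v = (\<integral>s. ?n s - indicator {-v..v} s * ?n s \<partial>lborel)"
    unfolding Xi_def using Xi_integrable[OF \<kappa>, of v] \<kappa> by simp
  also have "\<dots> \<le> (\<integral>s. 1 / d\<^sup>2 * (?n s * s\<^sup>2) \<partial>lborel)"
  proof (rule integral_mono)
    show "integrable lborel (\<lambda>s. ?n s - indicator {-v..v} s * ?n s)" using Xi_integrable[OF \<kappa>, of v] \<kappa> by simp
    show "integrable lborel (\<lambda>s. 1 / d\<^sup>2 * (?n s * s\<^sup>2))" using mi by (rule integrable_mult_right)
    fix s
    show "?n s - indicator {-v..v} s * ?n s \<le> 1 / d\<^sup>2 * (?n s * s\<^sup>2)"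
    proof (cases "s \<in> {-v..v}")
      case False
      then have "d \<le> \<bar>s\<bar>" using d by auto
      then have "d\<^sup>2 \<le> s\<^sup>2" using d power_mono[of d "\<bar>s\<bar>" 2] by simp
      then have "?n s * 1 \<le> ?n s * (s\<^sup>2 / d\<^sup>2)" using d by (intro mult_left_mono) auto
      then show ?thesis using False by simp
    qed simp
  qed
  also have "\<dots> = \<kappa> / d\<^sup>2" unfolding integral_mult_right_zero mv by simp
  finally show ?thesis .
qed

context markov_walk
begin

text \<open>A surviving walk is rarely as low as \<delta> sqrt n. Surviving the first half costs
  n^(-1/2); by the limit theorem for the free walk, the second half hits an interval of length
  \<delta> sqrt n with probability O(\<delta> + 1 / sqrt n), from anywhere.\<close>

lemma concentration:
  "\<exists>C\<ge>0. \<forall>n\<ge>2. \<forall>\<delta>\<ge>0. sqrt (real n) * (Q ^^ n) (\<lambda>x y. if y \<le> \<delta> * sqrt (real n) then 1 else 0) x y \<le> C * (\<delta> + 1 / sqrt (real n))"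
proof -
  obtain C where C: "C \<ge> 0" "\<forall>n x y. surv P f n x y * sqrt (real n) \<le> C * (2 + \<bar>y\<bar>)" using surv_bound by blast
  obtain K where K: "K \<ge> 0" "\<forall>Gm G Gp j x w. windowed (1/2) Gm G Gp \<longrightarrow> j \<ge> 1 \<longrightarrow> (T ^^ j) G x w \<le> K * totI Gp / sqrt (real j)"
    using T_upper by blast
  define N where "N = real (card (UNIV :: 'a set))"
  have N: "N \<ge> 0" by (simp add: N_def)
  define c where "c = C * (2 + \<bar>y\<bar>)"
  have c: "c \<ge> 0" using C by (simp add: c_def)
  have "sqrt (real n) * (Q ^^ n) (\<lambda>x y. if y \<le> \<delta> * sqrt (real n) then 1 else 0) x y \<le> (4 * K * N * c) * (\<delta> + 1 / sqrt (real n))"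
    if n: "n \<ge> 2" and \<delta>: "\<delta> \<ge> 0" for n \<delta>
  proof -
    let ?r = "sqrt (real n)"
    define a where "a = n div 2"
    define b where "b = n - a"
    have ab: "n = a + b" "a \<ge> 1" "b \<ge> 1" "n \<le> 4 * a" "n \<le> 4 * b" using n by (auto simp: a_def b_def)
    have ra: "?r \<le> 2 * sqrt (real a)" and rb: "?r \<le> 2 * sqrt (real b)"
    proof -
      have "?r \<le> sqrt (4 * real a)" "?r \<le> sqrt (4 * real b)" using ab(4,5) by (auto intro!: real_sqrt_le_mono)
      then show "?r \<le> 2 * sqrt (real a)" "?r \<le> 2 * sqrt (real b)" by (simp_all add: real_sqrt_mult)
    qed
    have rp: "?r > 0" "sqrt (real b) > 0" using n ab by auto
    define g where "g = (\<lambda>(x::'a) y. if y \<le> \<delta> * ?r then 1 else (0::real))"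
    define G where "G = (\<lambda>(z::'a). indicator {0<..\<delta> * ?r} :: real \<Rightarrow> real)"
    define Gp where "Gp = (\<lambda>(z::'a). indicator {-1/2..\<delta> * ?r + 1/2} :: real \<Rightarrow> real)"
    have dr: "\<delta> * ?r \<ge> 0" using \<delta> by simp
    have W: "windowed (1/2) (\<lambda>z r. 0) G Gp"
      unfolding windowed_def
    proof (intro conjI allI impI)
      show "integrable lborel (G z)" for z unfolding G_def by (rule integrable_real_indicator) (auto simp: dr)
      show "integrable lborel (Gp z)" for z unfolding Gp_def by (rule integrable_real_indicator) (auto simp: emeasure_lborel_Icc_eq)
      show "G z r \<le> Gp z (r + u)" if "\<bar>u\<bar> \<le> 1/2" for z r u using that by (auto simp: G_def Gp_def indicator_def abs_le_iff)
    qed (auto simp: G_def)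
    have tG: "totI Gp = N * (\<delta> * ?r + 1)" using dr by (simp add: totI_def Gp_def N_def)
    have "(Q ^^ b) g x' y' \<le> K * totI Gp / sqrt (real b) * 1" for x' y'
    proof -
      have "(Q ^^ b) g x' y' = (Q ^^ b) G x' y'"
        by (rule killed_pow_cong) (use ab in \<open>auto simp: g_def G_def\<close>)
      also have "\<dots> \<le> (T ^^ b) G x' y'" by (rule Q_le_T) (simp add: G_def)
      also have "\<dots> \<le> K * totI Gp / sqrt (real b)" using K(2) W ab(3) by blast
      finally show ?thesis by simp
    qed
    then have "(Q ^^ a) ((Q ^^ b) g) x y \<le> (Q ^^ a) (\<lambda>x y. K * totI Gp / sqrt (real b) * 1) x y" by (rule Q_mono)
    also have "\<dots> = K * totI Gp / sqrt (real b) * surv P f a x y" unfolding surv_eq_killed killed_step_def walk_step_pow_scale ..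
    finally have 1: "(Q ^^ n) g x y \<le> K * totI Gp / sqrt (real b) * surv P f a x y" unfolding ab(1) funpow_add o_def .
    have 2: "?r * surv P f a x y \<le> 2 * c"
    proof -
      have "?r * surv P f a x y \<le> 2 * sqrt (real a) * surv P f a x y" using ra surv_nonneg by (intro mult_right_mono) auto
      also have "\<dots> = 2 * (surv P f a x y * sqrt (real a))" by simp
      also have "\<dots> \<le> 2 * c" using C(2) by (simp add: c_def)
      finally show ?thesis .
    qed
    have 3: "totI Gp / sqrt (real b) \<le> 2 * N * (\<delta> + 1 / ?r)"
    proof -
      have "1 / sqrt (real b) \<le> 2 / ?r" using rb rp by (simp add: field_simps)
      then have "totI Gp * (1 / sqrt (real b)) \<le> totI Gp * (2 / ?r)" unfolding tG using N dr by (intro mult_left_mono) auto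
      also have "\<dots> = 2 * N * (\<delta> + 1 / ?r)" using rp unfolding tG by (simp add: field_simps)
      finally show ?thesis by simp
    qed
    have "?r * (Q ^^ n) g x y \<le> ?r * (K * totI Gp / sqrt (real b) * surv P f a x y)" using 1 by (intro mult_left_mono) auto
    also have "\<dots> = K * (totI Gp / sqrt (real b)) * (?r * surv P f a x y)" by simp
    also have "\<dots> \<le> K * (2 * N * (\<delta> + 1 / ?r)) * (2 * c)"
      by (rule mult_mono[OF mult_left_mono[OF 3 K(1)] 2]) (use K(1) N \<delta> surv_nonneg in auto)
    finally show ?thesis by (simp add: g_def mult_ac)
  qed
  moreover have "4 * K * N * c \<ge> 0" using K N c by simp
  ultimately show ?thesis by blast
qed

text \<open>The limit of the sine transforms is taken under the Gaussian integral over \<xi>, with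
  \<open>mean_bound\<close> as domination. The variances \<kappa> and \<open>\<sigma>2\<close> add
  in the exponent, and the remaining Gaussian integral over pi gives the constant.\<close>

lemma Xi_limit:
  assumes \<kappa>: "\<kappa> > 0"
  shows "(\<lambda>n. sqrt (real n) * (Q ^^ n) (\<lambda>x y. Xi \<kappa> (y / sqrt (real n))) x y) \<longlonglongrightarrow> harmV x y * sqrt (2 / pi) / sqrt (\<kappa> + \<sigma>2)"
proof -
  obtain C where C: "C \<ge> 0" "\<forall>n x y. (Q ^^ n) (\<lambda>x y. max 0 y) x y \<le> C + \<bar>y\<bar>" using mean_bound by blast
  let ?q = "\<lambda>n \<xi>. sqrt (real n) * (Q ^^ n) (\<lambda>x y. sin (\<xi> / sqrt (real n) * y)) x y"
  let ?i = "\<lambda>n \<xi>. exp (- \<kappa> * \<xi>\<^sup>2 / 2) * (?q n \<xi> / \<xi>)"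
  have repr: "sqrt (real n) * (Q ^^ n) (\<lambda>x y. Xi \<kappa> (y / sqrt (real n))) x y = (\<integral>\<xi>. ?i n \<xi> \<partial>lborel) / pi"
    and meas: "?i n \<in> borel_measurable lborel" if n: "n > 0" for n
  proof -
    let ?g = "\<lambda>\<xi> x y. exp (- \<kappa> * \<xi>\<^sup>2 / 2) * (sin (\<xi> * (y / sqrt (real n))) / \<xi>)"
    have int: "integrable lborel (\<lambda>\<xi>. ?g \<xi> x y)" for x :: 'a and y by (rule sin_quotient_integrable[OF \<kappa>])
    have gQ: "(Q ^^ n) (?g \<xi>) x y = exp (- \<kappa> * \<xi>\<^sup>2 / 2) / \<xi> * (Q ^^ n) (\<lambda>x y. sin (\<xi> / sqrt (real n) * y)) x y" for \<xi>
    proof -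
      have "?g \<xi> = (\<lambda>x y. (exp (- \<kappa> * \<xi>\<^sup>2 / 2) / \<xi>) * sin (\<xi> / sqrt (real n) * y))" by (intro ext) simp
      then have "(Q ^^ n) (?g \<xi>) x y = (Q ^^ n) (\<lambda>x y. (exp (- \<kappa> * \<xi>\<^sup>2 / 2) / \<xi>) * sin (\<xi> / sqrt (real n) * y)) x y" by (rule arg_cong)
      then show ?thesis unfolding killed_step_def walk_step_pow_scale[of _ _ _ "exp (- \<kappa> * \<xi>\<^sup>2 / 2) / \<xi>"] .
    qed
    have iQ: "integrable lborel (\<lambda>\<xi>. (Q ^^ n) (?g \<xi>) x y)" unfolding killed_step_def by (rule walk_step_pow_integral(1)[OF int])
    have i: "?i n \<xi> = sqrt (real n) * (Q ^^ n) (?g \<xi>) x y" for \<xi> unfolding gQ by simp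
    show "?i n \<in> borel_measurable lborel" unfolding i using borel_measurable_integrable[OF iQ] by measurable
    have "(Q ^^ n) (\<lambda>x y. Xi \<kappa> (y / sqrt (real n))) x y = (Q ^^ n) (\<lambda>x y. 1 / pi * (\<integral>\<xi>. ?g \<xi> x y \<partial>lborel)) x y"
      by (rule killed_pow_cong) (use n in \<open>auto simp: Xi_sine[OF \<kappa>]\<close>)
    also have "\<dots> = 1 / pi * (Q ^^ n) (\<lambda>x y. \<integral>\<xi>. ?g \<xi> x y \<partial>lborel) x y" unfolding killed_step_def walk_step_pow_scale ..
    also have "(Q ^^ n) (\<lambda>x y. \<integral>\<xi>. ?g \<xi> x y \<partial>lborel) x y = (\<integral>\<xi>. (Q ^^ n) (?g \<xi>) x y \<partial>lborel)"
      unfolding killed_step_def by (rule walk_step_pow_integral(2)[OF int])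
    finally show "sqrt (real n) * (Q ^^ n) (\<lambda>x y. Xi \<kappa> (y / sqrt (real n))) x y = (\<integral>\<xi>. ?i n \<xi> \<partial>lborel) / pi"
      unfolding i integral_mult_right_zero by simp
  qed
  have lim: "(\<lambda>n. \<integral>\<xi>. ?i (Suc n) \<xi> \<partial>lborel) \<longlonglongrightarrow> (\<integral>\<xi>. harmV x y * exp (- (\<kappa> + \<sigma>2) * \<xi>\<^sup>2 / 2) \<partial>lborel)"
  proof (rule integral_dominated_convergence[where w = "\<lambda>\<xi>. (C + \<bar>y\<bar>) * exp (- \<kappa> * \<xi>\<^sup>2 / 2)"])
    show "integrable lborel (\<lambda>\<xi>. (C + \<bar>y\<bar>) * exp (- \<kappa> * \<xi>\<^sup>2 / 2))" by (intro integrable_mult_right gauss_integrable \<kappa>)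
    show "?i (Suc n) \<in> borel_measurable lborel" for n by (rule meas) simp
    show "AE \<xi> in lborel. (\<lambda>n. ?i (Suc n) \<xi>) \<longlonglongrightarrow> harmV x y * exp (- (\<kappa> + \<sigma>2) * \<xi>\<^sup>2 / 2)"
      using AE_lborel_singleton[of 0]
    proof eventually_elim
      case (elim \<xi>)
      have "(\<lambda>n. sqrt (real n) * (\<xi> / sqrt (real n))) \<longlonglongrightarrow> \<xi>"
      proof (rule Lim_transform_eventually[OF tendsto_const])
        show "\<forall>\<^sub>F n in sequentially. \<xi> = sqrt (real n) * (\<xi> / sqrt (real n))"
          using eventually_gt_at_top[of 0] by eventually_elim simp
      qed
      then have "(\<lambda>n. ?q n \<xi>) \<longlonglongrightarrow> harmV x y * (\<xi> * exp (- \<sigma>2 * \<xi>\<^sup>2 / 2))" by (rule sine_limit)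
      then have q: "(\<lambda>n. ?q (Suc n) \<xi>) \<longlonglongrightarrow> harmV x y * (\<xi> * exp (- \<sigma>2 * \<xi>\<^sup>2 / 2))" by (rule LIMSEQ_Suc)
      have "(\<lambda>n. ?i (Suc n) \<xi>) \<longlonglongrightarrow> exp (- \<kappa> * \<xi>\<^sup>2 / 2) * (harmV x y * (\<xi> * exp (- \<sigma>2 * \<xi>\<^sup>2 / 2)) / \<xi>)"
        by (rule tendsto_mult[OF tendsto_const tendsto_divide[OF q tendsto_const elim]])
      also have "exp (- \<kappa> * \<xi>\<^sup>2 / 2) * (harmV x y * (\<xi> * exp (- \<sigma>2 * \<xi>\<^sup>2 / 2)) / \<xi>) = harmV x y * (exp (- \<kappa> * \<xi>\<^sup>2 / 2) * exp (- \<sigma>2 * \<xi>\<^sup>2 / 2))"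
        using elim by simp
      also have "exp (- \<kappa> * \<xi>\<^sup>2 / 2) * exp (- \<sigma>2 * \<xi>\<^sup>2 / 2) = exp (- (\<kappa> + \<sigma>2) * \<xi>\<^sup>2 / 2)"
        unfolding exp_add[symmetric] by (simp add: algebra_simps add_divide_distrib)
      finally show ?case .
    qed
    show "AE \<xi> in lborel. norm (?i (Suc n) \<xi>) \<le> (C + \<bar>y\<bar>) * exp (- \<kappa> * \<xi>\<^sup>2 / 2)" for n
    proof (rule AE_I2)
      fix \<xi>
      let ?r = "sqrt (real (Suc n))"
      have "\<bar>(Q ^^ Suc n) (\<lambda>x y. sin (\<xi> / ?r * y)) x y\<bar> \<le> (\<bar>\<xi>\<bar> / ?r) * (Q ^^ Suc n) (\<lambda>x y. max 0 y) x y"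
      proof (rule Q_abs_le)
        show "\<bar>sin (\<xi> / ?r * y)\<bar> \<le> (\<bar>\<xi>\<bar> / ?r) * max 0 y" if "y > 0" for y :: real
          using abs_sin_x_le_abs_x[of "\<xi> / ?r * y"] that by (simp add: abs_mult)
      qed simp
      also have "\<dots> \<le> (\<bar>\<xi>\<bar> / ?r) * (C + \<bar>y\<bar>)" by (rule mult_left_mono[OF C(2)[rule_format]]) simp
      finally have "?r * \<bar>(Q ^^ Suc n) (\<lambda>x y. sin (\<xi> / ?r * y)) x y\<bar> \<le> ?r * ((\<bar>\<xi>\<bar> / ?r) * (C + \<bar>y\<bar>))" by (intro mult_left_mono) auto
      then have "\<bar>?q (Suc n) \<xi>\<bar> \<le> \<bar>\<xi>\<bar> * (C + \<bar>y\<bar>)" by (simp add: abs_mult)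
      then have "\<bar>?q (Suc n) \<xi> / \<xi>\<bar> \<le> C + \<bar>y\<bar>" using C(1) by (cases "\<xi> = 0") (simp_all add: field_simps)
      then have "exp (- \<kappa> * \<xi>\<^sup>2 / 2) * \<bar>?q (Suc n) \<xi> / \<xi>\<bar> \<le> exp (- \<kappa> * \<xi>\<^sup>2 / 2) * (C + \<bar>y\<bar>)" by (intro mult_left_mono) auto
      then show "norm (?i (Suc n) \<xi>) \<le> (C + \<bar>y\<bar>) * exp (- \<kappa> * \<xi>\<^sup>2 / 2)" by (simp only: real_norm_def abs_mult abs_exp_cancel mult.commute)
    qed
  qed measurable
  have p: "\<kappa> + \<sigma>2 > 0" using \<kappa> \<sigma>2_pos by simp
  have "(\<integral>\<xi>. harmV x y * exp (- (\<kappa> + \<sigma>2) * \<xi>\<^sup>2 / 2) \<partial>lborel) = harmV x y * (\<integral>\<xi>. exp (- (\<kappa> + \<sigma>2) * \<xi>\<^sup>2 / 2) * cos (0 * \<xi>) \<partial>lborel)" by simp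
  also have "\<dots> = harmV x y * sqrt (2 * pi / (\<kappa> + \<sigma>2))" unfolding gauss_cos[OF p] by simp
  finally have I: "(\<integral>\<xi>. harmV x y * exp (- (\<kappa> + \<sigma>2) * \<xi>\<^sup>2 / 2) \<partial>lborel) = harmV x y * sqrt (2 * pi / (\<kappa> + \<sigma>2))" .
  have "(\<lambda>n. (\<integral>\<xi>. ?i (Suc n) \<xi> \<partial>lborel) / pi) \<longlonglongrightarrow> harmV x y * sqrt (2 * pi / (\<kappa> + \<sigma>2)) / pi"
    using lim unfolding I by (intro tendsto_divide tendsto_const) auto
  moreover have "harmV x y * sqrt (2 * pi / (\<kappa> + \<sigma>2)) / pi = harmV x y * sqrt (2 / pi) / sqrt (\<kappa> + \<sigma>2)"
  proof -
    have "sqrt (2 * pi) / pi = sqrt (2 / pi)"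
    proof -
      have "sqrt (2 / pi) = sqrt ((2 * pi) / pi\<^sup>2)" by (simp add: power2_eq_square)
      then show ?thesis by (simp only: real_sqrt_divide real_sqrt_abs) simp
    qed
    moreover have "harmV x y * (sqrt (2 * pi) / sqrt (\<kappa> + \<sigma>2)) / pi = harmV x y * (sqrt (2 * pi) / pi) / sqrt (\<kappa> + \<sigma>2)" by simp
    ultimately show ?thesis by (simp only: real_sqrt_divide[of "2 * pi" "\<kappa> + \<sigma>2"])
  qed
  ultimately have "(\<lambda>n. sqrt (real (Suc n)) * (Q ^^ Suc n) (\<lambda>x y. Xi \<kappa> (y / sqrt (real (Suc n)))) x y) \<longlonglongrightarrow> harmV x y * sqrt (2 / pi) / sqrt (\<kappa> + \<sigma>2)"
    by (simp only: repr zero_less_Suc)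
  then show ?thesis by (rule LIMSEQ_imp_Suc)
qed

text \<open>From below, Xi \<le> 1. From above, at positive levels 1 is at most Xi plus the
  indicator of a low level plus a Chebyshev tail. Both bounds meet when \<kappa> tends to
  zero.\<close>

theorem surv_limit: "(\<lambda>n. sqrt (real n) * surv P f n x y) \<longlonglongrightarrow> harmV x y * sqrt (2 / pi) / sqrt \<sigma>2"
proof (rule LIMSEQ_I)
  fix e :: real assume e: "e > 0"
  obtain C where C: "C \<ge> 0" "\<forall>n\<ge>2. \<forall>\<delta>\<ge>0. sqrt (real n) * (Q ^^ n) (\<lambda>x y. if y \<le> \<delta> * sqrt (real n) then 1 else 0) x y \<le> C * (\<delta> + 1 / sqrt (real n))"
    using concentration by blast
  obtain C' where C': "C' \<ge> 0" "\<forall>n x y. surv P f n x y * sqrt (real n) \<le> C' * (2 + \<bar>y\<bar>)" using surv_bound by blast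
  let ?c = "C' * (2 + \<bar>y\<bar>)"
  \<comment> \<open>\<delta> is fixed before \<kappa>: low levels cost about C \<delta>, whereas the
    tail costs a multiple of \<kappa> / \<delta>^2.\<close>
  define \<delta> where "\<delta> = e / 8 / (C + 1)"
  have \<delta>: "\<delta> > 0" "C * \<delta> \<le> e / 8"
  proof -
    show "\<delta> > 0" using e C by (simp add: \<delta>_def)
    then have "C * \<delta> \<le> (C + 1) * \<delta>" by (intro mult_right_mono) auto
    also have "\<dots> = e / 8"
    proof -
      have "C + 1 \<noteq> 0" using C(1) by linarith
      then show ?thesis unfolding \<delta>_def times_divide_eq_right[of "C + 1" "e / 8" "C + 1"] by (rule nonzero_mult_div_cancel_left)
    qed
    finally show "C * \<delta> \<le> e / 8" .
  qed
  let ?L = "\<lambda>\<kappa>. harmV x y * sqrt (2 / pi) / sqrt (\<kappa> + \<sigma>2)"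
  have "(?L \<longlongrightarrow> ?L 0) (at_right 0)" using \<sigma>2_pos by (intro tendsto_intros) auto
  then have "\<forall>\<^sub>F \<kappa> in at_right 0. \<bar>?L \<kappa> - ?L 0\<bar> < e / 4" using e by (auto dest!: tendstoD[where e = "e/4"] simp: dist_real_def)
  moreover have "((\<lambda>\<kappa>. ?c * (\<kappa> / \<delta>\<^sup>2)) \<longlongrightarrow> ?c * (0 / \<delta>\<^sup>2)) (at_right 0)" using \<delta> by (intro tendsto_intros) auto
  then have "\<forall>\<^sub>F \<kappa> in at_right 0. ?c * (\<kappa> / \<delta>\<^sup>2) < e / 4" using e by (intro order_tendstoD) auto
  moreover have "\<forall>\<^sub>F \<kappa>::real in at_right 0. \<kappa> > 0" by (simp add: eventually_at_right_less)
  ultimately have "\<forall>\<^sub>F \<kappa> in at_right 0. \<bar>?L \<kappa> - ?L 0\<bar> < e / 4 \<and> ?c * (\<kappa> / \<delta>\<^sup>2) < e / 4 \<and> \<kappa> > 0" by eventually_elim simp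
  then obtain \<kappa> where \<kappa>: "\<bar>?L \<kappa> - ?L 0\<bar> < e / 4" "?c * (\<kappa> / \<delta>\<^sup>2) < e / 4" "\<kappa> > 0"
    using eventually_happens trivial_limit_at_right_real by blast
  let ?X = "\<lambda>n. sqrt (real n) * (Q ^^ n) (\<lambda>x y. Xi \<kappa> (y / sqrt (real n))) x y"
  have ev1: "\<forall>\<^sub>F n in sequentially. \<bar>?X n - ?L \<kappa>\<bar> < e / 4"
    using tendstoD[OF Xi_limit[OF \<kappa>(3), of x y], of "e / 4"] e by (simp add: dist_real_def)
  have "(\<lambda>n. C * (1 / sqrt (real n))) \<longlonglongrightarrow> C * 0" by (intro tendsto_mult tendsto_const) real_asymp
  then have ev2: "\<forall>\<^sub>F n in sequentially. C * (1 / sqrt (real n)) < e / 8" using e by (intro order_tendstoD) auto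
  have "\<forall>\<^sub>F n in sequentially. norm (sqrt (real n) * surv P f n x y - ?L 0) < e"
    using ev1 ev2 eventually_ge_at_top[of 2]
  proof eventually_elim
    case (elim n)
    let ?r = "sqrt (real n)"
    have r: "?r > 0" using elim(3) by simp
    have lo: "?X n \<le> ?r * surv P f n x y"
      unfolding surv_eq_killed by (intro mult_left_mono Q_mono Xi_le_1 \<kappa>) auto
    have "surv P f n x y \<le> (Q ^^ n) (\<lambda>x y. Xi \<kappa> (y / ?r) + ((if y \<le> \<delta> * ?r then 1 else 0) + \<kappa> / \<delta>\<^sup>2 * 1)) x y"
      unfolding surv_eq_killed
    proof (rule killed_pow_mono[OF P_nonneg])
      fix x :: 'a and y :: real assume y: "y > 0"
      show "1 \<le> Xi \<kappa> (y / ?r) + ((if y \<le> \<delta> * ?r then 1 else 0) + \<kappa> / \<delta>\<^sup>2 * 1)"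
      proof (cases "y \<le> \<delta> * ?r")
        case True
        then show ?thesis using Xi_nonneg[of \<kappa> "y / ?r"] \<kappa>(3) by simp
      next
        case False
        then have "\<delta> \<le> y / ?r" using r by (simp add: field_simps)
        from Xi_tail[OF \<kappa>(3) \<delta>(1) this] False show ?thesis by simp
      qed
    qed (use elim(3) in simp)
    also have "\<dots> = (Q ^^ n) (\<lambda>x y. Xi \<kappa> (y / ?r)) x y + ((Q ^^ n) (\<lambda>x y. if y \<le> \<delta> * ?r then 1 else 0) x y + \<kappa> / \<delta>\<^sup>2 * surv P f n x y)"
      unfolding surv_eq_killed killed_step_def walk_step_pow_add walk_step_pow_scale ..
    finally have "?r * surv P f n x y \<le> ?r * ((Q ^^ n) (\<lambda>x y. Xi \<kappa> (y / ?r)) x y + ((Q ^^ n) (\<lambda>x y. if y \<le> \<delta> * ?r then 1 else 0) x y + \<kappa> / \<delta>\<^sup>2 * surv P f n x y))"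
      by (intro mult_left_mono) auto
    also have "\<dots> = ?X n + ?r * (Q ^^ n) (\<lambda>x y. if y \<le> \<delta> * ?r then 1 else 0) x y + \<kappa> / \<delta>\<^sup>2 * (surv P f n x y * ?r)"
      by (simp only: distrib_left add.assoc mult_ac)
    also have "?r * (Q ^^ n) (\<lambda>x y. if y \<le> \<delta> * ?r then 1 else 0) x y \<le> C * (\<delta> + 1 / ?r)" using C(2) elim(3) \<delta>(1) by (simp add: less_imp_le)
    also have "\<kappa> / \<delta>\<^sup>2 * (surv P f n x y * ?r) \<le> \<kappa> / \<delta>\<^sup>2 * ?c" using C'(2) \<kappa>(3) by (intro mult_left_mono) auto
    finally have hi: "?r * surv P f n x y \<le> ?X n + C * (\<delta> + 1 / ?r) + \<kappa> / \<delta>\<^sup>2 * ?c" by simp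
    have "C * (\<delta> + 1 / ?r) < e / 4" unfolding distrib_left using \<delta>(2) elim(2) by linarith
    moreover have "\<kappa> / \<delta>\<^sup>2 * ?c < e / 4" using \<kappa>(2) by (simp only: mult.commute)
    ultimately show ?case using lo hi elim(1) \<kappa>(1) unfolding real_norm_def abs_less_iff by linarith
  qed
  then show "\<exists>no. \<forall>n\<ge>no. norm (sqrt (real n) * surv P f n x y - harmV x y * sqrt (2 / pi) / sqrt \<sigma>2) < e"
    by (simp add: eventually_sequentially)
qed

text \<open>\<open>surv_limit\<close> supplies the convergence that gives the value of
  \<open>lim\<close> a meaning; its constant cancels the normalisation in
  \<open>Vfun\<close>.\<close>

lemma Vfun_eq_harmV: "Vfun P f (sqrt \<sigma>2) x y = harmV x y"
proof -
  have "lim (\<lambda>n. sqrt (real n) * surv P f n x y) = harmV x y * sqrt (2 / pi) / sqrt \<sigma>2"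
    by (rule limI[OF surv_limit])
  then have "Vfun P f (sqrt \<sigma>2) x y = harmV x y * (sqrt (2 * pi) * sqrt (2 / pi)) / 2" using \<sigma>2_pos by (simp add: Vfun_def)
  also have "sqrt (2 * pi) * sqrt (2 / pi) = 2" by (simp add: real_sqrt_mult[symmetric])
  finally show ?thesis by simp
qed

lemma harmV_measurable [measurable]: "harmV x \<in> borel_measurable borel"
proof -
  have "(\<lambda>y. sqrt (real n) * surv P f n x y * (sqrt \<sigma>2 / sqrt (2 / pi))) \<in> borel_measurable borel" for n
    proof -
    have [measurable]: "(Q ^^ n) (\<lambda>x y. 1) x \<in> borel_measurable borel" by (rule killed_step_measurable) simp
    show ?thesis unfolding surv_eq_killed by measurable
  qed
  moreover have "(\<lambda>n. sqrt (real n) * surv P f n x y * (sqrt \<sigma>2 / sqrt (2 / pi))) \<longlonglongrightarrow> harmV x y" for y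
    using tendsto_mult[OF surv_limit[of x y] tendsto_const[of "sqrt \<sigma>2 / sqrt (2 / pi)"]] \<sigma>2_pos by simp
  ultimately show ?thesis by (rule borel_measurable_LIMSEQ_real[rotated]) 
qed

end

subsection \<open>The dual chain\<close>

context markov_walk
begin

lemma Pker_Suc_right: "Pker (Suc n) x z = (\<Sum>u\<in>UNIV. Pker n x u * P u z)"
proof -
  have "Pker (Suc n) x z = Ppow P (n + 1) (\<lambda>w. if w = z then 1 else 0) x" by (simp add: Pker_def)
  also have "\<dots> = Ppow P n (Ppow P 1 (\<lambda>w. if w = z then 1 else 0)) x" unfolding Ppow_add ..
  also have "Ppow P 1 (\<lambda>w. if w = z then 1 else 0) = (\<lambda>u. P u z)"
    by (intro ext) (simp add: Pop_def if_distrib[of "\<lambda>v. v * _"] sum.delta cong: if_cong)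
  also have "Ppow P n (\<lambda>u. P u z) x = (\<Sum>u\<in>UNIV. P u z * Pker n x u)" unfolding Pker_def by (rule Ppow_kernel)
  finally show ?thesis by (simp only: mult.commute)
qed

text \<open>Time reversal over n steps: the intermediate values of \<open>\<nu>\<close> cancel,
  leaving those at the two ends.\<close>

lemma Ppow_dual: "Ppow (Pdual P \<nu>) n g x = (\<Sum>x'\<in>UNIV. g x' * \<nu> x' * Pker n x' x) / \<nu> x"
proof (induction n arbitrary: x)
  case 0
  show ?case using nu_pos[of x] by (simp add: Pker_0 if_distrib[of "\<lambda>v. _ * v"] sum.delta cong: if_cong)
next
  case (Suc n)
  have "Ppow (Pdual P \<nu>) (Suc n) g x = (\<Sum>u\<in>UNIV. ((\<Sum>x'\<in>UNIV. g x' * \<nu> x' * Pker n x' u) / \<nu> u) * (\<nu> u / \<nu> x * P u x))"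
    by (simp add: Pop_def Suc.IH[abs_def] Suc.IH Pdual_def)
  also have "\<dots> = (\<Sum>u\<in>UNIV. \<Sum>x'\<in>UNIV. g x' * \<nu> x' * (Pker n x' u * P u x)) / \<nu> x"
  proof -
    have "(\<Sum>x'\<in>UNIV. g x' * \<nu> x' * Pker n x' u) / \<nu> u * (\<nu> u / \<nu> x * P u x) = (\<Sum>x'\<in>UNIV. g x' * \<nu> x' * (Pker n x' u * P u x)) / \<nu> x" for u
    proof -
      have "S / \<nu> u * (\<nu> u / \<nu> x * P u x) = S * P u x / \<nu> x" for S using nu_pos[of u] by simp
      then show ?thesis by (simp only: sum_distrib_right mult.assoc)
    qed
    then show ?thesis by (simp only: sum_divide_distrib[symmetric])
  qed
  also have "(\<Sum>u\<in>UNIV. \<Sum>x'\<in>UNIV. g x' * \<nu> x' * (Pker n x' u * P u x)) = (\<Sum>x'\<in>UNIV. g x' * \<nu> x' * Pker (Suc n) x' x)"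
    unfolding Pker_Suc_right sum_distrib_left by (rule sum.swap)
  finally show ?case .
qed

lemma dual_stochastic: "stochastic (Pdual P \<nu>)"
proof -
  have "(\<Sum>y\<in>UNIV. Pdual P \<nu> x y) = (\<Sum>y\<in>UNIV. \<nu> y * P y x) / \<nu> x" for x
    by (simp add: Pdual_def sum_divide_distrib)
  then show ?thesis using nu_pos P_nonneg by (auto simp: stochastic_def Pdual_def nu_inv less_imp_le less_imp_neq[symmetric])
qed

lemma dual_invariant: "invariant_prob (Pdual P \<nu>) \<nu>"
proof -
  have "(\<Sum>x\<in>UNIV. \<nu> x * Pdual P \<nu> x y) = (\<Sum>x\<in>UNIV. \<nu> y * P y x)" for y
    using nu_pos by (intro sum.cong refl) (simp add: Pdual_def less_imp_neq[symmetric])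
  then show ?thesis by (simp add: invariant_prob_def nu_nonneg nu_sum sum_distrib_left[symmetric] P_sum)
qed

lemma dual_H1: "H1 (Pdual P \<nu>)"
proof -
  obtain k0 where k0: "k0 \<ge> 1" and k: "\<forall>x x'. Ppow P k0 (\<lambda>z. if z = x' then 1 else 0) x > 0" using ex_positive_power by blast
  have pk: "Pker k0 x z > 0" for x z using k by (simp add: Pker_def)
  have "Ppow (Pdual P \<nu>) k0 g x > 0" if g: "\<forall>x. g x \<ge> 0" "g x0 \<noteq> 0" for g x x0
  proof -
    have "g x0 > 0" using g by (metis order_le_less)
    then have "0 < g x0 * \<nu> x0 * Pker k0 x0 x" using nu_pos pk by simp
    also have "\<dots> \<le> (\<Sum>x'\<in>UNIV. g x' * \<nu> x' * Pker k0 x' x)"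
      by (rule member_le_sum) (use g nu_nonneg Pker_nonneg in auto)
    finally show ?thesis unfolding Ppow_dual using nu_pos by simp
  qed
  then show ?thesis unfolding H1_def using k0 by blast
qed

text \<open>A cycle traversed backwards is possible for the dual chain and carries the opposite sum,
  so the original condition is used with the opposite \<theta>.\<close>

lemma dual_H3: "H3 (Pdual P \<nu>) (\<lambda>u. - f u)"
  unfolding H3_def
proof (intro allI)
  fix \<theta> a :: real
  from nonlattice[unfolded H3_def, rule_format, of "- \<theta>" a] obtain n xs where
    pr: "(\<Prod>i<n. P (xs i) (xs (Suc i))) * P (xs n) (xs 0) > 0"
    and ns: "(\<Sum>i\<le>n. f (xs i)) - real (n + 1) * (- \<theta>) \<notin> {a * of_int k | k. True}" by blast
  have "(\<Prod>i<n. P (xs i) (xs (Suc i))) \<ge> 0" by (intro prod_nonneg) (auto simp: P_nonneg)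
  then have pp: "(\<Prod>i<n. P (xs i) (xs (Suc i))) > 0" and pn: "P (xs n) (xs 0) > 0"
    using pr by (auto simp: zero_less_mult_iff)
  have ps: "P (xs i) (xs (Suc i)) > 0" if "i < n" for i
    using pp P_nonneg[of "xs i" "xs (Suc i)"] that
    by (metis finite_lessThan lessThan_iff less_irrefl order_le_less prod_zero)
  define ys where "ys i = xs (n - i)" for i
  have "(\<Prod>i<n. Pdual P \<nu> (ys i) (ys (Suc i))) > 0"
  proof (rule prod_pos)
    fix i assume i: "i \<in> {..<n}"
    then have "P (xs (n - Suc i)) (xs (Suc (n - Suc i))) > 0" by (intro ps) auto
    moreover have "Suc (n - Suc i) = n - i" using i by auto
    ultimately show "0 < Pdual P \<nu> (ys i) (ys (Suc i))" using nu_pos by (simp add: Pdual_def ys_def)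
  qed
  moreover have "Pdual P \<nu> (ys n) (ys 0) > 0" using nu_pos pn by (simp add: Pdual_def ys_def)
  moreover have "(\<Sum>i\<le>n. - f (ys i)) - real (n + 1) * \<theta> \<notin> {a * of_int k | k. True}"
  proof
    assume "(\<Sum>i\<le>n. - f (ys i)) - real (n + 1) * \<theta> \<in> {a * of_int k | k. True}"
    then obtain k :: int where k: "(\<Sum>i\<le>n. - f (ys i)) - real (n + 1) * \<theta> = a * of_int k" by auto
    have "(\<Sum>i\<le>n. f (ys i)) = (\<Sum>i\<le>n. f (xs i))"
      unfolding ys_def lessThan_Suc_atMost[symmetric] using sum.nat_diff_reindex[of "\<lambda>i. f (xs i)" "Suc n"] by simp
    then have "(\<Sum>i\<le>n. f (xs i)) - real (n + 1) * (- \<theta>) = a * of_int (- k)" using k by (simp add: sum_negf)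
    then show False using ns by blast
  qed
  ultimately show "\<exists>(n::nat) (xs::nat \<Rightarrow> 'a). (\<Prod>i<n. Pdual P \<nu> (xs i) (xs (Suc i))) * Pdual P \<nu> (xs n) (xs 0) > 0 \<and>
      (\<Sum>i\<le>n. - f (xs i)) - real (n + 1) * \<theta> \<notin> {a * of_int k | k. True}"
    by (intro exI[of _ n] exI[of _ ys] conjI mult_pos_pos)
qed

lemma dual_walk: "markov_walk (Pdual P \<nu>) \<nu> (\<lambda>u. - f u)"
  using dual_stochastic dual_invariant dual_H1 dual_H3 centred'
  by unfold_locales (simp_all add: H2_def sum_negf)

text \<open>Stationary covariances are symmetric under time reversal, and the two changes of sign of
  f cancel.\<close>

lemma dual_sigma2: "sigma2 (Pdual P \<nu>) \<nu> (\<lambda>u. - f u) = sigma2 P \<nu> f"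
proof -
  have "(\<Sum>x\<in>UNIV. - f x * Ppow (Pdual P \<nu>) (Suc n) (\<lambda>u. - f u) x * \<nu> x) = (\<Sum>x\<in>UNIV. f x * Ppow P (Suc n) f x * \<nu> x)" for n
  proof -
    have "(\<Sum>x\<in>UNIV. - f x * Ppow (Pdual P \<nu>) (Suc n) (\<lambda>u. - f u) x * \<nu> x) = (\<Sum>x\<in>UNIV. \<Sum>x'\<in>UNIV. f x * (f x' * \<nu> x' * Pker (Suc n) x' x))"
    proof (intro sum.cong refl)
      fix x
      have "Ppow (Pdual P \<nu>) (Suc n) (\<lambda>u. - f u) x * \<nu> x = (\<Sum>x'\<in>UNIV. - f x' * \<nu> x' * Pker (Suc n) x' x)"
        unfolding Ppow_dual using nu_pos[of x] by simp
      then have "- f x * Ppow (Pdual P \<nu>) (Suc n) (\<lambda>u. - f u) x * \<nu> x = - f x * (\<Sum>x'\<in>UNIV. - f x' * \<nu> x' * Pker (Suc n) x' x)"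
        by (simp only: mult.assoc)
      also have "\<dots> = (\<Sum>x'\<in>UNIV. f x * (f x' * \<nu> x' * Pker (Suc n) x' x))" by (simp add: sum_distrib_left sum_negf)
      finally show "- f x * Ppow (Pdual P \<nu>) (Suc n) (\<lambda>u. - f u) x * \<nu> x = (\<Sum>x'\<in>UNIV. f x * (f x' * \<nu> x' * Pker (Suc n) x' x))" .
    qed
    also have "\<dots> = (\<Sum>x'\<in>UNIV. \<Sum>x\<in>UNIV. f x * (f x' * \<nu> x' * Pker (Suc n) x' x))" by (rule sum.swap)
    also have "\<dots> = (\<Sum>x'\<in>UNIV. f x' * Ppow P (Suc n) f x' * \<nu> x')"
    proof (intro sum.cong refl)
      fix x'
      have "Ppow P (Suc n) f x' = (\<Sum>x\<in>UNIV. f x * Pker (Suc n) x' x)" unfolding Pker_def by (rule Ppow_kernel)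
      then show "(\<Sum>x\<in>UNIV. f x * (f x' * \<nu> x' * Pker (Suc n) x' x)) = f x' * Ppow P (Suc n) f x' * \<nu> x'"
        by (simp add: sum_distrib_left sum_distrib_right mult_ac)
    qed
    finally show ?thesis .
  qed
  then show ?thesis unfolding sigma2_def by simp
qed

section \<open>Factorisation of the killed step and adjoints\<close>

definition "Pm g x y = (\<Sum>x'\<in>UNIV. P x x' * g x' y)" for g :: "'a \<Rightarrow> real \<Rightarrow> real" and y :: real
definition "Pd g x y = (\<Sum>x'\<in>UNIV. Pdual P \<nu> x x' * g x' y)" for g :: "'a \<Rightarrow> real \<Rightarrow> real" and y :: real
definition "Mf g x y = (if y + f x > 0 then g x (y + f x) else 0)" for g :: "'a \<Rightarrow> real \<Rightarrow> real" and y :: real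
definition "Md g x y = (if y - f x > 0 then g x (y - f x) else 0)" for g :: "'a \<Rightarrow> real \<Rightarrow> real" and y :: real

abbreviation "Qd \<equiv> killed_step (Pdual P \<nu>) (\<lambda>u. - f u)"

text \<open>A killed step averages over the next state after a translation with killing. The two
  factors have simple adjoints: \<open>Pd\<close> for the average, with respect to
  \<open>\<nu>\<close>, and \<open>Md\<close> for the translation, with respect to Lebesgue measure
  on the positive levels.\<close>

lemma Q_eq_Pm_Mf: "Q g = Pm (Mf g)"
  by (intro ext) (auto simp: killed_step_def walk_step_def Pm_def Mf_def intro!: sum.cong)

lemma Qd_eq_Pd_Md: "Qd g = Pd (Md g)"
  by (intro ext) (auto simp: killed_step_def walk_step_def Pd_def Md_def intro!: sum.cong)

text \<open>\<open>tame\<close> and \<open>tame0\<close> make the pairing below converge: both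
  functions bounded and measurable, one of them zero at high levels. Nonpositive levels are excluded
  by the pairing itself.\<close>

definition "tame g \<longleftrightarrow> (\<forall>x::'a. g x \<in> borel_measurable borel) \<and> (\<exists>B. \<forall>x y. \<bar>g x y\<bar> \<le> B)" for g :: "'a \<Rightarrow> real \<Rightarrow> real"
definition "tame0 g \<longleftrightarrow> tame g \<and> (\<exists>r. \<forall>x y. y > r \<longrightarrow> g x y = 0)" for g :: "'a \<Rightarrow> real \<Rightarrow> real"

lemma wsum_bound:
  assumes "\<And>x'. w x' \<ge> 0" "(\<Sum>x'\<in>UNIV. w x') = 1" "\<And>x'. \<bar>g x'\<bar> \<le> B"
  shows "\<bar>\<Sum>x'\<in>(UNIV::'a set). w x' * (g x' :: real)\<bar> \<le> B"
proof -
  have "\<bar>\<Sum>x'\<in>UNIV. w x' * g x'\<bar> \<le> (\<Sum>x'\<in>UNIV. w x' * B)"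
    by (rule order_trans[OF sum_abs], rule sum_mono) (use assms in \<open>auto simp: abs_mult intro!: mult_left_mono\<close>)
  then show ?thesis by (simp add: sum_distrib_right[symmetric] assms)
qed

lemma Pd_nonneg: "Pdual P \<nu> x y \<ge> 0" and Pd_sum: "(\<Sum>y\<in>UNIV. Pdual P \<nu> x y) = 1"
  using dual_stochastic by (auto simp: stochastic_def)

lemma tame_Pm: "tame g \<Longrightarrow> tame (Pm g)"
  unfolding tame_def
proof (elim conjE exE, intro conjI allI)
  fix B x assume m[measurable]: "\<forall>x. g x \<in> borel_measurable borel" and B: "\<forall>x y. \<bar>g x y\<bar> \<le> B"
  have [measurable]: "g x \<in> borel_measurable borel" for x using m by simp
  show "Pm g x \<in> borel_measurable borel" unfolding Pm_def[abs_def] by measurable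
  show "\<exists>B. \<forall>x y. \<bar>Pm g x y\<bar> \<le> B"
    unfolding Pm_def by (intro exI[of _ B] allI wsum_bound) (use P_nonneg P_sum B in auto)
qed

lemma tame_Pd: "tame g \<Longrightarrow> tame (Pd g)"
  unfolding tame_def
proof (elim conjE exE, intro conjI allI)
  fix B x assume m: "\<forall>x. g x \<in> borel_measurable borel" and B: "\<forall>x y. \<bar>g x y\<bar> \<le> B"
  have [measurable]: "g x \<in> borel_measurable borel" for x using m by simp
  show "Pd g x \<in> borel_measurable borel" unfolding Pd_def[abs_def] by measurable
  show "\<exists>B. \<forall>x y. \<bar>Pd g x y\<bar> \<le> B"
    unfolding Pd_def by (intro exI[of _ B] allI wsum_bound) (use Pd_nonneg Pd_sum B in auto)
qed

lemma tame_Mf: "tame g \<Longrightarrow> tame (Mf g)"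
  unfolding tame_def
proof (elim conjE exE, intro conjI allI)
  fix B x assume m: "\<forall>x. g x \<in> borel_measurable borel" and B: "\<forall>x y. \<bar>g x y\<bar> \<le> B"
  have [measurable]: "g x \<in> borel_measurable borel" for x using m by simp
  show "Mf g x \<in> borel_measurable borel" unfolding Mf_def[abs_def] by measurable
  have "0 \<le> B" using B abs_ge_zero order_trans by blast
  then show "\<exists>B. \<forall>x y. \<bar>Mf g x y\<bar> \<le> B" unfolding Mf_def by (intro exI[of _ B]) (use B in auto)
qed

lemma tame_Md: "tame g \<Longrightarrow> tame (Md g)"
  unfolding tame_def
proof (elim conjE exE, intro conjI allI)
  fix B x assume m: "\<forall>x. g x \<in> borel_measurable borel" and B: "\<forall>x y. \<bar>g x y\<bar> \<le> B"
  have [measurable]: "g x \<in> borel_measurable borel" for x using m by simp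
  show "Md g x \<in> borel_measurable borel" unfolding Md_def[abs_def] by measurable
  have "0 \<le> B" using B abs_ge_zero order_trans by blast
  then show "\<exists>B. \<forall>x y. \<bar>Md g x y\<bar> \<le> B" unfolding Md_def by (intro exI[of _ B]) (use B in auto)
qed

lemma tame0_Pm:
  assumes "tame0 g" shows "tame0 (Pm g)"
proof -
  obtain r where r: "\<forall>x y. y > r \<longrightarrow> g x y = 0" using assms by (auto simp: tame0_def)
  then have "Pm g x y = 0" if "y > r" for x y using that by (simp add: Pm_def)
  then show ?thesis using assms tame_Pm unfolding tame0_def by blast
qed

lemma tame0_Mf:
  assumes "tame0 g" shows "tame0 (Mf g)"
proof -
  obtain r where r: "\<forall>x y. y > r \<longrightarrow> g x y = 0" using assms by (auto simp: tame0_def)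
  have "Mf g x y = 0" if "y > r + fM" for x y
  proof -
    have "y + f x > r" using that fM(1)[of x] by (simp add: abs_le_iff)
    then show ?thesis using r by (simp add: Mf_def)
  qed
  then show ?thesis using assms tame_Mf unfolding tame0_def by blast
qed

lemma tame0_Qpow: "tame0 g \<Longrightarrow> tame0 ((Q ^^ n) g)"
  by (induction n) (simp_all add: Q_eq_Pm_Mf tame0_Pm tame0_Mf)

definition "pairing a b = (\<Sum>x\<in>UNIV. \<nu> x * (\<integral>y. indicator {0<..} y * (a x y * b x y) \<partial>lborel))" for a b :: "'a \<Rightarrow> real \<Rightarrow> real"

lemma pairing_integrable:
  assumes "tame a" "tame0 b"
  shows "integrable lborel (\<lambda>y. indicator {0<..} y * (a x y * b x' y))"
proof -
  obtain A where A: "\<forall>x y. \<bar>a x y\<bar> \<le> A" using assms by (auto simp: tame_def)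
  obtain B where B: "\<forall>x y. \<bar>b x y\<bar> \<le> B" using assms by (auto simp: tame0_def tame_def)
  obtain r where r: "\<forall>x y. y > r \<longrightarrow> b x y = 0" using assms by (auto simp: tame0_def)
  have [measurable]: "a x \<in> borel_measurable borel" "b x \<in> borel_measurable borel" for x using assms by (auto simp: tame_def tame0_def)
  have A0: "0 \<le> A" using A abs_ge_zero order_trans by blast
  show ?thesis
  proof (rule Bochner_Integration.integrable_bound)
    show "integrable lborel (\<lambda>y. A * B * indicator {0..r} y :: real)" by (intro integrable_mult_right integrable_real_indicator) (auto simp: emeasure_lborel_Icc_eq)
    show "AE y in lborel. norm (indicator {0<..} y * (a x y * b x' y)) \<le> norm (A * B * indicator {0..r} y :: real)"
    proof (rule AE_I2)
      fix y
      have "\<bar>a x y\<bar> * \<bar>b x' y\<bar> \<le> A * B" using A B A0 by (intro mult_mono) auto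
      then have "\<bar>a x y * b x' y\<bar> \<le> \<bar>A * B\<bar>" by (simp add: abs_mult[of "a x y"])
      then show "norm (indicator {0<..} y * (a x y * b x' y)) \<le> norm (A * B * indicator {0..r} y :: real)"
        using r by (cases "y > r") (auto simp: indicator_def)
    qed
  qed measurable
qed

lemma pairing_Pm:
  assumes a: "tame a" and b: "tame0 b" shows "pairing a (Pm b) = pairing (Pd a) b"
proof -
  let ?J = "\<lambda>x x'. \<integral>y. indicator {0<..} y * (a x y * b x' y) \<partial>lborel"
  note i = pairing_integrable[OF a b]
  have "pairing a (Pm b) = (\<Sum>x\<in>UNIV. \<nu> x * (\<Sum>x'\<in>UNIV. P x x' * ?J x x'))"
    unfolding pairing_def
  proof (intro sum.cong refl)
    fix x
    have "(\<integral>y. indicator {0<..} y * (a x y * Pm b x y) \<partial>lborel) = (\<integral>y. (\<Sum>x'\<in>UNIV. P x x' * (indicator {0<..} y * (a x y * b x' y))) \<partial>lborel)"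
      by (intro Bochner_Integration.integral_cong refl) (simp add: Pm_def sum_distrib_left mult_ac)
    also have "\<dots> = (\<Sum>x'\<in>UNIV. \<integral>y. P x x' * (indicator {0<..} y * (a x y * b x' y)) \<partial>lborel)"
      by (rule Bochner_Integration.integral_sum) (rule integrable_mult_right[OF i])
    finally show "\<nu> x * (\<integral>y. indicator {0<..} y * (a x y * Pm b x y) \<partial>lborel) = \<nu> x * (\<Sum>x'\<in>UNIV. P x x' * ?J x x')" by simp
  qed
  also have "\<dots> = (\<Sum>x\<in>UNIV. \<Sum>x'\<in>UNIV. \<nu> x * P x x' * ?J x x')" by (simp add: sum_distrib_left mult.assoc)
  also have "\<dots> = (\<Sum>x'\<in>UNIV. \<Sum>x\<in>UNIV. \<nu> x * P x x' * ?J x x')" by (rule sum.swap)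
  also have "\<dots> = (\<Sum>x'\<in>UNIV. \<nu> x' * (\<Sum>x\<in>UNIV. Pdual P \<nu> x' x * ?J x x'))"
    unfolding sum_distrib_left
    by (intro sum.cong refl) (use nu_pos in \<open>simp add: Pdual_def less_imp_neq[symmetric]\<close>)
  also have "\<dots> = pairing (Pd a) b"
    unfolding pairing_def
  proof (intro sum.cong refl)
    fix x'
    have "(\<integral>y. indicator {0<..} y * (Pd a x' y * b x' y) \<partial>lborel) = (\<integral>y. (\<Sum>x\<in>UNIV. Pdual P \<nu> x' x * (indicator {0<..} y * (a x y * b x' y))) \<partial>lborel)"
      by (intro Bochner_Integration.integral_cong refl) (simp add: Pd_def sum_distrib_left sum_distrib_right mult_ac)
    also have "\<dots> = (\<Sum>x\<in>UNIV. \<integral>y. Pdual P \<nu> x' x * (indicator {0<..} y * (a x y * b x' y)) \<partial>lborel)"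
      by (rule Bochner_Integration.integral_sum) (rule integrable_mult_right[OF i])
    finally show "\<nu> x' * (\<Sum>x\<in>UNIV. Pdual P \<nu> x' x * ?J x x') = \<nu> x' * (\<integral>y. indicator {0<..} y * (Pd a x' y * b x' y) \<partial>lborel)" by simp
  qed
  finally show ?thesis .
qed

text \<open>The translation moves the integration variable. The restriction to positive levels
  before the step and the killing after it exchange their roles.\<close>

lemma pairing_Mf: "pairing a (Mf b) = pairing (Md a) b"
  unfolding pairing_def
proof (intro sum.cong refl)
  fix x
  have "(\<integral>y. indicator {0<..} y * (a x y * Mf b x y) \<partial>lborel) = \<bar>1\<bar> *\<^sub>R (\<integral>z. indicator {0<..} (- f x + 1 * z) * (a x (- f x + 1 * z) * Mf b x (- f x + 1 * z)) \<partial>lborel)"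
    by (rule lborel_integral_real_affine) simp
  also have "\<dots> = (\<integral>z. indicator {0<..} z * (Md a x z * b x z) \<partial>lborel)"
    by (simp, intro Bochner_Integration.integral_cong refl) (auto simp: Mf_def Md_def indicator_def)
  finally show "\<nu> x * (\<integral>y. indicator {0<..} y * (a x y * Mf b x y) \<partial>lborel) = \<nu> x * (\<integral>z. indicator {0<..} z * (Md a x z * b x z) \<partial>lborel)" by (rule arg_cong)
qed

text \<open>The word Pm Mf Pm ... Mf Pm alternates and both begins and ends with the average. Its
  adjoint is therefore the word Pd Md ... Pd of the same shape, which is n killed dual steps after
  one \<open>Pd\<close>.\<close>

theorem duality:
  assumes "tame a" "tame0 b"
  shows "pairing a ((Q ^^ n) (Pm b)) = pairing ((Qd ^^ n) (Pd a)) b"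
  using assms(1)
proof (induction n arbitrary: a)
  case 0
  then show ?case by (simp add: pairing_Pm assms)
next
  case (Suc n)
  let ?h = "(Q ^^ n) (Pm b)"
  have h: "tame0 ?h" by (intro tame0_Qpow tame0_Pm assms)
  have "pairing a ((Q ^^ Suc n) (Pm b)) = pairing a (Pm (Mf ?h))" by (simp add: Q_eq_Pm_Mf)
  also have "\<dots> = pairing (Pd a) (Mf ?h)" by (rule pairing_Pm[OF Suc.prems tame0_Mf[OF h]])
  also have "\<dots> = pairing (Md (Pd a)) ?h" by (rule pairing_Mf)
  also have "\<dots> = pairing ((Qd ^^ n) (Pd (Md (Pd a)))) b" by (intro Suc.IH tame_Md tame_Pd Suc.prems)
  also have "(Qd ^^ n) (Pd (Md (Pd a))) = (Qd ^^ Suc n) (Pd a)" by (simp add: Qd_eq_Pd_Md[symmetric] funpow_swap1)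
  finally show ?case .
qed

end

subsection \<open>Comparison with the odd Gaussian kernel\<close>

text \<open>A Cesaro argument with weights 1 / sqrt i. Their sum is at most 2 sqrt m, whence the
  factor 2 in front of the limit.\<close>

lemma sqrt_weighted_mean:
  fixes \<delta> :: "nat \<Rightarrow> real"
  assumes \<delta>: "\<delta> \<longlonglongrightarrow> d" and d: "d \<ge> 0" and e: "e > 0"
  shows "\<forall>\<^sub>F m in sequentially. (\<Sum>i<m. \<delta> i / sqrt (real i)) / sqrt (real m) \<le> 2 * d + e"
proof -
  have "\<forall>\<^sub>F i in sequentially. \<delta> i < d + e / 4" using \<delta> e by (intro order_tendstoD) auto
  then obtain N where N: "\<And>i. i \<ge> N \<Longrightarrow> \<delta> i < d + e / 4" by (auto simp: eventually_sequentially)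
  define A where "A = (\<Sum>i<N. \<bar>\<delta> i\<bar> / sqrt (real i))"
  have "(\<lambda>m. A / sqrt (real m)) \<longlonglongrightarrow> 0" by real_asymp
  then have "\<forall>\<^sub>F m in sequentially. A / sqrt (real m) < e / 2" using e by (intro order_tendstoD) auto
  then show ?thesis using eventually_gt_at_top[of 0]
  proof eventually_elim
    case (elim m)
    have "\<delta> i / sqrt (real i) \<le> (if i < N then \<bar>\<delta> i\<bar> / sqrt (real i) else 0) + (d + e / 4) * (1 / sqrt (real i))" for i
    proof (cases "i < N")
      case True
      have "\<delta> i / sqrt (real i) \<le> \<bar>\<delta> i\<bar> / sqrt (real i)" by (intro divide_right_mono) auto
      moreover have "0 \<le> (d + e / 4) * (1 / sqrt (real i))" using d e by simp
      ultimately show ?thesis using True by simp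
    next
      case False
      then have "\<delta> i * (1 / sqrt (real i)) \<le> (d + e / 4) * (1 / sqrt (real i))" using N[of i] by (intro mult_right_mono) auto
      then show ?thesis using False by simp
    qed
    then have "(\<Sum>i<m. \<delta> i / sqrt (real i)) \<le> (\<Sum>i<m. (if i < N then \<bar>\<delta> i\<bar> / sqrt (real i) else 0) + (d + e / 4) * (1 / sqrt (real i)))" by (rule sum_mono)
    also have "\<dots> = (\<Sum>i<m. if i < N then \<bar>\<delta> i\<bar> / sqrt (real i) else 0) + (d + e / 4) * (\<Sum>i<m. 1 / sqrt (real i))"
      by (simp only: sum.distrib sum_distrib_left)
    also have "(\<Sum>i<m. if i < N then \<bar>\<delta> i\<bar> / sqrt (real i) else 0) \<le> A"
    proof -
      have "(\<Sum>i<m. if i < N then \<bar>\<delta> i\<bar> / sqrt (real i) else 0) = (\<Sum>i\<in>{..<m} \<inter> {..<N}. \<bar>\<delta> i\<bar> / sqrt (real i))"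
        by (subst sum.inter_restrict) auto
      also have "\<dots> \<le> A" unfolding A_def by (intro sum_mono2) auto
      finally show ?thesis .
    qed
    also have "(d + e / 4) * (\<Sum>i<m. 1 / sqrt (real i)) \<le> (d + e / 4) * (2 * sqrt (real m))"
      using d e by (intro mult_left_mono sum_inverse_sqrt_le) auto
    finally have "(\<Sum>i<m. \<delta> i / sqrt (real i)) \<le> A + (d + e / 4) * (2 * sqrt (real m))" by simp
    then have "(\<Sum>i<m. \<delta> i / sqrt (real i)) / sqrt (real m) \<le> (A + (d + e / 4) * (2 * sqrt (real m))) / sqrt (real m)"
      by (intro divide_right_mono) auto
    also have "\<dots> = A / sqrt (real m) + 2 * (d + e / 4)" using elim(2) by (simp add: add_divide_distrib)
    also have "\<dots> \<le> e / 2 + 2 * (d + e / 4)" using elim(1) by (intro add_right_mono less_imp_le)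
    also have "\<dots> = 2 * d + e" by simp
    finally show ?case .
  qed
qed

context markov_walk
begin

text \<open>Here x is the state that the last step reaches, before averaging over it. With the
  average kept apart as \<open>Pm\<close>, the last stretch has the form that \<open>duality\<close>
  requires.\<close>

definition "kc c x y = (if y + f x \<le> c then 1 else (0::real))"
definition "Hj j c = (Q ^^ j) (Pm (kc c))"
text \<open>The cut at nonpositive levels makes this function and its mirror image live on opposite
  half-lines.\<close>

definition "Gj j c x y = (if y > 0 then Hj j c x y else 0)"

lemma exit_prob_Pm: "exit_prob P f c = Pm (kc c)"
  by (intro ext) (simp add: exit_prob_def Pm_def kc_def)

lemma tame0_kc: "tame0 (kc c)"
proof -
  have "kc c x \<in> borel_measurable borel" for x unfolding kc_def[abs_def] by measurable
  moreover have "\<bar>kc c x y\<bar> \<le> 1" for x y by (simp add: kc_def)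
  moreover have "kc c x y = 0" if "y > c + fM" for x y using that fM(1)[of x] by (auto simp: kc_def abs_le_iff)
  ultimately show ?thesis unfolding tame0_def tame_def by blast
qed

lemma tame_fun: "g \<in> borel_measurable borel \<Longrightarrow> (\<And>y. \<bar>g y\<bar> \<le> B) \<Longrightarrow> tame (\<lambda>x y. g y)"
  unfolding tame_def by blast

lemma Pd_fun: "Pd (\<lambda>x y. g y) = (\<lambda>x y. g y)"
  by (intro ext) (simp add: Pd_def sum_distrib_right[symmetric] Pd_sum)

lemma Hj_nonneg: "Hj j c x y \<ge> 0"
  unfolding Hj_def by (rule Q_nonneg) (auto simp: Pm_def kc_def P_nonneg intro!: sum_nonneg)

lemma Gj_nonneg: "Gj j c x y \<ge> 0" by (simp add: Gj_def Hj_nonneg)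

text \<open>A weight that depends on the level only is fixed by \<open>Pd\<close>, so after duality
  it is acted on by exactly j killed dual steps.\<close>

lemma Gj_weighted_integrable:
  assumes "g \<in> borel_measurable borel" "\<And>y. \<bar>g y\<bar> \<le> B"
  shows "integrable lborel (\<lambda>y. Gj j c x y * g y)"
    and "(\<Sum>x\<in>UNIV. \<nu> x * (\<integral>y. Gj j c x y * g y \<partial>lborel)) = pairing ((Qd ^^ j) (\<lambda>x y. g y)) (kc c)"
proof -
  have t: "tame (\<lambda>x y. g y)" using assms by (rule tame_fun)
  have t0: "tame0 (Hj j c)" unfolding Hj_def by (intro tame0_Qpow tame0_Pm tame0_kc)
  have eq: "(\<lambda>y. Gj j c x y * g y) = (\<lambda>y. indicator {0<..} y * (g y * Hj j c x y))" for x
    by (intro ext) (simp add: Gj_def indicator_def)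
  show "integrable lborel (\<lambda>y. Gj j c x y * g y)" unfolding eq by (rule pairing_integrable[OF t t0])
  have "(\<Sum>x\<in>UNIV. \<nu> x * (\<integral>y. Gj j c x y * g y \<partial>lborel)) = pairing (\<lambda>x y. g y) (Hj j c)" unfolding eq pairing_def ..
  also have "\<dots> = pairing ((Qd ^^ j) (Pd (\<lambda>x y. g y))) (kc c)" unfolding Hj_def by (rule duality[OF t tame0_kc])
  finally show "(\<Sum>x\<in>UNIV. \<nu> x * (\<integral>y. Gj j c x y * g y \<partial>lborel)) = pairing ((Qd ^^ j) (\<lambda>x y. g y)) (kc c)" unfolding Pd_fun .
qed

lemma Gj_integrable: "integrable lborel (Gj j c x)"
  using Gj_weighted_integrable(1)[of "\<lambda>y. 1" 1 j c x] by simp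

lemma Gj_mass: "(\<Sum>x\<in>UNIV. \<nu> x * (\<integral>y. Gj j c x y \<partial>lborel)) = pairing (surv (Pdual P \<nu>) (\<lambda>u. - f u) j) (kc c)"
proof -
  have "surv (Pdual P \<nu>) (\<lambda>u. - f u) j = (Qd ^^ j) (\<lambda>x y. 1)" by (intro ext) (rule surv_eq_killed)
  then show ?thesis using Gj_weighted_integrable(2)[of "\<lambda>y. 1" 1 j c] by simp
qed

text \<open>Along each path, raising the start keeps all levels positive, and raising the exit level
  by at least as much keeps the final landing below it.\<close>

lemma Hj_shift:
  assumes "c \<le> c'" "r \<le> r'" "r' - r \<le> c' - c" shows "Hj j c x r \<le> Hj j c' x r'"
  using assms(2,3)
proof (induction j arbitrary: x r r')
  case 0
  then show ?case unfolding Hj_def Pm_def by (auto simp: kc_def P_nonneg intro!: sum_mono)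
next
  case (Suc j)
  have h: "(if 0 < r + f x' then Hj j c x' (r + f x') else 0) \<le> (if 0 < r' + f x' then Hj j c' x' (r' + f x') else 0)" for x'
    using Suc.IH[of "r + f x'" "r' + f x'" x'] Suc.prems Hj_nonneg[of j c' x' "r' + f x'"] by auto
  show ?case unfolding Hj_def killed_pow_Suc by (rule sum_mono, rule mult_left_mono, rule h[unfolded Hj_def], rule P_nonneg)
qed

lemma Gj_shift: "c \<le> c' \<Longrightarrow> r \<le> r' \<Longrightarrow> r' - r \<le> c' - c \<Longrightarrow> Gj j c x r \<le> Gj j c' x r'"
  using Hj_shift[of c c' r r' j x] Hj_nonneg[of j c' x r'] by (auto simp: Gj_def)

text \<open>Shifting the exit level by \<open>2 * \<eta>\<close> absorbs a displacement of the starting point by \<open>\<eta>\<close>.\<close>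

definition "Gup \<eta> j z r = Gj j (2 * \<eta>) z (r + \<eta>)"
definition "Glo \<eta> j z r = Gj j (- 2 * \<eta>) z (r - \<eta>)"

lemma Gup_integrable: "integrable lborel (Gup \<eta> j z)" and Gup_integral: "(\<integral>r. Gup \<eta> j z r \<partial>lborel) = (\<integral>r. Gj j (2 * \<eta>) z r \<partial>lborel)"
  using lborel_integrable_real_affine[OF Gj_integrable[of j "2 * \<eta>" z], of 1 \<eta>] lborel_integral_real_affine[of 1 "Gj j (2 * \<eta>) z" \<eta>]
  by (simp_all add: Gup_def[abs_def] add.commute)

lemma Glo_integrable: "integrable lborel (Glo \<eta> j z)" and Glo_integral: "(\<integral>r. Glo \<eta> j z r \<partial>lborel) = (\<integral>r. Gj j (- 2 * \<eta>) z r \<partial>lborel)"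
  using lborel_integrable_real_affine[OF Gj_integrable[of j "- 2 * \<eta>" z], of 1 "- \<eta>"] lborel_integral_real_affine[of 1 "Gj j (- 2 * \<eta>) z" "- \<eta>"]
  by (simp_all add: Glo_def[abs_def])

lemma G_windowed:
  assumes "\<eta> > 0" shows "windowed \<eta> (Glo \<eta> j) (Gj j 0) (Gup \<eta> j)"
  unfolding windowed_def
proof (intro conjI allI impI)
  show "integrable lborel (Gj j 0 z)" for z by (rule Gj_integrable)
  show "integrable lborel (Gup \<eta> j z)" for z by (rule Gup_integrable)
  show "integrable lborel (Glo \<eta> j z)" for z by (rule Glo_integrable)
  show "0 \<le> Glo \<eta> j z r" for z r by (simp add: Glo_def Gj_nonneg)
  show "Glo \<eta> j z (r + u) \<le> Gj j 0 z r" if "\<bar>u\<bar> \<le> \<eta>" for z r u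
    unfolding Glo_def by (rule Gj_shift) (use that assms in \<open>auto simp: abs_le_iff\<close>)
  show "Gj j 0 z r \<le> Gup \<eta> j z (r + u)" if "\<bar>u\<bar> \<le> \<eta>" for z r u
    unfolding Gup_def by (rule Gj_shift) (use that assms in \<open>auto simp: abs_le_iff\<close>)
qed

text \<open>By \<open>Gj_mass\<close> the total masses are integrals of dual survival probabilities,
  which are O(1 / sqrt j) over bounded levels. Passing from exit level -2 \<eta> to 2 \<eta>
  affects, for each state, starting levels in an interval of length 4 \<eta>. The constant does not
  depend on \<eta>, so that \<eta> may be chosen after it.\<close>

lemma tot_bounds:
  "\<exists>C\<ge>0. \<forall>\<eta> j. 0 < \<eta> \<longrightarrow> \<eta> \<le> 1/2 \<longrightarrow> j \<ge> 1 \<longrightarrow> totI (Gup \<eta> j) \<le> C / sqrt (real j) \<and> totI (Gup \<eta> j) - totI (Glo \<eta> j) \<le> C * \<eta> / sqrt (real j)"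
proof -
  interpret D: markov_walk "Pdual P \<nu>" \<nu> "\<lambda>u. - f u" by (rule dual_walk)
  let ?s = "surv (Pdual P \<nu>) (\<lambda>u. - f u)"
  obtain Cd where Cd: "Cd \<ge> 0" "\<forall>n x y. ?s n x y * sqrt (real n) \<le> Cd * (2 + \<bar>y\<bar>)" using D.surv_bound by blast
  define B where "B = Cd * (3 + fM)"
  have B0: "B \<ge> 0" using Cd fM(2) by (simp add: B_def)
  have sB: "?s j x y \<le> B / sqrt (real j)" if "0 < y" "y \<le> 1 + fM" "j \<ge> 1" for j x y
  proof -
    have "?s j x y * sqrt (real j) \<le> Cd * (2 + \<bar>y\<bar>)" using Cd by blast
    also have "\<dots> \<le> B" unfolding B_def using that Cd(1) by (intro mult_left_mono) auto
    finally show ?thesis using that(3) by (simp add: field_simps)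
  qed
  \<comment> \<open>Duality yields masses weighted by \<open>\<nu>\<close>, whereas
    \<open>totI\<close> is unweighted; the least weight converts one into the other.\<close>
  define vm where "vm = Min (range \<nu>)"
  have vm: "vm > 0" "vm \<le> \<nu> z" for z using nu_pos by (auto simp: vm_def)
  have ts: "tame (?s j)" for j
  proof -
    have "?s j x \<in> borel_measurable borel" for x
      unfolding surv_eq_killed by (rule killed_step_measurable) simp
    moreover have "\<bar>?s j x y\<bar> \<le> 1" for x y using D.surv_le_1[of j x y] D.surv_nonneg[of j x y] by simp
    ultimately show ?thesis unfolding tame_def by blast
  qed
  have icb: "integrable lborel (\<lambda>y. K * indicator {p..q} y :: real)" for K p q :: real
    by (intro integrable_mult_right integrable_real_indicator) (auto simp: emeasure_lborel_Icc_eq)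
  have up: "pairing (?s j) (kc c) \<le> B / sqrt (real j) * (1 + fM)" if c: "c \<le> 1" and j: "j \<ge> 1" for j c
  proof -
    have "pairing (?s j) (kc c) \<le> (\<Sum>x\<in>UNIV. \<nu> x * (B / sqrt (real j) * (1 + fM)))"
      unfolding pairing_def
    proof (intro sum_mono mult_left_mono nu_nonneg)
      fix x
      have "(\<integral>y. indicator {0<..} y * (?s j x y * kc c x y) \<partial>lborel) \<le> (\<integral>y. B / sqrt (real j) * indicator {0..1 + fM} y \<partial>lborel)"
      proof (rule integral_mono[OF pairing_integrable[OF ts tame0_kc] icb])
        fix y
        have "y \<le> 1 + fM" if "kc c x y \<noteq> 0" using that c fM(1)[of x] by (auto simp: kc_def abs_le_iff split: if_splits)
        then show "indicator {0<..} y * (?s j x y * kc c x y) \<le> B / sqrt (real j) * indicator {0..1 + fM} y"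
          using sB[of y j x] j B0 by (auto simp: indicator_def kc_def split: if_splits)
      qed
      also have "\<dots> = B / sqrt (real j) * (1 + fM)" using fM(2) by simp
      finally show "(\<integral>y. indicator {0<..} y * (?s j x y * kc c x y) \<partial>lborel) \<le> B / sqrt (real j) * (1 + fM)" .
    qed
    then show ?thesis by (simp only: sum_distrib_right[symmetric] nu_sum mult_1)
  qed
  have diff: "pairing (?s j) (kc (2 * \<eta>)) - pairing (?s j) (kc (- 2 * \<eta>)) \<le> B / sqrt (real j) * (4 * \<eta>)" if \<eta>: "0 < \<eta>" "\<eta> \<le> 1/2" and j: "j \<ge> 1" for j \<eta>
  proof -
    have "pairing (?s j) (kc (2 * \<eta>)) - pairing (?s j) (kc (- 2 * \<eta>)) \<le> (\<Sum>x\<in>UNIV. \<nu> x * (B / sqrt (real j) * (4 * \<eta>)))"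
      unfolding pairing_def sum_subtractf[symmetric] right_diff_distrib[symmetric]
    proof (intro sum_mono mult_left_mono nu_nonneg)
      fix x
      let ?i = "\<lambda>c y. indicator {0<..} y * (?s j x y * kc c x y)"
      have "(\<integral>y. ?i (2 * \<eta>) y \<partial>lborel) - (\<integral>y. ?i (- 2 * \<eta>) y \<partial>lborel) = (\<integral>y. ?i (2 * \<eta>) y - ?i (- 2 * \<eta>) y \<partial>lborel)"
        by (rule Bochner_Integration.integral_diff[symmetric]) (rule pairing_integrable[OF ts tame0_kc], rule pairing_integrable[OF ts tame0_kc])
      also have "\<dots> \<le> (\<integral>y. B / sqrt (real j) * indicator {- 2 * \<eta> - f x..2 * \<eta> - f x} y \<partial>lborel)"
      proof (rule integral_mono[OF Bochner_Integration.integrable_diff[OF pairing_integrable[OF ts tame0_kc] pairing_integrable[OF ts tame0_kc]] icb])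
        fix y
        show "?i (2 * \<eta>) y - ?i (- 2 * \<eta>) y \<le> B / sqrt (real j) * indicator {- 2 * \<eta> - f x..2 * \<eta> - f x} y"
        proof (cases "0 < y \<and> - 2 * \<eta> < y + f x \<and> y + f x \<le> 2 * \<eta>")
          case True
          then have "y \<le> 1 + fM" using \<eta> fM(1)[of x] by (auto simp: abs_le_iff)
          then have "?s j x y \<le> B / sqrt (real j)" using sB True j by simp
          then show ?thesis using True by (simp add: indicator_def kc_def)
        next
          case False
          then have z: "?i (2 * \<eta>) y - ?i (- 2 * \<eta>) y = 0" using \<eta> by (auto simp: indicator_def kc_def)
          show ?thesis unfolding z using B0 by simp
        qed
      qed
      also have "\<dots> = B / sqrt (real j) * (4 * \<eta>)" using \<eta> by simp
      finally show "(\<integral>y. ?i (2 * \<eta>) y \<partial>lborel) - (\<integral>y. ?i (- 2 * \<eta>) y \<partial>lborel) \<le> B / sqrt (real j) * (4 * \<eta>)" .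
    qed
    then show ?thesis by (simp only: sum_distrib_right[symmetric] nu_sum mult_1)
  qed
  define C where "C = B * (5 + fM) / vm"
  have C0: "C \<ge> 0" using B0 fM(2) vm(1) by (simp add: C_def)
  have "totI (Gup \<eta> j) \<le> C / sqrt (real j) \<and> totI (Gup \<eta> j) - totI (Glo \<eta> j) \<le> C * \<eta> / sqrt (real j)"
    if \<eta>: "0 < \<eta>" "\<eta> \<le> 1/2" and j: "j \<ge> 1" for \<eta> j
  proof
    have sj: "sqrt (real j) > 0" using j by simp
    let ?m = "\<lambda>c z. \<integral>r. Gj j c z r \<partial>lborel"
    have m0: "?m c z \<ge> 0" for c z by (rule integral_nonneg_AE) (simp add: Gj_nonneg)
    have "vm * totI (Gup \<eta> j) = (\<Sum>z\<in>UNIV. vm * ?m (2 * \<eta>) z)" unfolding totI_def Gup_integral by (rule sum_distrib_left)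
    also have "\<dots> \<le> (\<Sum>z\<in>UNIV. \<nu> z * ?m (2 * \<eta>) z)" by (intro sum_mono mult_right_mono vm m0)
    also have "\<dots> \<le> B / sqrt (real j) * (1 + fM)" unfolding Gj_mass by (rule up) (use \<eta> j in auto)
    also have "\<dots> \<le> B / sqrt (real j) * (5 + fM)" using B0 by (intro mult_left_mono) auto
    finally show "totI (Gup \<eta> j) \<le> C / sqrt (real j)" using vm(1) sj by (simp add: C_def field_simps)
    have le: "?m (- 2 * \<eta>) z \<le> ?m (2 * \<eta>) z" for z
      by (rule integral_mono[OF Gj_integrable Gj_integrable]) (rule Gj_shift, use \<eta> in auto)
    have "vm * (totI (Gup \<eta> j) - totI (Glo \<eta> j)) = (\<Sum>z\<in>UNIV. vm * (?m (2 * \<eta>) z - ?m (- 2 * \<eta>) z))"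
      unfolding totI_def Gup_integral Glo_integral sum_subtractf[symmetric] by (rule sum_distrib_left)
    also have "\<dots> \<le> (\<Sum>z\<in>UNIV. \<nu> z * (?m (2 * \<eta>) z - ?m (- 2 * \<eta>) z))" using le by (intro sum_mono mult_right_mono vm) simp
    also have "\<dots> = pairing (?s j) (kc (2 * \<eta>)) - pairing (?s j) (kc (- 2 * \<eta>))"
      unfolding Gj_mass[symmetric] right_diff_distrib sum_subtractf ..
    also have "\<dots> \<le> B / sqrt (real j) * (4 * \<eta>)" by (rule diff[OF \<eta> j])
    also have "\<dots> \<le> B / sqrt (real j) * ((5 + fM) * \<eta>)" using B0 \<eta> fM(2) by (intro mult_left_mono mult_right_mono) auto
    finally show "totI (Gup \<eta> j) - totI (Glo \<eta> j) \<le> C * \<eta> / sqrt (real j)" using vm(1) sj by (simp add: C_def field_simps)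
  qed
  with C0 show ?thesis by blast
qed

text \<open>To leave in one step the walk must be within fM of zero, and the limit theorem bounds
  the chance of being in this fixed interval.\<close>

lemma Hj_sup_bound: "\<exists>C\<ge>0. \<forall>j x y. j \<ge> 1 \<longrightarrow> y > 0 \<longrightarrow> Hj j 0 x y \<le> C / sqrt (real j)"
proof -
  obtain K where K: "K \<ge> 0" "\<forall>Gm G Gp j x w. windowed (1/2) Gm G Gp \<longrightarrow> j \<ge> 1 \<longrightarrow> (T ^^ j) G x w \<le> K * totI Gp / sqrt (real j)"
    using T_upper by blast
  define G where "G = (\<lambda>(z::'a). indicator {0<..fM} :: real \<Rightarrow> real)"
  define Gp where "Gp = (\<lambda>(z::'a). indicator {-1/2..fM + 1/2} :: real \<Rightarrow> real)"
  have W: "windowed (1/2) (\<lambda>z r. 0) G Gp"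
    unfolding windowed_def
  proof (intro conjI allI impI)
    show "integrable lborel (G z)" for z unfolding G_def by (rule integrable_real_indicator) (auto simp: fM(2))
    show "integrable lborel (Gp z)" for z unfolding Gp_def by (rule integrable_real_indicator) (auto simp: emeasure_lborel_Icc_eq)
    show "G z r \<le> Gp z (r + u)" if "\<bar>u\<bar> \<le> 1/2" for z r u using that by (auto simp: G_def Gp_def indicator_def abs_le_iff)
  qed (auto simp: G_def)
  have t0: "totI Gp \<ge> 0" unfolding totI_def by (intro sum_nonneg integral_nonneg_AE) (auto simp: Gp_def)
  have "Hj j 0 x y \<le> K * totI Gp / sqrt (real j)" if j: "j \<ge> 1" and y: "y > 0" for j x y
  proof -
    have "Hj j 0 x y \<le> (Q ^^ j) G x y" unfolding Hj_def
    proof (rule killed_pow_mono[OF P_nonneg])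
      fix x y assume y: "(y::real) > 0"
      show "Pm (kc 0) x y \<le> G x y"
      proof (cases "y \<le> fM")
        case True
        have "Pm (kc 0) x y \<le> (\<Sum>x'\<in>UNIV. P x x')" unfolding Pm_def by (intro sum_mono) (auto simp: kc_def P_nonneg)
        then show ?thesis using True y by (simp add: P_sum G_def)
      next
        case False
        then have "kc 0 x' y = 0" for x' using fM(1)[of x'] by (auto simp: kc_def abs_le_iff)
        then show ?thesis by (simp add: Pm_def G_def)
      qed
    qed (use y in simp)
    also have "\<dots> \<le> (T ^^ j) G x y" by (rule Q_le_T) (simp add: G_def)
    also have "\<dots> \<le> K * totI Gp / sqrt (real j)" using K(2) W j by blast
    finally show ?thesis .
  qed
  then show ?thesis using K(1) t0 by (intro exI[of _ "K * totI Gp"]) auto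
qed

text \<open>The right order by the three stretches, with upper bounds only: survival, density and
  total mass each contribute a factor of order m^(-1/2).\<close>

lemma exit_time_upper: "\<exists>C\<ge>0. \<forall>m\<ge>3. \<forall>k. (Q ^^ (m + k)) (Pm (kc 0)) x y \<le> C / (real m * sqrt (real m))"
proof -
  obtain K where K: "K \<ge> 0" "\<forall>Gm G Gp j x w. windowed (1/2) Gm G Gp \<longrightarrow> j \<ge> 1 \<longrightarrow> (T ^^ j) G x w \<le> K * totI Gp / sqrt (real j)"
    using T_upper by blast
  obtain C1 where C1: "C1 \<ge> 0" "\<forall>\<eta> j. 0 < \<eta> \<longrightarrow> \<eta> \<le> 1/2 \<longrightarrow> j \<ge> 1 \<longrightarrow> totI (Gup \<eta> j) \<le> C1 / sqrt (real j) \<and> totI (Gup \<eta> j) - totI (Glo \<eta> j) \<le> C1 * \<eta> / sqrt (real j)"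
    using tot_bounds by blast
  obtain C2 where C2: "C2 \<ge> 0" "\<forall>n x y. surv P f n x y * sqrt (real n) \<le> C2 * (2 + \<bar>y\<bar>)" using surv_bound by blast
  define c where "c = C2 * (2 + \<bar>y\<bar>)"
  have c0: "c \<ge> 0" using C2 by (simp add: c_def)
  have "(Q ^^ (m + k)) (Pm (kc 0)) x y \<le> (15 * (K * C1 * c)) / (real m * sqrt (real m))" if m: "m \<ge> 3" for m k
  proof -
    define a where "a = m div 3"
    \<comment> \<open>All k extra steps go to the last stretch, where a longer time only improves
      the bound.\<close>
    define b where "b = m + k - 2 * a"
    have a: "a \<ge> 1" "a \<le> b" "m + k = a + (a + b)" using m by (auto simp: a_def b_def)
    \<comment> \<open>The worst case is m = 5 with a = 1. With sqrt m \<le> 3 sqrt a this yields the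
      constant 15.\<close>
    have a4: "m \<le> 5 * a" unfolding a_def using m by presburger
    have sa: "sqrt (real a) > 0" "sqrt (real a) * sqrt (real a) = real a" using a by auto
    have inner: "(Q ^^ a) (Hj b 0) x' y' \<le> K * C1 / real a * 1" for x' y'
    proof -
      have "(Q ^^ a) (Hj b 0) x' y' = (Q ^^ a) (Gj b 0) x' y'" by (rule killed_pow_cong) (use a in \<open>auto simp: Gj_def\<close>)
      also have "\<dots> \<le> (T ^^ a) (Gj b 0) x' y'" by (rule Q_le_T) (rule Gj_nonneg)
      also have "\<dots> \<le> K * totI (Gup (1/2) b) / sqrt (real a)" using K(2) G_windowed[of "1/2" b] a(1) by force
      also have "\<dots> \<le> K * (C1 / sqrt (real a)) / sqrt (real a)"
      proof (intro divide_right_mono mult_left_mono K(1))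
        have "totI (Gup (1/2) b) \<le> C1 / sqrt (real b)" using C1(2)[rule_format, of "1/2" b] a by simp
        also have "\<dots> \<le> C1 / sqrt (real a)" using a C1(1) by (intro divide_left_mono) auto
        finally show "totI (Gup (1/2) b) \<le> C1 / sqrt (real a)" .
      qed simp
      also have "\<dots> = K * C1 / (sqrt (real a) * sqrt (real a))" by simp
      also have "\<dots> = K * C1 / real a * 1" unfolding sa(2) by simp
      finally show ?thesis .
    qed
    have "(Q ^^ (m + k)) (Pm (kc 0)) x y = (Q ^^ a) ((Q ^^ a) (Hj b 0)) x y" unfolding a(3) funpow_add o_def Hj_def ..
    also have "\<dots> \<le> (Q ^^ a) (\<lambda>x y. K * C1 / real a * 1) x y" by (rule Q_mono) (rule inner)
    also have "\<dots> = K * C1 / real a * surv P f a x y" unfolding surv_eq_killed killed_step_def walk_step_pow_scale ..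
    also have "\<dots> \<le> K * C1 / real a * (c / sqrt (real a))"
    proof (intro mult_left_mono)
      have "surv P f a x y * sqrt (real a) \<le> c" using C2 by (simp add: c_def)
      then show "surv P f a x y \<le> c / sqrt (real a)" using sa by (simp add: field_simps)
    qed (use K C1 in simp)
    also have "\<dots> = K * C1 * c * (1 / (real a * sqrt (real a)))" by simp
    also have "\<dots> \<le> K * C1 * c * (15 / (real m * sqrt (real m)))"
    proof (intro mult_left_mono)
      have "sqrt (real m) \<le> sqrt (9 * real a)" using a4 by (intro real_sqrt_le_mono) simp
      then have "sqrt (real m) \<le> 3 * sqrt (real a)" by (simp add: real_sqrt_mult)
      moreover have "real m \<le> 5 * real a" using a4 by simp
      ultimately have "real m * sqrt (real m) \<le> (5 * real a) * (3 * sqrt (real a))" by (intro mult_mono) auto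
      then have "real m * sqrt (real m) \<le> 15 * (real a * sqrt (real a))" by simp
      moreover have "real m * sqrt (real m) > 0" "real a * sqrt (real a) > 0" using m a sa by auto
      ultimately show "1 / (real a * sqrt (real a)) \<le> 15 / (real m * sqrt (real m))" by (simp add: divide_simps)
    qed (use K C1 c0 in simp)
    finally show ?thesis by (simp add: mult.commute)
  qed
  then show ?thesis using K(1) C1(1) c0 by (intro exI[of _ "15 * (K * C1 * c)"]) auto
qed

section \<open>Reflection and the error of the odd kernel\<close>

definition "reflG G z r = G z (- r)" for G :: "'a \<Rightarrow> real \<Rightarrow> real" and r :: real

lemma windowed_refl:
  assumes "windowed \<eta> Gm G Gp" shows "windowed \<eta> (reflG Gm) (reflG G) (reflG Gp)"
proof -
  have i: "integrable lborel (reflG F z)" if "integrable lborel (F z)" for F z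
    using integrable_reflect_shift[OF that, of 0] by (simp add: reflG_def[abs_def])
  have w: "Gm z (r + u) \<le> G z r" "G z r \<le> Gp z (r + u)" if "\<bar>u\<bar> \<le> \<eta>" for z r u
    using assms that by (auto simp: windowed_def)
  show ?thesis unfolding windowed_def
  proof (intro conjI allI impI)
    show "integrable lborel (reflG Gm z)" "integrable lborel (reflG G z)" "integrable lborel (reflG Gp z)" for z
      using assms by (auto simp: windowed_def intro!: i)
    show "0 \<le> reflG Gm z r" for z r using assms by (simp add: windowed_def reflG_def)
    fix z r u assume u: "\<bar>u\<bar> \<le> \<eta>"
    then have u': "\<bar>- u\<bar> \<le> \<eta>" by simp
    show "reflG Gm z (r + u) \<le> reflG G z r" using w(1)[OF u', of z "- r"] by (simp add: reflG_def)
    show "reflG G z r \<le> reflG Gp z (r + u)" using w(2)[OF u', of z "- r"] by (simp add: reflG_def)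
  qed
qed

lemma totI_refl: "totI (reflG F) = totI F"
  unfolding totI_def reflG_def using integral_reflect_shift[of "F _" 0] by simp

text \<open>The Gaussian prediction \<open>Gs\<close> for the odd extension of G, by
  \<open>Gs_diff_refl\<close>.\<close>

definition "Ko j G w = (\<Sum>z\<in>UNIV. \<nu> z * (\<integral>r. G z r * (gk j (w - r) - gk j (w + r)) \<partial>lborel))"

lemma Gs_diff_refl:
  assumes j: "j \<ge> 1" and G: "\<And>z. integrable lborel (G z)"
  shows "Gs j G w - Gs j (reflG G) w = Ko j G w"
  unfolding Gs_def Ko_def sum_subtractf[symmetric] right_diff_distrib[symmetric, of "\<nu> _"]
proof (intro sum.cong refl)
  fix z
  have "(\<integral>r. reflG G z r * gk j (w - r) \<partial>lborel) = (\<integral>r. G z r * gk j (w + r) \<partial>lborel)"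
    using integral_reflect_shift[of "\<lambda>r. G z r * gk j (w + r)" 0] by (simp add: reflG_def)
  moreover have "integrable lborel (\<lambda>r. G z r * gk j (w + r))"
    by (rule integrable_mult_bounded[OF G, where K = "gC0 / sqrt (real j)"]) (use gk_bound[OF j] in auto)
  ultimately have "(\<integral>r. G z r * gk j (w - r) \<partial>lborel) - (\<integral>r. reflG G z r * gk j (w - r) \<partial>lborel) = (\<integral>r. G z r * gk j (w - r) - G z r * gk j (w + r) \<partial>lborel)"
    using gk_shift_integrable[OF j G, of z w] by simp
  then show "\<nu> z * ((\<integral>r. G z r * gk j (w - r) \<partial>lborel) - (\<integral>r. reflG G z r * gk j (w - r) \<partial>lborel)) = \<nu> z * (\<integral>r. G z r * (gk j (w - r) - gk j (w + r)) \<partial>lborel)"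
    by (simp only: right_diff_distrib)
qed

lemma Ko_bound:
  assumes j: "j \<ge> 1" and G: "\<And>z. integrable lborel (G z)" and G0: "\<And>z r. G z r \<ge> 0"
  shows "\<bar>Ko j G w\<bar> \<le> \<bar>w\<bar> * gC1 / real j * totI G"
  unfolding Ko_def totI_def sum_distrib_left
proof (rule order_trans[OF sum_abs], rule sum_mono)
  fix z
  let ?c = "\<bar>w\<bar> * gC1 / real j"
  have i: "integrable lborel (\<lambda>r. G z r * (gk j (w - r) - gk j (w + r)))"
    by (rule integrable_mult_bounded[OF G, where K = ?c]) (use gk_reflect_bound[OF j] in auto)
  have "\<bar>\<integral>r. G z r * (gk j (w - r) - gk j (w + r)) \<partial>lborel\<bar> \<le> (\<integral>r. \<bar>G z r * (gk j (w - r) - gk j (w + r))\<bar> \<partial>lborel)" by (rule integral_abs_bound)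
  also have "\<dots> \<le> (\<integral>r. ?c * G z r \<partial>lborel)"
  proof (rule integral_mono[OF integrable_abs[OF i]])
    show "\<bar>G z r * (gk j (w - r) - gk j (w + r))\<bar> \<le> ?c * G z r" for r
      unfolding abs_mult using mult_right_mono[OF gk_reflect_bound[OF j, of w r] G0[of z r]] G0[of z r] by (simp add: mult.commute)
  qed (use G in simp)
  also have "\<dots> = ?c * (\<integral>r. G z r \<partial>lborel)" by (rule integral_mult_right_zero)
  finally have 1: "\<bar>\<integral>r. G z r * (gk j (w - r) - gk j (w + r)) \<partial>lborel\<bar> \<le> ?c * (\<integral>r. G z r \<partial>lborel)" .
  have "\<bar>\<nu> z * (\<integral>r. G z r * (gk j (w - r) - gk j (w + r)) \<partial>lborel)\<bar> \<le> 1 * \<bar>\<integral>r. G z r * (gk j (w - r) - gk j (w + r)) \<partial>lborel\<bar>"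
    unfolding abs_mult using nu_le_1[of z] nu_nonneg[of z] by (intro mult_right_mono) auto
  with 1 show "\<bar>\<nu> z * (\<integral>r. G z r * (gk j (w - r) - gk j (w + r)) \<partial>lborel)\<bar> \<le> ?c * (\<integral>r. G z r \<partial>lborel)" by linarith
qed

end

lemma walk_step_pow_measurable_param:
  assumes "\<And>x y. (\<lambda>t. g t x y) \<in> borel_measurable M"
  shows "(\<lambda>t. (walk_step c f ^^ n) (g t) x y) \<in> borel_measurable M"
proof (induction n arbitrary: x y)
  case (Suc n)
  note [measurable] = Suc.IH
  show ?case unfolding walk_step_pow_Suc by measurable
qed (simp add: assms)

lemma gauss_second_moment:
  fixes a :: real assumes a: "a > 0"
  shows "(\<integral>s. exp (- a * s\<^sup>2 / 2) * s\<^sup>2 \<partial>lborel) = sqrt (2 * pi / a) / a"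
proof -
  let ?d = "1 / sqrt a"
  have d2: "?d\<^sup>2 = 1 / a" using a by (simp add: power_divide)
  have m: "has_bochner_integral lborel (\<lambda>s. normal_density 0 ?d s * (s - 0) ^ (2 * 1)) (fact (2 * 1) / ((2 / ?d\<^sup>2) ^ 1 * fact 1))"
    by (rule normal_moment_even) (use a in simp)
  then have mv: "(\<integral>s. normal_density 0 ?d s * s\<^sup>2 \<partial>lborel) = 1 / a"
    unfolding d2 by (simp add: has_bochner_integral_iff fact_numeral)
  have "normal_density 0 ?d s * s\<^sup>2 = 1 / sqrt (2 * pi / a) * (exp (- a * s\<^sup>2 / 2) * s\<^sup>2)" for s
    unfolding normal_density_def d2 by (simp add: mult.commute)
  then have "1 / sqrt (2 * pi / a) * (\<integral>s. exp (- a * s\<^sup>2 / 2) * s\<^sup>2 \<partial>lborel) = 1 / a"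
    using mv by (simp only: integral_mult_right_zero)
  moreover have "sqrt (2 * pi / a) > 0" using a by simp
  ultimately show ?thesis by (simp add: divide_simps mult.commute split: if_splits)
qed

context markov_walk
begin

lemma exit_step_sup:
  assumes "\<And>x b. - fM \<le> b \<Longrightarrow> b \<le> 0 \<Longrightarrow> \<bar>g x b\<bar> \<le> S" and y: "y > 0"
  shows "\<bar>exit_step P f g x y\<bar> \<le> S * Pm (kc 0) x y"
  unfolding exit_step_def walk_step_def Pm_def sum_distrib_left
proof (rule order_trans[OF sum_abs], rule sum_mono)
  fix x'
  have "- fM \<le> y + f x'" using y fM(1)[of x'] by (simp add: abs_le_iff)
  then have "\<bar>g x' (y + f x')\<bar> \<le> S" if "y + f x' \<le> 0" using assms(1) that by simp
  then show "\<bar>(if y + f x' \<le> 0 then P x x' else 0) * g x' (y + f x')\<bar> \<le> S * (P x x' * kc 0 x' y)"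
    using P_nonneg[of x x'] by (auto simp: kc_def abs_mult mult.commute[of S] intro!: mult_left_mono)
qed

text \<open>H is the odd extension of the last-stretch function. Making the second stretch free adds
  the paths that leave during it. They leave at a given step with probability O(m^(-3/2)), at a
  point of [-fM, 0], where the expectation of H over the i remaining free steps is at most S i /
  sqrt j: the odd kernel contributes order 1 / i and the limit theorem the error E i / sqrt i. The
  free stretch is then replaced by \<open>Ko m\<close>, with E m as relative error.\<close>

lemma core_error_bound:
  assumes \<eta>: "0 < \<eta>" "\<eta> \<le> 1/2"
    and eps: "\<forall>j. 0 \<le> \<epsilon> j" and llt': "\<forall>Gm G Gp j x w. windowed \<eta> Gm G Gp \<longrightarrow> j \<ge> 1 \<longrightarrow>
    (T ^^ j) G x w \<le> (2 * gC0 + \<epsilon> j) * totI Gp / sqrt (real j) \<and>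
    \<bar>(T ^^ j) G x w - Gs j G w\<bar> \<le> (gC0 * (totI Gp - totI Gm) + (2 * gC0 * \<eta> + \<epsilon> j) * totI Gp) / sqrt (real j)"
    and C1: "C1 \<ge> 0" "\<forall>\<eta> j. 0 < \<eta> \<longrightarrow> \<eta> \<le> 1/2 \<longrightarrow> j \<ge> 1 \<longrightarrow> totI (Gup \<eta> j) \<le> C1 / sqrt (real j) \<and> totI (Gup \<eta> j) - totI (Glo \<eta> j) \<le> C1 * \<eta> / sqrt (real j)"
    and C3: "C3 \<ge> 0" "\<forall>j x y. j \<ge> 1 \<longrightarrow> y > 0 \<longrightarrow> Hj j 0 x y \<le> C3 / sqrt (real j)"
    and C4: "C4 \<ge> 0" "\<forall>m\<ge>3. \<forall>k. (Q ^^ (m + k)) (Pm (kc 0)) x y \<le> C4 / (real m * sqrt (real m))"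
    and C5: "C5 \<ge> 0" "\<forall>n. surv P f n x y * sqrt (real n) \<le> C5"
    and m: "m \<ge> 3" "m \<le> j"
  defines "E \<equiv> (\<lambda>i. gC0 * (C1 * \<eta>) + (2 * gC0 * \<eta> + \<epsilon> i) * C1)"
  defines "\<delta> \<equiv> (\<lambda>i. fM * gC1 * C1 / sqrt (real i) + 2 * E i)"
  shows "real m * sqrt (real m) * \<bar>tau_eq P f (Suc (m + m + j)) x y - (Q ^^ m) (\<lambda>x w. Ko m (Gj j 0) w) x y\<bar>
    \<le> 2 * E m * C5 + C4 * (C3 / sqrt (real m) + (\<Sum>i<m. \<delta> i / sqrt (real i)) / sqrt (real m))"
proof -
  have j: "j \<ge> 1" and m1: "m \<ge> 1" using m by auto
  define G where "G = Gj j 0"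
  define H where "H = (\<lambda>z r. G z r - reflG G z r)"
  let ?J = "sqrt (real j)" and ?M = "sqrt (real m)"
  have J: "?J > 0" "?M > 0" "?M \<le> ?J" using j m by auto
  have W: "windowed \<eta> (Glo \<eta> j) G (Gup \<eta> j)" unfolding G_def by (rule G_windowed[OF \<eta>(1)])
  have G0: "0 \<le> G z r" for z r by (simp add: G_def Gj_nonneg)
  have iG: "integrable lborel (G z)" for z unfolding G_def by (rule Gj_integrable)
  have tU: "totI (Gup \<eta> j) \<le> C1 / ?J" and tD: "totI (Gup \<eta> j) - totI (Glo \<eta> j) \<le> C1 * \<eta> / ?J" using C1(2) \<eta> j by auto
  have E0: "E i \<ge> 0" for i using gC0_nonneg C1(1) \<eta> eps by (simp add: E_def)
  have \<delta>0: "\<delta> i \<ge> 0" for i using E0[of i] fM(2) gC1_nonneg C1(1) by (simp add: \<delta>_def)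
  have Ebd: "(gC0 * (totI (Gup \<eta> j) - totI (Glo \<eta> j)) + (2 * gC0 * \<eta> + \<epsilon> i) * totI (Gup \<eta> j)) / sqrt (real i) \<le> E i / ?J / sqrt (real i)" for i
  proof (rule divide_right_mono)
    have "gC0 * (totI (Gup \<eta> j) - totI (Glo \<eta> j)) + (2 * gC0 * \<eta> + \<epsilon> i) * totI (Gup \<eta> j) \<le> gC0 * (C1 * \<eta> / ?J) + (2 * gC0 * \<eta> + \<epsilon> i) * (C1 / ?J)"
      using tU tD gC0_nonneg \<eta> eps by (intro add_mono mult_left_mono) auto
    also have "\<dots> = E i / ?J" by (simp add: E_def add_divide_distrib)
    finally show "gC0 * (totI (Gup \<eta> j) - totI (Glo \<eta> j)) + (2 * gC0 * \<eta> + \<epsilon> i) * totI (Gup \<eta> j) \<le> E i / ?J" .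
  qed simp
  have TH: "\<bar>(T ^^ i) H x w - Ko i G w\<bar> \<le> 2 * (E i / ?J / sqrt (real i))" if i: "i \<ge> 1" for i x w
  proof -
    have 1: "\<bar>(T ^^ i) G x w - Gs i G w\<bar> \<le> E i / ?J / sqrt (real i)"
      by (rule order_trans[OF _ Ebd]) (use llt' W i in blast)
    have "\<bar>(T ^^ i) (reflG G) x w - Gs i (reflG G) w\<bar> \<le> (gC0 * (totI (reflG (Gup \<eta> j)) - totI (reflG (Glo \<eta> j))) + (2 * gC0 * \<eta> + \<epsilon> i) * totI (reflG (Gup \<eta> j))) / sqrt (real i)"
      using llt' windowed_refl[OF W] i by blast
    then have 2: "\<bar>(T ^^ i) (reflG G) x w - Gs i (reflG G) w\<bar> \<le> E i / ?J / sqrt (real i)"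
      unfolding totI_refl by (rule order_trans[OF _ Ebd])
    have "(T ^^ i) H x w = (T ^^ i) G x w - (T ^^ i) (reflG G) x w" unfolding H_def free_step_def by (rule walk_step_pow_diff)
    then show ?thesis using 1 2 Gs_diff_refl[where G = G and w = w, OF i iG] by linarith
  qed
  have tG: "totI G \<le> C1 / ?J"
  proof -
    have "totI G \<le> totI (Gup \<eta> j)" unfolding totI_def
    proof (rule sum_mono, rule integral_mono[OF iG Gup_integrable])
      have "\<bar>0::real\<bar> \<le> \<eta>" using \<eta> by simp
      then have "G z r \<le> Gup \<eta> j z (r + 0)" for z r using W unfolding windowed_def by blast
      then show "G z r \<le> Gup \<eta> j z r" for z r by simp
    qed
    then show ?thesis using tU by linarith
  qed
  \<comment> \<open>At i = 0 there are no free steps to smooth H, and the pointwise bound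
    \<open>Hj_sup_bound\<close> takes over. The term with \<delta> is then a division by zero, hence
    zero.\<close>
  define S where "S = (\<lambda>i. (if i = 0 then C3 else 0) + \<delta> i / sqrt (real i))"
  have S: "\<bar>(T ^^ i) H x b\<bar> \<le> S i / ?J" if b: "- fM \<le> b" "b \<le> 0" for i x b
  proof (cases "i = 0")
    case True
    have "\<bar>H x b\<bar> \<le> C3 / ?J"
    proof (cases "b = 0")
      case True
      then show ?thesis using C3(1) by (simp add: H_def reflG_def G_def Gj_def)
    next
      case False
      then have "Hj j 0 x (- b) \<le> C3 / ?J" using C3(2) j b by simp
      then show ?thesis using b False Hj_nonneg[of j 0 x "- b"] by (simp add: H_def reflG_def G_def Gj_def)
    qed
    then show ?thesis using True by (simp add: S_def)
  next
    case False
    then have i: "i \<ge> 1" by simp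
    have "\<bar>Ko i G b\<bar> \<le> \<bar>b\<bar> * gC1 / real i * totI G" by (rule Ko_bound[OF i iG G0])
    also have "\<dots> \<le> fM * gC1 / real i * (C1 / ?J)"
    proof (rule mult_mono[OF _ tG])
      show "\<bar>b\<bar> * gC1 / real i \<le> fM * gC1 / real i" using b gC1_nonneg by (intro divide_right_mono mult_right_mono) auto
      show "0 \<le> totI G" unfolding totI_def by (intro sum_nonneg integral_nonneg_AE) (auto simp: G0)
    qed (use fM(2) gC1_nonneg in simp)
    also have "\<dots> = fM * gC1 * C1 / sqrt (real i) / sqrt (real i) / ?J"
    proof -
      have "real i = sqrt (real i) * sqrt (real i)" by simp
      then have "fM * gC1 / real i * (C1 / ?J) = fM * gC1 / (sqrt (real i) * sqrt (real i)) * (C1 / ?J)" by simp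
      then show ?thesis by simp
    qed
    finally have "\<bar>(T ^^ i) H x b\<bar> \<le> fM * gC1 * C1 / sqrt (real i) / sqrt (real i) / ?J + 2 * (E i / ?J / sqrt (real i))"
      using TH[OF i, of x b] by linarith
    also have "\<dots> = S i / ?J" using False by (simp add: S_def \<delta>_def add_divide_distrib)
    finally show ?thesis .
  qed
  have S0: "S i \<ge> 0" for i using C3(1) \<delta>0[of i] by (simp add: S_def)
  let ?X = "\<lambda>k. exit_step P f ((T ^^ (m - Suc k)) H)"
  \<comment> \<open>At positive levels the mirror image vanishes, so H may replace the last-stretch
    function under the killed walk.\<close>
  have tau: "tau_eq P f (Suc (m + m + j)) x y = (Q ^^ (m + m)) H x y"
  proof -
    have "tau_eq P f (Suc (m + m + j)) x y = (Q ^^ (m + m)) (Hj j 0) x y"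
      unfolding tau_eq_killed exit_prob_Pm funpow_add[of "m + m" j] o_def Hj_def ..
    also have "\<dots> = (Q ^^ (m + m)) H x y"
      by (rule killed_pow_cong) (use m1 in \<open>auto simp: H_def G_def reflG_def Gj_def\<close>)
    finally show ?thesis .
  qed
  have "(T ^^ m) H = (\<lambda>x w. (Q ^^ m) H x w + (\<Sum>k<m. (Q ^^ k) (?X k) x w))"
    by (intro ext) (rule free_killed_telescope)
  then have "(Q ^^ m) ((T ^^ m) H) x y = (Q ^^ m) (\<lambda>x w. (Q ^^ m) H x w + (\<Sum>k<m. (Q ^^ k) (?X k) x w)) x y" by simp
  also have "\<dots> = (Q ^^ m) ((Q ^^ m) H) x y + (\<Sum>k<m. (Q ^^ m) ((Q ^^ k) (?X k)) x y)"
    unfolding killed_step_def walk_step_pow_add walk_step_pow_sum ..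
  finally have dec: "(Q ^^ m) ((T ^^ m) H) x y = (Q ^^ (m + m)) H x y + (\<Sum>k<m. (Q ^^ (m + k)) (?X k) x y)"
    unfolding funpow_add o_def .
  have e1: "\<bar>(Q ^^ m) ((T ^^ m) H) x y - (Q ^^ m) (\<lambda>x w. Ko m G w) x y\<bar> \<le> 2 * (E m / ?J / ?M) * (C5 / ?M)"
  proof -
    have eq: "(Q ^^ m) ((T ^^ m) H) x y - (Q ^^ m) (\<lambda>x w. Ko m G w) x y = (Q ^^ m) (\<lambda>x w. (T ^^ m) H x w - Ko m G w) x y"
      unfolding killed_step_def walk_step_pow_diff ..
    have 1: "\<bar>(Q ^^ m) (\<lambda>x w. (T ^^ m) H x w - Ko m G w) x y\<bar> \<le> 2 * (E m / ?J / ?M) * (Q ^^ m) (\<lambda>x y. 1) x y"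
      by (rule Q_abs_le) (use TH[OF m1] m1 in auto)
    have "surv P f m x y \<le> C5 / ?M" using C5(2)[rule_format, of m] J(2) by (simp only: pos_le_divide_eq)
    then have 2: "(Q ^^ m) (\<lambda>x y. 1) x y \<le> C5 / ?M" unfolding surv_eq_killed .
    have "0 \<le> 2 * (E m / ?J / ?M)" using E0[of m] by simp
    from order_trans[OF 1 mult_left_mono[OF 2 this]] show ?thesis unfolding eq .
  qed
  have e2: "\<bar>\<Sum>k<m. (Q ^^ (m + k)) (?X k) x y\<bar> \<le> (\<Sum>i<m. S i) / ?J * (C4 / (real m * ?M))"
  proof -
    have "\<bar>(Q ^^ (m + k)) (?X k) x y\<bar> \<le> S (m - Suc k) / ?J * (C4 / (real m * ?M))" for k
    proof -
      have "\<bar>(Q ^^ (m + k)) (?X k) x y\<bar> \<le> S (m - Suc k) / ?J * (Q ^^ (m + k)) (Pm (kc 0)) x y"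
        by (rule Q_abs_le) (use exit_step_sup[OF S] m1 in auto)
      also have "\<dots> \<le> S (m - Suc k) / ?J * (C4 / (real m * ?M))" 
        by (rule mult_left_mono[OF C4(2)[rule_format, OF m(1)]]) (use S0[of "m - Suc k"] in simp)
      finally show ?thesis .
    qed
    then have "\<bar>\<Sum>k<m. (Q ^^ (m + k)) (?X k) x y\<bar> \<le> (\<Sum>k<m. S (m - Suc k) / ?J * (C4 / (real m * ?M)))"
      by (intro order_trans[OF sum_abs] sum_mono) auto
    also have "\<dots> = (\<Sum>k<m. S (m - Suc k)) / ?J * (C4 / (real m * ?M))" by (simp only: sum_divide_distrib sum_distrib_right)
    finally show ?thesis unfolding sum.nat_diff_reindex .
  qed
  have "real m * ?M * \<bar>tau_eq P f (Suc (m + m + j)) x y - (Q ^^ m) (\<lambda>x w. Ko m G w) x y\<bar>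
     \<le> real m * ?M * (2 * (E m / ?J / ?M) * (C5 / ?M) + (\<Sum>i<m. S i) / ?J * (C4 / (real m * ?M)))"
  proof (rule mult_left_mono)
    show "\<bar>tau_eq P f (Suc (m + m + j)) x y - (Q ^^ m) (\<lambda>x w. Ko m G w) x y\<bar> \<le> 2 * (E m / ?J / ?M) * (C5 / ?M) + (\<Sum>i<m. S i) / ?J * (C4 / (real m * ?M))"
      using e1 e2 dec unfolding tau by linarith
  qed simp
  also have "\<dots> = 2 * E m * C5 * (?M / ?J) + C4 * ((\<Sum>i<m. S i) / ?J)"
  proof -
    have "real m = ?M * ?M" by simp
    then have "real m * ?M * (2 * (E m / ?J / ?M) * (C5 / ?M)) = (?M * ?M) * ?M * (2 * (E m / ?J / ?M) * (C5 / ?M))" by simp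
    also have "\<dots> = 2 * E m * C5 * (?M / ?J)" using J by (simp add: field_simps)
    finally have 1: "real m * ?M * (2 * (E m / ?J / ?M) * (C5 / ?M)) = 2 * E m * C5 * (?M / ?J)" .
    have "c * (q / ?J * (C4 / c)) = C4 * (q / ?J)" if "c > 0" for c q using that by simp
    moreover have "real m * ?M > 0" using J m by simp
    ultimately have 2: "real m * ?M * (q / ?J * (C4 / (real m * ?M))) = C4 * (q / ?J)" for q by blast
    show ?thesis unfolding distrib_left 1 2 ..
  qed
  also have "\<dots> \<le> 2 * E m * C5 * 1 + C4 * ((\<Sum>i<m. S i) / ?M)"
  proof (intro add_mono mult_left_mono)
    show "?M / ?J \<le> 1" using J by simp
    have "0 \<le> (\<Sum>i<m. S i)" by (rule sum_nonneg) (rule S0)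
    then show "(\<Sum>i<m. S i) / ?J \<le> (\<Sum>i<m. S i) / ?M" using J by (intro divide_left_mono) auto
  qed (use E0 C5 C4 in auto)
  also have "(\<Sum>i<m. S i) = C3 + (\<Sum>i<m. \<delta> i / sqrt (real i))"
  proof -
    have "(\<Sum>i<m. if i = 0 then C3 else 0) = C3" using m1 by (subst sum.delta) auto
    then show ?thesis unfolding S_def sum.distrib by simp
  qed
  finally show ?thesis by (simp add: G_def add_divide_distrib)
qed

text \<open>The bound above tends to a multiple of \<eta>, and all constants except the null
  sequence of the limit theorem are independent of \<eta>. The offset s lets the last stretch absorb
  the remainder of a division by three.\<close>

lemma core_error:
  assumes \<rho>: "\<rho> > 0"
  shows "\<forall>\<^sub>F m in sequentially. real m * sqrt (real m) * \<bar>tau_eq P f (Suc (m + m + (m + s))) x y - (Q ^^ m) (\<lambda>x w. Ko m (Gj (m + s) 0) w) x y\<bar> \<le> \<rho>"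
proof -
  obtain C1 where C1: "C1 \<ge> 0" "\<forall>\<eta> j. 0 < \<eta> \<longrightarrow> \<eta> \<le> 1/2 \<longrightarrow> j \<ge> 1 \<longrightarrow> totI (Gup \<eta> j) \<le> C1 / sqrt (real j) \<and> totI (Gup \<eta> j) - totI (Glo \<eta> j) \<le> C1 * \<eta> / sqrt (real j)"
    using tot_bounds by blast
  obtain C3 where C3: "C3 \<ge> 0" "\<forall>j x y. j \<ge> 1 \<longrightarrow> y > 0 \<longrightarrow> Hj j 0 x y \<le> C3 / sqrt (real j)" using Hj_sup_bound by blast
  obtain C4 where C4: "C4 \<ge> 0" "\<forall>m\<ge>3. \<forall>k. (Q ^^ (m + k)) (Pm (kc 0)) x y \<le> C4 / (real m * sqrt (real m))" using exit_time_upper by blast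
  obtain C2 where C2: "C2 \<ge> 0" "\<forall>n x y. surv P f n x y * sqrt (real n) \<le> C2 * (2 + \<bar>y\<bar>)" using surv_bound by blast
  define C5 where "C5 = C2 * (2 + \<bar>y\<bar>)"
  have C5: "C5 \<ge> 0" "\<forall>n. surv P f n x y * sqrt (real n) \<le> C5" using C2 by (auto simp: C5_def)
  \<comment> \<open>With E tending to e0 = 3 gC0 C1 \<eta>, the first term contributes 2 e0 C5. The
    weighted mean of \<delta>, which tends to 2 e0, is at most about 4 e0 and contributes 4 e0 C4.
    So the limit is at most A \<eta>.\<close>
  define A where "A = (2 * C5 + 4 * C4) * (3 * gC0 * C1)"
  have A0: "A \<ge> 0" using C5 C4 C1 gC0_nonneg by (simp add: A_def)
  define \<eta> where "\<eta> = min (1/2) (\<rho> / (4 * (1 + A)))"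
  have \<eta>: "0 < \<eta>" "\<eta> \<le> 1/2" using \<rho> A0 unfolding \<eta>_def by (simp, intro min.cobounded1)
  have A\<eta>: "A * \<eta> \<le> \<rho> / 4"
  proof -
    have "A * \<eta> \<le> (1 + A) * (\<rho> / (4 * (1 + A)))" using A0 \<eta> by (intro mult_mono) (auto simp: \<eta>_def)
    also have "\<dots> = \<rho> / 4" using A0 by (simp add: field_simps)
    finally show ?thesis .
  qed
  obtain \<epsilon> :: "nat \<Rightarrow> real" where e: "\<epsilon> \<longlonglongrightarrow> 0" "\<forall>j. 0 \<le> \<epsilon> j" and llt': "\<forall>Gm G Gp j x w. windowed \<eta> Gm G Gp \<longrightarrow> j \<ge> 1 \<longrightarrow>
    (T ^^ j) G x w \<le> (2 * gC0 + \<epsilon> j) * totI Gp / sqrt (real j) \<and>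
    \<bar>(T ^^ j) G x w - Gs j G w\<bar> \<le> (gC0 * (totI Gp - totI Gm) + (2 * gC0 * \<eta> + \<epsilon> j) * totI Gp) / sqrt (real j)"
    using llt[OF \<eta>] by blast
  let ?E = "\<lambda>i. gC0 * (C1 * \<eta>) + (2 * gC0 * \<eta> + \<epsilon> i) * C1"
  let ?d = "\<lambda>i. fM * gC1 * C1 / sqrt (real i) + 2 * ?E i"
  define e0 where "e0 = 3 * gC0 * C1 * \<eta>"
  have e00: "e0 \<ge> 0" using gC0_nonneg C1(1) \<eta> by (simp add: e0_def)
  have "?E \<longlonglongrightarrow> gC0 * (C1 * \<eta>) + (2 * gC0 * \<eta> + 0) * C1" by (intro tendsto_intros e)
  then have El: "?E \<longlonglongrightarrow> e0" by (simp add: e0_def algebra_simps)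
  have "(\<lambda>i. 1 / sqrt (real i)) \<longlonglongrightarrow> 0" by real_asymp
  from tendsto_mult[OF tendsto_const[of "fM * gC1 * C1"] this] have "(\<lambda>i. fM * gC1 * C1 / sqrt (real i)) \<longlonglongrightarrow> 0" by simp
  from tendsto_add[OF this tendsto_mult[OF tendsto_const[of 2] El]] have dl: "?d \<longlonglongrightarrow> 2 * e0" by simp
  define \<rho>' where "\<rho>' = \<rho> / (4 * (2 * C5 + 2 * C4 + 1))"
  have \<rho>': "\<rho>' > 0" "(2 * C5 + 2 * C4) * \<rho>' \<le> \<rho> / 4"
  proof -
    have k: "2 * C5 + 2 * C4 + 1 > 0" using C5 C4 by simp
    then show p: "\<rho>' > 0" using \<rho> by (simp add: \<rho>'_def)
    have "(2 * C5 + 2 * C4) * \<rho>' \<le> (2 * C5 + 2 * C4 + 1) * \<rho>'" using p by (intro mult_right_mono) auto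
    also have "\<dots> = \<rho> / 4"
    proof -
      have "K * (\<rho> / (4 * K)) = \<rho> / 4" if "K > 0" for K :: real using that by simp
      from this[OF k] show ?thesis unfolding \<rho>'_def .
    qed
    finally show "(2 * C5 + 2 * C4) * \<rho>' \<le> \<rho> / 4" .
  qed
  have ev1: "\<forall>\<^sub>F m in sequentially. ?E m < e0 + \<rho>'" using El \<rho>' by (intro order_tendstoD) auto
  have ev2: "\<forall>\<^sub>F m in sequentially. (\<Sum>i<m. ?d i / sqrt (real i)) / sqrt (real m) \<le> 2 * (2 * e0) + \<rho>'"
    by (rule sqrt_weighted_mean[OF dl _ \<rho>'(1)]) (use e00 in simp)
  have "(\<lambda>m. C3 / sqrt (real m)) \<longlonglongrightarrow> 0" by real_asymp
  then have ev3: "\<forall>\<^sub>F m in sequentially. C3 / sqrt (real m) < \<rho>'" using \<rho>' by (intro order_tendstoD) auto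
  show ?thesis using ev1 ev2 ev3 eventually_ge_at_top[of 3]
  proof eventually_elim
    case (elim m)
    have "real m * sqrt (real m) * \<bar>tau_eq P f (Suc (m + m + (m + s))) x y - (Q ^^ m) (\<lambda>x w. Ko m (Gj (m + s) 0) w) x y\<bar>
      \<le> 2 * ?E m * C5 + C4 * (C3 / sqrt (real m) + (\<Sum>i<m. ?d i / sqrt (real i)) / sqrt (real m))"
      by (rule core_error_bound[OF \<eta> e(2) llt' C1 C3 C4 C5]) (use elim in auto)
    also have "\<dots> \<le> 2 * (e0 + \<rho>') * C5 + C4 * (\<rho>' + (2 * (2 * e0) + \<rho>'))"
    proof (rule add_mono)
      show "2 * ?E m * C5 \<le> 2 * (e0 + \<rho>') * C5" by (rule mult_right_mono[OF mult_left_mono[OF less_imp_le[OF elim(1)]] C5(1)]) simp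
      show "C4 * (C3 / sqrt (real m) + (\<Sum>i<m. ?d i / sqrt (real i)) / sqrt (real m)) \<le> C4 * (\<rho>' + (2 * (2 * e0) + \<rho>'))"
        by (rule mult_left_mono[OF add_mono[OF less_imp_le[OF elim(3)] elim(2)] C4(1)])
    qed
    also have "\<dots> = A * \<eta> + (2 * C5 + 2 * C4) * \<rho>'" by (simp add: A_def e0_def algebra_simps)
    also have "\<dots> \<le> \<rho>" using A\<eta> \<rho>'(2) \<rho> by linarith
    finally show ?case .
  qed
qed

section \<open>The sine transform of the last stretch and the limit of the main term\<close>

definition "bj j t = (\<Sum>z\<in>UNIV. \<nu> z * (\<integral>r. Gj j 0 z r * sin (t * r) \<partial>lborel))" for t :: real

lemma bj_dual: "bj j t = pairing ((Qd ^^ j) (\<lambda>x y. sin (t * y))) (kc 0)"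
  unfolding bj_def by (rule Gj_weighted_integrable(2)[where B = 1]) auto

lemma dual_sine_bound:
  "\<exists>C\<ge>0. \<forall>j t x z. z > 0 \<longrightarrow> \<bar>(Qd ^^ j) (\<lambda>x y. sin (t * y)) x z\<bar> \<le> \<bar>t\<bar> * (C + \<bar>z\<bar>)"
proof -
  interpret D: markov_walk "Pdual P \<nu>" \<nu> "\<lambda>u. - f u" by (rule dual_walk)
  obtain C where C: "C \<ge> 0" "\<forall>n x y. (Qd ^^ n) (\<lambda>x y. max 0 y) x y \<le> C + \<bar>y\<bar>" using D.mean_bound by blast
  have "\<bar>(Qd ^^ j) (\<lambda>x y. sin (t * y)) x z\<bar> \<le> \<bar>t\<bar> * (C + \<bar>z\<bar>)" if "z > 0" for j t x z
  proof -
    have "\<bar>(Qd ^^ j) (\<lambda>x y. sin (t * y)) x z\<bar> \<le> \<bar>t\<bar> * (Qd ^^ j) (\<lambda>x y. max 0 y) x z"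
    proof (rule D.Q_abs_le)
      show "\<bar>sin (t * y)\<bar> \<le> \<bar>t\<bar> * max 0 y" if "y > 0" for y :: real
        using abs_sin_x_le_abs_x[of "t * y"] that by (simp add: abs_mult)
    qed (use that in simp)
    also have "\<dots> \<le> \<bar>t\<bar> * (C + \<bar>z\<bar>)" by (rule mult_left_mono[OF C(2)[rule_format]]) simp
    finally show ?thesis .
  qed
  with C(1) show ?thesis by blast
qed

definition "dualC = pairing (markov_walk.harmV (Pdual P \<nu>) (\<lambda>u. - f u)) (kc 0)"

lemma dual_sigma: "markov_walk.\<sigma>2 (Pdual P \<nu>) \<nu> (\<lambda>u. - f u) = \<sigma>2"
  unfolding markov_walk.\<sigma>2_def[OF dual_walk] \<sigma>2_def by (rule dual_sigma2)

end

text \<open>The exit time n splits as n - 1 = 3 m + e, with three stretches m, m, m + e before the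
  final step. Only three remainders occur, so their thresholds can be added.\<close>

lemma tendsto_residues_mod3:
  fixes a :: "nat \<Rightarrow> real"
  assumes "\<And>e. (\<lambda>m. a (Suc (m + m + (m + e)))) \<longlonglongrightarrow> L"
  shows "a \<longlonglongrightarrow> L"
proof (rule LIMSEQ_I)
  fix r :: real assume r: "r > 0"
  obtain M where M: "norm (a (Suc (m + m + (m + e))) - L) < r" if "m \<ge> M e" for e m
    using LIMSEQ_D[OF assms r] by metis
  define K where "K = M 0 + M 1 + M 2"
  have "norm (a n - L) < r" if n: "n \<ge> 3 * K + 3" for n
  proof -
    define k m e where "k = n - 1" and "m = k div 3" and "e = k mod 3"
    have k: "n = Suc k" using n by (simp add: k_def)
    have "k = 3 * m + e" unfolding m_def e_def by simp
    then have nm: "n = Suc (m + m + (m + e))" using k by simp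
    have "e < 3" by (simp add: e_def)
    then have e: "e = 0 \<or> e = 1 \<or> e = 2" by auto
    then have "M e \<le> K" by (auto simp: K_def)
    then have "m \<ge> M e" using n nm \<open>e < 3\<close> by linarith
    then show ?thesis unfolding nm by (rule M)
  qed
  then show "\<exists>no. \<forall>n\<ge>no. norm (a n - L) < r" by blast
qed

context markov_walk
begin

lemma kc0_support: "0 < y \<Longrightarrow> kc 0 x y \<noteq> 0 \<Longrightarrow> y \<le> fM"
  using fM(1)[of x] by (auto simp: kc_def abs_le_iff split: if_splits)

lemma kc0_pointwise_bound:
  assumes "B \<ge> 0" "\<And>y. 0 < y \<Longrightarrow> y \<le> fM \<Longrightarrow> \<bar>a y\<bar> \<le> B"
  shows "\<bar>indicator {0<..} y * (a y * kc 0 x y)\<bar> \<le> B * indicator {0..fM} y"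
proof (cases "0 < y \<and> kc 0 x y \<noteq> 0")
  case True
  then have "y \<le> fM" using kc0_support by blast
  then show ?thesis using True assms(2)[of y] by (auto simp: kc_def split: if_splits)
qed (use assms(1) in auto)

lemma kc_measurable [measurable]: "kc c x \<in> borel_measurable borel"
  unfolding kc_def[abs_def] by measurable

lemma indicator_fM_integrable: "integrable lborel (\<lambda>y. B * indicator {0..fM} y :: real)"
  by (intro integrable_mult_right integrable_real_indicator) (auto simp: emeasure_lborel_Icc_eq)

lemma kc0_integrable:
  assumes [measurable]: "a \<in> borel_measurable borel" and B: "B \<ge> 0" "\<And>y. 0 < y \<Longrightarrow> y \<le> fM \<Longrightarrow> \<bar>a y\<bar> \<le> B"
  shows "integrable lborel (\<lambda>y. indicator {0<..} y * (a y * kc 0 x y))"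
proof (rule Bochner_Integration.integrable_bound[OF indicator_fM_integrable[of B]])
  show "AE y in lborel. norm (indicator {0<..} y * (a y * kc 0 x y)) \<le> norm (B * indicator {0..fM} y :: real)"
  proof (rule AE_I2)
    fix y
    have "norm (indicator {0<..} y * (a y * kc 0 x y)) \<le> B * indicator {0..fM} y"
      unfolding real_norm_def by (rule kc0_pointwise_bound[OF B])
    also have "\<dots> \<le> norm (B * indicator {0..fM} y :: real)" by simp
    finally show "norm (indicator {0<..} y * (a y * kc 0 x y)) \<le> norm (B * indicator {0..fM} y :: real)" .
  qed
qed measurable

lemma pairing_kc0_bound:
  assumes m: "\<And>x. a x \<in> borel_measurable borel" and B: "B \<ge> 0" "\<And>x y. 0 < y \<Longrightarrow> y \<le> fM \<Longrightarrow> \<bar>a x y\<bar> \<le> B"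
  shows "\<bar>pairing a (kc 0)\<bar> \<le> B * fM"
proof -
  have "norm (\<integral>y. indicator {0<..} y * (a x y * kc 0 x y) \<partial>lborel) \<le> (\<integral>y. B * indicator {0..fM} y \<partial>lborel)" for x
  proof (rule Bochner_Integration.integral_norm_bound_integral[OF kc0_integrable[OF m B] indicator_fM_integrable])
    show "norm (indicator {0<..} y * (a x y * kc 0 x y)) \<le> B * indicator {0..fM} y" for y
      unfolding real_norm_def by (rule kc0_pointwise_bound[OF B])
  qed
  then have "\<bar>\<integral>y. indicator {0<..} y * (a x y * kc 0 x y) \<partial>lborel\<bar> \<le> B * fM" for x
    using fM(2) by simp
  then show ?thesis unfolding pairing_def by (rule wsum_bound[OF nu_nonneg nu_sum])
qed

lemma pairing_kc0_tendsto:
  assumes m: "\<And>n x. a n x \<in> borel_measurable borel" "\<And>x. b x \<in> borel_measurable borel"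
    and B: "B \<ge> 0" "\<And>n x y. 0 < y \<Longrightarrow> y \<le> fM \<Longrightarrow> \<bar>a n x y\<bar> \<le> B"
    and l: "\<And>x y. 0 < y \<Longrightarrow> (\<lambda>n. a n x y) \<longlonglongrightarrow> b x y"
  shows "(\<lambda>n. pairing (a n) (kc 0)) \<longlonglongrightarrow> pairing b (kc 0)"
  unfolding pairing_def
proof (intro tendsto_sum tendsto_mult tendsto_const)
  fix x
  note [measurable] = m
  show "(\<lambda>n. \<integral>y. indicator {0<..} y * (a n x y * kc 0 x y) \<partial>lborel) \<longlonglongrightarrow> (\<integral>y. indicator {0<..} y * (b x y * kc 0 x y) \<partial>lborel)"
  proof (rule integral_dominated_convergence[where w = "\<lambda>y. B * indicator {0..fM} y"])
    show "AE y in lborel. (\<lambda>n. indicator {0<..} y * (a n x y * kc 0 x y)) \<longlonglongrightarrow> indicator {0<..} y * (b x y * kc 0 x y)"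
    proof (rule AE_I2)
      fix y
      show "(\<lambda>n. indicator {0<..} y * (a n x y * kc 0 x y)) \<longlonglongrightarrow> indicator {0<..} y * (b x y * kc 0 x y)"
        using l[of y x] by (cases "y > 0") (auto intro!: tendsto_intros)
    qed
    show "AE y in lborel. norm (indicator {0<..} y * (a n x y * kc 0 x y)) \<le> B * indicator {0..fM} y" for n
      unfolding real_norm_def by (rule AE_I2, rule kc0_pointwise_bound[OF B])
  qed (use indicator_fM_integrable in measurable)
qed

lemma Gj_measurable [measurable]: "Gj j c z \<in> borel_measurable borel"
  using borel_measurable_integrable[OF Gj_integrable] by simp

lemma bj_measurable [measurable]: "bj j \<in> borel_measurable borel"
  unfolding bj_def[abs_def] by measurable

lemma sin_pow_measurable: "(\<lambda>z. (killed_step p g ^^ j) (\<lambda>x y. sin (t * y)) x z) \<in> borel_measurable borel"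
  by (rule killed_step_measurable) measurable

lemma bj_bound: "\<exists>C\<ge>0. \<forall>j t. \<bar>bj j t\<bar> \<le> C * \<bar>t\<bar>"
proof -
  obtain C where C: "C \<ge> 0" "\<forall>j t x z. z > 0 \<longrightarrow> \<bar>(Qd ^^ j) (\<lambda>x y. sin (t * y)) x z\<bar> \<le> \<bar>t\<bar> * (C + \<bar>z\<bar>)" using dual_sine_bound by blast
  have "\<bar>bj j t\<bar> \<le> (\<bar>t\<bar> * (C + fM)) * fM" for j t
    unfolding bj_dual
  proof (rule pairing_kc0_bound)
    fix x :: 'a and z :: real assume z: "0 < z" "z \<le> fM"
    have "\<bar>(Qd ^^ j) (\<lambda>x y. sin (t * y)) x z\<bar> \<le> \<bar>t\<bar> * (C + \<bar>z\<bar>)" by (rule C(2)[rule_format, OF z(1)])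
    also have "\<dots> \<le> \<bar>t\<bar> * (C + fM)" using z by (intro mult_left_mono) auto
    finally show "\<bar>(Qd ^^ j) (\<lambda>x y. sin (t * y)) x z\<bar> \<le> \<bar>t\<bar> * (C + fM)" .
  qed (use C(1) fM(2) sin_pow_measurable in auto)
  then have "\<bar>bj j t\<bar> \<le> ((C + fM) * fM) * \<bar>t\<bar>" for j t by (simp add: mult_ac)
  moreover have "(C + fM) * fM \<ge> 0" using C(1) fM(2) by simp
  ultimately show ?thesis by blast
qed

lemma pairing_scale: "pairing (\<lambda>x y. c * a x y) b = c * pairing a b"
proof -
  have "(\<integral>y. indicator {0<..} y * (c * a x y * b x y) \<partial>lborel) = c * (\<integral>y. indicator {0<..} y * (a x y * b x y) \<partial>lborel)" for x
    by (subst integral_mult_right_zero[symmetric]) (simp add: mult_ac)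
  then show ?thesis unfolding pairing_def by (simp add: sum_distrib_left mult_ac)
qed

text \<open>\<open>sine_limit\<close> for the dual walk, integrated over the overshoot, which is at
  most fM; on this range the sine bound supplies a constant majorant.\<close>

lemma bj_limit: "(\<lambda>m. sqrt (real m) * bj (m + e) (s / sqrt (real m))) \<longlonglongrightarrow> dualC * (s * exp (- \<sigma>2 * s\<^sup>2 / 2))"
proof -
  interpret D: markov_walk "Pdual P \<nu>" \<nu> "\<lambda>u. - f u" by (rule dual_walk)
  obtain C where C: "C \<ge> 0" "\<forall>j t x z. z > 0 \<longrightarrow> \<bar>(Qd ^^ j) (\<lambda>x y. sin (t * y)) x z\<bar> \<le> \<bar>t\<bar> * (C + \<bar>z\<bar>)" using dual_sine_bound by blast
  let ?k = "s * exp (- \<sigma>2 * s\<^sup>2 / 2)"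
  let ?a = "\<lambda>m x z. sqrt (real m) * (Qd ^^ (m + e)) (\<lambda>x y. sin (s / sqrt (real m) * y)) x z"
  have "(\<lambda>m. pairing (?a m) (kc 0)) \<longlonglongrightarrow> pairing (\<lambda>x z. ?k * D.harmV x z) (kc 0)"
  proof (rule pairing_kc0_tendsto[where B = "\<bar>s\<bar> * (C + fM)"])
    fix n :: nat and x :: 'a and z :: real assume z: "0 < z" "z \<le> fM"
    have "\<bar>?a n x z\<bar> \<le> sqrt (real n) * (\<bar>s / sqrt (real n)\<bar> * (C + \<bar>z\<bar>))"
    proof -
      have "\<bar>?a n x z\<bar> = sqrt (real n) * \<bar>(Qd ^^ (n + e)) (\<lambda>x y. sin (s / sqrt (real n) * y)) x z\<bar>" by (simp only: abs_mult) simp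
      then show ?thesis using mult_left_mono[OF C(2)[rule_format, OF z(1)], of "sqrt (real n)" "n + e" "s / sqrt (real n)" x] by simp
    qed
    also have "\<dots> \<le> \<bar>s\<bar> * (C + fM)"
    proof (cases "n = 0")
      case False
      then have "sqrt (real n) * (\<bar>s / sqrt (real n)\<bar> * (C + \<bar>z\<bar>)) = \<bar>s\<bar> * (C + \<bar>z\<bar>)" by simp
      also have "\<dots> \<le> \<bar>s\<bar> * (C + fM)" using z by (intro mult_left_mono) auto
      finally show ?thesis .
    qed (use C(1) fM(2) in simp)
    finally show "\<bar>?a n x z\<bar> \<le> \<bar>s\<bar> * (C + fM)" .
  next
    fix x :: 'a and z :: real assume z: "0 < z"
    \<comment> \<open>At time n = m + e the frequency is s / sqrt m = s / sqrt (n - e). Since sqrt n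
      times it still tends to s, the limit is unaffected by the offset.\<close>
    let ?t = "\<lambda>n. s / sqrt (real n - real e)"
    have "(\<lambda>n. sqrt (real n) / sqrt (real n - real e)) \<longlonglongrightarrow> 1" by real_asymp
    from tendsto_mult[OF tendsto_const[of s] this] have "(\<lambda>n. sqrt (real n) * ?t n) \<longlonglongrightarrow> s" by (simp add: mult.commute)
    from D.sine_limit[OF this, of x z] have "(\<lambda>n. sqrt (real n) * (Qd ^^ n) (\<lambda>x y. sin (?t n * y)) x z) \<longlonglongrightarrow> D.harmV x z * ?k"
      unfolding dual_sigma .
    from LIMSEQ_ignore_initial_segment[OF this, of e]
    have l: "(\<lambda>m. sqrt (real (m + e)) * (Qd ^^ (m + e)) (\<lambda>x y. sin (s / sqrt (real m) * y)) x z) \<longlonglongrightarrow> D.harmV x z * ?k" by simp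
    have "(\<lambda>m. sqrt (real m) / sqrt (real m + real e)) \<longlonglongrightarrow> 1" by real_asymp
    from tendsto_mult[OF this l] have "(\<lambda>m. sqrt (real m) / sqrt (real m + real e) * (sqrt (real (m + e)) * (Qd ^^ (m + e)) (\<lambda>x y. sin (s / sqrt (real m) * y)) x z)) \<longlonglongrightarrow> ?k * D.harmV x z"
      by (simp add: mult.commute)
    moreover have "sqrt (real m) / sqrt (real m + real e) * (sqrt (real (m + e)) * q) = sqrt (real m) * q" for m q
      by (cases "m = 0") (simp_all add: real_sqrt_eq_zero_cancel_iff)
    ultimately show "(\<lambda>m. ?a m x z) \<longlonglongrightarrow> ?k * D.harmV x z" by simp
  next
    show "(\<lambda>z. ?a m x z) \<in> borel_measurable borel" for m x
      by (intro borel_measurable_times borel_measurable_const sin_pow_measurable)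
  qed (use C(1) fM(2) in auto)
  then have "(\<lambda>m. sqrt (real m) * bj (m + e) (s / sqrt (real m))) \<longlonglongrightarrow> pairing (\<lambda>x z. ?k * D.harmV x z) (kc 0)"
    unfolding pairing_scale bj_dual .
  then show ?thesis unfolding pairing_scale dualC_def by (simp only: mult.commute)
qed

text \<open>By \<open>gk_reflect\<close> the odd kernel is an integral of products of sines. Fubini
  lets the integral over the level r act on one sine alone, which gives \<open>bj\<close>.\<close>

lemma Ko_sine:
  assumes m: "m \<ge> 1"
  shows "Ko m (Gj j 0) w = 1 / pi * (\<integral>t. exp (- (\<sigma>2 * real m) * t\<^sup>2 / 2) * bj j t * sin (t * w) \<partial>lborel)"
proof -
  let ?e = "\<lambda>t. exp (- (\<sigma>2 * real m) * t\<^sup>2 / 2)"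
  let ?B = "\<lambda>z t. \<integral>r. Gj j 0 z r * sin (t * r) \<partial>lborel"
  have p: "\<sigma>2 * real m > 0" using m \<sigma>2_pos by simp
  have Bm: "?B z \<in> borel_measurable borel" for z by measurable
  have Bb: "\<bar>?B z t\<bar> \<le> (\<integral>r. Gj j 0 z r \<partial>lborel)" for z t
  proof -
    have "norm (?B z t) \<le> (\<integral>r. Gj j 0 z r \<partial>lborel)"
      by (rule Bochner_Integration.integral_norm_bound_integral[OF Gj_weighted_integrable(1)[where B = 1] Gj_integrable])
         (auto simp: abs_mult Gj_nonneg intro!: mult_left_le)
    then show ?thesis by simp
  qed
  have i: "integrable lborel (\<lambda>t. ?e t * (\<nu> z * ?B z t * sin (t * w)))" for z
  proof (rule integrable_mult_bounded[OF gauss_integrable[OF p]])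
    show "(\<lambda>t. \<nu> z * ?B z t * sin (t * w)) \<in> borel_measurable borel" using Bm by measurable
    fix t
    have "\<bar>\<nu> z * ?B z t * sin (t * w)\<bar> \<le> \<bar>\<nu> z * ?B z t\<bar>" by (simp add: abs_mult mult_left_le)
    also have "\<dots> \<le> \<nu> z * (\<integral>r. Gj j 0 z r \<partial>lborel)" using nu_nonneg[of z] Bb by (simp add: abs_mult mult_left_mono)
    finally show "\<bar>\<nu> z * ?B z t * sin (t * w)\<bar> \<le> \<nu> z * (\<integral>r. Gj j 0 z r \<partial>lborel)" .
  qed
  have "\<nu> z * (\<integral>r. Gj j 0 z r * (gk m (w - r) - gk m (w + r)) \<partial>lborel) = 1 / pi * (\<integral>t. ?e t * (\<nu> z * ?B z t * sin (t * w)) \<partial>lborel)" for z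
  proof -
    have "(\<integral>r. Gj j 0 z r * (gk m (w - r) - gk m (w + r)) \<partial>lborel) = (\<integral>r. 1 / pi * (\<integral>t. ?e t * (Gj j 0 z r * (sin (t * w) * sin (t * r))) \<partial>lborel) \<partial>lborel)"
    proof (rule Bochner_Integration.integral_cong[OF refl])
      fix r
      have "Gj j 0 z r * (gk m (w - r) - gk m (w + r)) = 1 / pi * (Gj j 0 z r * (\<integral>t. ?e t * (sin (t * w) * sin (t * r)) \<partial>lborel))"
        unfolding gk_reflect[OF m] by simp
      also have "Gj j 0 z r * (\<integral>t. ?e t * (sin (t * w) * sin (t * r)) \<partial>lborel) = (\<integral>t. ?e t * (Gj j 0 z r * (sin (t * w) * sin (t * r))) \<partial>lborel)"
        by (subst integral_mult_right_zero[symmetric]) (simp add: mult_ac)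
      finally show "Gj j 0 z r * (gk m (w - r) - gk m (w + r)) = 1 / pi * (\<integral>t. ?e t * (Gj j 0 z r * (sin (t * w) * sin (t * r))) \<partial>lborel)" .
    qed
    also have "\<dots> = 1 / pi * (\<integral>r. (\<integral>t. ?e t * (Gj j 0 z r * (sin (t * w) * sin (t * r))) \<partial>lborel) \<partial>lborel)"
      by (rule integral_mult_right_zero)
    also have "(\<integral>r. (\<integral>t. ?e t * (Gj j 0 z r * (sin (t * w) * sin (t * r))) \<partial>lborel) \<partial>lborel) = (\<integral>t. (\<integral>r. ?e t * (Gj j 0 z r * (sin (t * w) * sin (t * r))) \<partial>lborel) \<partial>lborel)"
    proof (rule fubini_dominated[OF _ Gj_integrable gauss_integrable[OF p]])
      show "(\<lambda>(r, t). ?e t * (Gj j 0 z r * (sin (t * w) * sin (t * r)))) \<in> borel_measurable (borel \<Otimes>\<^sub>M borel)" by measurable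
      fix r t
      have "\<bar>sin (t * w)\<bar> * \<bar>sin (t * r)\<bar> \<le> 1" by (rule mult_le_one) auto
      then have "Gj j 0 z r * ?e t * (\<bar>sin (t * w)\<bar> * \<bar>sin (t * r)\<bar>) \<le> Gj j 0 z r * ?e t"
        by (rule mult_left_le) (simp add: Gj_nonneg)
      then show "\<bar>?e t * (Gj j 0 z r * (sin (t * w) * sin (t * r)))\<bar> \<le> Gj j 0 z r * ?e t"
        by (simp add: abs_mult Gj_nonneg mult_ac)
    qed
    finally have 1: "(\<integral>r. Gj j 0 z r * (gk m (w - r) - gk m (w + r)) \<partial>lborel) = 1 / pi * (\<integral>t. (\<integral>r. ?e t * (Gj j 0 z r * (sin (t * w) * sin (t * r))) \<partial>lborel) \<partial>lborel)" .
    have 2: "\<nu> z * (\<integral>t. (\<integral>r. ?e t * (Gj j 0 z r * (sin (t * w) * sin (t * r))) \<partial>lborel) \<partial>lborel) = (\<integral>t. ?e t * (\<nu> z * ?B z t * sin (t * w)) \<partial>lborel)"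
    proof -
      have "(\<integral>r. ?e t * (Gj j 0 z r * (sin (t * w) * sin (t * r))) \<partial>lborel) = ?e t * sin (t * w) * ?B z t" for t
        by (subst integral_mult_right_zero[symmetric]) (simp add: mult_ac)
      then have "\<nu> z * (\<integral>t. (\<integral>r. ?e t * (Gj j 0 z r * (sin (t * w) * sin (t * r))) \<partial>lborel) \<partial>lborel) = (\<integral>t. \<nu> z * (?e t * sin (t * w) * ?B z t) \<partial>lborel)"
        by (simp only: integral_mult_right_zero)
      then show ?thesis by (simp only: mult_ac)
    qed
    show ?thesis unfolding 1 mult.left_commute[of "\<nu> z" "1 / pi"] 2 ..
  qed
  then have "Ko m (Gj j 0) w = (\<Sum>z\<in>UNIV. 1 / pi * (\<integral>t. ?e t * (\<nu> z * ?B z t * sin (t * w)) \<partial>lborel))" unfolding Ko_def by (intro sum.cong) auto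
  also have "\<dots> = 1 / pi * (\<Sum>z\<in>UNIV. \<integral>t. ?e t * (\<nu> z * ?B z t * sin (t * w)) \<partial>lborel)" by (rule sum_distrib_left[symmetric])
  also have "(\<Sum>z\<in>UNIV. \<integral>t. ?e t * (\<nu> z * ?B z t * sin (t * w)) \<partial>lborel) = (\<integral>t. (\<Sum>z\<in>UNIV. ?e t * (\<nu> z * ?B z t * sin (t * w))) \<partial>lborel)"
    by (rule Bochner_Integration.integral_sum[symmetric]) (rule i)
  also have "\<dots> = (\<integral>t. ?e t * bj j t * sin (t * w) \<partial>lborel)"
    unfolding bj_def by (simp only: sum_distrib_left sum_distrib_right mult.assoc)
  finally show ?thesis .
qed

text \<open>The substitution t = s / sqrt m uses up one of the three factors sqrt m; each of the two
  sine transforms receives one of the others.\<close>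

lemma main_term_repr:
  assumes m: "m \<ge> 1"
  shows "real m * sqrt (real m) * (Q ^^ m) (\<lambda>x w. Ko m (Gj j 0) w) x y = 1 / pi * (\<integral>s. exp (- \<sigma>2 * s\<^sup>2 / 2) *
    ((sqrt (real m) * bj j (s / sqrt (real m))) * (sqrt (real m) * (Q ^^ m) (\<lambda>x y. sin (s / sqrt (real m) * y)) x y)) \<partial>lborel)"
proof -
  let ?e = "\<lambda>t. exp (- (\<sigma>2 * real m) * t\<^sup>2 / 2)" and ?M = "sqrt (real m)"
  have M: "?M > 0" "real m = ?M * ?M" using m by auto
  have p: "\<sigma>2 * real m > 0" using m \<sigma>2_pos by simp
  obtain C where C: "C \<ge> 0" "\<forall>j t. \<bar>bj j t\<bar> \<le> C * \<bar>t\<bar>" using bj_bound by blast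
  have i0: "integrable lborel (\<lambda>t. ?e t * bj j t)"
  proof (rule Bochner_Integration.integrable_bound)
    show "integrable lborel (\<lambda>t. C * (?e t * t ^ 1))" by (intro integrable_mult_right gauss_integrable_moment[OF p])
    show "AE t in lborel. norm (?e t * bj j t) \<le> norm (C * (?e t * t ^ 1))"
      using C by (intro AE_I2) (simp add: abs_mult mult.left_commute)
  qed measurable
  have i: "integrable lborel (\<lambda>t. ?e t * bj j t * sin (t * w))" for w
    by (rule integrable_mult_bounded[OF i0, where K = 1]) auto
  have "(Q ^^ m) (\<lambda>x w. Ko m (Gj j 0) w) x y = (Q ^^ m) (\<lambda>x w. 1 / pi * (\<integral>t. ?e t * bj j t * sin (t * w) \<partial>lborel)) x y"
    unfolding Ko_sine[OF m] ..
  also have "\<dots> = 1 / pi * (Q ^^ m) (\<lambda>x w. \<integral>t. ?e t * bj j t * sin (t * w) \<partial>lborel) x y"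
    unfolding killed_step_def by (rule walk_step_pow_scale)
  also have "(Q ^^ m) (\<lambda>x w. \<integral>t. ?e t * bj j t * sin (t * w) \<partial>lborel) x y = (\<integral>t. (Q ^^ m) (\<lambda>x w. ?e t * bj j t * sin (t * w)) x y \<partial>lborel)"
    unfolding killed_step_def by (rule walk_step_pow_integral(2)) (rule i)
  also have "\<dots> = (\<integral>t. ?e t * bj j t * (Q ^^ m) (\<lambda>x w. sin (t * w)) x y \<partial>lborel)"
    unfolding killed_step_def walk_step_pow_scale ..
  also have "\<dots> = \<bar>1 / ?M\<bar> *\<^sub>R (\<integral>s. ?e (0 + 1 / ?M * s) * bj j (0 + 1 / ?M * s) * (Q ^^ m) (\<lambda>x w. sin ((0 + 1 / ?M * s) * w)) x y \<partial>lborel)"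
    by (rule lborel_integral_real_affine) (use M in simp)
  also have "\<dots> = 1 / ?M * (\<integral>s. exp (- \<sigma>2 * s\<^sup>2 / 2) * (bj j (s / ?M) * (Q ^^ m) (\<lambda>x w. sin (s / ?M * w)) x y) \<partial>lborel)"
  proof -
    have "- (\<sigma>2 * real m) * (s / ?M)\<^sup>2 / 2 = - \<sigma>2 * s\<^sup>2 / 2" for s using m by (simp add: power_divide)
    then have "?e (s / ?M) = exp (- \<sigma>2 * s\<^sup>2 / 2)" for s by (simp only:)
    moreover have "0 + 1 / ?M * s = s / ?M" for s by simp
    moreover have "\<bar>1 / ?M\<bar> = 1 / ?M" by simp
    ultimately show ?thesis by (simp only: mult.assoc real_scaleR_def)
  qed
  finally have "real m * ?M * (Q ^^ m) (\<lambda>x w. Ko m (Gj j 0) w) x y = 1 / pi * ((?M * ?M) * (\<integral>s. exp (- \<sigma>2 * s\<^sup>2 / 2) * (bj j (s / ?M) * (Q ^^ m) (\<lambda>x w. sin (s / ?M * w)) x y) \<partial>lborel))"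
    using M(1) by simp
  also have "(?M * ?M) * (\<integral>s. exp (- \<sigma>2 * s\<^sup>2 / 2) * (bj j (s / ?M) * (Q ^^ m) (\<lambda>x w. sin (s / ?M * w)) x y) \<partial>lborel)
    = (\<integral>s. (?M * ?M) * (exp (- \<sigma>2 * s\<^sup>2 / 2) * (bj j (s / ?M) * (Q ^^ m) (\<lambda>x w. sin (s / ?M * w)) x y)) \<partial>lborel)"
    by (rule integral_mult_right_zero[symmetric])
  also have "\<dots> = (\<integral>s. exp (- \<sigma>2 * s\<^sup>2 / 2) * ((?M * bj j (s / ?M)) * (?M * (Q ^^ m) (\<lambda>x w. sin (s / ?M * w)) x y)) \<partial>lborel)"
    by (simp only: mult_ac)
  finally show ?thesis .
qed

text \<open>Each stretch contributes one factor exp(-\<sigma>2 s^2 / 2) and each transform a factor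
  s. Hence the limit is a Gaussian second moment with parameter 3 \<sigma>2; linear bounds on both
  transforms give the majorant.\<close>

lemma main_term_limit:
  "(\<lambda>m. real m * sqrt (real m) * (Q ^^ m) (\<lambda>x w. Ko m (Gj (m + e) 0) w) x y)
     \<longlonglongrightarrow> 1 / pi * (dualC * harmV x y * (sqrt (2 * pi / (3 * \<sigma>2)) / (3 * \<sigma>2)))"
proof -
  obtain C where C: "C \<ge> 0" "\<forall>j t. \<bar>bj j t\<bar> \<le> C * \<bar>t\<bar>" using bj_bound by blast
  obtain C' where C': "C' \<ge> 0" "\<forall>n x y. (Q ^^ n) (\<lambda>x y. max 0 y) x y \<le> C' + \<bar>y\<bar>" using mean_bound by blast
  let ?e = "\<lambda>s. exp (- \<sigma>2 * s\<^sup>2 / 2)"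
  let ?b = "\<lambda>m s. sqrt (real m) * bj (m + e) (s / sqrt (real m))"
  let ?a = "\<lambda>m s. sqrt (real m) * (Q ^^ m) (\<lambda>x y. sin (s / sqrt (real m) * y)) x y"
  have bb: "\<bar>?b m s\<bar> \<le> C * \<bar>s\<bar>" for m s
  proof (cases "m = 0")
    case False
    have "\<bar>?b m s\<bar> \<le> sqrt (real m) * (C * \<bar>s / sqrt (real m)\<bar>)"
    proof -
      have "\<bar>?b m s\<bar> = sqrt (real m) * \<bar>bj (m + e) (s / sqrt (real m))\<bar>" by (simp only: abs_mult) simp
      then show ?thesis using mult_left_mono[OF C(2)[rule_format, of "m + e" "s / sqrt (real m)"], of "sqrt (real m)"] by simp
    qed
    also have "\<dots> = C * \<bar>s\<bar>" using False by simp
    finally show ?thesis .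
  qed (use C(1) in simp)
  have ab: "\<bar>?a m s\<bar> \<le> (C' + \<bar>y\<bar>) * \<bar>s\<bar>" for m s
  proof (cases "m = 0")
    case False
    let ?t = "s / sqrt (real m)"
    have "\<bar>(Q ^^ m) (\<lambda>x y. sin (?t * y)) x y\<bar> \<le> \<bar>?t\<bar> * (Q ^^ m) (\<lambda>x y. max 0 y) x y"
    proof (rule Q_abs_le)
      show "\<bar>sin (?t * y)\<bar> \<le> \<bar>?t\<bar> * max 0 y" if "y > 0" for y :: real
        using abs_sin_x_le_abs_x[of "?t * y"] that by (simp add: abs_mult)
    qed (use False in simp)
    also have "\<dots> \<le> \<bar>?t\<bar> * (C' + \<bar>y\<bar>)" by (rule mult_left_mono[OF C'(2)[rule_format]]) simp
    finally have "sqrt (real m) * \<bar>(Q ^^ m) (\<lambda>x y. sin (?t * y)) x y\<bar> \<le> sqrt (real m) * (\<bar>?t\<bar> * (C' + \<bar>y\<bar>))" by (rule mult_left_mono) simp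
    moreover have "\<bar>?a m s\<bar> = sqrt (real m) * \<bar>(Q ^^ m) (\<lambda>x y. sin (?t * y)) x y\<bar>" by (simp only: abs_mult) simp
    ultimately have "\<bar>?a m s\<bar> \<le> sqrt (real m) * (\<bar>?t\<bar> * (C' + \<bar>y\<bar>))" by (simp only:)
    also have "\<dots> = (C' + \<bar>y\<bar>) * \<bar>s\<bar>" using False by simp
    finally show ?thesis .
  qed (use C'(1) in simp)
  have [measurable]: "(\<lambda>s. (Q ^^ m) (\<lambda>x y. sin (s / sqrt (real m) * y)) x y) \<in> borel_measurable borel" for m
    unfolding killed_step_def by (rule walk_step_pow_measurable_param) measurable
  have "(\<lambda>m. \<integral>s. ?e s * (?b m s * ?a m s) \<partial>lborel) \<longlonglongrightarrow> (\<integral>s. ?e s * ((dualC * (s * ?e s)) * (harmV x y * (s * ?e s))) \<partial>lborel)"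
  proof (rule integral_dominated_convergence[where w = "\<lambda>s. C * (C' + \<bar>y\<bar>) * (?e s * s ^ 2)"])
    show "integrable lborel (\<lambda>s. C * (C' + \<bar>y\<bar>) * (?e s * s ^ 2))" by (intro integrable_mult_right gauss_integrable_moment[OF \<sigma>2_pos])
    show "AE s in lborel. (\<lambda>m. ?e s * (?b m s * ?a m s)) \<longlonglongrightarrow> ?e s * ((dualC * (s * ?e s)) * (harmV x y * (s * ?e s)))"
    proof (rule AE_I2)
      fix s
      have "(\<lambda>n. sqrt (real n) * (1 / sqrt (real n))) \<longlonglongrightarrow> 1" by real_asymp
      from tendsto_mult[OF tendsto_const[of s] this] have "(\<lambda>n. sqrt (real n) * (s / sqrt (real n))) \<longlonglongrightarrow> s" by (simp only: mult_1_right mult.left_commute[of s] times_divide_eq_right mult.commute[of s])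
      from sine_limit[OF this] have "(\<lambda>m. ?a m s) \<longlonglongrightarrow> harmV x y * (s * ?e s)" .
      then show "(\<lambda>m. ?e s * (?b m s * ?a m s)) \<longlonglongrightarrow> ?e s * ((dualC * (s * ?e s)) * (harmV x y * (s * ?e s)))"
        by (rule tendsto_mult[OF tendsto_const tendsto_mult[OF bj_limit]])
    qed
    show "AE s in lborel. norm (?e s * (?b m s * ?a m s)) \<le> C * (C' + \<bar>y\<bar>) * (?e s * s ^ 2)" for m
    proof (rule AE_I2)
      fix s
      have "\<bar>?b m s\<bar> * \<bar>?a m s\<bar> \<le> (C * \<bar>s\<bar>) * ((C' + \<bar>y\<bar>) * \<bar>s\<bar>)" by (rule mult_mono[OF bb ab]) (use C(1) in auto)
      also have "\<dots> = C * (C' + \<bar>y\<bar>) * s\<^sup>2" by (simp add: power2_eq_square abs_mult_self_eq mult_ac)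
      finally have "?e s * (\<bar>?b m s\<bar> * \<bar>?a m s\<bar>) \<le> ?e s * (C * (C' + \<bar>y\<bar>) * s\<^sup>2)" by (rule mult_left_mono) simp
      moreover have "norm (?e s * (?b m s * ?a m s)) = ?e s * (\<bar>?b m s\<bar> * \<bar>?a m s\<bar>)" unfolding real_norm_def abs_mult by simp
      ultimately show "norm (?e s * (?b m s * ?a m s)) \<le> C * (C' + \<bar>y\<bar>) * (?e s * s ^ 2)" by (simp only: mult_ac)
    qed
  qed measurable
  also have "(\<integral>s. ?e s * ((dualC * (s * ?e s)) * (harmV x y * (s * ?e s))) \<partial>lborel) = (\<integral>s. dualC * harmV x y * (exp (- (3 * \<sigma>2) * s\<^sup>2 / 2) * s\<^sup>2) \<partial>lborel)"
  proof (rule Bochner_Integration.integral_cong[OF refl])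
    fix s
    have "?e s * (?e s * ?e s) = exp (- (3 * \<sigma>2) * s\<^sup>2 / 2)" unfolding exp_add[symmetric] by (rule arg_cong[where f = exp]) (simp add: field_simps)
    then have "dualC * harmV x y * (exp (- (3 * \<sigma>2) * s\<^sup>2 / 2) * s\<^sup>2) = dualC * harmV x y * ((?e s * (?e s * ?e s)) * (s * s))"
      by (simp only: power2_eq_square)
    then show "?e s * ((dualC * (s * ?e s)) * (harmV x y * (s * ?e s))) = dualC * harmV x y * (exp (- (3 * \<sigma>2) * s\<^sup>2 / 2) * s\<^sup>2)"
      by (simp only: mult_ac)
  qed
  also have "\<dots> = dualC * harmV x y * (\<integral>s. exp (- (3 * \<sigma>2) * s\<^sup>2 / 2) * s\<^sup>2 \<partial>lborel)" by (rule integral_mult_right_zero)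
  also have "(\<integral>s. exp (- (3 * \<sigma>2) * s\<^sup>2 / 2) * s\<^sup>2 \<partial>lborel) = sqrt (2 * pi / (3 * \<sigma>2)) / (3 * \<sigma>2)"
    by (rule gauss_second_moment) (use \<sigma>2_pos in simp)
  finally have "(\<lambda>m. 1 / pi * (\<integral>s. ?e s * (?b m s * ?a m s) \<partial>lborel)) \<longlonglongrightarrow> 1 / pi * (dualC * harmV x y * (sqrt (2 * pi / (3 * \<sigma>2)) / (3 * \<sigma>2)))"
    by (rule tendsto_mult_left)
  then show ?thesis
    by (rule Lim_transform_eventually) (rule eventually_mono[OF eventually_ge_at_top[of 1]], rule main_term_repr[symmetric])
qed

text \<open>\<open>core_error\<close> and \<open>main_term_limit\<close> give the asymptotics in m.
  As n is about 3 m, rescaling brings the factor 3^(3/2), which cancels the 3 in the second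
  moment.\<close>

theorem exit_time_limit:
  "(\<lambda>n. real n powr (3/2) * tau_eq P f n x y) \<longlonglongrightarrow> 2 * harmV x y / (sqrt (2 * pi) * sqrt \<sigma>2 ^ 3) * dualC"
proof (rule tendsto_residues_mod3)
  fix e
  let ?t = "\<lambda>m. tau_eq P f (Suc (m + m + (m + e))) x y" and ?k = "\<lambda>m. (Q ^^ m) (\<lambda>x w. Ko m (Gj (m + e) 0) w) x y"
  let ?L = "1 / pi * (dualC * harmV x y * (sqrt (2 * pi / (3 * \<sigma>2)) / (3 * \<sigma>2)))"
  have "(\<lambda>m. real m * sqrt (real m) * (?t m - ?k m)) \<longlonglongrightarrow> 0"
  proof (rule tendstoI)
    fix r :: real assume "r > 0"
    then have "\<forall>\<^sub>F m in sequentially. real m * sqrt (real m) * \<bar>?t m - ?k m\<bar> \<le> r / 2" by (intro core_error) simp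
    then show "\<forall>\<^sub>F m in sequentially. dist (real m * sqrt (real m) * (?t m - ?k m)) 0 < r"
      by eventually_elim (use \<open>r > 0\<close> in \<open>simp add: abs_mult\<close>)
  qed
  from tendsto_add[OF this main_term_limit[of e x y]] have l: "(\<lambda>m. real m * sqrt (real m) * ?t m) \<longlonglongrightarrow> ?L"
    by (simp add: right_diff_distrib)
  \<comment> \<open>Here 3 m + e + 1 is the exit time itself: three stretches and the final
    step.\<close>
  have "(\<lambda>m. (3 * real m + real e + 1) powr (3/2) / (real m * sqrt (real m))) \<longlonglongrightarrow> 3 powr (3/2)" by real_asymp
  from tendsto_mult[OF this l]
  have "(\<lambda>m. (3 * real m + real e + 1) powr (3/2) / (real m * sqrt (real m)) * (real m * sqrt (real m) * ?t m)) \<longlonglongrightarrow> 3 powr (3/2) * ?L" .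
  moreover have "3 powr (3/2) * ?L = 2 * harmV x y / (sqrt (2 * pi) * sqrt \<sigma>2 ^ 3) * dualC"
  proof -
    have "(3::real) powr (3/2) = 3 powr (1 + 1/2)" by simp
    also have "\<dots> = 3 * sqrt 3" unfolding powr_add by (simp add: powr_half_sqrt)
    finally have 3: "(3::real) powr (3/2) = 3 * sqrt 3" .
    have s: "sqrt \<sigma>2 ^ 3 = \<sigma>2 * sqrt \<sigma>2" "sqrt \<sigma>2 > 0" using \<sigma>2_pos by (simp_all add: power3_eq_cube)
    have q: "sqrt (2 * pi / (3 * \<sigma>2)) = sqrt (2 * pi) / (sqrt 3 * sqrt \<sigma>2)" by (simp add: real_sqrt_divide real_sqrt_mult)
    have pp: "pi = sqrt (2 * pi) * sqrt (2 * pi) / 2" by simp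
    have "3 * sqrt 3 * (1 / (w * w / 2) * (d * h * (w / (sqrt 3 * u) / (3 * v)))) = 2 * h / (w * (v * u)) * d"
      if "w > 0" "u > 0" "v > 0" for w u v d h :: real using that by (simp add: field_simps)
    from this[of "sqrt (2 * pi)" "sqrt \<sigma>2" \<sigma>2 dualC "harmV x y"] show ?thesis
      unfolding 3 s(1) q using s(2) \<sigma>2_pos by (simp add: pp[symmetric])
  qed
  ultimately have l2: "(\<lambda>m. (3 * real m + real e + 1) powr (3/2) / (real m * sqrt (real m)) * (real m * sqrt (real m) * ?t m)) \<longlonglongrightarrow> 2 * harmV x y / (sqrt (2 * pi) * sqrt \<sigma>2 ^ 3) * dualC" by simp
  show "(\<lambda>m. real (Suc (m + m + (m + e))) powr (3/2) * ?t m) \<longlonglongrightarrow> 2 * harmV x y / (sqrt (2 * pi) * sqrt \<sigma>2 ^ 3) * dualC"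
  proof (rule Lim_transform_eventually[OF l2 eventually_mono[OF eventually_ge_at_top[of 1]]])
    fix m :: nat assume m: "1 \<le> m"
    have "real (Suc (m + m + (m + e))) = 3 * real m + real e + 1" by simp
    moreover have "q / c * (c * t) = q * t" if "c > 0" for q c t :: real using that by simp
    moreover have "real m * sqrt (real m) > 0" using m by simp
    ultimately show "(3 * real m + real e + 1) powr (3/2) / (real m * sqrt (real m)) * (real m * sqrt (real m) * ?t m) = real (Suc (m + m + (m + e))) powr (3/2) * ?t m" by metis
  qed
qed

lemma harmV_bound: "\<exists>C\<ge>0. \<forall>x y. \<bar>harmV x y\<bar> \<le> C * (2 + \<bar>y\<bar>)"
proof -
  obtain C where C: "C \<ge> 0" "\<forall>n x y. surv P f n x y * sqrt (real n) \<le> C * (2 + \<bar>y\<bar>)" using surv_bound by blast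
  let ?k = "sqrt \<sigma>2 / sqrt (2 / pi)"
  have k: "?k > 0" using \<sigma>2_pos by simp
  have "\<bar>harmV x y\<bar> \<le> (C * ?k) * (2 + \<bar>y\<bar>)" for x y
  proof -
    have "(\<lambda>n. sqrt (real n) * surv P f n x y * ?k) \<longlonglongrightarrow> harmV x y"
      using tendsto_mult[OF surv_limit[of x y] tendsto_const[of ?k]] \<sigma>2_pos by simp
    then have "(\<lambda>n. \<bar>sqrt (real n) * surv P f n x y * ?k\<bar>) \<longlonglongrightarrow> \<bar>harmV x y\<bar>" by (rule tendsto_rabs)
    moreover have "\<bar>sqrt (real n) * surv P f n x y * ?k\<bar> \<le> (C * ?k) * (2 + \<bar>y\<bar>)" for n
    proof -
      have "\<bar>sqrt (real n) * surv P f n x y * ?k\<bar> = (surv P f n x y * sqrt (real n)) * ?k"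
        using surv_nonneg[of n x y] \<sigma>2_pos by (simp add: abs_mult mult_ac)
      also have "\<dots> \<le> (C * (2 + \<bar>y\<bar>)) * ?k" using C(2) k by (intro mult_right_mono) auto
      finally show ?thesis by (simp only: mult_ac)
    qed
    ultimately show ?thesis by (intro LIMSEQ_le_const2) auto
  qed
  moreover have "C * ?k \<ge> 0" by (rule mult_nonneg_nonneg[OF C(1) less_imp_le[OF k]])
  ultimately show ?thesis by blast
qed

text \<open>\<open>\<nu>\<close> is invariant for the dual chain, so the law of its first state from
  equilibrium is again \<open>\<nu>\<close>, and the sum over \<open>x0\<close> collapses. The
  condition \<open>- f x1 \<ge> z\<close> is \<open>kc 0\<close>, and the endpoint z = 0 is a null
  set.\<close>

lemma dualC_integral:
  "dualC = (LINT z:{0..}|lborel. (\<Sum>x0\<in>UNIV. \<nu> x0 * (\<Sum>x1\<in>UNIV. Pdual P \<nu> x0 x1 *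
     (if - f x1 \<ge> z then Vfun (Pdual P \<nu>) (\<lambda>u. - f u) (sqrt \<sigma>2) x1 z else 0))))"
proof -
  interpret D: markov_walk "Pdual P \<nu>" \<nu> "\<lambda>u. - f u" by (rule dual_walk)
  have V: "Vfun (Pdual P \<nu>) (\<lambda>u. - f u) (sqrt \<sigma>2) = D.harmV" by (intro ext) (rule D.Vfun_eq_harmV[unfolded dual_sigma])
  obtain C where C: "C \<ge> 0" "\<forall>x y. \<bar>D.harmV x y\<bar> \<le> C * (2 + \<bar>y\<bar>)" using D.harmV_bound by blast
  have i: "integrable lborel (\<lambda>y. indicator {0<..} y * (D.harmV x y * kc 0 x y))" for x
  proof (rule kc0_integrable[where B = "C * (2 + fM)"])
    fix y :: real assume y: "0 < y" "y \<le> fM"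
    have "\<bar>D.harmV x y\<bar> \<le> C * (2 + \<bar>y\<bar>)" using C(2) by simp
    also have "\<dots> \<le> C * (2 + fM)" using y C(1) by (intro mult_left_mono) auto
    finally show "\<bar>D.harmV x y\<bar> \<le> C * (2 + fM)" .
  qed (use C(1) fM(2) in auto)
  have inner: "(\<Sum>x0\<in>UNIV. \<nu> x0 * (\<Sum>x1\<in>UNIV. Pdual P \<nu> x0 x1 * h x1)) = (\<Sum>x1\<in>UNIV. \<nu> x1 * h x1)" for h
  proof -
    have "(\<Sum>x0\<in>UNIV. \<nu> x0 * (\<Sum>x1\<in>UNIV. Pdual P \<nu> x0 x1 * h x1)) = (\<Sum>x0\<in>UNIV. \<Sum>x1\<in>UNIV. \<nu> x0 * Pdual P \<nu> x0 x1 * h x1)"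
      by (simp add: sum_distrib_left mult.assoc)
    also have "\<dots> = (\<Sum>x1\<in>UNIV. \<Sum>x0\<in>UNIV. \<nu> x0 * Pdual P \<nu> x0 x1 * h x1)" by (rule sum.swap)
    also have "\<dots> = (\<Sum>x1\<in>UNIV. \<nu> x1 * h x1)" unfolding sum_distrib_right[symmetric] D.nu_inv ..
    finally show ?thesis .
  qed
  have "(LINT z:{0..}|lborel. (\<Sum>x0\<in>UNIV. \<nu> x0 * (\<Sum>x1\<in>UNIV. Pdual P \<nu> x0 x1 *
     (if - f x1 \<ge> z then Vfun (Pdual P \<nu>) (\<lambda>u. - f u) (sqrt \<sigma>2) x1 z else 0))))
    = (\<integral>z. (\<Sum>x1\<in>UNIV. \<nu> x1 * (indicator {0..} z * (D.harmV x1 z * kc 0 x1 z))) \<partial>lborel)"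
    unfolding V inner set_lebesgue_integral_def
  proof (intro Bochner_Integration.integral_cong refl)
    fix z
    have "(if z \<le> - f x1 then D.harmV x1 z else 0) = D.harmV x1 z * kc 0 x1 z" for x1 by (auto simp: kc_def)
    then show "indicator {0..} z *\<^sub>R (\<Sum>x1\<in>UNIV. \<nu> x1 * (if z \<le> - f x1 then D.harmV x1 z else 0)) = (\<Sum>x1\<in>UNIV. \<nu> x1 * (indicator {0..} z * (D.harmV x1 z * kc 0 x1 z)))"
      by (simp only: real_scaleR_def sum_distrib_left mult.left_commute[of "indicator {0..} z"])
  qed
  also have "\<dots> = (\<integral>z. (\<Sum>x1\<in>UNIV. \<nu> x1 * (indicator {0<..} z * (D.harmV x1 z * kc 0 x1 z))) \<partial>lborel)"
  proof (rule integral_cong_AE)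
    have "AE z in lborel. z \<noteq> (0::real)" by (rule AE_lborel_singleton)
    then show "AE z in lborel. (\<Sum>x1\<in>UNIV. \<nu> x1 * (indicator {0..} z * (D.harmV x1 z * kc 0 x1 z))) = (\<Sum>x1\<in>UNIV. \<nu> x1 * (indicator {0<..} z * (D.harmV x1 z * kc 0 x1 z)))"
    proof eventually_elim
      case (elim z)
      then have "(indicator {0..} z :: real) = indicator {0<..} z" by (auto simp: indicator_def)
      then show ?case by simp
    qed
  qed measurable
  also have "\<dots> = (\<Sum>x1\<in>UNIV. \<integral>z. \<nu> x1 * (indicator {0<..} z * (D.harmV x1 z * kc 0 x1 z)) \<partial>lborel)"
    by (rule Bochner_Integration.integral_sum) (rule integrable_mult_right[OF i])
  also have "\<dots> = dualC" unfolding dualC_def pairing_def by (simp only: integral_mult_right_zero)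
  finally show ?thesis by (rule sym)
qed

end

theorem theorem2p8:
  fixes P :: "'a::finite \<Rightarrow> 'a \<Rightarrow> real" and \<nu> f :: "'a \<Rightarrow> real"
    and x :: 'a and y :: real
  assumes "stochastic P" and "invariant_prob P \<nu>"
    and "H1 P" and "H2 \<nu> f" and "H3 P f"
  shows "(\<lambda>n. real n powr (3/2) * tau_eq P f n x y) \<longlonglongrightarrow>
     2 * Vfun P f (sqrt (sigma2 P \<nu> f)) x y / (sqrt (2 * pi) * sqrt (sigma2 P \<nu> f) ^ 3) *
     (LINT z:{0..}|lborel.
        (\<Sum>x0\<in>UNIV. \<nu> x0 * (\<Sum>x1\<in>UNIV. Pdual P \<nu> x0 x1 *
           (if - f x1 \<ge> z then Vfun (Pdual P \<nu>) (\<lambda>u. - f u) (sqrt (sigma2 P \<nu> f)) x1 z else 0))))"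
proof -
  interpret markov_walk P \<nu> f by unfold_locales (rule assms)+
  show ?thesis
    using exit_time_limit[of x y] unfolding dualC_integral Vfun_eq_harmV[symmetric] \<sigma>2_def .
qed

end
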